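(* Let $1<p<+\infty$, $\kappa>0$, and let $a\in L^\infty(\mathbb{R}_+\times(0,1))$ be non-negative. Then there exist positive constants $C,\gamma$ depending only on $p$, $\kappa$, and $\|a\|_{L^\infty(\mathbb{R}_+\times(0,1))}$ such that for all $u_0\in W^{1,p}(0,1)$ and $u_1\in L^p(0,1)$, there exists a unique weak solution $u\in C([0,+\infty);W^{1,p}(0,1))\cap C^1([0,+\infty);L^p(0,1))$ with $\partial_tu,\partial_xu\in C([0,1];L^p(0,T))$ for all $T>0$ of $$\begin{cases}\partial_{tt}u-\partial_{xx}u+a\,\partial_t u=0 & \text{in }\mathbb{R}_+\times(0,1),\\ \partial_xu(t,0)-\kappa\,\partial_tu(t,0)=\partial_xu(t,1)+\kappa\,\partial_tu(t,1)=0 & \text{in }\mathbb{R}_+,\\ u(0,\cdot)=u_0,\quad \partial_t u(0,\cdot)=u_1 & \text{in }(0,1),\end{cases}$$ and it satisfies $$\|\partial_t u(t,\cdot)\|_{L^p(0,1)}+\|\partial_x u(t,\cdot)\|_{L^p(0,1)}\le C e^{-\gamma t}\Big(\|u_1\|_{L^p(0,1)}+\|\partial_x u_0\|_{L^p(0,1)}\Big),\qquad t\ge 0.$$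
   Context: $\mathbb{R}_+=(0,+\infty)$. Here a weak solution means that $\partial_{tt}u-\partial_{xx}u+a\,\partial_tu=0$ holds in the sense of distributions in $\mathbb{R}_+\times(0,1)$, and that the boundary and initial conditions hold in the usual sense, which makes sense thanks to the regularity imposed on $u$: the initial conditions hold in $W^{1,p}(0,1)$ and $L^p(0,1)$ by continuity in $t$, and the boundary conditions hold for a.e. $t$, using that $\partial_tu,\partial_xu\in C([0,1];L^p(0,T))$ (continuity in the variable $x$ with values in $L^p$ in time) for all $T>0$. *)

theory Defs
  imports "HOL-Probability.Essential_Supremum"
begin

text \<open>
  Elements of the Lebesgue and Sobolev spaces are represented by real-valued functions; two
  functions represent the same element iff they agree almost everywhere.  All notions below
  are invariant under a change of representative.
\<close>

section \<open>Test functions\<close>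

definition pdiff :: "'a::euclidean_space \<Rightarrow> ('a \<Rightarrow> real) \<Rightarrow> 'a \<Rightarrow> real" where
  "pdiff b f = (\<lambda>z. frechet_derivative f (at z) b)"

primrec C_k :: "nat \<Rightarrow> ('a::euclidean_space \<Rightarrow> real) \<Rightarrow> bool" where
  "C_k 0 f \<longleftrightarrow> continuous_on UNIV f"
| "C_k (Suc k) f \<longleftrightarrow> (\<forall>z. f differentiable (at z)) \<and> (\<forall>b\<in>Basis. C_k k (pdiff b f))"

definition test_functions :: "'a::euclidean_space set \<Rightarrow> ('a \<Rightarrow> real) set" where
  "test_functions \<Omega> = {\<phi>. (\<forall>k. C_k k \<phi>) \<and> compact (closure {z. \<phi> z \<noteq> 0}) \<and>
     closure {z. \<phi> z \<noteq> 0} \<subseteq> \<Omega>}"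

section \<open>Lebesgue spaces\<close>

definition Lp :: "real \<Rightarrow> 'a::euclidean_space set \<Rightarrow> ('a \<Rightarrow> real) set" where
  "Lp p \<Omega> = {f \<in> borel_measurable (lebesgue_on \<Omega>).
     integrable (lebesgue_on \<Omega>) (\<lambda>x. \<bar>f x\<bar> powr p)}"

definition Lp_norm :: "real \<Rightarrow> 'a::euclidean_space set \<Rightarrow> ('a \<Rightarrow> real) \<Rightarrow> real" where
  "Lp_norm p \<Omega> f = (LINT x|lebesgue_on \<Omega>. \<bar>f x\<bar> powr p) powr (1 / p)"

definition Linf :: "'a::euclidean_space set \<Rightarrow> ('a \<Rightarrow> real) set" where
  "Linf \<Omega> = {f \<in> borel_measurable (lebesgue_on \<Omega>).
     esssup (lebesgue_on \<Omega>) (\<lambda>x. ereal \<bar>f x\<bar>) < \<infinity>}"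

definition Linf_norm :: "'a::euclidean_space set \<Rightarrow> ('a \<Rightarrow> real) \<Rightarrow> real" where
  "Linf_norm \<Omega> f = real_of_ereal (esssup (lebesgue_on \<Omega>) (\<lambda>x. ereal \<bar>f x\<bar>))"

definition L1_loc :: "'a::euclidean_space set \<Rightarrow> ('a \<Rightarrow> real) set" where
  "L1_loc \<Omega> = {f. \<forall>K. compact K \<and> K \<subseteq> \<Omega> \<longrightarrow> integrable (lebesgue_on K) f}"

section \<open>Sobolev spaces in dimension one\<close>

definition is_weak_deriv :: "real set \<Rightarrow> (real \<Rightarrow> real) \<Rightarrow> (real \<Rightarrow> real) \<Rightarrow> bool" where
  "is_weak_deriv \<Omega> f g \<longleftrightarrow> (\<forall>\<phi>\<in>test_functions \<Omega>.
     (LINT x|lebesgue_on \<Omega>. f x * deriv \<phi> x) = - (LINT x|lebesgue_on \<Omega>. g x * \<phi> x))"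

text \<open>Any two locally integrable weak derivatives agree almost everywhere, so the choice
  below only fixes a representative.\<close>

definition weak_deriv :: "real set \<Rightarrow> (real \<Rightarrow> real) \<Rightarrow> real \<Rightarrow> real" where
  "weak_deriv \<Omega> f = (SOME g. g \<in> L1_loc \<Omega> \<and> is_weak_deriv \<Omega> f g)"

definition W1p :: "real \<Rightarrow> real set \<Rightarrow> (real \<Rightarrow> real) set" where
  "W1p p \<Omega> = {f \<in> Lp p \<Omega>. \<exists>g\<in>Lp p \<Omega>. is_weak_deriv \<Omega> f g}"

definition W1p_norm :: "real \<Rightarrow> real set \<Rightarrow> (real \<Rightarrow> real) \<Rightarrow> real" where
  "W1p_norm p \<Omega> f = Lp_norm p \<Omega> f + Lp_norm p \<Omega> (weak_deriv \<Omega> f)"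

section \<open>Curves in function spaces\<close>

text \<open>A curve defined on \<open>J\<close> with values in a space \<open>X\<close> of functions, normed by \<open>N\<close>, is
  written \<open>F :: real \<Rightarrow> 'a \<Rightarrow> real\<close>; its values outside \<open>J\<close> are irrelevant.\<close>

definition C0_curve ::
  "real set \<Rightarrow> ('a \<Rightarrow> real) set \<Rightarrow> (('a \<Rightarrow> real) \<Rightarrow> real) \<Rightarrow> (real \<Rightarrow> 'a \<Rightarrow> real) set" where
  "C0_curve J X N = {F. (\<forall>t\<in>J. F t \<in> X) \<and>
     (\<forall>t\<in>J. ((\<lambda>s. N (\<lambda>x. F s x - F t x)) \<longlongrightarrow> 0) (at t within J))}"

definition has_curve_deriv ::
  "real set \<Rightarrow> ('a \<Rightarrow> real) set \<Rightarrow> (('a \<Rightarrow> real) \<Rightarrow> real) \<Rightarrow> (real \<Rightarrow> 'a \<Rightarrow> real) \<Rightarrow>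
     ('a \<Rightarrow> real) \<Rightarrow> real \<Rightarrow> bool" where
  "has_curve_deriv J X N F v t \<longleftrightarrow> v \<in> X \<and>
     ((\<lambda>s. N (\<lambda>x. (F s x - F t x) / (s - t) - v x)) \<longlongrightarrow> 0) (at t within J)"

text \<open>The derivative is unique as an element of \<open>X\<close>; the choice only fixes a representative.\<close>

definition curve_deriv ::
  "real set \<Rightarrow> ('a \<Rightarrow> real) set \<Rightarrow> (('a \<Rightarrow> real) \<Rightarrow> real) \<Rightarrow> (real \<Rightarrow> 'a \<Rightarrow> real) \<Rightarrow>
     real \<Rightarrow> 'a \<Rightarrow> real" where
  "curve_deriv J X N F = (\<lambda>t. SOME v. has_curve_deriv J X N F v t)"

definition C1_curve ::
  "real set \<Rightarrow> ('a \<Rightarrow> real) set \<Rightarrow> (('a \<Rightarrow> real) \<Rightarrow> real) \<Rightarrow> (real \<Rightarrow> 'a \<Rightarrow> real) set" where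
  "C1_curve J X N = {F \<in> C0_curve J X N.
     (\<forall>t\<in>J. \<exists>v. has_curve_deriv J X N F v t) \<and> curve_deriv J X N F \<in> C0_curve J X N}"

section \<open>The damped wave equation\<close>

text \<open>The unknown is a curve \<open>u\<close> in the time variable, \<open>u t x\<close> being the value at time \<open>t\<close> and
  position \<open>x\<close>.\<close>

abbreviation unit_interval :: "real set" where
  "unit_interval \<equiv> {0<..<1}"

abbreviation time_deriv :: "real \<Rightarrow> (real \<Rightarrow> real \<Rightarrow> real) \<Rightarrow> real \<Rightarrow> real \<Rightarrow> real" where
  "time_deriv p u \<equiv> curve_deriv {0..} (Lp p unit_interval) (Lp_norm p unit_interval) u"

abbreviation space_deriv :: "(real \<Rightarrow> real \<Rightarrow> real) \<Rightarrow> real \<Rightarrow> real \<Rightarrow> real" where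
  "space_deriv u \<equiv> (\<lambda>t. weak_deriv unit_interval (u t))"

text \<open>A curve \<open>v\<close> in time with values in \<open>L\<^sup>p(0,1)\<close> belongs to \<open>C([0,1]; L\<^sup>p(0,T))\<close> if, as a
  distribution on \<open>(0,T) \<times> (0,1)\<close>, it coincides with a continuous curve \<open>w\<close> in the space variable
  with values in \<open>L\<^sup>p(0,T)\<close>; here \<open>w x t\<close> has its arguments in the opposite order.  The pairings
  are iterated integrals because representatives chosen separately for each \<open>t\<close> (or \<open>x\<close>) need
  not be jointly measurable.\<close>

definition space_curve_of ::
  "real \<Rightarrow> real \<Rightarrow> (real \<Rightarrow> real \<Rightarrow> real) \<Rightarrow> (real \<Rightarrow> real \<Rightarrow> real) \<Rightarrow> bool" where
  "space_curve_of p T v w \<longleftrightarrow>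
     w \<in> C0_curve {0..1} (Lp p {0<..<T}) (Lp_norm p {0<..<T}) \<and>
     (\<forall>\<phi>\<in>test_functions ({0<..<T} \<times> unit_interval).
        (LINT t|lebesgue_on {0<..<T}. LINT x|lebesgue_on unit_interval. v t x * \<phi> (t, x)) =
        (LINT x|lebesgue_on unit_interval. LINT t|lebesgue_on {0<..<T}. w x t * \<phi> (t, x)))"

definition wave_eq_distr ::
  "real \<Rightarrow> (real \<times> real \<Rightarrow> real) \<Rightarrow> (real \<Rightarrow> real \<Rightarrow> real) \<Rightarrow> bool" where
  "wave_eq_distr p a u \<longleftrightarrow> (\<forall>\<phi>\<in>test_functions ({0<..} \<times> unit_interval).
     (LINT t|lebesgue_on {0<..}. LINT x|lebesgue_on unit_interval.
        u t x * pdiff (1, 0) (pdiff (1, 0) \<phi>) (t, x)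
        - u t x * pdiff (0, 1) (pdiff (0, 1) \<phi>) (t, x)
        + a (t, x) * time_deriv p u t x * \<phi> (t, x)) = 0)"

definition weak_solution ::
  "real \<Rightarrow> real \<Rightarrow> (real \<times> real \<Rightarrow> real) \<Rightarrow> (real \<Rightarrow> real) \<Rightarrow> (real \<Rightarrow> real) \<Rightarrow>
     (real \<Rightarrow> real \<Rightarrow> real) \<Rightarrow> bool" where
  "weak_solution p \<kappa> a u0 u1 u \<longleftrightarrow>
     u \<in> C0_curve {0..} (W1p p unit_interval) (W1p_norm p unit_interval) \<and>
     u \<in> C1_curve {0..} (Lp p unit_interval) (Lp_norm p unit_interval) \<and>
     wave_eq_distr p a u \<and>
     (\<forall>T>0. \<exists>vt vx.
        space_curve_of p T (time_deriv p u) vt \<and>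
        space_curve_of p T (space_deriv u) vx \<and>
        (AE t in lebesgue_on {0<..<T}.
           vx 0 t - \<kappa> * vt 0 t = 0 \<and> vx 1 t + \<kappa> * vt 1 t = 0)) \<and>
     (AE x in lebesgue_on unit_interval. u 0 x = u0 x) \<and>
     (AE x in lebesgue_on unit_interval. time_deriv p u 0 x = u1 x)"

end

theory Submission
 imports Defs
begin

text \<open>
The Riemann invariants \<open>f = u\<^sub>t + u\<^sub>x\<close> and \<open>g = u\<^sub>t - u\<^sub>x\<close> of the wave equation travel to the left and to the
right with speed one and are coupled only by the damping. Both are folded into a single function
\<open>H(t,y)\<close> on the line: \<open>H(t,y) = g(t,y)\<close> for \<open>y\<close> in \<open>(0,1)\<close>, \<open>H(t,y) = f(t,-y)\<close> for \<open>y\<close> in \<open>(-1,0)\<close>, continued with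
period two. With the coefficient continued evenly, the equation becomes the transport equation
\<open>H\<^sub>t + H\<^sub>y = - a(t,y) (H(t,y) + H(t,-y)) / 2\<close>, and each of the two boundary conditions says that \<open>H\<close> is
multiplied by \<open>c = (1 - \<kappa>) / (1 + \<kappa>)\<close> whenever it crosses an integer. Since \<open>\<kappa> > 0\<close>, \<open>\<bar>c\<bar> < 1\<close>.

Existence. Along the characteristics \<open>y = xi + t\<close> the problem is a linear integral equation for
\<open>z(t,xi) = H(t,xi + t)\<close>, solved by a Neumann series (locale \<open>characteristics\<close>). Everything else is read off from
\<open>z\<close>: the first derivatives, their traces, and \<open>u = u\<^sub>0 + \<integral> u\<^sub>t\<close>. Integrating along characteristics against a test function
(\<open>transport_pair\<close>) shows that \<open>u\<close> is a weak solution (\<open>u_weak_solution\<close>).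

Decay. The functional \<open>V(t) = \<integral> W(y) \<bar>H(t,y)\<bar>\<^sup>p dy\<close> over one period, with a weight \<open>W\<close> that falls linearly from \<open>1 + mu\<close>
to \<open>1\<close> between consecutive integers, decreases exponentially: transport through the falling weight
yields a loss \<open>- mu \<integral> \<bar>H\<bar>\<^sup>p\<close>; the upward jump of \<open>W\<close> at the integers is paid for by \<open>(1 + mu) \<bar>c\<bar>\<^sup>p \<le> 1\<close>; and the
damping, which is dissipative for a constant weight, produces at most an error of order \<open>mu\<^sup>2\<close> because \<open>W(y)\<close> and \<open>W(-y)\<close>
differ by at most \<open>mu\<close> (\<open>cross_damping\<close>). A small \<open>mu\<close>, depending only on \<open>p\<close>, \<open>\<kappa>\<close> and the bound of \<open>a\<close>, therefore gives
a rate with the same dependence (\<open>energy_decay\<close>).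

Uniqueness. For \<open>p < 2\<close> the solutions are too weak for an energy identity, so the difference of two of them is estimated in
\<open>L\<^sup>1\<close> by duality. Testing with functions \<open>\<theta>(t + sg x)\<close>, which are constant along the
characteristics of \<open>u\<^sub>t + sg u\<^sub>x\<close>, gives a balance between the values at the times \<open>0\<close> and \<open>T\<close>, the traces and the
damping term (\<open>characteristic_balance\<close>). As \<open>\<theta>\<close> ranges over the polynomials, this bounds the outgoing \<open>L\<^sup>1\<close>
norms by the incoming ones (\<open>L1_balance_of_polynomials\<close>). The boundary conditions close the estimate and Gronwall's lemma finishes
(\<open>weak_solution_unique\<close>).
\<close>

section \<open>Notation\<close>

abbreviation (input) unit_lebesgue :: "real measure" ("\<U>") where "\<U> \<equiv> lebesgue_on unit_interval"

abbreviation borel2 :: "('a::topological_space \<times> 'b::topological_space \<Rightarrow> real) set" where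
 "borel2 \<equiv> borel_measurable (borel \<Otimes>\<^sub>M borel)"

abbreviation borel1 :: "('a::topological_space \<Rightarrow> real) set" where "borel1 \<equiv> borel_measurable borel"

abbreviation leb :: "real \<Rightarrow> real \<Rightarrow> real measure" where "leb a b \<equiv> lebesgue_on {a<..<b}"

abbreviation (input) dt :: "(real \<times> real \<Rightarrow> real) \<Rightarrow> real \<times> real \<Rightarrow> real" where "dt \<equiv> pdiff (1, 0)"

abbreviation (input) dx :: "(real \<times> real \<Rightarrow> real) \<Rightarrow> real \<times> real \<Rightarrow> real" where "dx \<equiv> pdiff (0, 1)"

abbreviation (input) open_unit :: "real set" ("\<J>") where "\<J> \<equiv> {0<..<1}"

abbreviation lint :: "'a::euclidean_space set \<Rightarrow> ('a \<Rightarrow> real) \<Rightarrow> bool" where "lint \<equiv> set_integrable lborel"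

lemmas integral_cong_space = Bochner_Integration.integral_cong[OF refl]

section \<open>Smooth functions\<close>

definition smooth :: "('a::euclidean_space => real) => bool" where
 "smooth f \<longleftrightarrow> (\<forall>k. C_k k f)"

lemma pdiff_eqI:
 assumes "(f has_derivative D) (at z)"
 shows "pdiff b f z = D b"
 unfolding pdiff_def using frechet_derivative_at[OF assms] by simp

lemma C_k_Suc_imp: "C_k (Suc k) f ==> C_k k f"
proof (induction k arbitrary: f)
 case 0
 then show ?case
  by (simp add: continuous_on_eq_continuous_at differentiable_imp_continuous_within)
next
 case (Suc k)
 have d: "\<forall>z. f differentiable (at z)" and p: "!!b. b \<in> Basis ==> C_k (Suc k) (pdiff b f)"
  using Suc.prems by simp_all
 show ?case using d Suc.IH[OF p] by simp
qed

lemma smoothD: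
 assumes "smooth f"
 shows "f differentiable (at z)" "continuous_on UNIV f" "b \<in> Basis ==> smooth (pdiff b f)"
proof -
 have "C_k (Suc 0) f" "C_k 0 f" using assms unfolding smooth_def by blast+
 then show "f differentiable (at z)" "continuous_on UNIV f" by simp_all
 show "smooth (pdiff b f)" if b: "b \<in> Basis"
  unfolding smooth_def
 proof
  fix k have "C_k (Suc k) f" using assms unfolding smooth_def by blast
  then show "C_k k (pdiff b f)" using b by simp
 qed
qed

lemma pdiff_add:
 assumes "!!z. f differentiable (at z)" "!!z. g differentiable (at z)"
 shows "pdiff b (%z. f z + g z) = (%z. pdiff b f z + pdiff b g z)"
proof
 fix z
 obtain D E where "(f has_derivative D) (at z)" "(g has_derivative E) (at z)"
  using assms unfolding differentiable_def by blast
 note d = this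
 show "pdiff b (%z. f z + g z) z = pdiff b f z + pdiff b g z"
  using pdiff_eqI[OF has_derivative_add[OF d]] pdiff_eqI[OF d(1)] pdiff_eqI[OF d(2)] by simp
qed

lemma pdiff_mult:
 assumes "!!z. f differentiable (at z)" "!!z. g differentiable (at z)"
 shows "pdiff b (%z. f z * g z) = (%z. f z * pdiff b g z + pdiff b f z * g z)"
proof
 fix z
 obtain D E where "(f has_derivative D) (at z)" "(g has_derivative E) (at z)"
  using assms unfolding differentiable_def by blast
 note d = this
 show "pdiff b (%z. f z * g z) z = f z * pdiff b g z + pdiff b f z * g z"
  using pdiff_eqI[OF has_derivative_mult[OF d]] pdiff_eqI[OF d(1)] pdiff_eqI[OF d(2)] by simp
qed

lemma C_k_add: "C_k k f ==> C_k k g ==> C_k k (%z. f z + g z)"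
proof (induction k arbitrary: f g)
 case 0 then show ?case by (auto intro: continuous_intros)
next
 case (Suc k)
 then show ?case by (simp add: pdiff_add)
qed

lemma C_k_mult: "C_k k f ==> C_k k g ==> C_k k (%z. f z * g z)"
proof (induction k arbitrary: f g)
 case 0 then show ?case by (auto intro: continuous_intros)
next
 case (Suc k)
 have "C_k k f" "C_k k g" using Suc.prems C_k_Suc_imp by blast+
 with Suc show ?case by (simp add: pdiff_mult C_k_add)
qed

lemma smooth_add: "smooth f ==> smooth g ==> smooth (%z. f z + g z)"
 and smooth_mult: "smooth f ==> smooth g ==> smooth (%z. f z * g z)"
 by (simp_all add: smooth_def C_k_add C_k_mult)

text \<open>Turns an explicit derivative on the line into one step of the recursive definition of
 \<open>C_k\<close>, so that smoothness can be shown by induction over a family of functions closed under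
 differentiation.\<close>
lemma C_k_SucI_real:
 assumes "!!x. (f has_real_derivative f' x) (at x)" "C_k k f'"
 shows "C_k (Suc k) f"
proof -
 have "pdiff 1 f = f'"
  using pdiff_eqI[OF assms(1)[unfolded has_field_derivative_def], of 1] by auto
 moreover have "f differentiable (at z)" for z
  using assms(1) real_differentiable_def by blast
 ultimately show ?thesis using assms(2) by simp
qed

lemma smoothI_real:
 assumes "!!x. (f has_real_derivative f' x) (at x)" "smooth f'"
 shows "smooth f"
 unfolding smooth_def
proof
 fix k show "C_k k f"
  using C_k_Suc_imp[OF C_k_SucI_real[OF assms(1)]] assms(2) unfolding smooth_def by blast
qed

lemma pdiff_real: "f differentiable (at x) ==> pdiff 1 f x = deriv f (x::real)"
 unfolding pdiff_def
 by (metis DERIV_deriv_iff_real_differentiable frechet_derivative_at has_field_derivative_imp_has_derivative mult.right_neutral)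

lemma smooth_real_deriv:
 assumes "smooth (f::real => real)"
 shows "(f has_real_derivative deriv f x) (at x)" "smooth (deriv f)"
proof -
 show "(f has_real_derivative deriv f x) (at x)"
  using smoothD(1)[OF assms] DERIV_deriv_iff_real_differentiable by blast
 have "pdiff 1 f = deriv f" using smoothD(1)[OF assms] pdiff_real by blast
 then show "smooth (deriv f)" using smoothD(3)[OF assms, of 1] by simp
qed

lemma smooth_const: "smooth (%z::'a::euclidean_space. c::real)"
proof -
 have "pdiff b (%z::'a. c) = (%z. 0)" for b c
  using pdiff_eqI[OF has_derivative_const] by blast
 then have "C_k k (%z::'a. c)" for k c by (induction k arbitrary: c) auto
 then show ?thesis by (simp add: smooth_def)
qed

text \<open>By the chain rule each partial derivative of a ridge function is again a constant multiple of a
 ridge function, so the induction on \<open>k\<close> closes.\<close>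
lemma C_k_compose_inner:
 fixes v :: "'a::euclidean_space"
 shows "C_k k g ==> C_k k (%z. g (inner v z + d))"
proof (induction k arbitrary: g)
 case 0
 then have c: "continuous_on UNIV g" by simp
 have "continuous_on UNIV (%z. g (inner v z + d))"
  by (rule continuous_on_compose2[OF c]) (auto intro!: continuous_intros)
 then show ?case by simp
next
 case (Suc k)
 have D: "((%z. g (inner v z + d)) has_derivative (%h. inner v h * pdiff 1 g (inner v z + d))) (at z)" for z
 proof -
  have "g differentiable (at (inner v z + d))" using Suc.prems by simp
  then obtain D where D: "(g has_derivative D) (at (inner v z + d))" by (auto simp: differentiable_def)
  have i: "((%z. inner v z + d) has_derivative (%h. inner v h)) (at z)"
   by (auto intro!: derivative_eq_intros)
  have "((%z. g (inner v z + d)) has_derivative (%h. D (inner v h))) (at z)"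
   using has_derivative_compose[OF i D] .
  moreover have "D (inner v h) = inner v h * pdiff 1 g (inner v z + d)" for h
   using pdiff_eqI[OF D, of 1] linear_scale[OF has_derivative_linear[OF D], of "inner v h" 1] by simp
  ultimately show ?thesis by simp
 qed
 have "pdiff b (%z. g (inner v z + d)) = (%z. inner v b * pdiff 1 g (inner v z + d))" for b
  using pdiff_eqI[OF D] by blast
 moreover have "C_k k (%z. pdiff 1 g (inner v z + d))" using Suc by simp
 moreover have "C_k k (%z::'a. c)" for c using smooth_const[of c] unfolding smooth_def by blast
 ultimately show ?case using D by (auto simp: differentiable_def intro: C_k_mult)
qed

lemma smooth_compose_inner: "smooth g ==> smooth (%z. g (inner v z + d))"
 by (simp add: smooth_def C_k_compose_inner)

lemma smooth_affine_real: "smooth g ==> smooth (%x::real. g (m * x + d))"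
 using smooth_compose_inner[of g m d] by (simp add: inner_real_def)

lemma smooth_fst: "smooth g ==> smooth (%z::real\<times>real. g (fst z))"
 and smooth_snd: "smooth g ==> smooth (%z::real\<times>real. g (snd z))"
 using smooth_compose_inner[of g "(1,0)::real\<times>real" 0] smooth_compose_inner[of g "(0,1)::real\<times>real" 0]
 by (simp_all add: inner_prod_def)

lemma slice_has_derivative:
 assumes "phi differentiable (at (a + x *\<^sub>R e))"
 shows "((%x. phi (a + x *\<^sub>R e)) has_real_derivative pdiff e phi (a + x *\<^sub>R e)) (at x)"
proof -
 obtain D where D: "(phi has_derivative D) (at (a + x *\<^sub>R e))" using assms by (auto simp: differentiable_def)
 have i: "((%x. a + x *\<^sub>R e) has_derivative (%h. h *\<^sub>R e)) (at x)"
  by (auto intro!: derivative_eq_intros)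
 have "((%x. phi (a + x *\<^sub>R e)) has_derivative (%h. D (h *\<^sub>R e))) (at x)"
  using has_derivative_compose[OF i D] .
 moreover have "D (h *\<^sub>R e) = h * pdiff e phi (a + x *\<^sub>R e)" for h
  using pdiff_eqI[OF D, of e] linear_scale[OF has_derivative_linear[OF D], of h e] by simp
 ultimately show ?thesis by (simp add: has_field_derivative_def mult_commute_abs)
qed

lemma C_k_slice: "e \<in> Basis ==> C_k k phi ==> C_k k (%x::real. phi (a + x *\<^sub>R e))"
proof (induction k arbitrary: phi)
 case 0
 then have c: "continuous_on UNIV phi" by simp
 have "continuous_on UNIV (%x. phi (a + x *\<^sub>R e))"
  by (rule continuous_on_compose2[OF c]) (auto intro!: continuous_intros)
 then show ?case by simp
next
 case (Suc k)
 show ?case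
  by (rule C_k_SucI_real[where f' = "%x. pdiff e phi (a + x *\<^sub>R e)"])
    (use Suc in \<open>auto intro!: slice_has_derivative\<close>)
qed

lemma smooth_slice: "e \<in> Basis ==> smooth phi ==> smooth (%x::real. phi (a + x *\<^sub>R e))"
 by (simp add: smooth_def C_k_slice)

section \<open>Cutoff functions\<close>

text \<open>The functions \<open>P(1/x) exp(-1/x)\<close>, continued by zero, form a family closed under
 differentiation. This makes the smoothness of \<open>exp(-1/x)\<close> at the origin an induction over all
 \<open>P\<close> at once.\<close>
definition flat :: "real poly => real => real" where
 "flat P x = (if 0 < x then poly P (1 / x) * exp (- (1 / x)) else 0)"

text \<open>With \<open>y = 1/x\<close> this is the decay of \<open>y ^ i * exp (- y)\<close>.\<close>
lemma flat_tendsto_0: "(flat P \<longlongrightarrow> 0) (at_right 0)"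
proof -
 have "((%y. poly P y * exp (- y)) \<longlongrightarrow> 0) at_top"
 proof (induction P)
  case 0 show ?case by simp
 next
  case (pCons a P)
  have *: "((%y::real. y ^ k * exp (- y)) \<longlongrightarrow> 0) at_top" for k :: nat
   using tendsto_power_div_exp_0[of k] by (simp add: exp_minus divide_inverse)
  have "((%y. \<Sum>i\<le>degree (pCons a P). coeff (pCons a P) i * (y ^ i * exp (- y))) \<longlongrightarrow> (\<Sum>i\<le>degree (pCons a P). coeff (pCons a P) i * 0)) at_top"
   by (intro tendsto_intros *)
  then show ?case by (simp add: poly_altdef sum_distrib_right mult.assoc)
 qed
 then have "((%x. poly P (inverse x) * exp (- inverse x)) \<longlongrightarrow> 0) (at_right 0)"
  by (rule filterlim_compose[OF _ filterlim_inverse_at_top_right])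
 moreover have "eventually (%x. flat P x = poly P (inverse x) * exp (- inverse x)) (at_right 0)"
  unfolding eventually_at_right_field flat_def by (intro exI[of _ 1]) (auto simp: inverse_eq_divide)
 ultimately show ?thesis by (simp add: tendsto_cong)
qed

lemma flat_has_derivative:
 "(flat P has_real_derivative flat (monom 1 2 * (P - pderiv P)) x) (at x)"
proof -
 consider "x < 0" | "x = 0" | "x > 0" by linarith
 then show ?thesis
 proof cases
  case 1
  have "((%_. 0) has_real_derivative 0) (at x)" by simp
  moreover have "eventually (%y. flat P y = 0) (nhds x)"
   using eventually_nhds_in_open[of "{..<0}" x] 1 by (auto elim!: eventually_mono simp: flat_def)
  ultimately show ?thesis using 1 DERIV_cong_ev[of x x "flat P" "%_. 0"] by (simp add: flat_def)
 next
  case 2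
  have r: "((%h. (flat P (0 + h) - flat P 0) / h) \<longlongrightarrow> 0) (at_right 0)"
  proof (rule Lim_transform_eventually[OF flat_tendsto_0[of "monom 1 1 * P"]])
   show "\<forall>\<^sub>F x in at_right 0. flat (monom 1 1 * P) x = (flat P (0 + x) - flat P 0) / x"
    unfolding eventually_at_right_field flat_def by (intro exI[of _ 1]) (auto simp: poly_monom)
  qed
  have l: "((%h. (flat P (0 + h) - flat P 0) / h) \<longlongrightarrow> 0) (at_left 0)"
  proof (rule Lim_transform_eventually[OF tendsto_const])
   show "\<forall>\<^sub>F x in at_left 0. 0 = (flat P (0 + x) - flat P 0) / x"
    unfolding eventually_at_left_field flat_def by (intro exI[of _ "-1"]) auto
  qed
  show ?thesis using filterlim_at_split[THEN iffD2, OF conjI[OF l r]] 2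
   by (simp add: DERIV_def flat_def)
 next
  case 3
  have "((%y. poly P (1/y) * exp (-(1/y))) has_real_derivative
    poly (monom 1 2 * (P - pderiv P)) (1/x) * exp (-(1/x))) (at x)"
   using 3 by (auto intro!: derivative_eq_intros simp: poly_monom field_simps power2_eq_square)
  moreover have "eventually (%y. flat P y = poly P (1/y) * exp (-(1/y))) (nhds x)"
   using eventually_nhds_in_open[of "{0<..}" x] 3 by (auto elim!: eventually_mono simp: flat_def)
  ultimately show ?thesis using 3 DERIV_cong_ev[of x x "flat P"] by (simp add: flat_def)
 qed
qed

lemma smooth_flat: "smooth (flat P)"
proof -
 have "C_k k (flat P)" for k
 proof (induction k arbitrary: P)
  case 0
  show ?case using DERIV_isCont[OF flat_has_derivative] by (simp add: continuous_on_eq_continuous_at)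
 next
  case (Suc k)
  show ?case by (rule C_k_SucI_real[OF flat_has_derivative Suc])
 qed
 then show ?thesis by (simp add: smooth_def)
qed

text \<open>The step is the primitive of a normalised bump, the product of a flat function with its mirror
 image.\<close>
lemma smooth_step_exists:
 obtains rho rho' :: "real => real" where
  "smooth rho" "!!x. (rho has_real_derivative rho' x) (at x)" "smooth rho'"
  "!!x. 0 <= rho' x" "!!x. x <= 1 \<or> 2 <= x ==> rho' x = 0" "!!x. x <= 1 ==> rho x = 0" "!!x. x >= 2 ==> rho x = 1"
  "!!x. 0 <= rho x" "!!x. rho x <= 1"
proof -
 define b where "b x = flat 1 (x - 1) * flat 1 (2 - x)" for x :: real
 have sb: "smooth b"
  using smooth_mult[OF smooth_affine_real[OF smooth_flat[of 1], of 1 "-1"] smooth_affine_real[OF smooth_flat[of 1], of "-1" 2]]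
  unfolding b_def by simp
 have b0: "0 <= b x" for x by (simp add: b_def flat_def)
 have bz: "b x = 0" if "x <= 1 \<or> 2 <= x" for x using that by (auto simp: b_def flat_def)
 have bc: "continuous_on S b" for S
  using smoothD(2)[OF sb] continuous_on_subset by blast
 define R where "R x = integral {1..x} b" for x
 define R0 where "R0 x = integral {0..x} b" for x
 have R0d: "(R0 has_real_derivative b x) (at x)" if "x > 0" for x
 proof -
  have "(R0 has_real_derivative b x) (at x within {0..x+1})"
   unfolding R0_def by (rule integral_has_real_derivative[OF bc]) (use that in auto)
  then show ?thesis using that by (simp add: at_within_Icc_at)
 qed
 have Rz: "R x = 0" if "x <= 1" for x
  using that unfolding R_def by (cases "x < 1") auto
 have R0R: "R0 x = R x" for x
 proof (cases "x <= 1")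
  case True
  have "R0 x = integral {0..x} (%_. 0)" unfolding R0_def by (rule integral_cong) (use True bz in auto)
  then show ?thesis using Rz[OF True] by simp
 next
  case False
  have "R0 x = integral {0..1} b + integral {1..x} b"
   unfolding R0_def by (rule Henstock_Kurzweil_Integration.integral_combine[symmetric])
    (use False bc in \<open>auto intro: integrable_continuous_real\<close>)
  moreover have "integral {0..1} b = integral {0..1} (%_::real. 0::real)" by (rule Henstock_Kurzweil_Integration.integral_cong) (use bz in auto)
  ultimately show ?thesis by (simp add: R_def)
 qed
 have Rd: "(R has_real_derivative b x) (at x)" for x
 proof (cases "x > 0")
  case True
  moreover have "R0 = R" by (rule ext) (rule R0R)
  ultimately show ?thesis using R0d by simp
 next
  case False
  have "((%_. 0) has_real_derivative 0) (at x)" by simp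
  moreover have "eventually (%y. R y = 0) (nhds x)"
   using eventually_nhds_in_open[of "{..<1}" x] False by (auto elim!: eventually_mono simp: Rz)
  ultimately show ?thesis using False DERIV_cong_ev[of x x R "%_. 0"] bz[of x] by simp
 qed
 have mono: "R x <= R y" if "x <= y" for x y
  by (rule DERIV_nonneg_imp_nondecreasing[OF that]) (use Rd b0 in auto)
 have const: "R x = R 2" if "x >= 2" for x
 proof (cases "x > 2")
  case True
  have "\<exists>z. 2 < z \<and> z < x \<and> R x - R 2 = (x - 2) * b z"
   by (rule MVT2[OF True]) (use Rd in auto)
  then show ?thesis using bz by force
 qed (use that in auto)
 have pos: "R 2 > 0"
 proof -
  have "R 1 < R 2"
  proof (rule DERIV_pos_imp_increasing_open[where f = R])
   show "\<exists>y. (R has_real_derivative y) (at x) \<and> y > 0" if "1 < x" "x < 2" for x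
    using Rd[of x] that by (intro exI[of _ "b x"]) (auto simp: b_def flat_def)
   show "continuous_on {1..2} R" using Rd DERIV_isCont by (auto intro!: continuous_at_imp_continuous_on)
  qed simp
  then show ?thesis using Rz[of 1] by simp
 qed
 let ?r = "%x. R x / R 2" and ?r' = "%x. b x / R 2"
 have d: "(?r has_real_derivative ?r' x) (at x)" for x
  using Rd[of x] pos by (auto intro!: derivative_eq_intros)
 have s': "smooth ?r'" using smooth_mult[OF sb smooth_const[of "1 / R 2"]] by simp
 have s: "smooth ?r" by (rule smoothI_real[OF d s'])
 have "0 <= R x \<and> R x <= R 2" for x
 proof (cases "x <= 1")
  case True then show ?thesis using Rz[of x] pos by simp
 next
  case False
  then have "0 <= R x" using mono[of 1 x] Rz[of 1] by simp
  then show ?thesis using mono[of x 2] const[of x] by (cases "x <= 2") auto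
 qed
 note R01 = this
 have r: "0 <= ?r x" "?r x <= 1" "0 <= ?r' x" for x using R01[of x] b0[of x] pos by simp_all
 have z': "?r' x = 0" if "x <= 1 \<or> 2 <= x" for x using bz[OF that] by simp
 have z: "?r x = 0" if "x <= 1" for x using Rz[OF that] by simp
 have o: "?r x = 1" if "2 <= x" for x using const[OF that] pos by simp
 show thesis by (rule that[OF s d s' r(3) z' z o r(1,2)])
qed

lemma integrable_lebesgue_on_subset:
 fixes f :: "'a::euclidean_space => real"
 assumes "integrable (lebesgue_on T) f" "S \<subseteq> T" "S \<in> sets lebesgue" "T \<in> sets lebesgue"
 shows "integrable (lebesgue_on S) f"
 using assms set_integrable_subset[of lebesgue T f S]
 by (simp add: integrable_restrict_space set_integrable_def)

lemma test_functionsI: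
 assumes "smooth phi" "compact K" "K \<subseteq> \<Omega>" "!!z. z \<notin> K ==> phi z = 0"
 shows "phi \<in> test_functions \<Omega>"
proof -
 have sub: "{z. phi z \<noteq> 0} \<subseteq> K" using assms(4) by auto
 then have cl: "closure {z. phi z \<noteq> 0} \<subseteq> K"
  using closure_minimal compact_imp_closed[OF assms(2)] by blast
 then have "compact (closure {z. phi z \<noteq> 0})"
  using compact_closure bounded_subset[OF compact_imp_bounded[OF assms(2)] sub] by auto
 then show ?thesis using cl assms(1,3) unfolding test_functions_def smooth_def by auto
qed

lemma test_functionsE:
 assumes "phi \<in> test_functions \<Omega>"
 obtains K where "smooth phi" "compact K" "K \<subseteq> \<Omega>" "!!z. z \<notin> K ==> phi z = 0"
proof (rule that)
 show "smooth phi" "compact (closure {z. phi z \<noteq> 0})" "closure {z. phi z \<noteq> 0} \<subseteq> \<Omega>"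
  using assms unfolding test_functions_def smooth_def by auto
 show "phi z = 0" if "z \<notin> closure {z. phi z \<noteq> 0}" for z
  using that closure_subset[of "{z. phi z \<noteq> 0}"] by auto
qed

text \<open>A unit mass concentrating at \<open>x0\<close> evaluates a continuous function there.\<close>
lemma concentrating_kernel:
 fixes d :: "nat => real => real"
 assumes d0: "!!n x. 0 <= d n x" and dc: "!!n. continuous_on {a..b} (d n)"
  and d1: "!!n. (d n has_integral 1) {a..b}"
  and supp: "!!n x. x \<in> {a..b} ==> d n x \<noteq> 0 ==> abs (x - x0) <= xi n" and xi: "xi \<longlonglongrightarrow> 0"
  and R: "continuous_on {a..b} R" and x0: "x0 \<in> {a..b}"
 shows "(%n. integral {a..b} (%x. d n x * R x)) \<longlonglongrightarrow> R x0"
proof (rule LIMSEQ_I)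
 fix e :: real assume e: "e > 0"
 obtain \<delta> where \<delta>: "\<delta> > 0" "!!x. x \<in> {a..b} ==> dist x x0 < \<delta> ==> dist (R x) (R x0) < e/2"
  using R x0 e unfolding continuous_on_iff by (metis half_gt_zero)
 obtain N where N: "!!n. n >= N ==> abs (xi n) < \<delta>"
  using LIMSEQ_D[OF xi \<delta>(1)] by auto
 show "\<exists>no. \<forall>n\<ge>no. norm (integral {a..b} (%x. d n x * R x) - R x0) < e"
 proof (intro exI allI impI)
  fix n assume n: "n >= N"
  have di: "d n integrable_on {a..b}" and i1: "integral {a..b} (d n) = 1" using d1 by auto
  have dRi: "(%x. d n x * R x) integrable_on {a..b}"
   by (intro integrable_continuous_real continuous_intros dc R)
  have "integral {a..b} (%x. d n x * R x) - R x0 = integral {a..b} (%x. d n x * R x) - integral {a..b} (%x. d n x * R x0)"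
   using i1 by simp
  also have "... = integral {a..b} (%x. d n x * (R x - R x0))"
   using Henstock_Kurzweil_Integration.integral_diff[OF dRi integrable_on_mult_left[OF di, of "R x0"]]
   by (simp only: right_diff_distrib)
  finally have eq: "integral {a..b} (%x. d n x * R x) - R x0 = integral {a..b} (%x. d n x * (R x - R x0))" .
  have "norm (integral {a..b} (%x. d n x * (R x - R x0))) <= integral {a..b} (%x. d n x * (e/2))"
  proof (rule integral_norm_bound_integral)
   show "(%x. d n x * (R x - R x0)) integrable_on {a..b}"
    by (intro integrable_continuous_real continuous_intros dc R)
   show "(%x. d n x * (e/2)) integrable_on {a..b}"
    by (intro integrable_continuous_real continuous_intros dc)
   show "norm (d n x * (R x - R x0)) <= d n x * (e/2)" if x: "x \<in> {a..b}" for x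
   proof (cases "d n x = 0")
    case False
    then have "dist x x0 < \<delta>" using supp[OF x] N[OF n] by (force simp: dist_real_def)
    then have "abs (R x - R x0) <= e/2" using \<delta>(2)[OF x] by (simp add: dist_real_def)
    then show ?thesis using mult_left_mono[OF _ d0[of n x], of "abs (R x - R x0)" "e/2"] d0[of n x]
     by (simp add: abs_mult)
   qed simp
  qed
  also have "... = e/2" using i1 by simp
  finally show "norm (integral {a..b} (%x. d n x * R x) - R x0) < e" using eq e by simp
 qed
qed

text \<open>Test functions that rise from \<open>0\<close> to \<open>1\<close> within a shrinking distance of
 \<open>a\<close> and fall symmetrically near \<open>b\<close>. Their derivatives act in the limit as the
 difference of the point evaluations at the two ends; this is how boundary and initial values are extracted
 from distributional identities.\<close>
lemma cutoffs_exist: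
 fixes a b :: real
 assumes ab: "a < b"
 obtains om om' :: "nat => real => real" where
  "!!n. om n \<in> test_functions {a<..<b}"
  "!!n x. (om n has_real_derivative om' n x) (at x)" "!!n. smooth (om' n)"
  "!!n x. 0 <= om n x" "!!n x. om n x <= 1"
  "!!x. a < x ==> x < b ==> (%n. om n x) \<longlonglongrightarrow> 1"
  "!!R. continuous_on {a..b} R ==> (%n. LINT x|leb a b. om' n x * R x) \<longlonglongrightarrow> R a - R b"
proof -
 obtain rho rho' :: "real => real" where rho: "smooth rho" "!!x. (rho has_real_derivative rho' x) (at x)" "smooth rho'"
  "!!x. 0 <= rho' x" "!!x. x <= 1 \<or> 2 <= x ==> rho' x = 0" "!!x. x <= 1 ==> rho x = 0" "!!x. x >= 2 ==> rho x = 1"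
  "!!x. 0 <= rho x" "!!x. rho x <= 1"
  by (rule smooth_step_exists) (rule that)
 define N where "N n = real n + 8 / (b - a)" for n
 have Npos: "N n > 0" for n using ab by (simp add: N_def add_nonneg_pos)
 have Nab: "N n * (b - a) >= 8" for n
 proof -
  have "b - a \<noteq> 0" using ab by simp
  then have "8 / (b - a) * (b - a) = 8" by (subst times_divide_eq_left) (rule nonzero_mult_div_cancel_right)
  then have "N n * (b - a) = real n * (b - a) + 8" unfolding N_def distrib_right by simp
  then show ?thesis using ab by simp
 qed
 have Ninf: "filterlim N at_top sequentially"
  unfolding N_def using filterlim_tendsto_add_at_top[OF tendsto_const filterlim_real_sequentially, of "8 / (b - a)"]
  by (simp add: add.commute)
 define om where "om n x = rho (N n * (x - a)) * rho (N n * (b - x))" for n x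
 define dl where "dl n x = N n * rho' (N n * (x - a))" for n x
 define dr where "dr n x = N n * rho' (N n * (b - x))" for n x
 have dl_eq: "dl n = (%x. N n * rho' (N n * (x - a)))" and dr_eq: "dr n = (%x. N n * rho' (N n * (b - x)))" for n
  by (simp_all add: fun_eq_iff dl_def dr_def)
 have sl: "smooth (%x. rho (N n * (x - a)))" "smooth (dl n)"
  and sr: "smooth (%x. rho (N n * (b - x)))" "smooth (dr n)" for n
  using smooth_affine_real[OF rho(1), of "N n" "- N n * a"] smooth_affine_real[OF rho(1), of "- N n" "N n * b"]
   smooth_mult[OF smooth_const[of "N n"] smooth_affine_real[OF rho(3), of "N n" "- N n * a"]]
   smooth_mult[OF smooth_const[of "N n"] smooth_affine_real[OF rho(3), of "- N n" "N n * b"]]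
  by (simp_all add: dl_eq dr_eq algebra_simps)
 have Dl: "((%x. rho (N n * (x - a))) has_real_derivative dl n x) (at x)"
  and Dr: "((%x. - rho (N n * (b - x))) has_real_derivative dr n x) (at x)" for n x
 proof -
  have l: "((%x. N n * (x - a)) has_real_derivative N n) (at x)"
   and r: "((%x. N n * (b - x)) has_real_derivative - N n) (at x)"
   by (auto intro!: derivative_eq_intros)
  show "((%x. rho (N n * (x - a))) has_real_derivative dl n x) (at x)"
   using DERIV_chain2[OF rho(2) l] by (simp add: dl_def mult.commute)
  show "((%x. - rho (N n * (b - x))) has_real_derivative dr n x) (at x)"
   using DERIV_minus[OF DERIV_chain2[OF rho(2) r]] by (simp add: dr_def mult.commute)
 qed
 have far: "N n * (x - a) <= 2 ==> N n * (b - x) >= 2" "N n * (b - x) <= 2 ==> N n * (x - a) >= 2" for n x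
  using Nab[of n] by (simp_all add: algebra_simps)
 have Dom: "(om n has_real_derivative (dl n x - dr n x)) (at x)" for n x
 proof -
  have "(om n has_real_derivative (dl n x * rho (N n * (b - x)) + (- dr n x) * rho (N n * (x - a)))) (at x)"
   unfolding om_def
   using DERIV_mult[OF Dl[of n x] DERIV_minus[OF Dr[of n x]]] by simp
  moreover have "dl n x * rho (N n * (b - x)) = dl n x"
   using rho(5)[of "N n * (x - a)"] far(1)[of n x] rho(7)[of "N n * (b - x)"]
   by (cases "N n * (x - a) <= 2") (auto simp: dl_def)
  moreover have "dr n x * rho (N n * (x - a)) = dr n x"
   using rho(5)[of "N n * (b - x)"] far(2)[of n x] rho(7)[of "N n * (x - a)"]
   by (cases "N n * (b - x) <= 2") (auto simp: dr_def)
  ultimately show ?thesis by simp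
 qed
 have test: "om n \<in> test_functions {a<..<b}" for n
 proof (rule test_functionsI[of _ "{a + 1 / N n .. b - 1 / N n}"])
  show "smooth (om n)" unfolding om_def by (rule smooth_mult[OF sl(1) sr(1)])
  have "0 < 1 / N n" using Npos by simp
  then show "{a + 1 / N n..b - 1 / N n} \<subseteq> {a<..<b}"
   by (intro subsetI, unfold atLeastAtMost_iff greaterThanLessThan_iff, intro conjI; linarith)
  show "om n z = 0" if z: "z \<notin> {a + 1 / N n..b - 1 / N n}" for z
  proof -
   have "N n * (z - a) <= 1 \<or> N n * (b - z) <= 1"
    using z Npos[of n] by (auto simp: field_simps)
   then show ?thesis using rho(6) by (auto simp: om_def)
  qed
 qed simp
 have lim1: "(%n. om n x) \<longlonglongrightarrow> 1" if x: "a < x" "x < b" for x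
 proof -
  have "eventually (%n. N n >= 2 / (x - a)) sequentially" "eventually (%n. N n >= 2 / (b - x)) sequentially"
   using Ninf unfolding filterlim_at_top by blast+
  then have "eventually (%n. om n x = 1) sequentially"
  proof eventually_elim
   case (elim n)
   then have "N n * (x - a) >= 2" "N n * (b - x) >= 2" using x by (simp_all add: field_simps)
   then show ?case using rho(7) by (simp add: om_def)
  qed
  then show ?thesis by (rule tendsto_eventually)
 qed
 have xi: "(%n. 2 / N n) \<longlonglongrightarrow> 0"
  by (rule tendsto_divide_0[OF tendsto_const filterlim_at_top_imp_at_infinity[OF Ninf]])
 have cl: "continuous_on S (dl n)" and cr: "continuous_on S (dr n)" for S n
  using smoothD(2)[OF sl(2)] smoothD(2)[OF sr(2)] continuous_on_subset by blast+
 have kernel: "(%n. LINT x|leb a b. (dl n x - dr n x) * R x) \<longlonglongrightarrow> R a - R b"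
  if R: "continuous_on {a..b} R" for R
 proof -
  have L: "(%n. integral {a..b} (%x. dl n x * R x)) \<longlonglongrightarrow> R a"
  proof (rule concentrating_kernel[OF _ cl _ _ xi R])
   show "0 <= dl n x" for n x using rho(4) Npos[of n] by (simp add: dl_def)
   have I: "(dl n has_integral (rho (N n * (b - a)) - rho (N n * (a - a)))) {a..b}" for n
    by (rule fundamental_theorem_of_calculus)
      (use ab Dl in \<open>auto simp flip: has_real_derivative_iff_has_vector_derivative intro: DERIV_subset\<close>)
   show "(dl n has_integral 1) {a..b}" for n using I[of n] rho(6)[of 0] rho(7)[of "N n * (b - a)"] Nab[of n] by simp
   show "abs (x - a) <= 2 / N n" if "x \<in> {a..b}" "dl n x \<noteq> 0" for n x
   proof -
    have "N n * (x - a) < 2" using that(2) rho(5)[of "N n * (x - a)"] by (auto simp: dl_def not_le[symmetric])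
    then show ?thesis using that(1) Npos[of n] by (simp add: field_simps)
   qed
   show "a \<in> {a..b}" using ab by simp
  qed
  have Rr: "(%n. integral {a..b} (%x. dr n x * R x)) \<longlonglongrightarrow> R b"
  proof (rule concentrating_kernel[OF _ cr _ _ xi R])
   show "0 <= dr n x" for n x using rho(4) Npos[of n] by (simp add: dr_def)
   have I: "(dr n has_integral (- rho (N n * (b - b)) - (- rho (N n * (b - a))))) {a..b}" for n
    by (rule fundamental_theorem_of_calculus)
      (use ab Dr in \<open>auto simp flip: has_real_derivative_iff_has_vector_derivative intro: DERIV_subset\<close>)
   show "(dr n has_integral 1) {a..b}" for n using I[of n] rho(6)[of 0] rho(7)[of "N n * (b - a)"] Nab[of n] by simp
   show "abs (x - b) <= 2 / N n" if "x \<in> {a..b}" "dr n x \<noteq> 0" for n x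
   proof -
    have "N n * (b - x) < 2" using that(2) rho(5)[of "N n * (b - x)"] by (auto simp: dr_def not_le[symmetric])
    then show ?thesis using that(1) Npos[of n] by (simp add: field_simps)
   qed
   show "b \<in> {a..b}" using ab by simp
  qed
  have "(LINT x|leb a b. (dl n x - dr n x) * R x) =
    integral {a..b} (%x. dl n x * R x) - integral {a..b} (%x. dr n x * R x)" for n
  proof -
   have c: "continuous_on {a..b} (%x. (dl n x - dr n x) * R x)"
    by (intro continuous_intros cl cr R)
   have "integrable (lebesgue_on {a..b}) (%x. (dl n x - dr n x) * R x)"
    by (rule continuous_imp_integrable_real[OF c])
   then have "integrable (leb a b) (%x. (dl n x - dr n x) * R x)"
    by (rule integrable_lebesgue_on_subset) auto
   then have "(LINT x|leb a b. (dl n x - dr n x) * R x) = integral {a<..<b} (%x. (dl n x - dr n x) * R x)"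
    by (rule lebesgue_integral_eq_integral) auto
   also have "... = integral {a..b} (%x. (dl n x - dr n x) * R x)"
    by (rule integral_open_interval_real[symmetric])
   also have "... = integral {a..b} (%x. dl n x * R x - dr n x * R x)" by (simp add: left_diff_distrib)
   also have "... = integral {a..b} (%x. dl n x * R x) - integral {a..b} (%x. dr n x * R x)"
    by (rule integral_diff) (intro integrable_continuous_real continuous_intros cl cr R)+
   finally show ?thesis .
  qed
  then show ?thesis using tendsto_diff[OF L Rr] by simp
 qed
 show thesis
 proof (rule that[of om "%n x. dl n x - dr n x"])
  show "smooth (%x. dl n x - dr n x)" for n
   using smooth_add[OF sl(2) smooth_mult[OF smooth_const[of "-1"] sr(2)]] by simp
  show "0 <= om n x" "om n x <= 1" for n x
   using rho(8,9) by (auto simp: om_def intro: mult_le_one)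
 qed (use test Dom lim1 kernel in auto)
qed

section \<open>Primitives of integrable functions\<close>

text \<open>An absolutely continuous function is always used together with its density, so the two are related
 by a predicate. It replaces the fundamental theorem of calculus for densities that are merely integrable.\<close>
definition primitive_on :: "real => real => (real => real) => (real => real) => bool" where
 "primitive_on r t k z \<longleftrightarrow> lint {r..t} k \<and>
   (\<forall>s\<in>{r..t}. z s = z r + (LBINT x:{r..s}. k x))"

lemma set_integral_subset_le:
 fixes f :: "'a => real"
 assumes "set_integrable M T f" "S \<in> sets M" "S \<subseteq> T" "!!x. x \<in> T ==> 0 <= f x"
 shows "(LINT x:S|M. f x) <= (LINT x:T|M. f x)"
proof -
 have "set_integrable M S f" using assms(1-3) by (rule set_integrable_subset)
 then show ?thesis
  using assms unfolding set_lebesgue_integral_def set_integrable_def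
  by (intro integral_mono) (auto simp: indicator_def)
qed

lemma set_integral_Icc_combine:
 fixes k :: "real => real"
 assumes "lint {r..t} k" "r <= s" "s <= t"
 shows "(LBINT x:{r..t}. k x) = (LBINT x:{r..s}. k x) + (LBINT x:{s..t}. k x)"
proof -
 have i: "lint {r..s} k" "lint {s..t} k"
  using assms by (auto intro: set_integrable_subset)
 show ?thesis
  using set_borel_integral_eq_integral[OF assms(1)] set_borel_integral_eq_integral[OF i(1)]
   set_borel_integral_eq_integral[OF i(2)]
   Henstock_Kurzweil_Integration.integral_combine[of r s t k] assms(2,3) by simp
qed

lemma primitive_onD:
 assumes "primitive_on r t k z"
 shows "lint {r..t} k" "r <= s ==> s <= t ==> z s = z r + (LBINT x:{r..s}. k x)"
  "r <= s ==> s <= s' ==> s' <= t ==> lint {s..s'} k"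
proof -
 show "lint {r..t} k" using assms unfolding primitive_on_def by blast
 then show "r <= s ==> s <= s' ==> s' <= t ==> lint {s..s'} k"
  by (auto intro: set_integrable_subset)
 show "r <= s ==> s <= t ==> z s = z r + (LBINT x:{r..s}. k x)"
  using assms unfolding primitive_on_def by (meson atLeastAtMost_iff)
qed

lemma primitive_on_increment:
 assumes "primitive_on r t k z" "r <= s" "s <= s'" "s' <= t"
 shows "z s' - z s = (LBINT x:{s..s'}. k x)"
proof -
 have i: "lint {r..s'} k" using primitive_onD(3)[OF assms(1)] assms by simp
 show ?thesis
  using primitive_onD(2)[OF assms(1), of s] primitive_onD(2)[OF assms(1), of s'] set_integral_Icc_combine[OF i, of s] assms(2-4)
  by linarith
qed

lemma primitive_on_subset:
 assumes "primitive_on r t k z" "r <= r'" "r' <= t'" "t' <= t"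
 shows "primitive_on r' t' k z"
 unfolding primitive_on_def
proof (intro conjI ballI)
 show "lint {r'..t'} k"
  by (rule primitive_onD(3)[OF assms])
 show "z s = z r' + (LBINT x:{r'..s}. k x)" if "s \<in> {r'..t'}" for s
  using primitive_on_increment[OF assms(1,2), of s] that assms(3,4) by (simp add: algebra_simps)
qed

lemma primitive_on_continuous:
 assumes "primitive_on r t k z"
 shows "continuous_on {r..t} z"
proof -
 have i: "lint {r..t} k" by (rule primitive_onD(1)[OF assms])
 have eq: "z r + integral {r..s} k = z s" if "s \<in> {r..t}" for s
 proof -
  have "lint {r..s} k" using i that by (auto intro: set_integrable_subset)
  then show ?thesis
   using primitive_onD(2)[OF assms, of s] that set_borel_integral_eq_integral(2)[of "{r..s}" k] by simp
 qed
 have "continuous_on {r..t} (%s. z r + integral {r..s} k)"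
  by (intro continuous_intros indefinite_integral_continuous_1 set_borel_integral_eq_integral(1)[OF i])
 then show ?thesis by (rule continuous_on_eq) (rule eq)
qed

lemma primitive_on_add:
 assumes "primitive_on r t k z" "primitive_on r t l w"
 shows "primitive_on r t (%s. k s + l s) (%s. z s + w s)"
 unfolding primitive_on_def
proof (intro conjI ballI)
 show "lint {r..t} (%s. k s + l s)"
  by (rule set_integral_add(1)[OF primitive_onD(1)[OF assms(1)] primitive_onD(1)[OF assms(2)]])
 fix s assume s: "s \<in> {r..t}"
 then have "lint {r..s} k" "lint {r..s} l"
  using primitive_onD(3)[OF assms(1)] primitive_onD(3)[OF assms(2)] by simp_all
 then show "z s + w s = z r + w r + (LBINT x:{r..s}. k x + l x)"
  using s primitive_onD(2)[OF assms(1), of s] primitive_onD(2)[OF assms(2), of s] by (simp add: set_integral_add)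
qed

lemma primitive_on_cmult:
 assumes "primitive_on r t k z"
 shows "primitive_on r t (%s. c * k s) (%s. c * z s)"
 unfolding primitive_on_def
proof (intro conjI ballI)
 show "lint {r..t} (%s. c * k s)" using primitive_onD(1)[OF assms] by simp
 show "c * z s = c * z r + (LBINT x:{r..s}. c * k x)" if "s \<in> {r..t}" for s
  using primitive_onD(2)[OF assms, of s] that by (simp add: distrib_left)
qed

lemma primitive_on_C1:
 assumes "!!s. s \<in> {r..t} ==> (f has_real_derivative f' s) (at s)" "continuous_on {r..t} f'"
 shows "primitive_on r t f' f"
 unfolding primitive_on_def
proof (intro conjI ballI)
 show i: "lint {r..t} f'"
  unfolding set_integrable_def by (rule borel_integrable_compact) (use assms in auto)
 fix s assume s: "s \<in> {r..t}"
 have "(f' has_integral (f s - f r)) {r..s}"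
  by (rule fundamental_theorem_of_calculus)
    (use s assms(1) in \<open>auto simp flip: has_real_derivative_iff_has_vector_derivative intro: has_field_derivative_at_within\<close>)
 moreover have "lint {r..s} f'" by (rule set_integrable_subset[OF i]) (use s in auto)
 ultimately show "f s = f r + (LBINT x:{r..s}. f' x)"
  using set_borel_integral_eq_integral(2)[of "{r..s}" f'] by (simp add: integral_unique)
qed

lemma set_integrable_continuous_mult:
 fixes g k :: "real => real"
 assumes g: "continuous_on {r..t} g" and k: "lint {r..t} k"
 shows "lint {r..t} (%s. g s * k s)"
proof -
 obtain B where B: "!!s. s \<in> {r..t} ==> abs (g s) <= B"
  using compact_imp_bounded[OF compact_continuous_image[OF g compact_Icc]]
  unfolding bounded_iff by (metis imageI real_norm_def)
 have gm: "(%x. indicator {r..t} x *\<^sub>R g x) \<in> borel1"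
  by (rule borel_measurable_continuous_on_indicator) (use g in auto)
 have km: "integrable lborel (%x. indicator {r..t} x *\<^sub>R k x)" using k by (simp add: set_integrable_def)
 have "integrable lborel (%x. (indicator {r..t} x *\<^sub>R g x) * (indicator {r..t} x *\<^sub>R k x))"
 proof (rule Bochner_Integration.integrable_bound[OF integrable_mult_right[OF km, of B]])
  show "(%x. (indicator {r..t} x *\<^sub>R g x) * (indicator {r..t} x *\<^sub>R k x)) \<in> borel_measurable lborel"
   by (rule borel_measurable_times) (use gm km in auto)
  show "AE x in lborel. norm ((indicator {r..t} x *\<^sub>R g x) * (indicator {r..t} x *\<^sub>R k x)) <= norm (B * (indicator {r..t} x *\<^sub>R k x))"
   using B by (auto simp: abs_mult indicator_def intro!: mult_right_mono AE_I2 order_trans[OF B])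
 qed
 moreover have "(%x. (indicator {r..t} x *\<^sub>R g x) * (indicator {r..t} x *\<^sub>R k x)) = (%x. indicator {r..t} x *\<^sub>R (g x * k x))"
  by (auto simp: indicator_def)
 ultimately show ?thesis by (simp add: set_integrable_def)
qed

text \<open>The chain rule for absolutely continuous functions: on short intervals \<open>\<Phi>' (z x)\<close>
 is within \<open>e\<close> of a mean value of \<open>\<Phi>'\<close>, so the error over a fine
 subdivision is at most \<open>e\<close> times the integral of the absolute density.\<close>
lemma primitive_on_chain:
 assumes z: "primitive_on r t k z"
  and D: "!!x. (\<Phi> has_real_derivative \<Phi>' x) (at x)" and c: "continuous_on UNIV \<Phi>'"
 shows "primitive_on r t (%s. \<Phi>' (z s) * k s) (%s. \<Phi> (z s))"
proof -
 have ki: "lint {r..t} k" by (rule primitive_onD(1)[OF z])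
 have zc: "continuous_on {r..t} z" by (rule primitive_on_continuous[OF z])
 have gc: "continuous_on {r..t} (%s. \<Phi>' (z s))"
  by (rule continuous_on_compose2[OF c zc]) auto
 have gki: "lint {r..t} (%s. \<Phi>' (z s) * k s)"
  by (rule set_integrable_continuous_mult[OF gc ki])
 have kabs: "lint {r..t} (%s. abs (k s))"
  using set_integrable_norm[OF ki] by simp
 have key: "abs (\<Phi> (z t') - \<Phi> (z r) - (LBINT x:{r..t'}. \<Phi>' (z x) * k x)) <= e * (LBINT x:{r..t}. abs (k x))"
  if t': "t' \<in> {r..t}" and e: "e > 0" for t' e
 proof -
  have "uniformly_continuous_on {r..t} (%s. \<Phi>' (z s))"
   by (rule compact_uniformly_continuous[OF gc]) simp
  then obtain \<delta> where \<delta>: "\<delta> > 0"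
   "!!s s'. s \<in> {r..t} ==> s' \<in> {r..t} ==> abs (s' - s) < \<delta> ==> abs (\<Phi>' (z s') - \<Phi>' (z s)) < e"
   unfolding uniformly_continuous_on_def dist_real_def using e by meson
  have step: "abs (\<Phi> (z s') - \<Phi> (z s) - (LBINT x:{s..s'}. \<Phi>' (z x) * k x)) <= e * (LBINT x:{s..s'}. abs (k x))"
   if s: "r <= s" "s <= s'" "s' <= t" "s' - s < \<delta>" for s s'
  proof -
   have inc: "z s' - z s = (LBINT x:{s..s'}. k x)" by (rule primitive_on_increment[OF z s(1-3)])
   have ki': "lint {s..s'} k" and kabs': "lint {s..s'} (%x. abs (k x))"
    and gki': "lint {s..s'} (%x. \<Phi>' (z x) * k x)"
    using s ki kabs gki by (auto intro: set_integrable_subset)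
   obtain sg where sg: "sg \<in> {s..s'}" "\<Phi> (z s') - \<Phi> (z s) = \<Phi>' (z sg) * (z s' - z s)"
   proof -
    have "\<exists>x\<in>closed_segment (z s) (z s'). \<Phi> (z s') - \<Phi> (z s) = \<Phi>' x * (z s' - z s)"
    proof -
     consider "z s = z s'" | "z s < z s'" | "z s > z s'" by linarith
     then show ?thesis
     proof cases
      case 1 then show ?thesis by auto
     next
      case 2
      show ?thesis using MVT2[OF 2, of \<Phi> \<Phi>'] D 2
       by (auto simp: closed_segment_eq_real_ivl mult.commute)
     next
      case 3
      have "\<exists>x. z s' < x \<and> x < z s \<and> \<Phi> (z s) - \<Phi> (z s') = (z s - z s') * \<Phi>' x"
       using MVT2[OF 3, of \<Phi> \<Phi>'] D by blast
      then obtain x where x: "z s' < x" "x < z s" "\<Phi> (z s) - \<Phi> (z s') = (z s - z s') * \<Phi>' x" by blast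
      show ?thesis using x by (intro bexI[of _ x]) (auto simp: closed_segment_eq_real_ivl algebra_simps)
     qed
    qed
    then obtain x where x: "x \<in> closed_segment (z s) (z s')" "\<Phi> (z s') - \<Phi> (z s) = \<Phi>' x * (z s' - z s)" by blast
    have "connected (z ` {s..s'})"
     by (rule connected_continuous_image[OF continuous_on_subset[OF zc]]) (use s in auto)
    then have "convex (z ` {s..s'})"
     using is_interval_connected_1 is_interval_convex_1 by blast
    then have "closed_segment (z s) (z s') \<subseteq> z ` {s..s'}"
     using s by (intro closed_segment_subset) auto
    then show ?thesis using x that by auto
   qed
   have ci: "lint {s..s'} (%x. \<Phi>' (z sg) * k x)" using ki' by simp
   have "\<Phi> (z s') - \<Phi> (z s) - (LBINT x:{s..s'}. \<Phi>' (z x) * k x)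
     = (LBINT x:{s..s'}. \<Phi>' (z sg) * k x) - (LBINT x:{s..s'}. \<Phi>' (z x) * k x)"
    using sg(2) inc by simp
   also have "... = (LBINT x:{s..s'}. \<Phi>' (z sg) * k x - \<Phi>' (z x) * k x)"
    by (rule set_integral_diff(2)[OF ci gki', symmetric])
   also have "abs (...) <= (LBINT x:{s..s'}. e * abs (k x))"
    unfolding set_lebesgue_integral_def
   proof (rule integral_abs_bound_integral)
    show "integrable lborel (%x. indicat_real {s..s'} x *\<^sub>R (\<Phi>' (z sg) * k x - \<Phi>' (z x) * k x))"
     using set_integral_diff(1)[OF ci gki'] by (simp add: set_integrable_def)
    show "integrable lborel (%x. indicat_real {s..s'} x *\<^sub>R (e * abs (k x)))"
     using set_integrable_mult_right[OF kabs', of e] by (simp add: set_integrable_def)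
    fix x
    show "abs (indicat_real {s..s'} x *\<^sub>R (\<Phi>' (z sg) * k x - \<Phi>' (z x) * k x)) <= indicat_real {s..s'} x *\<^sub>R (e * abs (k x))"
    proof (cases "x \<in> {s..s'}")
     case True
     then have "abs (\<Phi>' (z sg) - \<Phi>' (z x)) <= e" using \<delta>(2)[of x sg] sg(1) s by force
     then show ?thesis using True by (simp add: left_diff_distrib[symmetric] abs_mult mult_right_mono)
    qed simp
   qed
   finally show ?thesis by simp
  qed
  obtain n :: nat where n: "(t' - r) / real (Suc n) < \<delta>"
  proof -
   obtain n where "(t' - r) / \<delta> < real n" using reals_Archimedean2 by blast
   then have "(t' - r) / \<delta> < real (Suc n)" by simp
   then have "(t' - r) / real (Suc n) < \<delta>" using \<delta>(1) by (simp add: field_simps)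
   then show ?thesis using that by blast
  qed
  define h where "h = (t' - r) / real (Suc n)"
  have h0: "h >= 0" using t' by (simp add: h_def)
  have hn: "real (Suc n) * h = t' - r" by (simp add: h_def)
  have "abs (\<Phi> (z (r + i * h)) - \<Phi> (z r) - (LBINT x:{r..r + i * h}. \<Phi>' (z x) * k x)) <= e * (LBINT x:{r..r + i * h}. abs (k x))"
   if "i <= Suc n" for i :: nat
   using that
  proof (induction i)
   case 0
   have "(LBINT x:{r..r}. f x) = 0" for f :: "real => real"
    unfolding set_lebesgue_integral_def
    by (rule integral_eq_zero_AE) (rule eventually_mono[OF AE_lborel_singleton[of r]], auto)
   then show ?case by simp
  next
   case (Suc i)
   define s where "s = r + i * h"
   define s' where "s' = r + Suc i * h"
   have "real (Suc i) * h <= real (Suc n) * h" by (rule mult_right_mono) (use Suc.prems h0 in auto)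
   then have s: "r <= s" "s <= s'" "s' <= t'" "s' - s < \<delta>"
    using h0 hn n unfolding h_def[symmetric] by (auto simp: s_def s'_def algebra_simps)
   have st: "s' <= t" using s t' by simp
   have gki': "lint {r..s'} (%x. \<Phi>' (z x) * k x)" and kabs': "lint {r..s'} (%x. abs (k x))"
    using gki kabs st by (auto intro: set_integrable_subset)
   have IH: "abs (\<Phi> (z s) - \<Phi> (z r) - (LBINT x:{r..s}. \<Phi>' (z x) * k x)) <= e * (LBINT x:{r..s}. abs (k x))"
    using Suc by (simp add: s_def)
   have "(LBINT x:{r..s'}. \<Phi>' (z x) * k x) = (LBINT x:{r..s}. \<Phi>' (z x) * k x) + (LBINT x:{s..s'}. \<Phi>' (z x) * k x)"
    by (rule set_integral_Icc_combine[OF gki' s(1,2)])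
   moreover have "(LBINT x:{r..s'}. abs (k x)) = (LBINT x:{r..s}. abs (k x)) + (LBINT x:{s..s'}. abs (k x))"
    by (rule set_integral_Icc_combine[OF kabs' s(1,2)])
   ultimately show ?case
    unfolding s'_def[symmetric] using IH step[OF s(1,2) st s(4)] by (simp add: distrib_left)
  qed
  from this[of "Suc n"]
  have "abs (\<Phi> (z t') - \<Phi> (z r) - (LBINT x:{r..t'}. \<Phi>' (z x) * k x)) <= e * (LBINT x:{r..t'}. abs (k x))"
   unfolding hn by simp
  also have "... <= e * (LBINT x:{r..t}. abs (k x))"
   by (rule mult_left_mono[OF set_integral_subset_le[OF kabs]]) (use t' e in auto)
  finally show ?thesis .
 qed
 show ?thesis
  unfolding primitive_on_def
 proof (intro conjI ballI gki)
  fix t' assume t': "t' \<in> {r..t}"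
  let ?d = "abs (\<Phi> (z t') - \<Phi> (z r) - (LBINT x:{r..t'}. \<Phi>' (z x) * k x))"
  let ?K = "LBINT x:{r..t}. abs (k x)"
  have K0: "?K >= 0" unfolding set_lebesgue_integral_def by (rule integral_nonneg_AE) auto
  have "?d <= 0 + e" if "e > 0" for e
  proof -
   have "?d <= e / (?K + 1) * ?K" by (rule key[OF t']) (use that K0 in auto)
   also have "... <= e" using that K0 by (simp add: field_simps)
   finally show ?thesis by simp
  qed
  then have "?d <= 0" by (rule field_le_epsilon)
  then show "\<Phi> (z t') = \<Phi> (z r) + (LBINT x:{r..t'}. \<Phi>' (z x) * k x)" by simp
 qed
qed

text \<open>Polarisation reduces the product to squares, hence to the chain rule.\<close>
lemma primitive_on_mult:
 assumes z: "primitive_on r t k z" and w: "primitive_on r t l w"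
 shows "primitive_on r t (%s. k s * w s + z s * l s) (%s. z s * w s)"
proof -
 have D: "((%x. x\<^sup>2) has_real_derivative 2 * x) (at x)" for x :: real
  by (auto intro!: derivative_eq_intros)
 have sq: "primitive_on r t (%s. 2 * y s * m s) (%s. (y s)\<^sup>2)" if "primitive_on r t m y" for m y
  using primitive_on_chain[OF that D] by (simp add: continuous_intros)
 note p = sq[OF primitive_on_add[OF z w]]
 note q = sq[OF primitive_on_add[OF z primitive_on_cmult[OF w, of "-1"]]]
 have "primitive_on r t
   (%s. 1/4 * (2 * (z s + w s) * (k s + l s)) + - (1/4) * (2 * (z s + -1 * w s) * (k s + -1 * l s)))
   (%s. 1/4 * (z s + w s)\<^sup>2 + - (1/4) * (z s + -1 * w s)\<^sup>2)"
  by (intro primitive_on_add primitive_on_cmult p q)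
 moreover have "(%s. 1/4 * (2 * (z s + w s) * (k s + l s)) + - (1/4) * (2 * (z s + -1 * w s) * (k s + -1 * l s)))
   = (%s. k s * w s + z s * l s)"
  "(%s. 1/4 * (z s + w s)\<^sup>2 + - (1/4) * (z s + -1 * w s)\<^sup>2) = (%s. z s * w s)"
  by (auto simp: fun_eq_iff power2_eq_square algebra_simps)
 ultimately show ?thesis by simp
qed

section \<open>Lebesgue spaces\<close>

lemma lebesgue_on_borel:
 fixes f :: "'a::euclidean_space => real"
 assumes f: "f \<in> borel1" and S: "S \<in> sets borel"
 shows "f \<in> borel_measurable (lebesgue_on S)"
  "integrable (lebesgue_on S) f \<longleftrightarrow> lint S f"
  "(LINT x|lebesgue_on S. f x) = (LBINT x:S. f x)"
proof -
 have S': "S \<inter> space lebesgue \<in> sets lebesgue" using S by auto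
 have m: "(%x. indicator S x *\<^sub>R f x) \<in> borel_measurable lborel" using f S by simp
 show "f \<in> borel_measurable (lebesgue_on S)"
  by (rule measurable_restrict_space1) (use f in \<open>auto simp: measurable_completion\<close>)
 show "integrable (lebesgue_on S) f \<longleftrightarrow> lint S f"
  unfolding integrable_restrict_space[OF S'] set_integrable_def by (rule integrable_completion[OF m])
 show "(LINT x|lebesgue_on S. f x) = (LBINT x:S. f x)"
  unfolding integral_restrict_space[OF S'] set_lebesgue_integral_def by (rule integral_completion[OF m])
qed

lemma AE_lebesgue_on_iff:
 assumes "S \<in> sets lebesgue"
 shows "(AE x in lebesgue_on S. P x) \<longleftrightarrow> (AE x in lborel. x \<in> S --> P x)"
 using assms by (subst AE_restrict_space_iff) (auto simp: AE_completion_iff)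

lemma borel_representative:
 fixes f :: "'a::euclidean_space => real"
 assumes f: "f \<in> borel_measurable (lebesgue_on S)" and S: "S \<in> sets lebesgue"
 obtains g where "g \<in> borel1" "AE x in lebesgue_on S. f x = g x"
proof -
 have "(%x. if x \<in> S then f x else 0) \<in> borel_measurable lebesgue"
  using borel_measurable_if[OF S] f by blast
 from completion_ex_borel_measurable_real[OF this]
 obtain g where g: "g \<in> borel_measurable lborel" "AE x in lborel. (if x \<in> S then f x else 0) = g x" by blast
 show thesis
 proof (rule that)
  show "g \<in> borel1" using g(1) by simp
  show "AE x in lebesgue_on S. f x = g x"
   unfolding AE_lebesgue_on_iff[OF S] using g(2) by (rule eventually_mono) auto
 qed
qed

text \<open>The crude constant comes from bounding the sum by three times the largest term; it holds for every
 positive exponent.\<close>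
lemma powr_sum3_le:
 fixes a b c p :: real
 assumes "p > 0"
 shows "abs (a + b + c) powr p <= 3 powr p * (abs a powr p + abs b powr p + abs c powr p)"
proof -
 define m where "m = max (abs a) (max (abs b) (abs c))"
 have "abs (a + b + c) powr p <= (3 * m) powr p"
  by (rule powr_mono2) (use assms in \<open>auto simp: m_def\<close>)
 also have "... = 3 powr p * m powr p" by (rule powr_mult)
 also have "m powr p <= abs a powr p + abs b powr p + abs c powr p"
  by (auto simp: m_def max_def)
 finally show ?thesis by simp
qed

lemma powr_sum_le:
 fixes a b p :: real
 assumes "p > 0"
 shows "abs (a + b) powr p <= 3 powr p * (abs a powr p + abs b powr p)"
  "abs (a - b) powr p <= 3 powr p * (abs a powr p + abs b powr p)"
 using powr_sum3_le[OF assms, of a b 0] powr_sum3_le[OF assms, of a "-b" 0] assms by simp_all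

text \<open>The constant \<open>e\<close> may be chosen as small as desired. This makes
 \<open>L\<^sup>p\<close> convergence on a finite measure space imply \<open>L\<^sup>1\<close> convergence.\<close>
lemma abs_le_powr:
 fixes a e p :: real
 assumes "p >= 1" "e > 0"
 shows "abs a <= e + e powr (1 - p) * abs a powr p"
proof (cases "abs a <= e")
 case True
 then show ?thesis by (simp add: add_increasing2)
next
 case False
 then have "abs a = abs a powr (1 - p) * abs a powr p" using assms by (simp flip: powr_add)
 also have "... <= e powr (1 - p) * abs a powr p"
  by (rule mult_right_mono, rule powr_mono2') (use False assms in auto)
 finally show ?thesis using assms by simp
qed

lemma integrable_powr_add:
 fixes f g :: "'a => real"
 assumes "p > 0" and f: "f \<in> borel_measurable M" "integrable M (%x. abs (f x) powr p)"
  and g: "g \<in> borel_measurable M" "integrable M (%x. abs (g x) powr p)"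
 shows "integrable M (%x. abs (f x + g x) powr p)"
proof (rule Bochner_Integration.integrable_bound)
 show "integrable M (%x. 3 powr p * (abs (f x) powr p + abs (g x) powr p))" using f(2) g(2) by simp
 show "(%x. abs (f x + g x) powr p) \<in> borel_measurable M" using f(1) g(1) by measurable
 show "AE x in M. norm (abs (f x + g x) powr p) <= norm (3 powr p * (abs (f x) powr p + abs (g x) powr p))"
  using powr_sum_le(1)[OF assms(1)] by auto
qed

lemma integrable_powr_cmult:
 fixes f :: "'a => real"
 assumes "integrable M (%x. abs (f x) powr p)"
 shows "integrable M (%x. abs (c * f x) powr p)"
 using assms by (simp add: abs_mult powr_mult)

lemma LpD:
 assumes "f \<in> Lp p \<Omega>"
 shows "f \<in> borel_measurable (lebesgue_on \<Omega>)" "integrable (lebesgue_on \<Omega>) (%x. abs (f x) powr p)"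
 using assms by (auto simp: Lp_def)

lemma Lp_add: "p > 0 ==> f \<in> Lp p \<Omega> ==> g \<in> Lp p \<Omega> ==> (%x. f x + g x) \<in> Lp p \<Omega>"
 using integrable_powr_add[of p f "lebesgue_on \<Omega>" g] unfolding Lp_def by (simp add: borel_measurable_add)

lemma Lp_cmult: "f \<in> Lp p \<Omega> ==> (%x. c * f x) \<in> Lp p \<Omega>"
 using integrable_powr_cmult[of "lebesgue_on \<Omega>" f p c] unfolding Lp_def
 by (auto intro: borel_measurable_times)

lemma Lp_diff: "p > 0 ==> f \<in> Lp p \<Omega> ==> g \<in> Lp p \<Omega> ==> (%x. f x - g x) \<in> Lp p \<Omega>"
 using Lp_add[of p f \<Omega> "%x. - 1 * g x"] Lp_cmult[of g p \<Omega> "-1"] by simp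

lemma Lp_AE_cong:
 assumes "f \<in> Lp p \<Omega>" "AE x in lebesgue_on \<Omega>. f x = g x" "g \<in> borel_measurable (lebesgue_on \<Omega>)"
 shows "g \<in> Lp p \<Omega>"
proof -
 have m: "(%x. abs (g x) powr p) \<in> borel_measurable (lebesgue_on \<Omega>)" using assms(3) by measurable
 have "integrable (lebesgue_on \<Omega>) (%x. abs (g x) powr p)"
  by (rule integrable_cong_AE_imp[OF LpD(2)[OF assms(1)] m]) (use assms(2) in \<open>auto elim: eventually_mono\<close>)
 then show ?thesis using assms(3) by (simp add: Lp_def)
qed

lemma Lp_norm_AE_cong:
 assumes "AE x in lebesgue_on \<Omega>. f x = g x" "f \<in> borel_measurable (lebesgue_on \<Omega>)" "g \<in> borel_measurable (lebesgue_on \<Omega>)"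
 shows "Lp_norm p \<Omega> f = Lp_norm p \<Omega> g"
proof -
 have m: "(%x. abs (f x) powr p) \<in> borel_measurable (lebesgue_on \<Omega>)" "(%x. abs (g x) powr p) \<in> borel_measurable (lebesgue_on \<Omega>)"
  using assms(2,3) by measurable
 have "(LINT x|lebesgue_on \<Omega>. abs (f x) powr p) = (LINT x|lebesgue_on \<Omega>. abs (g x) powr p)"
  by (rule integral_cong_AE[OF m]) (use assms(1) in \<open>auto elim: eventually_mono\<close>)
 then show ?thesis by (simp add: Lp_norm_def)
qed

lemma Lp_norm_powr: "p > 0 ==> Lp_norm p \<Omega> f powr p = (LINT x|lebesgue_on \<Omega>. abs (f x) powr p)"
 by (simp add: Lp_norm_def powr_powr integral_nonneg_AE)

lemma Lp_norm_nonneg: "Lp_norm p \<Omega> f >= 0"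
 by (simp add: Lp_norm_def)

lemma Lp_norm_tendsto_0_iff:
 assumes "p > 0"
 shows "((%s. Lp_norm p \<Omega> (F s)) \<longlongrightarrow> 0) G \<longleftrightarrow> ((%s. LINT x|lebesgue_on \<Omega>. abs (F s x) powr p) \<longlongrightarrow> 0) G"
proof
 assume "((%s. Lp_norm p \<Omega> (F s)) \<longlongrightarrow> 0) G"
 then have "((%s. Lp_norm p \<Omega> (F s) powr p) \<longlongrightarrow> 0) G"
  by (rule tendsto_zero_powrI[OF _ tendsto_const]) (use assms in \<open>auto intro!: always_eventually Lp_norm_nonneg\<close>)
 then show "((%s. LINT x|lebesgue_on \<Omega>. abs (F s x) powr p) \<longlongrightarrow> 0) G"
  by (simp add: Lp_norm_powr[OF assms])
next
 assume "((%s. LINT x|lebesgue_on \<Omega>. abs (F s x) powr p) \<longlongrightarrow> 0) G"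
 then show "((%s. Lp_norm p \<Omega> (F s)) \<longlongrightarrow> 0) G"
  unfolding Lp_norm_def
  by (rule tendsto_zero_powrI[OF _ tendsto_const]) (use assms in \<open>auto intro: integral_nonneg_AE\<close>)
qed

lemma (in finite_measure) integrable_of_powr:
 fixes f :: "'a => real"
 assumes "p >= 1" "f \<in> borel_measurable M" "integrable M (%x. abs (f x) powr p)"
 shows "integrable M f"
proof (rule Bochner_Integration.integrable_bound)
 show "integrable M (%x. 1 + abs (f x) powr p)" using assms(3) by simp
 show "AE x in M. norm (f x) <= norm (1 + abs (f x) powr p)"
  using abs_le_powr[OF assms(1), of 1] by auto
qed fact

lemma (in finite_measure) L1_tendsto_0_of_Lp:
 fixes F :: "'b => 'a => real"
 assumes p: "p >= 1"
  and F: "eventually (%s. F s \<in> borel_measurable M \<and> integrable M (%x. abs (F s x) powr p)) G"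
  and lim: "((%s. LINT x|M. abs (F s x) powr p) \<longlongrightarrow> 0) G"
 shows "((%s. LINT x|M. abs (F s x)) \<longlongrightarrow> 0) G"
proof (rule tendstoI)
 fix e :: real assume e: "e > 0"
 define m where "m = measure M (space M)"
 define d where "d = e / (2 * (m + 1))"
 have m0: "m >= 0" by (simp add: m_def)
 have d: "d > 0" "d * m <= e / 2" using e m0 by (auto simp: d_def field_simps)
 have "((%s. d powr (1 - p) * (LINT x|M. abs (F s x) powr p)) \<longlongrightarrow> 0) G"
  using tendsto_mult_right_zero[OF lim] .
 then have "eventually (%s. \<bar>d powr (1 - p) * (LINT x|M. \<bar>F s x\<bar> powr p)\<bar> < e / 2) G"
  using tendstoD[of "%s. d powr (1 - p) * (LINT x|M. abs (F s x) powr p)" 0 G "e/2"] e unfolding dist_real_def diff_0_right by simp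
 then show "eventually (%s. dist (LINT x|M. abs (F s x)) 0 < e) G"
  using F
 proof eventually_elim
  case (elim s)
  have i: "integrable M (F s)" using integrable_of_powr[OF p] elim by blast
  have "(LINT x|M. abs (F s x)) <= (LINT x|M. d + d powr (1 - p) * abs (F s x) powr p)"
   by (rule integral_mono) (use i elim d abs_le_powr[OF p] in auto)
  also have "... = d * m + d powr (1 - p) * (LINT x|M. abs (F s x) powr p)"
   using elim by (subst Bochner_Integration.integral_add) (auto simp: m_def)
  also have "... < e" using d elim by linarith
  finally show ?case by (simp add: dist_real_def integral_nonneg_AE)
 qed
qed

lemma set_integral_shift:
 fixes f :: "real => real"
 shows "(LBINT y:{a..b}. f (y + s)) = (LBINT y:{a + s..b + s}. f y)"
  "lint {a..b} (%y. f (y + s)) \<longleftrightarrow> lint {a + s..b + s} f"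
proof -
 have e: "indicator {a + s..b + s} (s + 1 * x) *\<^sub>R f (s + 1 * x) = indicator {a..b} x *\<^sub>R f (x + s)" for x
  by (auto simp: indicator_def add.commute)
 show "(LBINT y:{a..b}. f (y + s)) = (LBINT y:{a + s..b + s}. f y)"
  unfolding set_lebesgue_integral_def
  using lborel_integral_real_affine[of 1 "%y. indicator {a + s..b + s} y *\<^sub>R f y" s] unfolding e by simp
 show "lint {a..b} (%y. f (y + s)) \<longleftrightarrow> lint {a + s..b + s} f"
  unfolding set_integrable_def
  using lborel_integrable_real_affine_iff[of 1 "%y. indicator {a + s..b + s} y *\<^sub>R f y" s] unfolding e by simp
qed

section \<open>Approximation by continuous functions\<close>

lemma continuous_approximation:
 fixes f :: "real => real"
 assumes "f \<in> borel_measurable (lebesgue_on S)" "S \<in> sets lebesgue"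
 obtains g :: "nat => real => real"
 where "!!n. continuous_on UNIV (g n)" "AE x in lebesgue_on S. (%n. g n x) \<longlonglongrightarrow> f x"
proof -
 have "f measurable_on S" using measurable_on_iff_borel_measurable assms by blast
 then obtain N g where N: "negligible N" and g: "!!n. continuous_on UNIV (g n)"
   "!!x. x \<notin> N ==> (%n. g n x) \<longlonglongrightarrow> (if x \<in> S then f x else 0)"
  unfolding measurable_on_def by blast
 have "AE x in lebesgue. x \<notin> N" using N AE_not_in negligible_iff_null_sets by blast
 then have "AE x in lborel. x \<notin> N" by (simp add: AE_completion_iff)
 then have "AE x in lebesgue_on S. (%n. g n x) \<longlonglongrightarrow> f x"
  unfolding AE_lebesgue_on_iff[OF assms(2)]
 proof eventually_elim
  case (elim x)
  show ?case
  proof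
   assume "x \<in> S"
   then show "(%n. g n x) \<longlonglongrightarrow> f x" using g(2)[OF elim] by simp
  qed
 qed
 then show thesis using that g(1) by blast
qed

definition clip :: "real => real => real" where
 "clip m x = max (- m) (min m x)"

lemma abs_clip: "m >= 0 ==> abs (clip m x) <= m"
 by (auto simp: clip_def)

lemma continuous_on_clip: "continuous_on S f ==> continuous_on S (%x. clip m (f x))"
 unfolding clip_def by (intro continuous_intros)

lemma tendsto_clip: "(f \<longlongrightarrow> l) F ==> ((%x. clip m (f x)) \<longlongrightarrow> clip m l) F"
 unfolding clip_def by (intro tendsto_intros)

lemma clip_measurable [measurable]: "clip m \<in> borel1"
 unfolding clip_def by measurable

text \<open>The \<open>L\<^sup>1\<close> norm is the supremum of the pairings with polynomials bounded by one:
 the sign of \<open>J\<close> is an almost everywhere limit of continuous functions with values in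
 \<open>[-1,1]\<close>, and these are uniform limits of polynomials by the Stone-Weierstrass theorem.\<close>
lemma L1_norm_le_of_polynomials:
 fixes J :: "real => real"
 assumes J: "integrable (lebesgue_on {a..b}) J"
  and bound: "!!P B. real_polynomial_function P ==> (!!x. x \<in> {a..b} ==> abs (P x) <= B) ==>
   abs (LINT x|lebesgue_on {a..b}. J x * P x) <= R * B"
 shows "(LINT x|lebesgue_on {a..b}. abs (J x)) <= R"
proof -
 let ?M = "lebesgue_on {a..b}"
 have Jm: "J \<in> borel_measurable ?M" using J by simp
 have "(%x. sgn (J x)) \<in> borel_measurable ?M" using Jm by simp
 from continuous_approximation[OF this]
 obtain g where g: "!!n. continuous_on UNIV (g n)" "AE x in ?M. (%n. g n x) \<longlonglongrightarrow> sgn (J x)" by auto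
 have "\<exists>P. real_polynomial_function P \<and> (\<forall>x\<in>{a..b}. abs (clip 1 (g n x) - P x) < 1 / Suc n)" for n
 proof -
  have "continuous_on {a..b} (%x. clip 1 (g n x))"
   by (rule continuous_on_clip[OF continuous_on_subset[OF g(1)]]) simp
  then obtain Q where "real_polynomial_function Q" "!!x. x \<in> {a..b} ==> abs (clip 1 (g n x) - Q x) < 1 / Suc n"
   by (rule Stone_Weierstrass_real_polynomial_function[OF compact_Icc, where e = "1 / Suc n"]) auto
  then show ?thesis by blast
 qed
 then obtain P where P: "!!n. real_polynomial_function (P n)" "!!n x. x \<in> {a..b} ==> abs (clip 1 (g n x) - P n x) < 1 / Suc n"
  by metis
 have Pb: "abs (P n x) <= 1 + 1 / Suc n" if "x \<in> {a..b}" for n x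
  using P(2)[OF that, of n] abs_clip[of 1 "g n x"] by linarith
 have Pm: "P n \<in> borel_measurable ?M" for n
  by (rule continuous_imp_measurable_on_sets_lebesgue)
    (auto intro!: continuous_at_imp_continuous_on continuous_real_polymonial_function P(1))
 have lim: "(%n. LINT x|?M. J x * P n x) \<longlonglongrightarrow> (LINT x|?M. abs (J x))"
 proof (rule integral_dominated_convergence[where w = "%x. 2 * abs (J x)"])
  show "integrable ?M (%x. 2 * abs (J x))" using J by simp
  show "AE x in ?M. norm (J x * P n x) <= 2 * abs (J x)" for n
  proof (rule AE_I2)
   fix x assume "x \<in> space ?M"
   then have "abs (P n x) <= 2" using Pb[of x n] by (simp add: order_trans)
   then have "abs (J x) * abs (P n x) <= abs (J x) * 2" by (rule mult_left_mono) simp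
   then show "norm (J x * P n x) <= 2 * abs (J x)" by (simp add: abs_mult)
  qed
  show "AE x in ?M. (%n. J x * P n x) \<longlonglongrightarrow> abs (J x)"
   using g(2) AE_space
  proof eventually_elim
   case (elim x)
   have "(%n. clip 1 (g n x)) \<longlonglongrightarrow> clip 1 (sgn (J x))" by (rule tendsto_clip[OF elim(1)])
   moreover have "clip 1 (sgn (J x)) = sgn (J x)" by (auto simp: clip_def sgn_if)
   moreover have "(%n. P n x - clip 1 (g n x)) \<longlonglongrightarrow> 0"
   proof (rule Lim_null_comparison[OF _ LIMSEQ_Suc[OF lim_1_over_n]])
    show "\<forall>\<^sub>F n in sequentially. norm (P n x - clip 1 (g n x)) <= 1 / real (Suc n)"
     using P(2)[of x] elim(2) by (intro always_eventually allI less_imp_le) (auto simp: abs_minus_commute)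
   qed
   ultimately have "(%n. clip 1 (g n x) + (P n x - clip 1 (g n x))) \<longlonglongrightarrow> sgn (J x) + 0"
    by (intro tendsto_add) auto
   then have "(%n. J x * P n x) \<longlonglongrightarrow> J x * sgn (J x)" by (intro tendsto_mult tendsto_const) simp
   then show ?case by (simp add: abs_sgn)
  qed
 qed (use Jm Pm in auto)
 have "(%n. R * (1 + 1 / Suc n)) \<longlonglongrightarrow> R * (1 + 0)"
  by (intro tendsto_intros LIMSEQ_Suc[OF lim_1_over_n])
 moreover have "(LINT x|?M. J x * P n x) <= R * (1 + 1 / Suc n)" for n
  using bound[OF P(1) Pb] by (rule order_trans[OF abs_ge_self])
 ultimately show ?thesis using LIMSEQ_le[OF lim, of "%n. R * (1 + 1 / Suc n)"] by auto
qed

lemma smooth_polynomial: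
 assumes "real_polynomial_function (P :: real => real)"
 shows "smooth P"
proof -
 obtain a n where P: "P = (%x. \<Sum>i\<le>n. a i * x ^ i)"
  using assms real_polynomial_function_iff_sum by blast
 have id: "smooth (%x::real. x)" by (rule smoothI_real[OF DERIV_ident smooth_const])
 have pow: "smooth (%x::real. x ^ i)" for i :: nat
 proof (induction i)
  case (Suc i) show ?case using smooth_mult[OF id Suc] by simp
 qed (simp add: smooth_const)
 have "smooth (%x::real. \<Sum>i\<le>n. a i * x ^ i)" for n :: nat
 proof (induction n)
  case (Suc n)
  show ?case using smooth_add[OF Suc smooth_mult[OF smooth_const[of "a (Suc n)"] pow[of "Suc n"]]] by simp
 qed (simp add: smooth_const)
 then show ?thesis using P by simp
qed

lemma test_function_mult:
 assumes "phi \<in> test_functions \<Omega>" "smooth psi"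
 shows "(%z. phi z * psi z) \<in> test_functions \<Omega>"
 by (rule test_functionsE[OF assms(1)], rule test_functionsI[OF smooth_mult[OF _ assms(2)]]) auto

lemma L1_loc_mult_test:
 fixes g :: "'a::euclidean_space => real"
 assumes g: "g \<in> L1_loc \<Omega>" and phi: "phi \<in> test_functions \<Omega>" and \<Omega>: "\<Omega> \<in> sets lebesgue"
 shows "integrable (lebesgue_on \<Omega>) (%x. g x * phi x)"
proof -
 obtain K where K: "smooth phi" "compact K" "K \<subseteq> \<Omega>" "!!z. z \<notin> K ==> phi z = 0"
  by (rule test_functionsE[OF phi]) (rule that)
 have KL: "K \<in> sets lebesgue" using K(2) by (simp add: lmeasurable_compact fmeasurableD)
 have gi: "integrable (lebesgue_on K) g" using g K by (simp add: L1_loc_def)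
 have c: "continuous_on K phi" using smoothD(2)[OF K(1)] continuous_on_subset by blast
 obtain B where B: "!!x. x \<in> K ==> abs (phi x) <= B"
  using compact_imp_bounded[OF compact_continuous_image[OF c K(2)]]
  unfolding bounded_iff by (metis imageI real_norm_def)
 have "integrable (lebesgue_on K) (%x. g x * phi x)"
 proof (rule Bochner_Integration.integrable_bound[OF integrable_mult_right[OF gi, of B]])
  show "(%x. g x * phi x) \<in> borel_measurable (lebesgue_on K)"
   using gi continuous_imp_measurable_on_sets_lebesgue[OF c KL] by (intro borel_measurable_times) auto
  show "AE x in lebesgue_on K. norm (g x * phi x) <= norm (B * g x)"
  proof (rule AE_I2)
   fix x assume "x \<in> space (lebesgue_on K)"
   then have "abs (phi x) <= abs B" using B[of x] by simp
   then have "abs (phi x) * abs (g x) <= abs B * abs (g x)" by (rule mult_right_mono) simp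
   then show "norm (g x * phi x) <= norm (B * g x)" by (simp add: abs_mult mult.commute)
  qed
 qed
 moreover have "(%x. indicator K x *\<^sub>R (g x * phi x)) = (%x. indicator \<Omega> x *\<^sub>R (g x * phi x))"
  using K by (auto simp: indicator_def fun_eq_iff)
 ultimately show ?thesis using KL \<Omega> by (simp add: integrable_restrict_space)
qed

text \<open>The fundamental lemma of the calculus of variations: multiplying \<open>g\<close> by a cutoff
 makes polynomials admissible as test functions, and the duality estimate with \<open>R = 0\<close> applies.\<close>
lemma weakly_zero_imp_AE_zero:
 fixes g :: "real => real"
 assumes ab: "a < b" and g: "g \<in> L1_loc {a<..<b}"
  and z: "!!phi. phi \<in> test_functions {a<..<b} ==> (LINT x|leb a b. g x * phi x) = 0"
 shows "AE x in leb a b. g x = 0"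
proof -
 obtain om om' :: "nat => real => real" where om: "!!n. om n \<in> test_functions {a<..<b}"
  "!!x. a < x ==> x < b ==> (%n. om n x) \<longlonglongrightarrow> 1"
  by (rule cutoffs_exist[OF ab]) blast
 have out: "om n x = 0" if "x \<notin> {a<..<b}" for n x
  by (rule test_functionsE[OF om(1)[of n]]) (use that in blast)
 have ind: "(%x. indicator {a..b} x *\<^sub>R F x) = (%x. indicator {a<..<b} x *\<^sub>R F x)"
  if "!!x. om n x = 0 ==> F x = 0" for n and F :: "real => real"
 proof
  fix x show "indicator {a..b} x *\<^sub>R F x = indicator {a<..<b} x *\<^sub>R F x"
   using out[of x n] that[of x] by (cases "x \<in> {a<..<b}") auto
 qed
 have "AE x in leb a b. g x * om n x = 0" for n
 proof -
  have i: "integrable (leb a b) (%x. g x * om n x)" by (rule L1_loc_mult_test[OF g om(1)]) simp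
  have "(%x. indicator {a..b} x *\<^sub>R (g x * om n x)) = (%x. indicator {a<..<b} x *\<^sub>R (g x * om n x))"
   by (rule ind[of n]) simp
  then have J: "integrable (lebesgue_on {a..b}) (%x. g x * om n x)"
   using i by (simp add: integrable_restrict_space)
  have "(LINT x|lebesgue_on {a..b}. abs (g x * om n x)) <= 0"
  proof (rule L1_norm_le_of_polynomials[OF J])
   fix P :: "real => real" and B assume P: "real_polynomial_function P"
   have "(LINT x|lebesgue_on {a..b}. g x * om n x * P x) = (LINT x|leb a b. g x * om n x * P x)"
    using ind[of n "%x. g x * om n x * P x"] by (simp add: integral_restrict_space)
   also have "... = 0"
    using z[OF test_function_mult[OF om(1)[of n] smooth_polynomial[OF P]]] by (simp add: mult.assoc)
   finally show "abs (LINT x|lebesgue_on {a..b}. g x * om n x * P x) <= 0 * B" by simp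
  qed
  moreover have "(LINT x|leb a b. abs (g x * om n x)) = (LINT x|lebesgue_on {a..b}. abs (g x * om n x))"
   using ind[of n "%x. abs (g x * om n x)"] by (simp add: integral_restrict_space)
  moreover have "(LINT x|leb a b. abs (g x * om n x)) >= 0" by (rule integral_nonneg_AE) simp
  ultimately have "(LINT x|leb a b. abs (g x * om n x)) = 0" by linarith
  then show ?thesis
   using integral_nonneg_eq_0_iff_AE[OF integrable_abs[OF i]] by simp
 qed
 then have "AE x in leb a b. \<forall>n. g x * om n x = 0" unfolding AE_all_countable ..
 then show ?thesis
  using AE_space
 proof eventually_elim
  case (elim x)
  then have "(%n. om n x) \<longlonglongrightarrow> 1" using om(2) by simp
  then have "(%n. g x * om n x) \<longlonglongrightarrow> g x * 1" by (intro tendsto_mult tendsto_const)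
  then show ?case using elim(1) LIMSEQ_unique[OF tendsto_const] by fastforce
 qed
qed

lemma set_integrable_bounded:
 fixes f :: "real => real"
 assumes "f \<in> borel1" "!!x. x \<in> {a..b} ==> abs (f x) <= B"
 shows "lint {a..b} f"
proof (rule set_integrable_bound[where f = "%_. B"])
 show "lint {a..b} (%_. B)"
  unfolding set_integrable_def by (rule integrable_indicator) (auto simp: emeasure_lborel_Icc_eq)
 show "set_borel_measurable lborel {a..b} f" using assms(1) by (simp add: set_borel_measurable_def)
 show "AE x in lborel. x \<in> {a..b} --> norm (f x) <= norm B"
  using assms(2) by (auto intro!: AE_I2 order_trans[OF _ abs_ge_self])
qed

text \<open>Truncation first reduces to bounded functions, which are almost everywhere limits of bounded
 continuous ones.\<close>
lemma Lp_approx_continuous: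
 fixes h :: "real => real"
 assumes p: "p > 0" and h [measurable]: "h \<in> borel1"
  and hi: "lint {a..b} (%x. abs (h x) powr p)" and e: "e > 0"
 obtains g where "continuous_on UNIV g" "(LBINT x:{a..b}. abs (h x - g x) powr p) < e"
  "lint {a..b} (%x. abs (h x - g x) powr p)"
proof -
 define d where "d = e / (2 * 3 powr p)"
 have d: "d > 0" using e by (simp add: d_def)
 have L: "(%n. LBINT x:{a..b}. abs (h x - clip (real n) (h x)) powr p) \<longlonglongrightarrow> (LBINT x:{a..b}. 0)"
  unfolding set_lebesgue_integral_def
 proof (rule integral_dominated_convergence[where w = "%x. indicator {a..b} x *\<^sub>R abs (h x) powr p"])
  show "AE x in lborel. (%n. indicat_real {a..b} x *\<^sub>R abs (h x - clip (real n) (h x)) powr p) \<longlonglongrightarrow> indicat_real {a..b} x *\<^sub>R 0"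
  proof (rule AE_I2)
   fix x
   obtain n0 :: nat where n0: "abs (h x) <= n0" using real_arch_simple by blast
   have "clip (real n) (h x) = h x" if "n >= n0" for n using n0 that by (auto simp: clip_def)
   then have "\<forall>\<^sub>F n in sequentially. indicat_real {a..b} x *\<^sub>R abs (h x - clip (real n) (h x)) powr p = indicat_real {a..b} x *\<^sub>R 0"
    using p unfolding eventually_sequentially by (intro exI[of _ n0]) simp
   then show "(%n. indicat_real {a..b} x *\<^sub>R abs (h x - clip (real n) (h x)) powr p) \<longlonglongrightarrow> indicat_real {a..b} x *\<^sub>R 0"
    by (rule tendsto_eventually)
  qed
  show "AE x in lborel. norm (indicat_real {a..b} x *\<^sub>R abs (h x - clip (real n) (h x)) powr p) <= indicat_real {a..b} x *\<^sub>R abs (h x) powr p" for n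
   using p by (auto simp: indicator_def clip_def intro!: AE_I2 powr_mono2)
 qed (use hi in \<open>auto simp: set_integrable_def\<close>)
 then obtain n where "\<bar>LBINT x:{a..b}. \<bar>h x - clip (real n) (h x)\<bar> powr p\<bar> < d"
  using LIMSEQ_D[OF L d] by auto
 then have n: "(LBINT x:{a..b}. abs (h x - clip (real n) (h x)) powr p) < d" by linarith
 have hm: "h \<in> borel_measurable (lebesgue_on {a..b})" by (rule lebesgue_on_borel) auto
 from continuous_approximation[OF this]
 obtain g where g: "!!m. continuous_on UNIV (g m)" "AE x in lebesgue_on {a..b}. (%m. g m x) \<longlonglongrightarrow> h x" by auto
 have gm [measurable]: "g m \<in> borel1" for m by (rule borel_measurable_continuous_onI[OF g(1)])
 have ae: "AE x in lborel. x \<in> {a..b} --> (%m. g m x) \<longlonglongrightarrow> h x" using g(2) by (simp add: AE_lebesgue_on_iff)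
 have b: "abs (clip (real n) (h x) - clip (real n) (g m x)) powr p <= (2 * real n) powr p" for m x
  by (rule powr_mono2) (use abs_clip[of "real n" "h x"] abs_clip[of "real n" "g m x"] p in linarith)+
 have "(%m. LBINT x:{a..b}. abs (clip (real n) (h x) - clip (real n) (g m x)) powr p) \<longlonglongrightarrow> (LBINT x:{a..b}. 0)"
  unfolding set_lebesgue_integral_def
 proof (rule integral_dominated_convergence[where w = "%x. indicator {a..b} x *\<^sub>R (2 * real n) powr p"])
  show "AE x in lborel. (%m. indicat_real {a..b} x *\<^sub>R abs (clip (real n) (h x) - clip (real n) (g m x)) powr p) \<longlonglongrightarrow> indicat_real {a..b} x *\<^sub>R 0"
   using ae
  proof eventually_elim
   case (elim x)
   show ?case
   proof (cases "x \<in> {a..b}")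
    case True
    then have "(%m. clip (real n) (h x) - clip (real n) (g m x)) \<longlonglongrightarrow> clip (real n) (h x) - clip (real n) (h x)"
     using elim by (intro tendsto_diff tendsto_const tendsto_clip) simp
    then have "(%m. abs (clip (real n) (h x) - clip (real n) (g m x))) \<longlonglongrightarrow> 0"
     by (simp add: tendsto_rabs_zero_iff)
    then have "(%m. abs (clip (real n) (h x) - clip (real n) (g m x)) powr p) \<longlonglongrightarrow> 0"
     by (rule tendsto_zero_powrI[OF _ tendsto_const]) (use p in auto)
    then show ?thesis using True by simp
   qed simp
  qed
  show "AE x in lborel. norm (indicat_real {a..b} x *\<^sub>R abs (clip (real n) (h x) - clip (real n) (g m x)) powr p) <= indicat_real {a..b} x *\<^sub>R (2 * real n) powr p" for m
   using b by (auto simp: indicator_def intro!: AE_I2)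
 qed (auto simp: emeasure_lborel_Icc_eq)
 note L2 = this
 obtain m where "\<bar>LBINT x:{a..b}. \<bar>clip (real n) (h x) - clip (real n) (g m x)\<bar> powr p\<bar> < d"
  using LIMSEQ_D[OF L2 d] by (auto simp: set_lebesgue_integral_def)
 then have m: "(LBINT x:{a..b}. abs (clip (real n) (h x) - clip (real n) (g m x)) powr p) < d" by linarith
 let ?g = "%x. clip (real n) (g m x)"
 have i1: "lint {a..b} (%x. abs (h x - clip (real n) (h x)) powr p)"
  by (rule set_integrable_bound[OF hi])
    (use p in \<open>auto simp: clip_def set_borel_measurable_def intro!: AE_I2 powr_mono2\<close>)
 have i2: "lint {a..b} (%x. abs (clip (real n) (h x) - ?g x) powr p)"
  by (rule set_integrable_bounded[where B = "(2 * real n) powr p"]) (use b in auto)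
 have i3: "lint {a..b} (%x. 3 powr p * (abs (h x - clip (real n) (h x)) powr p + abs (clip (real n) (h x) - ?g x) powr p))"
  using set_integral_add(1)[OF i1 i2] by simp
 have le: "abs (h x - ?g x) powr p <= 3 powr p * (abs (h x - clip (real n) (h x)) powr p + abs (clip (real n) (h x) - ?g x) powr p)" for x
  using powr_sum_le(1)[OF p, of "h x - clip (real n) (h x)" "clip (real n) (h x) - ?g x"] by simp
 have i4: "lint {a..b} (%x. abs (h x - ?g x) powr p)"
  by (rule set_integrable_bound[OF i3]) (use le in \<open>auto simp: set_borel_measurable_def intro!: AE_I2 order_trans[OF le abs_ge_self]\<close>)
 show thesis
 proof (rule that[of ?g])
  show "continuous_on UNIV ?g" by (rule continuous_on_clip[OF g(1)])
  have "(LBINT x:{a..b}. abs (h x - ?g x) powr p) <= (LBINT x:{a..b}. 3 powr p * (abs (h x - clip (real n) (h x)) powr p + abs (clip (real n) (h x) - ?g x) powr p))"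
   by (rule set_integral_mono[OF i4 i3 le])
  also have "... = 3 powr p * ((LBINT x:{a..b}. abs (h x - clip (real n) (h x)) powr p) + (LBINT x:{a..b}. abs (clip (real n) (h x) - ?g x) powr p))"
   using set_integral_add(2)[OF i1 i2] by simp
  also have "... < 3 powr p * (d + d)" using n m by (intro mult_strict_left_mono) auto
  also have "... = e" by (simp add: d_def)
  finally show "(LBINT x:{a..b}. abs (h x - ?g x) powr p) < e" .
 qed (rule i4)
qed

text \<open>The statement is clear for continuous functions, and it passes to \<open>L\<^sup>p\<close> limits
 because translations are isometries.\<close>
lemma translation_continuous_Lp:
 fixes h :: "real => real"
 assumes p: "p > 0" and h [measurable]: "h \<in> borel1"
  and hi: "!!a b. lint {a..b} (%x. abs (h x) powr p)" and ab: "a <= b"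
 shows "((%s. LBINT y:{a..b}. abs (h (y + s) - h y) powr p) \<longlongrightarrow> 0) (at 0)"
proof (rule tendstoI)
 fix e :: real assume e: "e > 0"
 define d where "d = e / (4 * 3 powr p)"
 have d: "d > 0" using e by (simp add: d_def)
 obtain g where g: "continuous_on UNIV g" "(LBINT x:{a-1..b+1}. abs (h x - g x) powr p) < d"
  "lint {a-1..b+1} (%x. abs (h x - g x) powr p)"
  by (rule Lp_approx_continuous[OF p h hi d])
 have gm [measurable]: "g \<in> borel1" by (rule borel_measurable_continuous_onI[OF g(1)])
 define xi where "xi = (d / (b - a + 1)) powr (1 / p)"
 have xi: "xi > 0" "xi powr p = d / (b - a + 1)" using d ab p by (auto simp: xi_def powr_powr)
 have "uniformly_continuous_on {a-1..b+1} g"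
  by (rule compact_uniformly_continuous[OF continuous_on_subset[OF g(1)]]) auto
 then obtain \<delta> where \<delta>: "\<delta> > 0" "!!x y. x \<in> {a-1..b+1} ==> y \<in> {a-1..b+1} ==> abs (y - x) < \<delta> ==> abs (g y - g x) < xi"
  unfolding uniformly_continuous_on_def dist_real_def using xi(1) by meson
 have key: "(LBINT y:{a..b}. abs (h (y + s) - h y) powr p) < e" if s: "abs s < min 1 \<delta>" for s
 proof -
  have i0: "lint {a+s..b+s} (%x. abs (h x - g x) powr p)"
   by (rule set_integrable_subset[OF g(3)]) (use s in auto)
  have i1: "lint {a..b} (%y. abs (h (y + s) - g (y + s)) powr p)"
   using set_integral_shift(2)[of a b "%x. abs (h x - g x) powr p" s] i0 by simp
  have I1: "(LBINT y:{a..b}. abs (h (y + s) - g (y + s)) powr p) < d"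
  proof -
   have "(LBINT y:{a..b}. abs (h (y + s) - g (y + s)) powr p) = (LBINT x:{a+s..b+s}. abs (h x - g x) powr p)"
    using set_integral_shift(1)[of a b "%x. abs (h x - g x) powr p" s] by simp
   also have "... <= (LBINT x:{a-1..b+1}. abs (h x - g x) powr p)"
    by (rule set_integral_subset_le[OF g(3)]) (use s in auto)
   finally show ?thesis using g(2) by simp
  qed
  have i3: "lint {a..b} (%y. abs (h y - g y) powr p)"
   by (rule set_integrable_subset[OF g(3)]) auto
  have I3: "(LBINT y:{a..b}. abs (h y - g y) powr p) < d"
   using set_integral_subset_le[OF g(3), of "{a..b}"] g(2) by auto
  have i2: "lint {a..b} (%_. d / (b - a + 1))"
   by (rule set_integrable_bounded[where B = "abs (d / (b - a + 1))"]) auto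
  have I2: "(LBINT y:{a..b}. d / (b - a + 1)) <= d"
  proof -
   have "(LBINT y:{a..b}. d / (b - a + 1)) = (b - a) * (d / (b - a + 1))"
    using ab by (simp add: set_lebesgue_integral_def)
   also have "... <= d" using ab d by (simp add: field_simps)
   finally show ?thesis .
  qed
  let ?B = "%y. 3 powr p * (abs (h (y + s) - g (y + s)) powr p + d / (b - a + 1) + abs (h y - g y) powr p)"
  have le: "abs (h (y + s) - h y) powr p <= ?B y" if y: "y \<in> {a..b}" for y
  proof -
   have "abs (g (y + s) - g y) powr p <= xi powr p"
   proof (rule powr_mono2)
    have "y \<in> {a-1..b+1}" "y + s \<in> {a-1..b+1}" using y s by auto
    then show "abs (g (y + s) - g y) <= xi" using \<delta>(2)[of y "y + s"] s by simp
   qed (use p in auto)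
   then have "abs (g (y + s) - g y) powr p <= d / (b - a + 1)" using xi(2) by simp
   moreover have "abs (h (y + s) - h y) powr p <= 3 powr p * (abs (h (y + s) - g (y + s)) powr p + abs (g (y + s) - g y) powr p + abs (g y - h y) powr p)"
    using powr_sum3_le[OF p, of "h (y + s) - g (y + s)" "g (y + s) - g y" "g y - h y"] by simp
   ultimately show ?thesis
    by (auto simp: abs_minus_commute[of "g y"] intro: order_trans)
  qed
  have iB: "lint {a..b} ?B" using set_integral_add(1)[OF set_integral_add(1)[OF i1 i2] i3] by simp
  have "(LBINT y:{a..b}. abs (h (y + s) - h y) powr p) <= (LBINT y:{a..b}. ?B y)"
  proof (rule set_integral_mono[OF _ iB le])
   show "lint {a..b} (%y. abs (h (y + s) - h y) powr p)"
    by (rule set_integrable_bound[OF iB]) (use le in \<open>auto simp: set_borel_measurable_def intro!: AE_I2 order_trans[OF le abs_ge_self]\<close>)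
  qed
  also have "... = 3 powr p * ((LBINT y:{a..b}. abs (h (y + s) - g (y + s)) powr p) + (LBINT y:{a..b}. d / (b - a + 1)) + (LBINT y:{a..b}. abs (h y - g y) powr p))"
   using set_integral_add[OF set_integral_add(1)[OF i1 i2] i3] set_integral_add(2)[OF i1 i2] by simp
  also have "... < 3 powr p * (4 * d)" using I1 I2 I3 d by (intro mult_strict_left_mono) auto
  also have "... = e" by (simp add: d_def)
  finally show ?thesis .
 qed
 have nn: "(LBINT y:{a..b}. abs (h (y + s) - h y) powr p) >= 0" for s
  unfolding set_lebesgue_integral_def by (rule integral_nonneg_AE) auto
 show "eventually (%s. dist (LBINT y:{a..b}. abs (h (y + s) - h y) powr p) 0 < e) (at 0)"
  unfolding eventually_at using key nn \<delta>(1)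
  by (intro exI[of _ "min 1 \<delta>"]) (auto simp: dist_real_def)
qed

section \<open>Periodic and reflected integrals\<close>

lemma periodic_int_shift:
 fixes f :: "real => 'a"
 assumes per: "!!x. f (x + 2) = f x"
 shows "f (x + 2 * of_int k) = f x"
proof -
 have n: "f (x + 2 * real n) = f x" for x n
 proof (induction n)
  case (Suc n)
  have "f (x + 2 * real (Suc n)) = f ((x + 2 * real n) + 2)" by (simp add: algebra_simps)
  then show ?case using per Suc by simp
 qed simp
 show ?thesis
 proof (cases "k >= 0")
  case True
  then show ?thesis using n[of x "nat k"] by simp
 next
  case False
  then have "f x = f ((x + 2 * of_int k) + 2 * real (nat (- k)))" by simp
  then show ?thesis using n by simp
 qed
qed

lemma periodic_set_integrable:
 fixes f :: "real => real"
 assumes per: "!!x. f (x + 2) = f x" and i: "lint {0..2} f"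
 shows "lint {a..b} f"
proof -
 have one: "lint {2 * of_int k .. 2 * of_int k + 2} f" for k
  using set_integral_shift(2)[of 0 2 f "2 * of_int k"] i by (simp add: periodic_int_shift[of f, OF per] add.commute)
 have all: "lint {- 2 * real n .. 2 * real n} f" for n
 proof (induction n)
  case 0
  show ?case using set_integrable_subset[OF i, of "{0..0}"] by simp
 next
  case (Suc n)
  have "lint ({- 2 * real n .. 2 * real n} \<union> ({2 * of_int (int n) .. 2 * of_int (int n) + 2} \<union> {2 * of_int (- int n - 1) .. 2 * of_int (- int n - 1) + 2})) f"
   by (intro set_integrable_Un Suc one) auto
  moreover have "{- 2 * real n .. 2 * real n} \<union> ({2 * of_int (int n) .. 2 * of_int (int n) + 2} \<union> {2 * of_int (- int n - 1) .. 2 * of_int (- int n - 1) + 2}) = {- 2 * real (Suc n) .. 2 * real (Suc n)}"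
   by auto
  ultimately show ?case by simp
 qed
 obtain n :: nat where "max (abs a) (abs b) <= real n" using real_arch_simple by blast
 then show ?thesis by (intro set_integrable_subset[OF all[of n]]) auto
qed

lemma periodic_set_integral:
 fixes f :: "real => real"
 assumes per: "!!x. f (x + 2) = f x" and i: "lint {0..2} f"
 shows "(LBINT x:{a..a + 2}. f x) = (LBINT x:{0..2}. f x)"
proof -
 define k where "k = \<lfloor>a / 2\<rfloor>"
 define r where "r = a - 2 * of_int k"
 have r: "0 <= r" "r <= 2" unfolding r_def k_def by linarith+
 have "(LBINT x:{a..a + 2}. f x) = (LBINT x:{r..r + 2}. f (x + 2 * of_int k))"
  using set_integral_shift(1)[of r "r + 2" f "2 * of_int k"] by (simp add: r_def add.commute)
 also have "... = (LBINT x:{r..r + 2}. f x)" by (simp add: periodic_int_shift[of f, OF per])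
 also have "... = (LBINT x:{r..2}. f x) + (LBINT x:{0 + 2..r + 2}. f x)"
  using set_integral_Icc_combine[OF periodic_set_integrable[of f, OF per i], of r 2 "r + 2"] r by simp
 also have "(LBINT x:{0 + 2..r + 2}. f x) = (LBINT x:{0..r}. f x)"
  using set_integral_shift(1)[of 0 r f 2] per by simp
 also have "(LBINT x:{r..2}. f x) + (LBINT x:{0..r}. f x) = (LBINT x:{0..2}. f x)"
  using set_integral_Icc_combine[OF i r] by simp
 finally show ?thesis .
qed

lemma periodic_set_integral_nat:
 fixes f :: "real => real"
 assumes per: "!!x. f (x + 2) = f x" and i: "lint {0..2} f"
 shows "(LBINT x:{a..a + 2 * real n}. f x) = n * (LBINT x:{0..2}. f x)"
proof (induction n)
 case 0
 have "(LBINT x:{a..a}. f x) = (LBINT x:{a..a}. f x) + (LBINT x:{a..a}. f x)"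
  by (rule set_integral_Icc_combine[OF periodic_set_integrable[of f, OF per i]]) auto
 then show ?case by simp
next
 case (Suc n)
 have "(LBINT x:{a..a + 2 * real (Suc n)}. f x) =
   (LBINT x:{a..a + 2 * real n}. f x) + (LBINT x:{a + 2 * real n..(a + 2 * real n) + 2}. f x)"
  by (subst set_integral_Icc_combine[OF periodic_set_integrable[of f, OF per i], of a "a + 2 * real n"])
    (auto simp: algebra_simps)
 then show ?case using Suc periodic_set_integral[of f, OF per i, of "a + 2 * real n"] by (simp add: algebra_simps)
qed

lemma set_integral_reflect:
 fixes f :: "real => real"
 shows "(LBINT y:{a..b}. f (- y)) = (LBINT y:{- b..- a}. f y)"
  "lint {a..b} (%y. f (- y)) \<longleftrightarrow> lint {- b..- a} f"
proof -
 have e: "indicator {- b..- a} (0 + (-1) * x) *\<^sub>R f (0 + (-1) * x) = indicator {a..b} x *\<^sub>R f (- x)" for x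
  by (auto simp: indicator_def)
 show "(LBINT y:{a..b}. f (- y)) = (LBINT y:{- b..- a}. f y)"
  unfolding set_lebesgue_integral_def
  using lborel_integral_real_affine[of "-1" "%y. indicator {- b..- a} y *\<^sub>R f y" 0] unfolding e by simp
 show "lint {a..b} (%y. f (- y)) \<longleftrightarrow> lint {- b..- a} f"
  unfolding set_integrable_def
  using lborel_integrable_real_affine_iff[of "-1" "%y. indicator {- b..- a} y *\<^sub>R f y" 0] unfolding e by simp
qed

lemma set_integral_halve:
 fixes f :: "real => real"
 shows "(LBINT s:{0..t}. f (- xi - 2 * s)) = (LBINT y:{- xi - 2 * t..- xi}. f y) / 2"
  "lint {0..t} (%s. f (- xi - 2 * s)) \<longleftrightarrow> lint {- xi - 2 * t..- xi} f"
proof -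
 have e: "indicator {- xi - 2 * t..- xi} (- xi + (-2) * x) *\<^sub>R f (- xi + (-2) * x) = indicator {0..t} x *\<^sub>R f (- xi - 2 * x)" for x
  by (auto simp: indicator_def)
 show "(LBINT s:{0..t}. f (- xi - 2 * s)) = (LBINT y:{- xi - 2 * t..- xi}. f y) / 2"
  unfolding set_lebesgue_integral_def
  using lborel_integral_real_affine[of "-2" "%y. indicator {- xi - 2 * t..- xi} y *\<^sub>R f y" "- xi"] unfolding e by simp
 show "lint {0..t} (%s. f (- xi - 2 * s)) \<longleftrightarrow> lint {- xi - 2 * t..- xi} f"
  unfolding set_integrable_def
  using lborel_integrable_real_affine_iff[of "-2" "%y. indicator {- xi - 2 * t..- xi} y *\<^sub>R f y" "- xi"] unfolding e by simp
qed

lemma set_integral_singleton: "(LBINT x:{r}. f x) = (0::real)" for r :: real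
 unfolding set_lebesgue_integral_def
 by (rule integral_eq_zero_AE) (rule eventually_mono[OF AE_lborel_singleton[of r]], auto)

lemma set_integrable_le:
 fixes f g :: "'a => real"
 assumes g: "set_integrable M S g" and f: "f \<in> borel_measurable M" and S: "S \<in> sets M"
  and le: "!!x. x \<in> S ==> abs (f x) <= g x"
 shows "set_integrable M S f"
proof (rule set_integrable_bound[OF g])
 show "set_borel_measurable M S f" using f S by (simp add: set_borel_measurable_def)
 show "AE x in M. x \<in> S --> norm (f x) <= norm (g x)"
  using le by (intro AE_I2) (metis abs_ge_self order_trans real_norm_def)
qed

lemma measurable_curried:
 assumes "(%(x, y). z x y) \<in> borel2" "f \<in> borel_measurable M" "g \<in> borel_measurable M"
 shows "(%x. z (f x) (g x)) \<in> borel_measurable M"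
 using measurable_compose[OF measurable_Pair[OF assms(2,3)] assms(1)] by simp

lemma set_integral_point: "(LBINT x:{r..r}. f x) = (0::real)" for r :: real
 using set_integral_singleton by simp

section \<open>The equation along characteristics\<close>

text \<open>The folded problem: \<open>\<alpha>\<close> is the even, 2-periodic continuation of the damping
 coefficient, \<open>h0\<close> the folded initial datum and \<open>c\<close> the factor picked up at each
 integer.\<close>
locale characteristics =
 fixes p c A :: real and \<alpha> :: "real => real => real" and h0 :: "real => real"
 assumes p: "1 < p" and c: "abs c < 1" and A: "0 <= A"
  and \<alpha>_measurable: "(%(s, y). \<alpha> s y) \<in> borel2"
  and \<alpha>_nonneg: "!!s y. 0 <= \<alpha> s y" and \<alpha>_le: "!!s y. \<alpha> s y <= A"
  and \<alpha>_periodic: "!!s y. \<alpha> s (y + 2) = \<alpha> s y" and \<alpha>_even: "!!s y. \<alpha> s (- y) = \<alpha> s y"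
  and h0_measurable [measurable]: "h0 \<in> borel1"
  and h0_periodic: "!!y. h0 (y + 2) = h0 y"
  and h0_integrable: "lint {0..2} (%y. abs (h0 y) powr p)"
begin

lemma h0_powr_integrable: "lint {a..b} (%y. abs (h0 y) powr p)"
 by (rule periodic_set_integrable[OF _ h0_integrable]) (simp add: h0_periodic)

lemma h0_abs_integrable: "lint {a..b} (%y. abs (h0 y))"
proof -
 have "lint {a..b} (%y. 1 + abs (h0 y) powr p)"
  by (rule set_integral_add(1)[OF set_integrable_bounded[where B = 1] h0_powr_integrable]) auto
 then show ?thesis
  by (rule set_integrable_bound)
    (use abs_le_powr[of p 1] p in \<open>auto simp: set_borel_measurable_def intro!: AE_I2\<close>)
qed

text \<open>A bound for the integral of the initial datum over the reflected point \<open>- xi - 2 s\<close>,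
 which sweeps an interval of length \<open>2 T\<close>; by periodicity it does not depend on
 \<open>xi\<close>.\<close>
definition swept :: "real => real" where
 "swept T = (real (nat \<lceil>T\<rceil>)) * (LBINT y:{0..2}. abs (h0 y)) / 2"

lemma swept_bound:
 shows "lint {0..t} (%s. abs (h0 (- xi - 2 * s)))"
  "t <= T ==> (LBINT s:{0..t}. abs (h0 (- xi - 2 * s))) <= swept T"
proof -
 show "lint {0..t} (%s. abs (h0 (- xi - 2 * s)))"
  using set_integral_halve(2)[of t "%y. abs (h0 y)" xi] h0_abs_integrable by simp
 assume t: "t <= T"
 define n where "n = nat \<lceil>T\<rceil>"
 have n: "T <= real n" unfolding n_def by linarith
 have "(LBINT s:{0..t}. abs (h0 (- xi - 2 * s))) = (LBINT y:{- xi - 2 * t..- xi}. abs (h0 y)) / 2"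
  using set_integral_halve(1)[of t "%y. abs (h0 y)" xi] by simp
 also have "(LBINT y:{- xi - 2 * t..- xi}. abs (h0 y)) <= (LBINT y:{- xi - 2 * real n..(- xi - 2 * real n) + 2 * real n}. abs (h0 y))"
  by (rule set_integral_subset_le[OF h0_abs_integrable]) (use t n in auto)
 also have "... = n * (LBINT y:{0..2}. abs (h0 y))"
  by (rule periodic_set_integral_nat[OF _ h0_abs_integrable]) (simp add: h0_periodic)
 finally show "(LBINT s:{0..t}. abs (h0 (- xi - 2 * s))) <= swept T" by (simp add: swept_def n_def)
qed

lemma swept_nonneg: "0 <= swept T"
 unfolding swept_def set_lebesgue_integral_def by (intro divide_nonneg_pos mult_nonneg_nonneg integral_nonneg_AE) auto

text \<open>The accumulated boundary factor: one power of \<open>c\<close> for every integer crossed by the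
 characteristic between the times \<open>s\<close> and \<open>t\<close>.\<close>
definition U :: "real => real => real => real" where
 "U t s xi = c ^ nat (\<lfloor>xi + t\<rfloor> - \<lfloor>xi + s\<rfloor>)"

lemma abs_U: "abs (U t s xi) <= 1"
 unfolding U_def using c by (simp add: power_abs power_le_one)

text \<open>The damping along the characteristic labelled \<open>xi\<close>. At time \<open>s\<close> it sits
 at \<open>y = xi + s\<close>, and the mirror point \<open>- y\<close> lies on the characteristic labelled
 \<open>- xi - 2 s\<close>.\<close>
definition dens :: "(real => real => real) => real => real => real" where
 "dens w s xi = - (1/2) * \<alpha> s (xi + s) * (w s xi + w s (- xi - 2 * s))"

definition damping :: "(real => real => real) => real => real => real" where
 "damping w t xi = (LBINT s:{0..t}. U t s xi * dens w s xi)"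

text \<open>The terms of the Neumann series of the integral equation \<open>z_equation\<close>.\<close>
primrec d :: "nat => real => real => real" where
 "d 0 = (%t xi. U t 0 xi * h0 xi)"
| "d (Suc n) = damping (d n)"

lemma U_measurable [measurable (raw)]:
 assumes [measurable]: "f \<in> borel_measurable M" "g \<in> borel_measurable M" "h \<in> borel_measurable M"
 shows "(%x. U (f x) (g x) (h x)) \<in> borel_measurable M"
 unfolding U_def by measurable

lemma dens_measurable:
 assumes w: "(%(t, xi). w t xi) \<in> borel2"
  and [measurable]: "f \<in> borel_measurable M" "g \<in> borel_measurable M"
 shows "(%x. dens w (f x) (g x)) \<in> borel_measurable M"
proof -
 have [measurable]: "(%x. \<alpha> (f x) (g x + f x)) \<in> borel_measurable M" "(%x. w (f x) (g x)) \<in> borel_measurable M"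
  "(%x. w (f x) (- g x - 2 * f x)) \<in> borel_measurable M"
  by (rule measurable_curried[OF \<alpha>_measurable] measurable_curried[OF w]; measurable)+
 show ?thesis unfolding dens_def by measurable
qed

lemma damping_measurable:
 assumes w: "(%(t, xi). w t xi) \<in> borel2"
 shows "(%(t, xi). damping w t xi) \<in> borel2"
proof -
 have [measurable]: "(%z. dens w (snd z) (snd (fst z))) \<in> borel_measurable ((borel \<Otimes>\<^sub>M borel) \<Otimes>\<^sub>M lborel)"
  by (rule dens_measurable[OF w]) measurable
 have "(%z. (if 0 <= snd z \<and> snd z <= fst (fst z) then 1 else 0) * (U (fst (fst z)) (snd z) (snd (fst z)) * dens w (snd z) (snd (fst z))))
   \<in> borel_measurable ((borel \<Otimes>\<^sub>M borel) \<Otimes>\<^sub>M lborel)"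
  by measurable
 moreover have "(%z. (if 0 <= snd z \<and> snd z <= fst (fst z) then 1 else 0) * (U (fst (fst z)) (snd z) (snd (fst z)) * dens w (snd z) (snd (fst z))))
  = (%(q, s). indicator {0..fst q} s *\<^sub>R (U (fst q) s (snd q) * dens w s (snd q)))"
  by (auto simp: fun_eq_iff indicator_def)
 ultimately have "(%(q, s). indicator {0..fst q} s *\<^sub>R (U (fst q) s (snd q) * dens w s (snd q)))
   \<in> borel_measurable ((borel \<Otimes>\<^sub>M borel) \<Otimes>\<^sub>M lborel)" by simp
 from lborel.borel_measurable_lebesgue_integral[OF this]
 show ?thesis by (simp add: damping_def set_lebesgue_integral_def case_prod_beta)
qed

lemma d_measurable: "(%(t, xi). d n t xi) \<in> borel2"
proof (induction n)
 case 0
 show ?case by (simp add: case_prod_beta)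
qed (simp add: damping_measurable)

definition rate :: real where "rate = 4 * A + 1"
text \<open>A majorant of the initial datum that is reproduced by the damping operator: the integral of its
 reflected value is controlled by \<open>swept\<close>.\<close>
definition weight :: "real => real => real" where "weight T xi = abs (h0 xi) + 2 * A * swept T"

lemma weight_nonneg: "0 <= weight T xi"
 unfolding weight_def using A swept_nonneg by simp

lemma dens_le:
 assumes "!!xi. abs (w s xi) <= b xi"
 shows "abs (dens w s xi) <= A / 2 * (b xi + b (- xi - 2 * s))"
proof -
 have "abs (dens w s xi) = \<alpha> s (xi + s) / 2 * abs (w s xi + w s (- xi - 2 * s))"
  using \<alpha>_nonneg[of s "xi + s"] by (simp add: dens_def abs_mult)
 also have "... <= A / 2 * (b xi + b (- xi - 2 * s))"
  by (rule mult_mono) (use \<alpha>_le[of s "xi + s"] A assms[of xi] assms[of "- xi - 2 * s"] in auto)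
 finally show ?thesis .
qed

text \<open>The exponential factor \<open>exp (rate * t)\<close> makes the damping operator a contraction with
 constant one half on every bounded time interval.\<close>
lemma damping_bound:
 assumes w: "(%(t, xi). w t xi) \<in> borel2"
  and b: "!!s xi. 0 <= s ==> s <= T ==> abs (w s xi) <= B * exp (rate * s) * weight T xi"
  and t: "0 <= t" "t <= T" and B: "0 <= B"
 shows "lint {0..t} (%s. U t s xi * dens w s xi)"
  "lint {0..t} (%s. dens w s xi)"
  "(LBINT s:{0..t}. abs (U t s xi * dens w s xi)) <= 1/2 * B * exp (rate * t) * weight T xi"
  "abs (damping w t xi) <= 1/2 * B * exp (rate * t) * weight T xi"
proof -
 let ?g = "%s. A / 2 * B * (2 * weight T xi * exp (rate * s) + exp (rate * t) * abs (h0 (- xi - 2 * s)))"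
 have rate: "rate > 0" using A by (simp add: rate_def)
 have dle: "abs (dens w s xi) <= ?g s" if s: "s \<in> {0..t}" for s
 proof -
  have w0: "2 * A * swept T <= weight T xi" unfolding weight_def by simp
  have "abs (dens w s xi) <= A / 2 * (B * exp (rate * s) * weight T xi + B * exp (rate * s) * weight T (- xi - 2 * s))"
   using dens_le[of w s "%xi. B * exp (rate * s) * weight T xi"] b s t by simp
  also have "... = A / 2 * B * (exp (rate * s) * (weight T xi + 2 * A * swept T) + exp (rate * s) * abs (h0 (- xi - 2 * s)))"
   by (simp add: weight_def algebra_simps)
  also have "... <= ?g s"
  proof (rule mult_left_mono[OF add_mono])
   show "exp (rate * s) * (weight T xi + 2 * A * swept T) <= 2 * weight T xi * exp (rate * s)"
    using w0 mult_left_mono[of "weight T xi + 2 * A * swept T" "2 * weight T xi" "exp (rate * s)"] by (simp add: mult.commute)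
   show "exp (rate * s) * abs (h0 (- xi - 2 * s)) <= exp (rate * t) * abs (h0 (- xi - 2 * s))"
    using rate s by (intro mult_right_mono) auto
   show "0 <= A / 2 * B" using A B by simp
  qed
  finally show ?thesis .
 qed
 have le: "abs (U t s xi * dens w s xi) <= ?g s" if s: "s \<in> {0..t}" for s
  using dle[OF s] mult_mono[OF abs_U[of t s xi] dle[OF s]] by (simp add: abs_mult)
 have E: "primitive_on 0 t (%s. exp (rate * s)) (%s. exp (rate * s) / rate)"
  by (rule primitive_on_C1) (use rate in \<open>auto intro!: derivative_eq_intros continuous_intros\<close>)
 have Ei: "lint {0..t} (%s. exp (rate * s))" by (rule primitive_onD(1)[OF E])
 have EI: "(LBINT s:{0..t}. exp (rate * s)) <= exp (rate * t) / rate"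
  using primitive_onD(2)[OF E, of t] t rate by simp
 have gi: "lint {0..t} ?g"
  using set_integral_add(1)[OF set_integrable_mult_right[OF Ei, of "2 * weight T xi"] set_integrable_mult_right[OF swept_bound(1)[of t xi], of "exp (rate * t)"]]
  by simp
 have dm: "(%s. dens w s xi) \<in> borel_measurable lborel" by (rule dens_measurable[OF w]) auto
 show di: "lint {0..t} (%s. dens w s xi)"
  by (rule set_integrable_le[OF gi _ _ dle]) (use dm in auto)
 show i: "lint {0..t} (%s. U t s xi * dens w s xi)"
  by (rule set_integrable_le[OF gi _ _ le]) (use dm in auto)
 have "(LBINT s:{0..t}. abs (U t s xi * dens w s xi)) <= (LBINT s:{0..t}. ?g s)"
  by (rule set_integral_mono[OF set_integrable_abs[OF i] gi le])
 also have "... = A / 2 * B * (2 * weight T xi * (LBINT s:{0..t}. exp (rate * s)) + exp (rate * t) * (LBINT s:{0..t}. abs (h0 (- xi - 2 * s))))"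
  using set_integral_add(2)[OF set_integrable_mult_right[OF Ei, of "2 * weight T xi"] set_integrable_mult_right[OF swept_bound(1)[of t xi], of "exp (rate * t)"]]
  by simp
 also have "... <= A / 2 * B * (2 * weight T xi * (exp (rate * t) / rate) + exp (rate * t) * swept T)"
  by (intro mult_left_mono add_mono EI swept_bound(2) t) (use A B weight_nonneg in auto)
 also have "... = 1/2 * B * exp (rate * t) * (2 * A / rate * weight T xi + A * swept T)"
  by (simp add: algebra_simps)
 also have "... <= 1/2 * B * exp (rate * t) * weight T xi"
 proof (rule mult_left_mono)
  have "2 * A / rate <= 1 / 2" using rate A by (simp add: rate_def field_simps)
  then have "2 * A / rate * weight T xi <= 1 / 2 * weight T xi" by (rule mult_right_mono) (rule weight_nonneg)
  moreover have "A * swept T <= 1 / 2 * weight T xi" by (simp add: weight_def)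
  ultimately show "2 * A / rate * weight T xi + A * swept T <= weight T xi" by linarith
 qed (use B in simp)
 finally show I: "(LBINT s:{0..t}. abs (U t s xi * dens w s xi)) <= 1/2 * B * exp (rate * t) * weight T xi" .
 have "abs (damping w t xi) <= (LBINT s:{0..t}. abs (U t s xi * dens w s xi))"
  using set_integral_norm_bound[OF i] by (simp add: damping_def)
 then show "abs (damping w t xi) <= 1/2 * B * exp (rate * t) * weight T xi" using I by linarith
qed

lemma d_bound:
 assumes "0 <= t" "t <= T"
 shows "abs (d n t xi) <= (1/2) ^ n * exp (rate * t) * weight T xi"
 using assms
proof (induction n arbitrary: t xi)
 case 0
 have "abs (U t 0 xi * h0 xi) <= 1 * abs (h0 xi)" unfolding abs_mult by (rule mult_right_mono[OF abs_U]) simp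
 also have "... <= exp (rate * t) * weight T xi"
 proof (rule mult_mono)
  show "1 <= exp (rate * t)" using 0 A by (simp add: rate_def)
  show "abs (h0 xi) <= weight T xi" using A swept_nonneg by (simp add: weight_def)
 qed auto
 finally show ?case by simp
next
 case (Suc n)
 have "abs (damping (d n) t xi) <= 1/2 * (1/2) ^ n * exp (rate * t) * weight T xi"
  by (rule damping_bound(4)[OF d_measurable Suc.IH Suc.prems]) auto
 then show ?case by simp
qed

definition z :: "real => real => real" where
 "z t xi = (\<Sum>n. d n t xi)"

abbreviation k :: "real => real => real" where "k \<equiv> dens z"

lemma z_measurable: "(%(t, xi). z t xi) \<in> borel2"
proof -
 have "(%q. \<Sum>n. (%(t, xi). d n t xi) q) \<in> borel2"
  by (rule borel_measurable_suminf[OF d_measurable])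
 then show ?thesis by (simp add: z_def case_prod_beta)
qed

lemma d_summable:
 assumes "0 <= t"
 shows "summable (%n. abs (d n t xi))"
proof (rule summable_comparison_test[OF exI[of _ 0]])
 show "\<forall>n\<ge>0. norm (abs (d n t xi)) <= (1/2) ^ n * (exp (rate * t) * weight t xi)"
  using d_bound[OF assms order_refl] by (simp add: mult.assoc)
 show "summable (%n. (1/2) ^ n * (exp (rate * t) * weight t xi))"
  by (intro summable_mult2 summable_geometric) simp
qed

lemma z_exp_bound:
 assumes "0 <= t" "t <= T"
 shows "abs (z t xi) <= 2 * exp (rate * t) * weight T xi"
proof -
 have "abs (z t xi) <= (\<Sum>n. abs (d n t xi))" unfolding z_def by (rule summable_rabs[OF d_summable[OF assms(1)]])
 also have "... <= (\<Sum>n. (1/2) ^ n * (exp (rate * t) * weight T xi))"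
  by (rule suminf_le[OF _ d_summable[OF assms(1)]])
    (use d_bound[OF assms] in \<open>auto simp: mult.assoc intro!: summable_mult2 summable_geometric\<close>)
 also have "... = 2 * exp (rate * t) * weight T xi"
  by (subst suminf_mult2[symmetric]) (auto simp: suminf_geometric intro!: summable_geometric)
 finally show ?thesis .
qed

lemma z_bound_exists:
 obtains B where "B >= 0" "!!t xi. 0 <= t ==> t <= T ==> abs (z t xi) <= B * (1 + abs (h0 xi))"
proof (rule that)
 let ?B = "2 * exp (rate * T) * (1 + 2 * A * swept T)"
 have "2 * A * swept T >= 0" using A swept_nonneg by simp
 then show "?B >= 0" by simp
 fix t xi :: real assume t: "0 <= t" "t <= T"
 have "abs (z t xi) <= 2 * exp (rate * t) * weight T xi" by (rule z_exp_bound[OF t])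
 also have "... <= 2 * exp (rate * T) * ((1 + 2 * A * swept T) * (1 + abs (h0 xi)))"
 proof (intro mult_mono)
  have "0 <= 2 * A * swept T * abs (h0 xi)" using A swept_nonneg by simp
  then show "weight T xi <= (1 + 2 * A * swept T) * (1 + abs (h0 xi))"
   by (simp add: weight_def algebra_simps)
  show "exp (rate * t) <= exp (rate * T)" using t A by (simp add: rate_def mult_left_mono)
 qed (use weight_nonneg in auto)
 finally show "abs (z t xi) <= ?B * (1 + abs (h0 xi))" by (simp add: mult.assoc)
qed

lemma k_integrable: "0 <= t ==> lint {0..t} (%s. k s xi)"
 by (rule damping_bound(2)[OF z_measurable, of t 2 t]) (use z_exp_bound in auto)

lemma k_integrable': "0 <= r ==> lint {r..t} (%s. k s xi)"
proof (cases "t >= 0")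
 case True
 assume "0 <= r"
 then show ?thesis by (intro set_integrable_subset[OF k_integrable[OF True]]) auto
qed auto

lemma z_equation:
 assumes t: "0 <= t"
 shows "z t xi = U t 0 xi * h0 xi + (LBINT s:{0..t}. U t s xi * k s xi)"
proof -
 let ?f = "%n s. indicator {0..t} s *\<^sub>R (U t s xi * dens (d n) s xi)"
 have b: "abs (d n s xi') <= (1/2) ^ n * exp (rate * s) * weight t xi'" if "0 <= s" "s <= t" for n s xi'
  by (rule d_bound[OF that])
 note D = damping_bound[OF d_measurable b t order_refl]
 have ds: "(%n. dens (d n) s xi) sums k s xi" if s: "s >= 0" for s
 proof -
  have sm: "(%n. d n s x) sums z s x" for x
   unfolding z_def by (rule summable_sums[OF summable_rabs_cancel[OF d_summable[OF s]]])
  show ?thesis unfolding dens_def by (intro sums_mult sums_add sm)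
 qed
 have abs_ds: "summable (%n. norm (?f n s))" for s
 proof (cases "s \<in> {0..t}")
  case True
  have "summable (%n. abs (d n s xi) + abs (d n s (- xi - 2 * s)))"
   by (intro summable_add d_summable) (use True in auto)
  then have "summable (%n. A / 2 * (abs (d n s xi) + abs (d n s (- xi - 2 * s))))" by (rule summable_mult)
  then show ?thesis
  proof (rule summable_comparison_test[OF exI[of _ 0], OF allI, OF impI, rotated])
   fix n
   have "abs (U t s xi) * abs (dens (d n) s xi) <= 1 * abs (dens (d n) s xi)" by (rule mult_right_mono[OF abs_U]) simp
   also have "... <= A / 2 * (abs (d n s xi) + abs (d n s (- xi - 2 * s)))"
    using dens_le[of "d n" s "%xi. abs (d n s xi)"] by simp
   finally show "norm (norm (?f n s)) <= A / 2 * (abs (d n s xi) + abs (d n s (- xi - 2 * s)))"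
    using True by (simp add: abs_mult)
  qed
 qed simp
 have "(%n. integral\<^sup>L lborel (?f n)) sums (LBINT s. (\<Sum>n. ?f n s))"
 proof (rule sums_integral)
  show "integrable lborel (?f n)" for n using D(1)[of n] by (simp add: set_integrable_def)
  show "AE s in lborel. summable (%n. norm (?f n s))" using abs_ds by simp
  show "summable (%n. LBINT s. norm (?f n s))"
  proof (rule summable_comparison_test[OF exI[of _ 0], OF allI, OF impI])
   fix n
   have "(LBINT s. norm (?f n s)) = (LBINT s:{0..t}. abs (U t s xi * dens (d n) s xi))"
    unfolding set_lebesgue_integral_def by (rule Bochner_Integration.integral_cong) (auto simp: abs_mult)
   also have "... <= 1/2 * (1/2) ^ n * exp (rate * t) * weight t xi" by (rule D(3)) auto
   finally show "norm (LBINT s. norm (?f n s)) <= (1/2) ^ n * (1/2 * exp (rate * t) * weight t xi)"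
    by (simp add: integral_nonneg_AE ac_simps)
   show "summable (%n. (1/2) ^ n * (1/2 * exp (rate * t) * weight t xi))"
    by (intro summable_mult2 summable_geometric) simp
  qed
 qed
 moreover have "(\<Sum>n. ?f n s) = indicator {0..t} s *\<^sub>R (U t s xi * k s xi)" for s
 proof (cases "s \<in> {0..t}")
  case True
  then have "(%n. U t s xi * dens (d n) s xi) sums (U t s xi * k s xi)" by (intro sums_mult ds) auto
  then show ?thesis using True by (simp add: sums_unique[symmetric])
 qed simp
 ultimately have "(%n. d (Suc n) t xi) sums (LBINT s:{0..t}. U t s xi * k s xi)"
  by (simp add: damping_def set_lebesgue_integral_def)
 from sums_Suc[OF this] show ?thesis unfolding z_def by (simp add: sums_unique[symmetric] add.commute)
qed

lemma d_periodic: "d n t (xi + 2) = d n t xi"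
proof (induction n arbitrary: t xi)
 case 0
 have f: "\<lfloor>xi + 2 + s\<rfloor> = \<lfloor>xi + s\<rfloor> + 2" for s by linarith
 show ?case by (simp add: U_def h0_periodic f[of 0, simplified] f)
next
 case (Suc n)
 have f: "\<lfloor>xi + 2 + s\<rfloor> = \<lfloor>xi + s\<rfloor> + 2" for s by linarith
 have U: "U t s (xi + 2) = U t s xi" for s by (simp add: U_def f)
 have "d n s (- (xi + 2) - 2 * s) = d n s (- (xi + 2) - 2 * s + 2)" for s by (rule Suc.IH[symmetric])
 then have r: "d n s (- (xi + 2) - 2 * s) = d n s (- xi - 2 * s)" for s by simp
 have "\<alpha> s (xi + 2 + s) = \<alpha> s (xi + s)" for s using \<alpha>_periodic[of s "xi + s"] by (simp add: ac_simps)
 then have "dens (d n) s (xi + 2) = dens (d n) s xi" for s unfolding dens_def r by (simp only: Suc.IH)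
 then show ?case by (simp add: damping_def U)
qed

lemma z_periodic: "z t (xi + 2) = z t xi"
 by (simp add: z_def d_periodic)

lemma z_initial: "z 0 xi = h0 xi"
 using z_equation[of 0 xi] unfolding set_integral_point by (simp add: U_def)

lemma z_evolution:
 assumes r: "0 <= r" "r <= t"
 shows "z t xi = U t r xi * z r xi + (LBINT s:{r..t}. U t s xi * k s xi)"
proof -
 have t: "0 <= t" using r by simp
 have comp: "U t s xi = U t r xi * U r s xi" if "s <= r" for s
 proof -
  have "\<lfloor>xi + s\<rfloor> <= \<lfloor>xi + r\<rfloor>" "\<lfloor>xi + r\<rfloor> <= \<lfloor>xi + t\<rfloor>" using that r by (auto intro: floor_mono)
  then have "nat (\<lfloor>xi + t\<rfloor> - \<lfloor>xi + s\<rfloor>) = nat (\<lfloor>xi + t\<rfloor> - \<lfloor>xi + r\<rfloor>) + nat (\<lfloor>xi + r\<rfloor> - \<lfloor>xi + s\<rfloor>)" by simp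
  then show ?thesis by (simp add: U_def power_add)
 qed
 have i: "lint {0..t} (%s. U t s xi * k s xi)"
  by (rule damping_bound(1)[OF z_measurable, of t 2 t]) (use z_exp_bound t in auto)
 have "z t xi = U t 0 xi * h0 xi + (LBINT s:{0..r}. U t s xi * k s xi) + (LBINT s:{r..t}. U t s xi * k s xi)"
  using z_equation[OF t] set_integral_Icc_combine[OF i r] by simp
 also have "(LBINT s:{0..r}. U t s xi * k s xi) = (LBINT s:{0..r}. U t r xi * (U r s xi * k s xi))"
 proof (rule set_lebesgue_integral_cong)
  show "\<forall>s. s \<in> {0..r} --> U t s xi * k s xi = U t r xi * (U r s xi * k s xi)"
  proof (intro allI impI)
   fix s assume "s \<in> {0..r}"
   then have "U t s xi = U t r xi * U r s xi" by (intro comp) simp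
   then show "U t s xi * k s xi = U t r xi * (U r s xi * k s xi)" by simp
  qed
 qed simp
 also have "... = U t r xi * (LBINT s:{0..r}. U r s xi * k s xi)" by simp
 also have "U t 0 xi = U t r xi * U r 0 xi" by (rule comp) (rule r)
 finally show ?thesis using z_equation[OF r(1), of xi] by (simp add: algebra_simps)
qed

text \<open>The time at which the characteristic enters the cell between \<open>n\<close> and \<open>n + 1\<close>,
 or zero if it starts in that cell or beyond it.\<close>
definition entry :: "int => real => real" where
 "entry n xi = max 0 (of_int n - xi)"

text \<open>The solution followed inside one cell up to and including its right end. It agrees with
 \<open>z\<close> in the half-open cell, while at the right end \<open>z\<close> already carries the factor
 \<open>c\<close> (\<open>Zc_jump\<close>); \<open>Zc\<close> is thus the trace from the left.\<close>
definition Zc :: "int => real => real => real" where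
 "Zc n t xi = z (entry n xi) xi + (LBINT s:{entry n xi..t}. k s xi)"

lemma entry_nonneg: "0 <= entry n xi" by (simp add: entry_def)

lemma Zc_eq_z:
 assumes "0 <= t" "of_int n <= xi + t" "xi + t < of_int n + 1"
 shows "Zc n t xi = z t xi"
proof -
 have r: "0 <= entry n xi" "entry n xi <= t" using assms by (auto simp: entry_def)
 have fl: "\<lfloor>xi + s\<rfloor> = n" if "entry n xi <= s" "s <= t" for s
  using that assms by (intro floor_unique) (auto simp: entry_def)
 have "z t xi = U t (entry n xi) xi * z (entry n xi) xi + (LBINT s:{entry n xi..t}. U t s xi * k s xi)"
  by (rule z_evolution[OF r])
 also have "(LBINT s:{entry n xi..t}. U t s xi * k s xi) = (LBINT s:{entry n xi..t}. k s xi)"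
  by (rule set_lebesgue_integral_cong) (use r in \<open>auto simp: U_def fl\<close>)
 finally show ?thesis using r by (simp add: Zc_def U_def fl)
qed

lemma Zc_jump:
 assumes "0 < t" "xi + t = of_int n + 1"
 shows "z t xi = c * Zc n t xi"
proof -
 have r: "0 <= entry n xi" "entry n xi < t" using assms by (auto simp: entry_def)
 have fl: "\<lfloor>xi + s\<rfloor> = n" if "entry n xi <= s" "s < t" for s
  using that assms by (intro floor_unique) (auto simp: entry_def)
 have flt: "\<lfloor>xi + t\<rfloor> = n + 1" using assms by (intro floor_unique) auto
 have U: "U t s xi = c" if "entry n xi <= s" "s < t" for s
  by (simp add: U_def fl[OF that] flt)
 have "z t xi = U t (entry n xi) xi * z (entry n xi) xi + (LBINT s:{entry n xi..t}. U t s xi * k s xi)"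
  by (rule z_evolution) (use r in auto)
 also have "(LBINT s:{entry n xi..t}. U t s xi * k s xi) = (LBINT s:{entry n xi..t}. c * k s xi)"
  unfolding set_lebesgue_integral_def
 proof (rule integral_cong_AE)
  have [measurable]: "(%s. k s xi) \<in> borel_measurable lborel" by (rule dens_measurable[OF z_measurable]) auto
  show "(%s. indicat_real {entry n xi..t} s *\<^sub>R (U t s xi * k s xi)) \<in> borel_measurable lborel"
   "(%s. indicat_real {entry n xi..t} s *\<^sub>R (c * k s xi)) \<in> borel_measurable lborel" by measurable
  show "AE s in lborel. indicat_real {entry n xi..t} s *\<^sub>R (U t s xi * k s xi) = indicat_real {entry n xi..t} s *\<^sub>R (c * k s xi)"
   using AE_lborel_singleton[of t] by (rule eventually_mono) (auto simp: indicator_def U)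
 qed
 finally show ?thesis using U[of "entry n xi"] r by (simp add: Zc_def algebra_simps)
qed

lemma Zc_primitive: "primitive_on (entry n xi) t (%s. k s xi) (%s. Zc n s xi)"
 unfolding primitive_on_def Zc_def
 by (intro conjI ballI k_integrable' entry_nonneg) (simp add: set_integral_singleton)

lemma k_bound_exists:
 obtains B where "B >= 0" "!!t xi. 0 <= t ==> t <= T ==> abs (z t xi) <= B * (1 + abs (h0 xi))"
  "!!t xi. 0 <= t ==> t <= T ==> abs (k t xi) <= B * (2 + abs (h0 xi) + abs (h0 (- xi - 2 * t)))"
  "!!n t xi. entry n xi <= t ==> t <= T ==> abs (Zc n t xi) <= B * (1 + abs (h0 xi))"
proof -
 obtain B where B: "B >= 0" "!!t xi. 0 <= t ==> t <= T ==> abs (z t xi) <= B * (1 + abs (h0 xi))"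
  using z_bound_exists by blast
 define B1 where "B1 = A / 2 * B"
 have B1: "B1 >= 0" using A B by (simp add: B1_def)
 have kb: "abs (k t xi) <= B1 * (2 + abs (h0 xi) + abs (h0 (- xi - 2 * t)))" if "0 <= t" "t <= T" for t xi
  using dens_le[of z t "%xi. B * (1 + abs (h0 xi))" xi] B(2)[OF that] by (simp add: B1_def algebra_simps)
 define B2 where "B2 = B + B1 * (2 * abs T + swept T) + B1"
 have B2: "B2 >= 0" "B <= B2" "B1 <= B2" using B1 B swept_nonneg[of T] by (auto simp: B2_def)
 have Zb: "abs (Zc n t xi) <= B2 * (1 + abs (h0 xi))" if t: "entry n xi <= t" "t <= T" for n t xi
 proof -
  let ?r = "entry n xi" and ?g = "%s. B1 * (2 + abs (h0 xi)) + B1 * abs (h0 (- xi - 2 * s))"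
  have t0: "0 <= t" using entry_nonneg[of n xi] t by linarith
  have ci: "lint {0..t} (%s. B1 * (2 + abs (h0 xi)))"
   by (rule set_integrable_bounded[where B = "\<bar>B1 * (2 + \<bar>h0 xi\<bar>)\<bar>"]) auto
  note gi = set_integral_add[OF ci set_integrable_mult_right[OF swept_bound(1)[of t xi], of B1]]
  have "abs (LBINT s:{?r..t}. k s xi) <= (LBINT s:{?r..t}. abs (k s xi))"
   using set_integral_norm_bound[OF k_integrable'[OF entry_nonneg, of n xi t xi]] by simp
  also have "... <= (LBINT s:{0..t}. abs (k s xi))"
   by (rule set_integral_subset_le[OF set_integrable_abs[OF k_integrable[OF t0]]]) (use entry_nonneg[of n xi] in auto)
  also have "... <= (LBINT s:{0..t}. ?g s)"
   by (rule set_integral_mono[OF set_integrable_abs[OF k_integrable[OF t0]] gi(1)])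
     (use kb[of _ xi] t in \<open>simp add: algebra_simps\<close>)
  also have "... = t * (B1 * (2 + abs (h0 xi))) + B1 * (LBINT s:{0..t}. abs (h0 (- xi - 2 * s)))"
   using gi(2) t0 by (simp add: set_lebesgue_integral_def)
  also have "... <= abs T * (B1 * (2 * (1 + abs (h0 xi)))) + B1 * swept T"
   by (intro add_mono mult_mono mult_left_mono swept_bound(2)) (use t0 t B1 in auto)
  also have "... <= B1 * (2 * abs T + swept T) * (1 + abs (h0 xi))"
  proof -
   have "0 <= B1 * swept T * abs (h0 xi)" using B1 swept_nonneg by simp
   then show ?thesis by (simp add: algebra_simps)
  qed
  finally have I: "abs (LBINT s:{?r..t}. k s xi) <= B1 * (2 * abs T + swept T) * (1 + abs (h0 xi))" .
  have "abs (Zc n t xi) <= abs (z ?r xi) + abs (LBINT s:{?r..t}. k s xi)" unfolding Zc_def by (rule abs_triangle_ineq)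
  also have "... <= B * (1 + abs (h0 xi)) + B1 * (2 * abs T + swept T) * (1 + abs (h0 xi))"
   by (rule add_mono[OF B(2) I]) (use t entry_nonneg in auto)
  also have "... <= B2 * (1 + abs (h0 xi))"
   using B1 by (simp add: B2_def distrib_right)
  finally show ?thesis .
 qed
 show thesis
 proof (rule that[OF B2(1) _ _ Zb])
  fix t xi assume t: "0 <= t" "t <= T"
  show "abs (z t xi) <= B2 * (1 + abs (h0 xi))"
   using B(2)[OF t, of xi] mult_right_mono[OF B2(2), of "1 + abs (h0 xi)"] by linarith
  show "abs (k t xi) <= B2 * (2 + abs (h0 xi) + abs (h0 (- xi - 2 * t)))"
   using kb[OF t, of xi] mult_right_mono[OF B2(3), of "2 + abs (h0 xi) + abs (h0 (- xi - 2 * t))"] by linarith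
 qed
qed

end

section \<open>Continuity in time and traces\<close>

lemma tendsto_set_integral_zero:
 fixes f :: "real => real => real"
 assumes m: "!!s. f s \<in> borel1" and g: "lint {a..b} g"
  and dom: "eventually (%s. \<forall>y\<in>{a..b}. abs (f s y) <= g y) (at x within S)"
  and lim: "AE y in lborel. y \<in> {a..b} --> ((%s. f s y) \<longlongrightarrow> 0) (at x within S)"
 shows "((%s. LBINT y:{a..b}. f s y) \<longlongrightarrow> 0) (at x within S)"
 unfolding tendsto_at_iff_sequentially
proof (intro allI impI)
 fix X assume X: "\<forall>i. X i \<in> S - {x}" "X \<longlonglongrightarrow> x"
 then have XF: "filterlim X (at x within S) sequentially"
  by (auto simp: filterlim_at intro!: always_eventually)
 then have "eventually (%i. \<forall>y\<in>{a..b}. abs (f (X i) y) <= g y) sequentially"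
  by (rule eventually_compose_filterlim[OF dom])
 then obtain N where N: "!!i. i >= N ==> \<forall>y\<in>{a..b}. abs (f (X i) y) <= g y"
  unfolding eventually_sequentially by blast
 have "(%i. LBINT y. indicator {a..b} y *\<^sub>R f (X (i + N)) y) \<longlonglongrightarrow> (LINT y|(lborel :: real measure). 0)"
 proof (rule integral_dominated_convergence[where w = "%y. indicator {a..b} y *\<^sub>R g y"])
  show "integrable lborel (%y. indicator {a..b} y *\<^sub>R g y)" using g by (simp add: set_integrable_def)
  show "AE y in lborel. (%i. indicat_real {a..b} y *\<^sub>R f (X (i + N)) y) \<longlonglongrightarrow> 0"
   using lim
  proof eventually_elim
   case (elim y)
   show ?case
   proof (cases "y \<in> {a..b}")
    case True
    then have "(%i. f (X i) y) \<longlonglongrightarrow> 0" using elim filterlim_compose[OF _ XF] by blast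
    from LIMSEQ_ignore_initial_segment[OF this, of N] show ?thesis using True by simp
   qed simp
  qed
  show "AE y in lborel. norm (indicat_real {a..b} y *\<^sub>R f (X (i + N)) y) <= indicat_real {a..b} y *\<^sub>R g y" for i
   using N[of "i + N"] by (auto simp: indicator_def intro!: AE_I2)
 qed (use m in auto)
 then have "(%i. LBINT y:{a..b}. f (X (i + N)) y) \<longlonglongrightarrow> 0"
  by (simp add: set_lebesgue_integral_def)
 then have "(%i. LBINT y:{a..b}. f (X i) y) \<longlonglongrightarrow> 0"
  by (rule LIMSEQ_offset[where k = N])
 then show "((%s. LBINT y:{a..b}. f s y) \<circ> X) \<longlonglongrightarrow> 0" by (simp add: o_def)
qed

lemma rectangle_Fubini_dominated:
 fixes F G :: "real => real => real"
 assumes F: "(%(t, xi). F t xi) \<in> borel2"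
  and G: "!!t. t \<in> {r..T} ==> lint {a..b} (G t)"
  and le: "!!t xi. t \<in> {r..T} ==> xi \<in> {a..b} ==> abs (F t xi) <= G t xi"
  and Q: "!!t. t \<in> {r..T} ==> (LBINT xi:{a..b}. G t xi) <= Q"
 shows "(LBINT t:{r..T}. LBINT xi:{a..b}. F t xi) = (LBINT xi:{a..b}. LBINT t:{r..T}. F t xi)"
  "lint {r..T} (%t. LBINT xi:{a..b}. F t xi)"
  "lint {a..b} (%xi. LBINT t:{r..T}. F t xi)"
  "t \<in> {r..T} ==> lint {a..b} (F t)"
proof -
 let ?g = "%t xi. indicator {r..T} t *\<^sub>R (indicator {a..b} xi *\<^sub>R F t xi)"
 have Fm: "(%x. F (f x) (g x)) \<in> borel_measurable M" if "f \<in> borel_measurable M" "g \<in> borel_measurable M" for f g and M :: "'c measure"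
  by (rule measurable_curried[OF F that])
 have gm: "case_prod ?g \<in> borel_measurable (lborel \<Otimes>\<^sub>M lborel)"
 proof -
  have [measurable]: "(%x. F (fst x) (snd x)) \<in> borel_measurable (lborel \<Otimes>\<^sub>M lborel)" by (rule Fm) measurable
  show ?thesis unfolding case_prod_beta by measurable
 qed
 show inner: "lint {a..b} (F t)" if "t \<in> {r..T}" for t
  by (rule set_integrable_le[OF G[OF that] _ _ le[OF that]]) (auto intro!: Fm)
 have bd: "(LBINT xi:{a..b}. abs (F t xi)) <= Q" if t: "t \<in> {r..T}" for t
  using set_integral_mono[OF set_integrable_abs[OF inner[OF t]] G[OF t] le[OF t]] Q[OF t] by linarith
 have gi: "integrable (lborel \<Otimes>\<^sub>M lborel) (case_prod ?g)"
 proof (rule lborel_pair.Fubini_integrable[OF gm])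
  have e: "(LBINT xi. norm (case_prod ?g (t, xi))) = indicator {r..T} t *\<^sub>R (LBINT xi:{a..b}. abs (F t xi))" for t
   by (auto simp: set_lebesgue_integral_def abs_mult indicator_def)
  have Im: "(%t. LBINT xi:{a..b}. abs (F t xi)) \<in> borel_measurable lborel"
  proof -
   have [measurable]: "(%x. F (fst x) (snd x)) \<in> borel_measurable (lborel \<Otimes>\<^sub>M lborel)" by (rule Fm) measurable
   show ?thesis unfolding set_lebesgue_integral_def
    by (rule lborel.borel_measurable_lebesgue_integral) (unfold case_prod_beta, measurable)
  qed
  have nn: "0 <= (LBINT xi:{a..b}. abs (F t xi))" for t
   unfolding set_lebesgue_integral_def by (rule integral_nonneg_AE) auto
  have "lint {r..T} (%t. LBINT xi:{a..b}. abs (F t xi))"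
   by (rule set_integrable_bounded[where B = Q]) (use Im bd nn in auto)
  then show "integrable lborel (%t. LBINT xi. norm (case_prod ?g (t, xi)))"
   unfolding e set_integrable_def .
  show "AE t in lborel. integrable lborel (%xi. case_prod ?g (t, xi))"
  proof (rule AE_I2)
   fix t show "integrable lborel (%xi. case_prod ?g (t, xi))"
    using inner[of t] by (cases "t \<in> {r..T}") (auto simp: set_integrable_def)
  qed
 qed
 have e1: "(LBINT xi. ?g t xi) = indicator {r..T} t *\<^sub>R (LBINT xi:{a..b}. F t xi)" for t
  by (simp add: set_lebesgue_integral_def)
 have e2: "(LBINT t. ?g t xi) = indicator {a..b} xi *\<^sub>R (LBINT t:{r..T}. F t xi)" for xi
 proof -
  have "(LBINT t. ?g t xi) = (LBINT t. indicator {a..b} xi *\<^sub>R (indicator {r..T} t *\<^sub>R F t xi))"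
   by (rule Bochner_Integration.integral_cong) auto
  then show ?thesis by (simp add: set_lebesgue_integral_def)
 qed
 show "(LBINT t:{r..T}. LBINT xi:{a..b}. F t xi) = (LBINT xi:{a..b}. LBINT t:{r..T}. F t xi)"
  using lborel_pair.Fubini_integral[OF gi] unfolding e1 e2 by (simp add: set_lebesgue_integral_def)
 show "lint {r..T} (%t. LBINT xi:{a..b}. F t xi)"
  using lborel_pair.integrable_fst'[OF gi] by (simp add: set_integrable_def set_lebesgue_integral_def)
 show "lint {a..b} (%xi. LBINT t:{r..T}. F t xi)"
  using lborel_pair.integrable_snd[OF gi] by (simp add: e2[unfolded real_scaleR_def] set_integrable_def)
qed

text \<open>The envelope contains the reflected point \<open>- xi - 2 t\<close> because the damping does.\<close>
lemma rectangle_Fubini: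
 fixes F :: "real => real => real" and q :: "real => real"
 assumes F: "(%(t, xi). F t xi) \<in> borel2"
  and q [measurable]: "q \<in> borel1" and q0: "!!y. 0 <= q y"
  and qi: "!!a b. lint {a..b} q"
  and le: "!!t xi. t \<in> {r..T} ==> xi \<in> {a..b} ==> abs (F t xi) <= C * (1 + q xi + q (- xi - 2 * t))" and C: "0 <= C"
 shows "(LBINT t:{r..T}. LBINT xi:{a..b}. F t xi) = (LBINT xi:{a..b}. LBINT t:{r..T}. F t xi)"
  "lint {r..T} (%t. LBINT xi:{a..b}. F t xi)"
  "lint {a..b} (%xi. LBINT t:{r..T}. F t xi)"
  "t \<in> {r..T} ==> lint {a..b} (F t)"
proof -
 have qs: "lint {a..b} (%xi. q (- xi - 2 * t))" for t
  using set_integral_reflect(2)[of a b "%y. q (y - 2 * t)"] set_integral_shift(2)[of "- b" "- a" q "- 2 * t"] qi by simp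
 have one: "lint {a..b} (%_. 1::real)" by (rule set_integrable_bounded[where B = 1]) auto
 note Gi = set_integral_add[OF set_integral_add(1)[OF one qi] qs]
 have G: "lint {a..b} (%xi. C * (1 + q xi + q (- xi - 2 * t)))" for t using Gi(1) by simp
 have Q: "(LBINT xi:{a..b}. C * (1 + q xi + q (- xi - 2 * t)))
   <= C * ((LBINT xi:{a..b}. 1 + q xi) + (LBINT y:{- b - 2 * T..- a - 2 * r}. q y))" if t: "t \<in> {r..T}" for t
 proof -
  have "(LBINT xi:{a..b}. C * (1 + q xi + q (- xi - 2 * t))) = C * ((LBINT xi:{a..b}. 1 + q xi) + (LBINT xi:{a..b}. q (- xi - 2 * t)))"
   using Gi(2) by simp
  also have "(LBINT xi:{a..b}. q (- xi - 2 * t)) = (LBINT y:{- b - 2 * t..- a - 2 * t}. q y)"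
   using set_integral_reflect(1)[of a b "%y. q (y - 2 * t)"] set_integral_shift(1)[of "- b" "- a" q "- 2 * t"] by simp
  also have "... <= (LBINT y:{- b - 2 * T..- a - 2 * r}. q y)"
   by (rule set_integral_subset_le[OF qi]) (use t q0 in auto)
  finally show ?thesis using C by (simp add: mult_left_mono)
 qed
 note R = rectangle_Fubini_dominated[OF F G le Q]
 show "(LBINT t:{r..T}. LBINT xi:{a..b}. F t xi) = (LBINT xi:{a..b}. LBINT t:{r..T}. F t xi)"
  "lint {r..T} (%t. LBINT xi:{a..b}. F t xi)"
  "lint {a..b} (%xi. LBINT t:{r..T}. F t xi)"
  "t \<in> {r..T} ==> lint {a..b} (F t)"
  by (rule R, assumption+)+
qed

lemma AE_not_integer_shift: "AE xi in lborel. xi + t \<notin> \<int>" for t :: real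
proof -
 have "countable ((%n. of_int n - t) ` UNIV)" by (rule countable_image) simp
 then have "(%n. of_int n - t) ` UNIV \<in> null_sets lborel" by (rule countable_imp_null_set_lborel)
 then have "AE xi in lborel. xi \<notin> (%n. of_int n - t) ` UNIV" by (rule AE_not_in)
 then show ?thesis
 proof (rule eventually_mono, intro notI)
  fix xi assume "xi \<notin> (%n. of_int n - t) ` UNIV" "xi + t \<in> \<int>"
  moreover from this obtain m :: int where "xi + t = of_int m" by (auto elim: Ints_cases)
  then have "xi = of_int m - t" by simp
  ultimately show False by blast
 qed
qed

lemma powr_const_le:
 assumes "0 <= x" "x <= B * m" "0 <= m" "p > (0::real)"
 shows "x powr p <= abs B powr p * m powr p"
proof -
 have "x <= abs B * m" using assms mult_right_mono[of B "abs B" m] by linarith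
 then have "x powr p <= (abs B * m) powr p" using assms by (intro powr_mono2) auto
 then show ?thesis by (simp add: powr_mult)
qed

text \<open>Separates the change of the function, handled by dominated convergence, from the displacement of
 its argument, handled by the continuity of translations in \<open>L\<^sup>p\<close>.\<close>
lemma moving_translate_continuous:
 fixes f :: "real => real => real"
 assumes p: "p > 0" and f [measurable]: "!!s. f s \<in> borel1" and s0: "s0 \<in> S" and ab: "a <= b"
  and G: "lint {l..h} G" and le: "!!s xi. s \<in> S ==> xi \<in> {l..h} ==> abs (f s xi) powr p <= G xi"
  and i0: "!!u v. lint {u..v} (%xi. abs (f s0 xi) powr p)"
  and lim: "AE xi in lborel. ((%s. f s xi) \<longlongrightarrow> f s0 xi) (at s0 within S)"
  and sg: "(sg \<longlongrightarrow> sg s0) (at s0 within S)" "!!s. s \<in> S ==> s \<noteq> s0 ==> sg s \<noteq> sg s0"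
  and win: "!!s. s \<in> S ==> l <= a + sg s \<and> b + sg s <= h"
 shows "((%s. LBINT y:{a..b}. abs (f s (y + sg s) - f s0 (y + sg s0)) powr p) \<longlongrightarrow> 0) (at s0 within S)"
proof -
 let ?F = "at s0 within S"
 let ?f1 = "%s xi. abs (f s xi - f s0 xi) powr p" and ?f2 = "%s y. abs (f s0 (y + (sg s - sg s0)) - f s0 y) powr p"
 let ?I1 = "%s. LBINT xi:{l..h}. ?f1 s xi" and ?I2 = "%s. LBINT y:{a + sg s0..b + sg s0}. ?f2 s y"
 have ev: "eventually (%s. s \<in> S) ?F" by (simp add: eventually_at_filter)
 have GG: "lint {l..h} (%xi. 3 powr p * (G xi + G xi))" by (intro set_integrable_mult_right set_integral_add(1) G)
 have dle: "?f1 s xi <= 3 powr p * (G xi + G xi)" if "s \<in> S" "xi \<in> {l..h}" for s xi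
  by (rule order_trans[OF powr_sum_le(2)[OF p] mult_left_mono[OF add_mono[OF le[OF that] le[OF s0 that(2)]]]]) simp
 have A1: "(?I1 \<longlongrightarrow> 0) ?F"
 proof (rule tendsto_set_integral_zero[OF _ GG])
  show "eventually (%s. \<forall>xi\<in>{l..h}. abs (?f1 s xi) <= 3 powr p * (G xi + G xi)) ?F"
   using ev by (rule eventually_mono) (use dle in auto)
  show "AE xi in lborel. xi \<in> {l..h} --> ((%s. ?f1 s xi) \<longlongrightarrow> 0) ?F"
   using lim by (rule eventually_mono) (auto intro!: tendsto_zero_powrI[OF tendsto_rabs_zero[OF LIM_zero] tendsto_const _ p])
 qed measurable
 have "((%s. LBINT y:{a + sg s0..b + sg s0}. abs (f s0 (y + s) - f s0 y) powr p) \<longlongrightarrow> 0) (at 0)"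
  by (rule translation_continuous_Lp[OF p f i0]) (use ab in simp)
 moreover have "filterlim (%s. sg s - sg s0) (at 0) ?F"
  unfolding filterlim_at using LIM_zero[OF sg(1)] sg(2) by (auto simp: eventually_at_filter)
 ultimately have A2: "(?I2 \<longlongrightarrow> 0) ?F" by (rule filterlim_compose)
 have lim: "((%s. 3 powr p * (?I1 s + ?I2 s)) \<longlongrightarrow> 0) ?F"
  using tendsto_mult_left[OF tendsto_add[OF A1 A2], of "3 powr p"] by simp
 show ?thesis
 proof (rule Lim_null_comparison[OF eventually_mono[OF ev] lim])
  fix s assume s: "s \<in> S"
  note w = win[OF s]
  have f1: "lint {l..h} (?f1 s)" by (rule set_integrable_le[OF GG]) (use dle[OF s] in auto)
  have zs: "lint {u..v} (%y. abs (f s0 (y + (sg s - sg s0))) powr p)" for u v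
   using set_integral_shift(2)[of u v "%y. abs (f s0 y) powr p" "sg s - sg s0"] i0 by simp
  have f2: "lint {u..v} (?f2 s)" for u v
   by (rule set_integrable_le[OF set_integrable_mult_right[OF set_integral_add(1)[OF zs i0], where a = "3 powr p"]])
     (use powr_sum_le(2)[OF p] in auto)
  have f1s: "lint {a..b} (%y. ?f1 s (y + sg s))" "(LBINT y:{a..b}. ?f1 s (y + sg s)) = (LBINT y:{a + sg s..b + sg s}. ?f1 s y)"
   using set_integral_shift[of a b "?f1 s" "sg s"] set_integrable_subset[OF f1, of "{a + sg s..b + sg s}"] w by simp_all
  have f2s: "lint {a..b} (%y. ?f2 s (y + sg s0))" "(LBINT y:{a..b}. ?f2 s (y + sg s0)) = ?I2 s"
   using set_integral_shift[of a b "?f2 s" "sg s0"] f2 by simp_all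
  have le: "abs (f s (y + sg s) - f s0 (y + sg s0)) powr p <= 3 powr p * (?f1 s (y + sg s) + ?f2 s (y + sg s0))" for y
   using powr_sum_le(1)[OF p, of "f s (y + sg s) - f s0 (y + sg s)" "f s0 (y + sg s) - f s0 (y + sg s0)"] by simp
  have si: "lint {a..b} (%y. 3 powr p * (?f1 s (y + sg s) + ?f2 s (y + sg s0)))"
   by (intro set_integrable_mult_right set_integral_add(1) f1s f2s)
  have i: "lint {a..b} (%y. abs (f s (y + sg s) - f s0 (y + sg s0)) powr p)"
   by (rule set_integrable_le[OF si]) (use le in auto)
  have "norm (LBINT y:{a..b}. abs (f s (y + sg s) - f s0 (y + sg s0)) powr p) = (LBINT y:{a..b}. abs (f s (y + sg s) - f s0 (y + sg s0)) powr p)"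
   unfolding real_norm_def by (rule abs_of_nonneg) (auto simp: set_lebesgue_integral_def intro: integral_nonneg_AE)
  also have "... <= (LBINT y:{a..b}. 3 powr p * (?f1 s (y + sg s) + ?f2 s (y + sg s0)))"
   by (rule set_integral_mono[OF i si le])
  also have "... = 3 powr p * ((LBINT y:{a + sg s..b + sg s}. ?f1 s y) + ?I2 s)"
   using set_integral_add(2)[OF f1s(1) f2s(1)] f1s(2) f2s(2) by simp
  also have "... <= 3 powr p * (?I1 s + ?I2 s)"
   by (intro mult_left_mono add_right_mono set_integral_subset_le[OF f1]) (use w in auto)
  finally show "norm (LBINT y:{a..b}. abs (f s (y + sg s) - f s0 (y + sg s0)) powr p) <= 3 powr p * (?I1 s + ?I2 s)" .
 qed
qed

context characteristics
begin

lemma envelope_integrable: "lint {a..b} (%xi. K * (1 + abs (h0 xi)) powr p)"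
proof -
 have i: "lint {a..b} (%xi. 3 powr p * (\<bar>1\<bar> powr p + \<bar>\<bar>h0 xi\<bar>\<bar> powr p))"
  by (intro set_integrable_mult_right set_integral_add(1) h0_powr_integrable[THEN set_integrable_cong[THEN iffD1, rotated -1]] set_integrable_bounded[where B = "abs (1::real) powr p"]) auto
 have "lint {a..b} (%xi. \<bar>1 + \<bar>h0 xi\<bar>\<bar> powr p)"
  by (rule set_integrable_le[OF i]) (use powr_sum_le(1)[of p 1 "abs (h0 _)"] p in auto)
 then show ?thesis by simp
qed

lemma z_slice_measurable [measurable (raw)]:
 assumes [measurable]: "f \<in> borel_measurable M" "g \<in> borel_measurable M"
 shows "(%x. z (f x) (g x)) \<in> borel_measurable M"
 by (rule measurable_curried[OF z_measurable]) measurable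

lemma k_slice_measurable [measurable (raw)]:
 assumes [measurable]: "f \<in> borel_measurable M" "g \<in> borel_measurable M"
 shows "(%x. k (f x) (g x)) \<in> borel_measurable M"
 by (rule dens_measurable[OF z_measurable]) measurable

lemma Zc_slice_measurable [measurable (raw)]:
 assumes "f \<in> borel_measurable M" "g \<in> borel_measurable M"
 shows "(%x. Zc n (f x) (g x)) \<in> borel_measurable M"
proof -
 have [measurable]: "(%q. entry n (f q)) \<in> borel_measurable N" if [measurable]: "f \<in> borel_measurable N" for f and N :: "'c measure"
  unfolding entry_def by measurable
 \<comment> \<open>An indicator of an interval with variable ends is measurable once it is written as a condition on all variables.\<close>
 have "(%q. (if entry n (snd (fst q)) <= snd q \<and> snd q <= fst (fst q) then 1 else 0) * k (snd q) (snd (fst q)))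
   \<in> borel_measurable ((borel \<Otimes>\<^sub>M borel) \<Otimes>\<^sub>M lborel)"
  by measurable
 moreover have "(%q. (if entry n (snd (fst q)) <= snd q \<and> snd q <= fst (fst q) then 1 else 0) * k (snd q) (snd (fst q)))
  = (%(q, s). indicator {entry n (snd q)..fst q} s *\<^sub>R k s (snd q))"
  by (auto simp: fun_eq_iff indicator_def)
 ultimately have "(%(q, s). indicator {entry n (snd q)..fst q} s *\<^sub>R k s (snd q))
   \<in> borel_measurable ((borel \<Otimes>\<^sub>M borel) \<Otimes>\<^sub>M lborel)" by simp
 from lborel.borel_measurable_lebesgue_integral[OF this]
 have [measurable]: "(%q. LBINT s:{entry n (snd q)..fst q}. k s (snd q)) \<in> borel2"
  by (simp add: set_lebesgue_integral_def)
 have "(%(t, xi). Zc n t xi) \<in> borel2"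
  unfolding Zc_def case_prod_beta by measurable
 then show ?thesis by (rule measurable_curried[OF _ assms])
qed

lemma Zc_continuous: "continuous_on {entry n xi..} (%t. Zc n t xi)"
proof -
 have "continuous (at t within {entry n xi..}) (%t. Zc n t xi)" if t: "t >= entry n xi" for t
 proof -
  have "continuous (at t within {entry n xi..t + 1}) (%t. Zc n t xi)"
   using primitive_on_continuous[OF Zc_primitive[of n xi "t + 1"]] t
   by (simp add: continuous_on_eq_continuous_within)
  moreover have "at t within {entry n xi..t + 1} = at t within {entry n xi..}"
   by (rule at_within_nhd[of _ "{..<t+1}"]) auto
  ultimately show ?thesis by simp
 qed
 then show ?thesis by (simp add: continuous_on_eq_continuous_within)
qed

text \<open>In time, \<open>z\<close> jumps only when the characteristic meets an integer; for a fixed time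
 this concerns countably many characteristics.\<close>
lemma z_continuous_off_jumps:
 assumes t0: "t0 >= 0" and xi: "xi + t0 \<notin> \<int>"
 shows "((%t. z t xi) \<longlongrightarrow> z t0 xi) (at t0 within {0..})"
proof -
 define n where "n = \<lfloor>xi + t0\<rfloor>"
 have n: "of_int n < xi + t0" "xi + t0 < of_int n + 1"
 proof -
  have "of_int n \<noteq> xi + t0" using xi by (metis Ints_of_int)
  then show "of_int n < xi + t0" unfolding n_def by linarith
 qed (simp add: n_def)
 let ?W = "{t. of_int n < xi + t \<and> xi + t < of_int n + 1}"
 have W: "open ?W" "t0 \<in> ?W"
  using n by (auto intro!: open_Collect_conj open_Collect_less continuous_intros)
 have eq: "at t0 within {0..} = at t0 within {entry n xi..}"
  by (rule at_within_nhd[OF W(2,1)]) (auto simp: entry_def)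
 have "((%t. Zc n t xi) \<longlongrightarrow> Zc n t0 xi) (at t0 within {entry n xi..})"
  using Zc_continuous[of n xi] t0 n unfolding continuous_on_def by (auto simp: entry_def)
 then have l: "((%t. Zc n t xi) \<longlongrightarrow> Zc n t0 xi) (at t0 within {0..})" using eq by simp
 have "eventually (%t. t \<in> ?W \<and> t >= 0) (at t0 within {0..})"
  using eventually_nhds_in_open[OF W] unfolding eventually_at_filter by (auto elim: eventually_mono)
 then have "eventually (%t. Zc n t xi = z t xi) (at t0 within {0..})"
  by (rule eventually_mono) (auto intro!: Zc_eq_z)
 from Lim_transform_eventually[OF l this] show ?thesis
  using Zc_eq_z[of t0 n xi] t0 n by simp
qed

lemma H_continuous:
 assumes t0: "t0 >= 0" and ab: "a <= b"
 shows "((%t. LBINT y:{a..b}. abs (z t (y - t) - z t0 (y - t0)) powr p) \<longlongrightarrow> 0) (at t0 within {0..})"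
proof -
 obtain B where B: "B >= 0" "!!t xi. 0 <= t ==> t <= t0 + 1 ==> abs (z t xi) <= B * (1 + abs (h0 xi))"
  using z_bound_exists by blast
 let ?G = "%xi. abs B powr p * (1 + abs (h0 xi)) powr p"
 have le: "abs (z t xi) powr p <= ?G xi" if "t \<in> {0..t0 + 1}" for t xi
  using powr_const_le[OF abs_ge_zero B(2)] that p by auto
 have nhd: "at t0 within {0..t0 + 1} = at t0 within {0..}" by (rule at_within_nhd[of _ "{..<t0 + 1}"]) auto
 have "((%t. LBINT y:{a..b}. abs (z t (y + - t) - z t0 (y + - t0)) powr p) \<longlongrightarrow> 0) (at t0 within {0..t0 + 1})"
 proof (rule moving_translate_continuous[where l = "a - (t0 + 1)" and h = b and G = ?G])
  show "lint {u..v} (%xi. abs (z t0 xi) powr p)" for u v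
   by (rule set_integrable_le[OF envelope_integrable[of u v "abs B powr p"]]) (use le t0 in auto)
  show "AE xi in lborel. ((%t. z t xi) \<longlongrightarrow> z t0 xi) (at t0 within {0..t0 + 1})"
   unfolding nhd using AE_not_integer_shift[of t0] by (rule eventually_mono) (rule z_continuous_off_jumps[OF t0])
 qed (use le t0 ab p envelope_integrable in \<open>auto intro!: tendsto_intros\<close>)
 then show ?thesis by (simp add: nhd)
qed

text \<open>Characteristics that reach \<open>y\<close> are labelled by their starting point, so that the
 trace at \<open>y\<close> becomes the translate of a function which depends continuously on \<open>y\<close>.
 A characteristic starting to the right of \<open>y\<close> never reaches it and contributes zero.\<close>
lemma trace_continuous:
 assumes y0: "y0 \<in> {of_int n..of_int n + 1}" and T: "0 <= T"
 shows "((%y. LBINT t:{0..T}. abs (Zc n t (y - t) - Zc n t (y0 - t)) powr p) \<longlongrightarrow> 0) (at y0 within {of_int n..of_int n + 1})"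
proof -
 let ?N = "of_int n :: real"
 let ?F = "at y0 within {?N..?N + 1}"
 define \<zeta> where "\<zeta> y xi = (if xi <= y then Zc n (y - xi) xi else 0)" for y xi
 have [measurable]: "\<zeta> y \<in> borel1" for y unfolding \<zeta>_def by measurable
 have en: "entry n xi <= y - xi" if "xi <= y" "?N <= y" for xi y using that by (auto simp: entry_def)
 have \<zeta>b: "\<exists>B\<ge>0. \<forall>y\<in>{?N..?N+1}. \<forall>xi\<ge>u. abs (\<zeta> y xi) <= B * (1 + abs (h0 xi))" for u
 proof -
  obtain B where B: "B >= 0" "!!m t xi. entry m xi <= t ==> t <= ?N + 1 - u ==> abs (Zc m t xi) <= B * (1 + abs (h0 xi))"
   by (rule k_bound_exists[of "?N + 1 - u"]) blast
  have "abs (\<zeta> y xi) <= B * (1 + abs (h0 xi))" if "y \<in> {?N..?N+1}" "xi >= u" for y xi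
   using B(2)[OF en, of xi y] that B(1) by (auto simp: \<zeta>_def)
  then show ?thesis using B(1) by blast
 qed
 have \<zeta>i: "lint {u..v} (%xi. abs (\<zeta> y xi) powr p)" if y: "y \<in> {?N..?N+1}" for u v y
 proof -
  obtain B where B: "B >= 0" "\<forall>y\<in>{?N..?N+1}. \<forall>xi\<ge>u. abs (\<zeta> y xi) <= B * (1 + abs (h0 xi))" using \<zeta>b by blast
  have "abs (\<zeta> y xi) powr p <= abs B powr p * (1 + abs (h0 xi)) powr p" if "xi \<in> {u..v}" for xi
   by (rule powr_const_le) (use B y p that in auto)
  then show ?thesis
   by (intro set_integrable_le[OF envelope_integrable[of u v "abs B powr p"]]) auto
 qed
 obtain B where B: "B >= 0" "!!y xi. y \<in> {?N..?N+1} ==> xi >= ?N - T ==> abs (\<zeta> y xi) <= B * (1 + abs (h0 xi))"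
  using \<zeta>b[of "?N - T"] by blast
 let ?G = "%xi. abs B powr p * (1 + abs (h0 xi)) powr p"
 have "((%y. LBINT s:{- T..0}. abs (\<zeta> y (s + y) - \<zeta> y0 (s + y0)) powr p) \<longlongrightarrow> 0) ?F"
 proof (rule moving_translate_continuous[where l = "?N - T" and h = "?N + 1" and G = ?G])
  show "abs (\<zeta> y xi) powr p <= ?G xi" if "y \<in> {?N..?N + 1}" "xi \<in> {?N - T..?N + 1}" for y xi
   by (rule powr_const_le) (use B that p in auto)
  show "AE xi in lborel. ((%y. \<zeta> y xi) \<longlongrightarrow> \<zeta> y0 xi) ?F"
   using AE_lborel_singleton[of y0]
  proof (rule eventually_mono)
   fix xi assume "xi \<noteq> y0"
   then consider "xi < y0" | "xi > y0" by linarith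
   then show "((%y. \<zeta> y xi) \<longlongrightarrow> \<zeta> y0 xi) ?F"
   proof cases
    case 1
    have c: "continuous_on {max ?N xi..} (%y. Zc n (y - xi) xi)"
     by (rule continuous_on_compose2[OF Zc_continuous[of n xi]]) (auto intro!: continuous_intros simp: entry_def)
    have "((%y. Zc n (y - xi) xi) \<longlongrightarrow> Zc n (y0 - xi) xi) (at y0 within {max ?N xi..})"
     using c 1 y0 unfolding continuous_on_def by auto
    moreover have "at y0 within {max ?N xi..?N+1} = at y0 within {?N..?N+1}"
     by (rule at_within_nhd[of _ "{xi<..}"]) (use 1 in auto)
    ultimately have "((%y. Zc n (y - xi) xi) \<longlongrightarrow> Zc n (y0 - xi) xi) ?F"
     by (metis tendsto_within_subset Icc_subset_Ici_iff order_refl)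
    moreover have "eventually (%y. Zc n (y - xi) xi = \<zeta> y xi) ?F"
     using eventually_nhds_in_open[of "{xi<..}" y0] 1 unfolding eventually_at_filter
     by (auto simp: \<zeta>_def elim!: eventually_mono)
    ultimately show ?thesis using 1 by (auto simp: \<zeta>_def[of y0] intro: Lim_transform_eventually)
   next
    case 2
    have "eventually (%y. 0 = \<zeta> y xi) ?F"
     using eventually_nhds_in_open[of "{..<xi}" y0] 2 unfolding eventually_at_filter
     by (auto simp: \<zeta>_def elim!: eventually_mono)
    then show ?thesis using 2 by (auto simp: \<zeta>_def[of y0] intro: Lim_transform_eventually[OF tendsto_const])
   qed
  qed
 qed (use y0 T p envelope_integrable \<zeta>i in \<open>auto intro!: tendsto_intros\<close>)
 moreover have "(LBINT s:{- T..0}. abs (\<zeta> y (s + y) - \<zeta> y0 (s + y0)) powr p) = (LBINT t:{0..T}. abs (Zc n t (y - t) - Zc n t (y0 - t)) powr p)" for y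
 proof -
  have "(LBINT t:{0..T}. abs (\<zeta> y (- t + y) - \<zeta> y0 (- t + y0)) powr p) = (LBINT t:{0..T}. abs (Zc n t (y - t) - Zc n t (y0 - t)) powr p)"
   by (rule set_lebesgue_integral_cong) (auto simp: \<zeta>_def)
  then show ?thesis using set_integral_reflect(1)[of 0 T "%s. abs (\<zeta> y (s + y) - \<zeta> y0 (s + y0)) powr p"] by simp
 qed
 ultimately show ?thesis by simp
qed

text \<open>As the test function vanishes outside the open cell, only the part of the characteristic inside
 the cell matters, and there \<open>z\<close> is absolutely continuous. The jumps at the integers are not
 seen.\<close>
lemma transport_along_characteristic:
 assumes D: "!!t. ((%t. phi t (xi + t)) has_real_derivative psi t (xi + t)) (at t)"
  and psic: "continuous_on UNIV (%t. psi t (xi + t))"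
  and out: "!!t y. y <= of_int n \<or> of_int n + 1 <= y ==> phi t y = 0 \<and> psi t y = 0" and T: "0 <= T"
 shows "z T xi * phi T (xi + T) - h0 xi * phi 0 xi = (LBINT t:{0..T}. z t xi * psi t (xi + t) + k t xi * phi t (xi + t))"
proof -
 let ?e = "entry n xi" and ?T = "min T (of_int n + 1 - xi)"
 let ?F = "%t. z t xi * psi t (xi + t) + k t xi * phi t (xi + t)"
 show ?thesis
 proof (cases "?e <= ?T")
  case True
  have P: "primitive_on ?e ?T (%t. k t xi * phi t (xi + t) + Zc n t xi * psi t (xi + t)) (%t. Zc n t xi * phi t (xi + t))"
   by (rule primitive_on_mult[OF Zc_primitive primitive_on_C1[OF D continuous_on_subset[OF psic]]]) auto
  have Z: "Zc n t xi = z t xi" if "t \<in> {?e..?T}" "xi + t \<noteq> of_int n + 1" for t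
   using that by (intro Zc_eq_z) (auto simp: entry_def)
  have "Zc n ?T xi * phi ?T (xi + ?T) = Zc n ?e xi * phi ?e (xi + ?e) + (LBINT t:{?e..?T}. k t xi * phi t (xi + t) + Zc n t xi * psi t (xi + t))"
   by (rule primitive_onD(2)[OF P True order_refl])
  moreover have "Zc n ?T xi * phi ?T (xi + ?T) = z T xi * phi T (xi + T)"
  proof (cases "T < of_int n + 1 - xi")
   case True
   then show ?thesis using Z[of T] \<open>?e <= ?T\<close> by (simp add: min_def)
  next
   case False
   then have "phi T (xi + T) = 0" "phi ?T (xi + ?T) = 0" using out by (auto simp: min_def)
   then show ?thesis by simp
  qed
  moreover have "Zc n ?e xi * phi ?e (xi + ?e) = h0 xi * phi 0 xi"
  proof (cases "?e = 0")
   case True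
   then show ?thesis by (simp add: Zc_def set_integral_singleton z_initial)
  next
   case False
   then have "?e = of_int n - xi" "xi <= of_int n" by (auto simp: entry_def split: if_splits)
   then have "phi ?e (xi + ?e) = 0" "phi 0 xi = 0" using out by auto
   then show ?thesis by simp
  qed
  moreover have "(LBINT t:{?e..?T}. k t xi * phi t (xi + t) + Zc n t xi * psi t (xi + t)) = (LBINT t:{0..T}. ?F t)"
   unfolding set_lebesgue_integral_def
  proof (rule integral_cong_space)
   fix t
   show "indicat_real {?e..?T} t *\<^sub>R (k t xi * phi t (xi + t) + Zc n t xi * psi t (xi + t)) = indicat_real {0..T} t *\<^sub>R ?F t"
   proof (cases "t \<in> {?e..?T} \<and> xi + t \<noteq> of_int n + 1")
    case True
    then have "t \<in> {0..T}" using entry_nonneg[of n xi] by auto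
    then show ?thesis using True Z[of t] by simp
   next
    case False
    have "t \<notin> {0..T} \<and> t \<notin> {?e..?T} \<or> (xi + t <= of_int n \<or> of_int n + 1 <= xi + t)"
     using False entry_nonneg[of n xi] by (auto simp: entry_def min_def max_def split: if_splits)
    then show ?thesis using out[of "xi + t" t] by auto
   qed
  qed
  ultimately show ?thesis by simp
 next
  case False
  have off: "xi + t <= of_int n \<or> of_int n + 1 <= xi + t" if "t \<in> {0..T}" for t
   using False that by (auto simp: entry_def min_def max_def split: if_splits)
  have "(LBINT t:{0..T}. ?F t) = (LBINT t:{0..T}. 0)"
   by (rule set_lebesgue_integral_cong) (use out off in auto)
  moreover have "phi T (xi + T) = 0" using out[of "xi + T" T] off[of T] T by simp
  moreover have "phi 0 xi = 0" using out[of xi 0] off[of 0] T by simp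
  ultimately show ?thesis by simp
 qed
qed

end

section \<open>Exponential decay\<close>

text \<open>The odd continuation of the power; \<open>p * signed_powr (p - 1)\<close> is the derivative of
 \<open>\<bar>x\<bar> powr p\<close>.\<close>
definition signed_powr :: "real => real => real" where
 "signed_powr q x = (max x 0) powr q - (max (- x) 0) powr q"

lemma signed_powr_nonneg: "x >= 0 ==> signed_powr q x = x powr q"
 and signed_powr_nonpos: "x <= 0 ==> signed_powr q x = - ((- x) powr q)"
 and abs_signed_powr: "abs (signed_powr q x) = abs x powr q"
 by (auto simp: signed_powr_def max_def abs_if)

lemma continuous_signed_powr: "q > 0 ==> continuous_on S (signed_powr q)"
 unfolding signed_powr_def
 by (intro continuous_on_diff continuous_on_powr' continuous_intros) auto

lemma DERIV_abs_powr:
 fixes x p :: real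
 assumes p: "p > 1"
 shows "((%x. abs x powr p) has_real_derivative p * signed_powr (p - 1) x) (at x)"
proof -
 consider "x > 0" | "x < 0" | "x = 0" by linarith
 then show ?thesis
 proof cases
  case 1
  have "((%x. x powr p) has_real_derivative p * x powr (p - 1)) (at x)"
   using has_real_derivative_powr[OF 1] .
  moreover have "eventually (%y. abs y powr p = y powr p) (nhds x)"
   using eventually_nhds_in_open[of "{0<..}" x] 1 by (auto elim!: eventually_mono)
  ultimately show ?thesis
   using 1 DERIV_cong_ev[of x x "%y. abs y powr p"] by (simp add: signed_powr_nonneg)
 next
  case 2
  have "((%x. (- x) powr p) has_real_derivative - (p * (- x) powr (p - 1))) (at x)"
   using DERIV_chain2[OF has_real_derivative_powr[of "- x" p] DERIV_minus[OF DERIV_ident]] 2 by simp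
  moreover have "eventually (%y. abs y powr p = (- y) powr p) (nhds x)"
   using eventually_nhds_in_open[of "{..<0}" x] 2 by (auto elim!: eventually_mono)
  ultimately show ?thesis
   using 2 DERIV_cong_ev[of x x "%y. abs y powr p"] by (simp add: signed_powr_nonpos)
 next
  case 3
  have "((%h. abs h powr (p - 1)) \<longlongrightarrow> 0) (at (0::real))"
   by (rule tendsto_zero_powrI[OF _ tendsto_const]) (use p in \<open>auto intro!: tendsto_rabs_zero\<close>)
  then have "((%h. (abs (0 + h) powr p - abs 0 powr p) / h) \<longlongrightarrow> 0) (at (0::real))"
  proof (rule Lim_null_comparison[rotated])
   show "\<forall>\<^sub>F h in at 0. norm ((abs (0 + h) powr p - abs 0 powr p) / h) <= abs h powr (p - 1)"
    using p by (auto simp: eventually_at_filter powr_diff intro!: always_eventually)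
  qed
  then show ?thesis using 3 by (simp add: DERIV_def signed_powr_def)
 qed
qed

definition cross_const :: "real => real" where
 "cross_const p = p * (1 / (p - 1) * exp (1 / (p - 1)))"

text \<open>The left side is positive only if the ratio \<open>a / h\<close> lies between \<open>1\<close> and
 \<open>(w2 / w1) powr (1 / (p - 1))\<close>. Then both factors are of order \<open>mu\<close>, which gives
 the square.\<close>
lemma cross_damping_aux:
 fixes a h w1 w2 p mu :: real
 assumes p: "p > 1" and w: "1 <= w1" "w1 <= 1 + mu" "1 <= w2" "w2 <= 1 + mu" and mu: "0 <= mu" "mu <= 1"
  and h: "0 <= h" "h <= a"
 shows "- ((a - h) * (w1 * a powr (p - 1) - w2 * h powr (p - 1))) <= 1 / (p - 1) * exp (1 / (p - 1)) * mu\<^sup>2 * h powr p"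
proof (cases "w1 * a powr (p - 1) >= w2 * h powr (p - 1)")
 case True
 have "0 <= 1 / (p - 1) * exp (1 / (p - 1)) * mu\<^sup>2 * h powr p" using p by simp
 moreover have "0 <= (a - h) * (w1 * a powr (p - 1) - w2 * h powr (p - 1))" using True h by simp
 ultimately show ?thesis by linarith
next
 case False
 define q where "q = p - 1"
 have q: "q > 0" using p by (simp add: q_def)
 have h0: "h > 0" using False h q w unfolding q_def[symmetric] by (cases "h = 0") auto
 have a0: "a > 0" using h h0 by simp
 have L: "w1 * a powr q < w2 * h powr q" using False by (simp add: q_def)
 have "a powr q <= w1 * a powr q" using mult_right_mono[OF w(1), of "a powr q"] by simp
 also have "... <= (1 + mu) * h powr q" using L w(4) mult_right_mono[OF w(4), of "h powr q"] by simp
 finally have "(a powr q) powr (1/q) <= ((1 + mu) * h powr q) powr (1/q)" by (intro powr_mono2) (use q in auto)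
 then have "a <= (1 + mu) powr (1/q) * h" using q a0 h0 mu by (simp add: powr_powr powr_mult)
 moreover have "(1 + mu) powr (1/q) <= 1 + mu * (1/q * exp (1/q))"
 proof -
  have "ln (1 + mu) <= mu" by (rule ln_add_one_self_le_self) (use mu in auto)
  then have "(1 + mu) powr (1/q) <= exp (mu / q)" using mu q by (simp add: powr_def divide_right_mono)
  also have "... <= 1 + mu / q * exp (mu / q)"
  proof -
   have "1 - mu / q <= exp (- (mu / q))" using exp_ge_add_one_self[of "- (mu / q)"] by simp
   then have "(1 - mu / q) * exp (mu / q) <= exp (- (mu / q)) * exp (mu / q)" by (rule mult_right_mono) simp
   then show ?thesis by (simp add: left_diff_distrib flip: exp_add)
  qed
  also have "... <= 1 + mu / q * exp (1 / q)"
   using mu q by (intro add_left_mono mult_left_mono) (auto simp: divide_right_mono)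
  finally show ?thesis by simp
 qed
 ultimately have "a <= (1 + mu * (1/q * exp (1/q))) * h" using h0 mult_right_mono by (meson less_imp_le order_trans)
 then have A: "a - h <= mu * (1/q * exp (1/q)) * h" by (simp add: distrib_right)
 have "h powr q <= a powr q" by (rule powr_mono2) (use q h in auto)
 then have "w1 * h powr q <= w1 * a powr q" using w by (intro mult_left_mono) auto
 moreover have "w2 * h powr q <= (w1 + mu) * h powr q" by (rule mult_right_mono) (use w in auto)
 ultimately have B: "w2 * h powr q - w1 * a powr q <= mu * h powr q" by (simp add: distrib_right)
 have "(a - h) * (w2 * h powr q - w1 * a powr q) <= (mu * (1/q * exp (1/q)) * h) * (mu * h powr q)"
  by (rule mult_mono[OF A B]) (use L mu q h in auto)
 also have "... = 1/q * exp (1/q) * mu\<^sup>2 * (h * h powr q)" by (simp add: power2_eq_square)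
 also have "h * h powr q = h powr p" using h0 by (simp add: q_def powr_diff)
 finally show ?thesis by (simp add: q_def algebra_simps)
qed

lemma cross_damping_opposite:
 fixes a h w1 w2 p mu :: real
 assumes p: "p > 1" and w: "1 <= w1" "w1 <= 1 + mu" "1 <= w2" "w2 <= 1 + mu" and mu: "0 <= mu" "mu <= 1"
  and h: "0 <= h" "0 <= a"
 shows "- ((a - h) * (p * (w1 * a powr (p - 1) - w2 * h powr (p - 1)))) <= cross_const p * mu\<^sup>2 * (a powr p + h powr p)"
proof -
 let ?L = "1 / (p - 1) * exp (1 / (p - 1)) * mu\<^sup>2"
 have L: "0 <= ?L" using p by simp
 have "- ((a - h) * (w1 * a powr (p - 1) - w2 * h powr (p - 1))) <= ?L * (a powr p + h powr p)"
 proof (cases "h <= a")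
  case True
  have "?L * h powr p <= ?L * (a powr p + h powr p)" by (rule mult_left_mono[OF _ L]) simp
  then show ?thesis using cross_damping_aux[OF p w mu h(1) True] by linarith
 next
  case False
  have "?L * a powr p <= ?L * (a powr p + h powr p)" by (rule mult_left_mono[OF _ L]) simp
  moreover have "- ((h - a) * (w2 * h powr (p - 1) - w1 * a powr (p - 1))) <= ?L * a powr p"
   using cross_damping_aux[OF p w(3,4,1,2) mu h(2)] False by simp
  ultimately show ?thesis by (simp add: algebra_simps)
 qed
 then have "p * (- ((a - h) * (w1 * a powr (p - 1) - w2 * h powr (p - 1)))) <= p * (?L * (a powr p + h powr p))"
  by (rule mult_left_mono) (use p in simp)
 then show ?thesis by (simp add: cross_const_def algebra_simps)
qed

text \<open>For equal weights the left side is not positive because \<open>signed_powr\<close> is odd and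
 increasing. Unequal weights matter only when \<open>a\<close> and \<open>b\<close> have opposite signs.\<close>
lemma cross_damping:
 fixes a b w1 w2 p mu :: real
 assumes p: "p > 1" and w: "1 <= w1" "w1 <= 1 + mu" "1 <= w2" "w2 <= 1 + mu" and mu: "0 <= mu" "mu <= 1"
 shows "- ((a + b) * (w1 * (p * signed_powr (p - 1) a) + w2 * (p * signed_powr (p - 1) b)))
  <= cross_const p * mu\<^sup>2 * (abs a powr p + abs b powr p)"
proof -
 have R: "0 <= cross_const p * mu\<^sup>2 * (abs a powr p + abs b powr p)"
  using p by (simp add: cross_const_def)
 consider "a >= 0" "b >= 0" | "a <= 0" "b <= 0" | "a >= 0" "b <= 0" | "a <= 0" "b >= 0" by linarith
 then show ?thesis
 proof cases
  case 1
  have "0 <= (a + b) * (w1 * (p * signed_powr (p - 1) a) + w2 * (p * signed_powr (p - 1) b))"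
   using 1 p w by (simp add: signed_powr_nonneg)
  then show ?thesis using R by linarith
 next
  case 2
  have "0 <= (- a - b) * (w1 * (p * (- a) powr (p - 1)) + w2 * (p * (- b) powr (p - 1)))"
   using 2 p w by simp
  then show ?thesis using R 2 by (simp add: signed_powr_nonpos algebra_simps)
 next
  case 3
  then show ?thesis using cross_damping_opposite[OF p w mu, of "- b" a]
   by (simp add: signed_powr_nonneg signed_powr_nonpos algebra_simps)
 next
  case 4
  then show ?thesis using cross_damping_opposite[OF p w(3,4,1,2) mu, of "- a" b]
   by (simp add: signed_powr_nonneg signed_powr_nonpos algebra_simps)
 qed
qed

context characteristics
begin

text \<open>The Lyapunov weight: it falls with slope \<open>- mu\<close> along the flow and jumps back to
 \<open>1 + mu\<close> at the integers.\<close>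
definition W :: "real => real => real" where
 "W mu y = 1 + mu * (of_int \<lfloor>y\<rfloor> + 1 - y)"

lemma W_bounds: "0 <= mu ==> 1 <= W mu y" "0 <= mu ==> W mu y <= 1 + mu"
proof -
 assume mu: "0 <= mu"
 have "0 <= of_int \<lfloor>y\<rfloor> + 1 - y" "of_int \<lfloor>y\<rfloor> + 1 - y <= 1" by linarith+
 then show "1 <= W mu y" "W mu y <= 1 + mu"
  using mu mult_left_mono[of "of_int \<lfloor>y\<rfloor> + 1 - y" 1 mu] by (simp_all add: W_def)
qed

lemma W_periodic: "W mu (y + 2) = W mu y"
proof -
 have "\<lfloor>y + 2\<rfloor> = \<lfloor>y\<rfloor> + 2" by linarith
 then show ?thesis by (simp add: W_def)
qed

lemma W_measurable [measurable]: "W mu \<in> borel1"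
 unfolding W_def by measurable

abbreviation pw :: "real => real" where "pw x \<equiv> p * signed_powr (p - 1) x"

lemma pw_measurable [measurable]: "signed_powr (p - 1) \<in> borel1"
 by (rule borel_measurable_continuous_onI[OF continuous_signed_powr]) (use p in simp)

text \<open>The time derivative of \<open>W \<bar>H\<bar>\<^sup>p\<close> along a characteristic inside a
 cell.\<close>
definition G :: "real => real => real => real" where
 "G mu s xi = - mu * abs (z s xi) powr p + W mu (xi + s) * (pw (z s xi) * k s xi)"

lemma cell_step:
 assumes r: "0 <= r" "r <= t" and n: "of_int n <= xi + r" "xi + r < of_int n + 1" "xi + t <= of_int n + 1"
 shows "lint {r..t} (%s. G mu s xi)"
  "(1 + mu * (of_int n + 1 - xi - t)) * abs (Zc n t xi) powr p = W mu (xi + r) * abs (z r xi) powr p + (LBINT s:{r..t}. G mu s xi)"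
proof -
 let ?om = "%s. 1 + mu * (of_int n + 1 - xi - s)"
 have e: "entry n xi <= r" using r n by (simp add: entry_def)
 have P: "primitive_on r t (%s. k s xi) (%s. Zc n s xi)"
  by (rule primitive_on_subset[OF Zc_primitive e r(2) order_refl])
 have P2: "primitive_on r t (%s. pw (Zc n s xi) * k s xi) (%s. abs (Zc n s xi) powr p)"
  by (rule primitive_on_chain[OF P DERIV_abs_powr[OF p]]) (intro continuous_intros continuous_signed_powr, use p in simp)
 have P1: "primitive_on r t (%s. - mu) ?om"
  by (rule primitive_on_C1) (auto intro!: derivative_eq_intros)
 note P3 = primitive_on_mult[OF P1 P2]
 have ae: "AE s in lborel. s \<in> {r..t} --> - mu * abs (Zc n s xi) powr p + ?om s * (pw (Zc n s xi) * k s xi) = G mu s xi"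
  using AE_lborel_singleton[of t]
 proof (rule eventually_mono, intro impI)
  fix s assume s: "s \<noteq> t" "s \<in> {r..t}"
  then have c: "of_int n <= xi + s" "xi + s < of_int n + 1" "0 <= s" using n r by auto
  then have "\<lfloor>xi + s\<rfloor> = n" by (intro floor_unique) auto
  then show "- mu * abs (Zc n s xi) powr p + ?om s * (pw (Zc n s xi) * k s xi) = G mu s xi"
   using Zc_eq_z[OF c(3,1,2)] by (simp add: G_def W_def algebra_simps)
 qed
 have m1: "(%s. - mu * abs (Zc n s xi) powr p + ?om s * (pw (Zc n s xi) * k s xi)) \<in> borel_measurable lborel" by measurable
 have m2: "(%s. G mu s xi) \<in> borel_measurable lborel" unfolding G_def by measurable
 show "lint {r..t} (%s. G mu s xi)"
  by (rule set_integrable_cong_AE[THEN iffD1, OF _ _ ae _ primitive_onD(1)[OF P3]])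
    (use m1 m2 in \<open>auto simp: set_borel_measurable_def\<close>)
 have "?om t * abs (Zc n t xi) powr p = ?om r * abs (Zc n r xi) powr p + (LBINT s:{r..t}. - mu * abs (Zc n s xi) powr p + ?om s * (pw (Zc n s xi) * k s xi))"
  by (rule primitive_onD(2)[OF P3 r(2) order_refl])
 also have "(LBINT s:{r..t}. - mu * abs (Zc n s xi) powr p + ?om s * (pw (Zc n s xi) * k s xi)) = (LBINT s:{r..t}. G mu s xi)"
  by (rule set_lebesgue_integral_cong_AE) (use m1 m2 ae in auto)
 also have "?om r = W mu (xi + r)"
 proof -
  have "\<lfloor>xi + r\<rfloor> = n" using n by (intro floor_unique) auto
  then show ?thesis by (simp add: W_def algebra_simps)
 qed
 also have "Zc n r xi = z r xi" by (rule Zc_eq_z) (use r n in auto)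
 finally show "(1 + mu * (of_int n + 1 - xi - t)) * abs (Zc n t xi) powr p = W mu (xi + r) * abs (z r xi) powr p + (LBINT s:{r..t}. G mu s xi)"
  by (simp add: algebra_simps)
qed

text \<open>Over a time shorter than one at most one integer is crossed, and there the product of the weight
 with \<open>\<bar>z\<bar>\<^sup>p\<close> cannot increase by the assumption on \<open>mu\<close> and
 \<open>c\<close>.\<close>
lemma lyapunov_along_characteristic:
 assumes r: "0 <= r" "r <= t" "t < r + 1" and mu: "0 <= mu" "(1 + mu) * abs c powr p <= 1"
 shows "W mu (xi + t) * abs (z t xi) powr p <= W mu (xi + r) * abs (z r xi) powr p + (LBINT s:{r..t}. G mu s xi)"
proof -
 define n where "n = \<lfloor>xi + r\<rfloor>"
 have n: "of_int n <= xi + r" "xi + r < of_int n + 1" unfolding n_def by linarith+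
 have within: "W mu (xi + t') * abs (z t' xi) powr p = W mu (xi + r') * abs (z r' xi) powr p + (LBINT s:{r'..t'}. G mu s xi)"
  if "0 <= r'" "r' <= t'" "of_int m <= xi + r'" "xi + t' < of_int m + 1" for m r' t'
 proof -
  have "\<lfloor>xi + t'\<rfloor> = m" using that by (intro floor_unique) auto
  then have "W mu (xi + t') = 1 + mu * (of_int m + 1 - xi - t')" by (simp add: W_def algebra_simps)
  moreover have "Zc m t' xi = z t' xi" by (rule Zc_eq_z) (use that in auto)
  ultimately show ?thesis using cell_step(2)[of r' t' m xi mu] that by simp
 qed
 show ?thesis
 proof (cases "xi + t < of_int n + 1")
  case True
  then show ?thesis using within[OF r(1,2) n(1)] by simp
 next
  case False
  define \<tau> where "\<tau> = of_int n + 1 - xi"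
  have \<tau>: "r < \<tau>" "\<tau> <= t" "xi + \<tau> = of_int n + 1" using n False by (auto simp: \<tau>_def)
  have f\<tau>: "\<lfloor>xi + \<tau>\<rfloor> = n + 1" using \<tau>(3) by (intro floor_unique) auto
  have W\<tau>: "W mu (xi + \<tau>) = 1 + mu" by (simp add: W_def f\<tau> \<tau>(3))
  have z\<tau>: "z \<tau> xi = c * Zc n \<tau> xi" by (rule Zc_jump) (use r \<tau> in auto)
  have "W mu (xi + \<tau>) * abs (z \<tau> xi) powr p = (1 + mu) * abs c powr p * abs (Zc n \<tau> xi) powr p"
   by (simp add: W\<tau> z\<tau> abs_mult powr_mult)
  also have "... <= 1 * abs (Zc n \<tau> xi) powr p" by (rule mult_right_mono[OF mu(2)]) simp
  also have "... = (1 + mu * (of_int n + 1 - xi - \<tau>)) * abs (Zc n \<tau> xi) powr p" by (simp add: \<tau>_def)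
  also have "... = W mu (xi + r) * abs (z r xi) powr p + (LBINT s:{r..\<tau>}. G mu s xi)"
   by (rule cell_step(2)) (use r n \<tau> in auto)
  finally have 1: "W mu (xi + \<tau>) * abs (z \<tau> xi) powr p <= W mu (xi + r) * abs (z r xi) powr p + (LBINT s:{r..\<tau>}. G mu s xi)" .
  have c: "xi + t < of_int (n + 1) + 1" "of_int (n + 1) <= xi + \<tau>" using r n \<tau> by auto
  have 2: "W mu (xi + t) * abs (z t xi) powr p = W mu (xi + \<tau>) * abs (z \<tau> xi) powr p + (LBINT s:{\<tau>..t}. G mu s xi)"
   by (rule within[OF _ \<tau>(2) c(2,1)]) (use r \<tau> in auto)
  have "lint {r..\<tau>} (%s. G mu s xi)"
   by (rule cell_step(1)) (use r n \<tau> in auto)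
  moreover have "lint {\<tau>..t} (%s. G mu s xi)"
   by (rule cell_step(1)[of _ _ "n + 1"]) (use r n \<tau> c in auto)
  ultimately have "lint ({r..\<tau>} \<union> {\<tau>..t}) (%s. G mu s xi)" by (rule set_integrable_Un) auto
  moreover have "{r..\<tau>} \<union> {\<tau>..t} = {r..t}" using \<tau> by auto
  ultimately have "(LBINT s:{r..t}. G mu s xi) = (LBINT s:{r..\<tau>}. G mu s xi) + (LBINT s:{\<tau>..t}. G mu s xi)"
   using set_integral_Icc_combine[of r t "%s. G mu s xi" \<tau>] \<tau> by simp
  then show ?thesis using 1 2 by simp
 qed
qed

lemma G_bound:
 assumes "0 <= mu" "mu <= 1"
 obtains C where "C >= 0" "!!s xi. 0 <= s ==> s <= T ==>
  abs (G mu s xi) <= C * (1 + abs (h0 xi) powr p + abs (h0 (- xi - 2 * s)) powr p)"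
proof -
 obtain B where B: "B >= 0" "!!t xi. 0 <= t ==> t <= T ==> abs (z t xi) <= B * (1 + abs (h0 xi))"
  "!!t xi. 0 <= t ==> t <= T ==> abs (k t xi) <= B * (2 + abs (h0 xi) + abs (h0 (- xi - 2 * t)))"
  by (rule k_bound_exists[of T]) blast
 define C where "C = (1 + 2 * p) * (abs B powr p * (3 powr p * 2 powr p))"
 show thesis
 proof (rule that[of C])
  show "C >= 0" using p by (simp add: C_def)
  fix s xi assume s: "0 <= s" "s <= T"
  define X where "X = B * (2 + abs (h0 xi) + abs (h0 (- xi - 2 * s)))"
  have "B * (1 + abs (h0 xi)) <= X" unfolding X_def by (rule mult_left_mono[OF _ B(1)]) simp
  then have zX: "abs (z s xi) <= X" using B(2)[OF s, of xi] by linarith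
  have kX: "abs (k s xi) <= X" using B(3)[OF s] by (simp add: X_def)
  have X0: "X >= 0" using zX by linarith
  have "abs (z s xi) powr (p - 1) * abs (k s xi) <= X powr (p - 1) * X"
   by (rule mult_mono[OF powr_mono2 kX]) (use p zX X0 in auto)
  also have "... = X powr p" using X0 by (cases "X = 0") (auto simp: powr_diff)
  finally have zk: "abs (z s xi) powr (p - 1) * abs (k s xi) <= X powr p" .
  have "\<bar>G mu s xi\<bar> <= \<bar>- mu * \<bar>z s xi\<bar> powr p\<bar> + \<bar>W mu (xi + s) * (pw (z s xi) * k s xi)\<bar>"
   unfolding G_def by (rule abs_triangle_ineq)
  also have "... = mu * abs (z s xi) powr p + W mu (xi + s) * (p * (abs (z s xi) powr (p - 1) * abs (k s xi)))"
   using assms W_bounds(1)[OF assms(1), of "xi + s"] p by (simp add: abs_mult abs_signed_powr)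
  also have "... <= 1 * X powr p + 2 * (p * X powr p)"
  proof (intro add_mono mult_mono)
   show "abs (z s xi) powr p <= X powr p" by (rule powr_mono2) (use p zX in auto)
   show "W mu (xi + s) <= 2" using W_bounds(2)[OF assms(1), of "xi + s"] assms by simp
  qed (use assms zk p in auto)
  also have "... = (1 + 2 * p) * X powr p" by (simp add: algebra_simps)
  also have "... <= C * (1 + abs (h0 xi) powr p + abs (h0 (- xi - 2 * s)) powr p)"
  proof -
   have "X powr p <= abs B powr p * (2 + abs (h0 xi) + abs (h0 (- xi - 2 * s))) powr p"
    by (rule powr_const_le[OF X0]) (use p in \<open>auto simp: X_def\<close>)
   also have "(2 + abs (h0 xi) + abs (h0 (- xi - 2 * s))) powr p <= 3 powr p * (2 powr p + abs (h0 xi) powr p + abs (h0 (- xi - 2 * s)) powr p)"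
    using powr_sum3_le[of p 2 "abs (h0 xi)" "abs (h0 (- xi - 2 * s))"] p by simp
   also have "2 powr p + abs (h0 xi) powr p + abs (h0 (- xi - 2 * s)) powr p <= 2 powr p * (1 + abs (h0 xi) powr p + abs (h0 (- xi - 2 * s)) powr p)"
   proof -
    have 2: "1 <= (2::real) powr p" using p by (simp add: ge_one_powr_ge_zero)
    have "x <= 2 powr p * x" if "x >= 0" for x :: real using mult_right_mono[OF 2 that] by simp
    from this[of "abs (h0 xi) powr p"] this[of "abs (h0 (- xi - 2 * s)) powr p"] show ?thesis
     by (simp add: distrib_left)
   qed
   finally have "X powr p <= abs B powr p * (3 powr p * (2 powr p * (1 + abs (h0 xi) powr p + abs (h0 (- xi - 2 * s)) powr p)))"
    by (simp add: mult_left_mono)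
   then have "(1 + 2 * p) * X powr p <= (1 + 2 * p) * (abs B powr p * (3 powr p * (2 powr p * (1 + abs (h0 xi) powr p + abs (h0 (- xi - 2 * s)) powr p))))"
    by (rule mult_left_mono) (use p in simp)
   then show ?thesis by (simp add: C_def mult.assoc)
  qed
  finally show "abs (G mu s xi) <= C * (1 + abs (h0 xi) powr p + abs (h0 (- xi - 2 * s)) powr p)" .
 qed
qed

lemma z_powr_integrable:
 assumes "0 <= t"
 shows "lint {a..b} (%xi. abs (z t xi) powr p)"
proof -
 obtain B where B: "B >= 0" "!!s xi. 0 <= s ==> s <= t ==> abs (z s xi) <= B * (1 + abs (h0 xi))"
  by (rule z_bound_exists[of t]) blast
 have le: "abs (z t xi) powr p <= abs B powr p * (1 + abs (h0 xi)) powr p" for xi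
  by (rule powr_const_le) (use B assms p in auto)
 show ?thesis
  by (rule set_integrable_le[OF envelope_integrable[of a b "abs B powr p"]]) (use le in auto)
qed

definition V :: "real => real => real" where
 "V mu t = (LBINT xi:{0..2}. W mu (xi + t) * abs (z t xi) powr p)"

lemma Wz_integrable:
 assumes "0 <= t" "0 <= mu" "mu <= 1"
 shows "lint {a..b} (%xi. W mu (xi + t) * abs (z t xi) powr p)"
proof (rule set_integrable_le[OF set_integrable_mult_right[OF z_powr_integrable[OF assms(1)], where a = 2]])
 have "abs (W mu y) <= 2" for y using W_bounds[OF assms(2), of y] assms(3) by (simp add: abs_le_iff)
 then show "\<bar>W mu (xi + t) * \<bar>z t xi\<bar> powr p\<bar> <= 2 * \<bar>z t xi\<bar> powr p" for xi by (simp add: abs_mult mult_right_mono)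
qed auto

text \<open>Since the coefficient is even, averaging the damping term over \<open>y\<close> and \<open>- y\<close> produces the expression of \<open>cross_damping\<close>; its error of order
 \<open>mu\<^sup>2\<close> is absorbed by the loss of order \<open>mu\<close>.\<close>
lemma G_integral_le:
 assumes s: "0 <= s" and mu: "0 <= mu" "mu <= 1" "A * cross_const p * mu <= 1"
 shows "(LBINT xi:{0..2}. G mu s xi) <= - (mu / 4) * V mu s"
proof -
 define H where "H y = z s (y - s)" for y
 have Hper: "H (y + 2) = H y" for y using z_periodic[of s "y - s"] by (simp add: H_def algebra_simps)
 define F where "F y = - mu * abs (H y) powr p + W mu y * (pw (H y) * (- (1/2) * \<alpha> s y * (H y + H (- y))))" for y
 have Hper': "H (- y - 2) = H (- y)" for y using Hper[of "- y - 2"] by simp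
 have Fper: "F (y + 2) = F y" for y by (simp add: F_def Hper Hper' W_periodic \<alpha>_periodic)
 have GF: "G mu s xi = F (xi + s)" for xi
  by (simp add: G_def F_def H_def dens_def algebra_simps)
 obtain C where C: "C >= 0" "!!s' xi. 0 <= s' ==> s' <= s ==> abs (G mu s' xi) <= C * (1 + abs (h0 xi) powr p + abs (h0 (- xi - 2 * s')) powr p)"
  using G_bound[OF mu(1,2)] by blast
 have Gm: "(%(s, xi). G mu s xi) \<in> borel2"
  unfolding G_def case_prod_beta by measurable
 have Gi: "lint {a..b} (G mu s)" for a b
  by (rule rectangle_Fubini(4)[OF Gm, of "%y. abs (h0 y) powr p" s s a b C])
    (use C s h0_powr_integrable in auto)
 have Fi: "lint {a..b} F" for a b
  using set_integral_shift(2)[of "a - s" "b - s" F s] Gi[of "a - s" "b - s"] by (simp add: GF[symmetric])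
 have Fri: "lint {a..b} (%y. F (- y))" for a b
  using set_integral_reflect(2)[of a b F] Fi by simp
 have Hi: "lint {a..b} (%y. abs (H y) powr p)" for a b
  using set_integral_shift(2)[of a b "%xi. abs (z s xi) powr p" "- s"] z_powr_integrable[OF s] by (simp add: H_def)
 have Hri: "lint {a..b} (%y. abs (H (- y)) powr p)" for a b
  using set_integral_reflect(2)[of a b "%y. abs (H y) powr p"] Hi by simp
 have refl: "(LBINT y:{0..2}. f (- y)) = (LBINT y:{0..2}. f y)"
  if "!!y. f (y + 2) = f y" "lint {0..2} f" for f :: "real => real"
  using set_integral_reflect(1)[of 0 2 f] periodic_set_integral[of f, OF that, of "- 2"] by simp
 have "(LBINT xi:{0..2}. G mu s xi) = (LBINT y:{s..s + 2}. F y)"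
  using set_integral_shift(1)[of 0 2 F s] by (simp add: GF add.commute)
 also have "... = (LBINT y:{0..2}. F y)" by (rule periodic_set_integral[of F, OF Fper Fi])
 finally have GI: "2 * (LBINT xi:{0..2}. G mu s xi) = (LBINT y:{0..2}. F y + F (- y))"
  using refl[OF Fper Fi] set_integral_add(2)[OF Fi Fri] by simp
 have pt: "F y + F (- y) <= - (mu / 2) * (abs (H y) powr p + abs (H (- y)) powr p)" for y
 proof -
  define S where "S = abs (H y) powr p + abs (H (- y)) powr p"
  have S: "S >= 0" by (simp add: S_def)
  define X where "X = - ((H y + H (- y)) * (W mu y * pw (H y) + W mu (- y) * pw (H (- y))))"
  have "X <= cross_const p * mu\<^sup>2 * S" unfolding X_def S_def
   by (rule cross_damping[OF p]) (use W_bounds[OF mu(1)] mu in auto)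
  then have "\<alpha> s y / 2 * X <= \<alpha> s y / 2 * (cross_const p * mu\<^sup>2 * S)" by (rule mult_left_mono) (use \<alpha>_nonneg in simp)
  also have "... <= A / 2 * (cross_const p * mu\<^sup>2 * S)"
   by (rule mult_right_mono) (use \<alpha>_le p S in \<open>auto simp: cross_const_def\<close>)
  also have "... = (A * cross_const p * mu) * (mu / 2 * S)" by (simp add: power2_eq_square)
  also have "... <= 1 * (mu / 2 * S)" by (rule mult_right_mono[OF mu(3)]) (use mu S in simp)
  finally have "\<alpha> s y / 2 * X <= mu / 2 * S" by simp
  moreover have "F y + F (- y) = - mu * S + \<alpha> s y / 2 * X"
   by (simp add: F_def S_def X_def \<alpha>_even algebra_simps add_divide_distrib)
  ultimately show ?thesis by (simp add: S_def[symmetric])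
 qed
 have "(LBINT y:{0..2}. F y + F (- y)) <= (LBINT y:{0..2}. - (mu / 2) * (abs (H y) powr p + abs (H (- y)) powr p))"
  by (intro set_integral_mono set_integral_add(1) Fi Fri set_integrable_mult_right Hi Hri pt)
 also have "... = - (mu / 2) * ((LBINT y:{0..2}. abs (H y) powr p) + (LBINT y:{0..2}. abs (H (- y)) powr p))"
  by (subst set_integral_mult_right, subst set_integral_add(2)[OF Hi Hri]) simp
 also have "(LBINT y:{0..2}. abs (H (- y)) powr p) = (LBINT y:{0..2}. abs (H y) powr p)"
  by (rule refl[of "%y. abs (H y) powr p"]) (use Hper Hi in auto)
 finally have a: "(LBINT xi:{0..2}. G mu s xi) <= - (mu / 2) * (LBINT y:{0..2}. abs (H y) powr p)"
  using GI by simp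
 have "V mu s <= (LBINT xi:{0..2}. 2 * abs (z s xi) powr p)"
  unfolding V_def
  by (rule set_integral_mono[OF Wz_integrable[OF s mu(1,2)] set_integrable_mult_right[OF z_powr_integrable[OF s]]])
    (use W_bounds(2)[OF mu(1)] mu in \<open>auto intro!: mult_right_mono order_trans[OF W_bounds(2)[OF mu(1)]]\<close>)
 also have "... = 2 * (LBINT xi:{0..2}. abs (z s xi) powr p)" by simp
 also have "(LBINT xi:{0..2}. abs (z s xi) powr p) = (LBINT y:{0..2}. abs (H y) powr p)"
  using set_integral_shift(1)[of 0 2 "%y. abs (H y) powr p" s] periodic_set_integral[of "%y. abs (H y) powr p", OF _ Hi, of s] Hper
  by (simp add: H_def add.commute)
 finally have "mu / 4 * V mu s <= mu / 4 * (2 * (LBINT y:{0..2}. abs (H y) powr p))"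
  by (rule mult_left_mono) (use mu in simp)
 then show ?thesis using a by simp
qed

lemma V_step:
 assumes r: "0 <= r" "r <= t" "t < r + 1"
  and mu: "0 <= mu" "mu <= 1" "A * cross_const p * mu <= 1" "(1 + mu) * abs c powr p <= 1"
 shows "V mu t <= V mu r + (LBINT s:{r..t}. LBINT xi:{0..2}. G mu s xi)"
  "lint {r..t} (%s. LBINT xi:{0..2}. G mu s xi)"
proof -
 obtain C where C: "C >= 0" "!!s' xi. 0 <= s' ==> s' <= t ==> abs (G mu s' xi) <= C * (1 + abs (h0 xi) powr p + abs (h0 (- xi - 2 * s')) powr p)"
  using G_bound[OF mu(1,2)] by blast
 have Gm: "(%(s, xi). G mu s xi) \<in> borel2"
  unfolding G_def case_prod_beta by measurable
 have le: "!!s xi. s \<in> {r..t} ==> xi \<in> {0..2} ==> abs (G mu s xi) <= C * (1 + abs (h0 xi) powr p + abs (h0 (- xi - 2 * s)) powr p)"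
  using C(2) r by auto
 have q: "(%y. abs (h0 y) powr p) \<in> borel1" by measurable
 note R = rectangle_Fubini[OF Gm q _ h0_powr_integrable le C(1)]
 show "lint {r..t} (%s. LBINT xi:{0..2}. G mu s xi)" by (rule R(2)) auto
 have i3: "lint {0..2} (%xi. LBINT s:{r..t}. G mu s xi)" by (rule R(3)) auto
 have t0: "0 <= t" using r by simp
 note ir = Wz_integrable[OF r(1) mu(1,2), of 0 2] and it = Wz_integrable[OF t0 mu(1,2), of 0 2]
 have "V mu t <= (LBINT xi:{0..2}. W mu (xi + r) * abs (z r xi) powr p + (LBINT s:{r..t}. G mu s xi))"
  unfolding V_def
  by (rule set_integral_mono[OF it set_integral_add(1)[OF ir i3]]) (rule lyapunov_along_characteristic[OF r mu(1,4)])
 also have "... = V mu r + (LBINT xi:{0..2}. LBINT s:{r..t}. G mu s xi)"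
  by (simp add: set_integral_add(2)[OF ir i3] V_def)
 also have "(LBINT xi:{0..2}. LBINT s:{r..t}. G mu s xi) = (LBINT s:{r..t}. LBINT xi:{0..2}. G mu s xi)"
  by (rule R(1)[symmetric]) auto
 finally show "V mu t <= V mu r + (LBINT s:{r..t}. LBINT xi:{0..2}. G mu s xi)" .
qed

lemma V_nonneg: "0 <= mu ==> 0 <= V mu t"
 unfolding V_def set_lebesgue_integral_def
 by (intro integral_nonneg_AE AE_I2 scaleR_nonneg_nonneg mult_nonneg_nonneg order_trans[OF zero_le_one W_bounds(1)]) auto

lemma V_contraction:
 assumes r: "0 <= r" "r <= t" "t < r + 1"
  and mu: "0 <= mu" "mu <= 1" "A * cross_const p * mu <= 1" "(1 + mu) * abs c powr p <= 1"
 shows "(1 + mu / 4 * (t - r)) * V mu t <= V mu r"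
proof -
 have mono: "V mu t <= V mu s" if s: "s \<in> {r..t}" for s
 proof -
  have s': "0 <= s" "s <= t" "t < s + 1" using s r by auto
  have "(LBINT s:{s..t}. LBINT xi:{0..2}. G mu s xi) <= (LBINT s:{s..t}. 0)"
  proof (rule set_integral_mono[OF V_step(2)[OF s' mu]])
   fix x assume "x \<in> {s..t}"
   then have "(LBINT xi:{0..2}. G mu x xi) <= - (mu / 4) * V mu x" using G_integral_le[of x mu] s' mu by simp
   also have "... <= 0" using mu V_nonneg[OF mu(1), of x] by simp
   finally show "(LBINT xi:{0..2}. G mu x xi) <= 0" .
  qed (simp add: set_integrable_def)
  then show ?thesis using V_step(1)[OF s' mu] by simp
 qed
 have "(LBINT s:{r..t}. LBINT xi:{0..2}. G mu s xi) <= (LBINT s:{r..t}. - (mu / 4) * V mu t)"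
 proof (rule set_integral_mono[OF V_step(2)[OF r mu]])
  show "lint {r..t} (%s. - (mu / 4) * V mu t)"
   by (rule set_integrable_bounded[where B = "abs (- (mu / 4) * V mu t)"]) auto
  fix s assume s: "s \<in> {r..t}"
  have "(LBINT xi:{0..2}. G mu s xi) <= - (mu / 4) * V mu s" using G_integral_le[of s mu] s r mu by simp
  also have "... <= - (mu / 4) * V mu t" using mono[OF s] mu by (intro mult_left_mono_neg) auto
  finally show "(LBINT xi:{0..2}. G mu s xi) <= - (mu / 4) * V mu t" .
 qed
 also have "... = - (mu / 4 * (t - r)) * V mu t" using r by (simp add: set_lebesgue_integral_def)
 finally show ?thesis using V_step(1)[OF r mu] by (simp add: algebra_simps)
qed

text \<open>The contraction is iterated over time steps of length one half. The constant collects the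
 comparison of \<open>V\<close> with the unweighted integral (a factor \<open>1 + mu \<le> 2\<close>) and the
 incomplete last step (again at most \<open>2\<close>).\<close>
lemma energy_decay:
 assumes t: "0 <= t"
  and mu: "0 <= mu" "mu <= 1" "A * cross_const p * mu <= 1" "(1 + mu) * abs c powr p <= 1"
 shows "(LBINT y:{0..2}. abs (z t (y - t)) powr p)
  <= 4 * exp (- (2 * ln (1 + mu / 8)) * t) * (LBINT y:{0..2}. abs (h0 y) powr p)"
proof -
 \<comment> \<open>The factor gained in a time step of length one half.\<close>
 define q where "q = 1 + mu / 8"
 have q: "q >= 1" "q <= 2" using mu by (auto simp: q_def)
 have steps: "q ^ n * V mu (real n / 2) <= V mu 0" for n
 proof (induction n)
  case (Suc n)
  have "(1 + mu / 4 * (real (Suc n) / 2 - real n / 2)) * V mu (real (Suc n) / 2) <= V mu (real n / 2)"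
   by (rule V_contraction[OF _ _ _ mu]) (auto simp: field_simps)
  then have "q * V mu (real (Suc n) / 2) <= V mu (real n / 2)" by (simp add: q_def add_divide_distrib)
  then have "q ^ n * (q * V mu (real (Suc n) / 2)) <= q ^ n * V mu (real n / 2)" by (rule mult_left_mono) (use q in simp)
  then show ?case using Suc by (simp add: ac_simps)
 qed simp
 define n where "n = nat \<lfloor>2 * t\<rfloor>"
 have n: "real n <= 2 * t" "2 * t < real n + 1" using t unfolding n_def by linarith+
 have "(1 + mu / 4 * (t - real n / 2)) * V mu t <= V mu (real n / 2)"
  by (rule V_contraction[OF _ _ _ mu]) (use n in auto)
 moreover have "1 * V mu t <= (1 + mu / 4 * (t - real n / 2)) * V mu t"
  by (rule mult_right_mono[OF _ V_nonneg[OF mu(1)]]) (use n mu in auto)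
 ultimately have "V mu t <= V mu (real n / 2)" by simp
 then have "q ^ n * V mu t <= q ^ n * V mu (real n / 2)" by (rule mult_left_mono) (use q in simp)
 with steps[of n] have "q ^ n * V mu t <= V mu 0" by linarith
 moreover have "q powr (2 * t - 1) <= q ^ n"
  using powr_mono[of "2 * t - 1" "real n" q] n q by (simp add: powr_realpow)
 then have "q powr (2 * t - 1) * V mu t <= q ^ n * V mu t" by (rule mult_right_mono[OF _ V_nonneg[OF mu(1)]])
 ultimately have "q powr (2 * t - 1) * V mu t <= V mu 0" by linarith
 then have "q powr (1 - 2 * t) * (q powr (2 * t - 1) * V mu t) <= q powr (1 - 2 * t) * V mu 0" by (rule mult_left_mono) simp
 then have Vt: "V mu t <= q powr (1 - 2 * t) * V mu 0" using q by (simp add: mult.assoc[symmetric] flip: powr_add)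
 have qe: "q powr (1 - 2 * t) = q * exp (- (2 * ln (1 + mu / 8)) * t)"
 proof -
  have "q powr (1 - 2 * t) = q powr 1 * q powr (- (2 * t))" using powr_add[of q 1 "- (2 * t)"] by simp
  also have "q powr (- (2 * t)) = exp (- (2 * ln q) * t)" using q by (simp add: powr_def mult.commute mult.left_commute)
  finally show ?thesis using q by (simp add: q_def)
 qed
 have "(LBINT y:{0..2}. abs (z t (y - t)) powr p) = (LBINT y:{- t..- t + 2}. abs (z t y) powr p)"
  using set_integral_shift(1)[of 0 2 "%y. abs (z t y) powr p" "- t"] by (simp add: add.commute)
 also have "... = (LBINT y:{0..2}. abs (z t y) powr p)"
  by (rule periodic_set_integral[of "%y. abs (z t y) powr p"]) (simp add: z_periodic, rule z_powr_integrable[OF t])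
 also have "... <= V mu t" unfolding V_def
  by (rule set_integral_mono[OF z_powr_integrable[OF t] Wz_integrable[OF t mu(1,2)]])
    (use mult_right_mono[OF W_bounds(1)[OF mu(1)]] in fastforce)
 also have "... <= q powr (1 - 2 * t) * V mu 0" by (rule Vt)
 also have "... <= (2 * exp (- (2 * ln (1 + mu / 8)) * t)) * (2 * (LBINT y:{0..2}. abs (h0 y) powr p))"
 proof (rule mult_mono)
  show "q powr (1 - 2 * t) <= 2 * exp (- (2 * ln (1 + mu / 8)) * t)" unfolding qe using q by (intro mult_right_mono) auto
  have "V mu 0 <= (LBINT xi:{0..2}. 2 * abs (z 0 xi) powr p)"
   unfolding V_def
   by (rule set_integral_mono[OF Wz_integrable[OF order_refl mu(1,2)] set_integrable_mult_right[OF z_powr_integrable[OF order_refl]]])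
     (use W_bounds(2)[OF mu(1)] mu in \<open>auto intro!: mult_right_mono order_trans[OF W_bounds(2)[OF mu(1)]]\<close>)
  then show "V mu 0 <= 2 * (LBINT y:{0..2}. abs (h0 y) powr p)" by (simp add: z_initial)
 qed (use V_nonneg[OF mu(1)] in auto)
 finally show ?thesis by simp
qed

end

section \<open>Curves of functions and their representatives\<close>

lemma measurable_lebesgue_on_AE:
 fixes f g :: "'a::euclidean_space => real"
 assumes "f \<in> borel_measurable (lebesgue_on S)" "AE x in lebesgue_on S. f x = g x" "S \<in> sets lebesgue"
 shows "g \<in> borel_measurable (lebesgue_on S)"
proof -
 have 1: "(%x. if x \<in> S then f x else 0) \<in> borel_measurable lebesgue" using borel_measurable_if[OF assms(3)] assms(1) by blast
 have "AE x in lborel. x \<in> S --> f x = g x" using assms(2,3) by (simp add: AE_lebesgue_on_iff)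
 then have "AE x in lebesgue. (if x \<in> S then f x else 0) = (if x \<in> S then g x else 0)"
  unfolding AE_completion_iff by (rule eventually_mono) simp
 then have "(%x. if x \<in> S then g x else 0) \<in> borel_measurable lebesgue" by (rule borel_measurable_AE[OF 1])
 then show ?thesis using borel_measurable_if[OF assms(3)] by blast
qed

lemma integral_lebesgue_on_cong_AE:
 fixes f g :: "'a::euclidean_space => real"
 assumes "f \<in> borel_measurable (lebesgue_on S)" "AE x in lebesgue_on S. f x = g x" "S \<in> sets lebesgue"
 shows "integral\<^sup>L (lebesgue_on S) g = integral\<^sup>L (lebesgue_on S) f"
 by (rule integral_cong_AE) (use assms measurable_lebesgue_on_AE[OF assms] in \<open>auto elim: eventually_mono\<close>)

lemma lborel_Ioo_Icc:
 fixes f :: "real => real"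
 assumes [measurable]: "f \<in> borel1"
 shows "(LINT x|leb a b. f x) = (LBINT x:{a..b}. f x)"
  "integrable (leb a b) f \<longleftrightarrow> lint {a..b} f"
proof -
 have ae: "AE x in lborel. indicator {a<..<b} x *\<^sub>R f x = indicator {a..b} x *\<^sub>R f x"
  using AE_lborel_singleton[of a] AE_lborel_singleton[of b] by eventually_elim (auto simp: indicator_def)
 have S: "{a<..<b} \<in> sets borel" by simp
 show "(LINT x|leb a b. f x) = (LBINT x:{a..b}. f x)"
  unfolding lebesgue_on_borel(3)[OF assms S] set_lebesgue_integral_def by (rule integral_cong_AE[OF _ _ ae]) auto
 show "integrable (leb a b) f \<longleftrightarrow> lint {a..b} f"
  unfolding lebesgue_on_borel(2)[OF assms S] set_integrable_def by (rule integrable_cong_AE[OF _ _ ae]) auto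
qed

lemma finite_measure_Ioo: "finite_measure (lebesgue_on {a<..<b::real})"
 by (rule finite_measure_lebesgue_on) simp

lemma Lp_limit_unique:
 fixes F :: "real => 'a::euclidean_space => real"
 assumes p: "p > 0" and v: "v \<in> Lp p \<Omega>" and w: "w \<in> Lp p \<Omega>"
  and F: "eventually (%s. F s \<in> Lp p \<Omega>) G" and G: "G \<noteq> bot"
  and lv: "((%s. Lp_norm p \<Omega> (%x. F s x - v x)) \<longlongrightarrow> 0) G"
  and lw: "((%s. Lp_norm p \<Omega> (%x. F s x - w x)) \<longlongrightarrow> 0) G"
 shows "AE x in lebesgue_on \<Omega>. v x = w x"
proof -
 let ?M = "lebesgue_on \<Omega>"
 let ?I = "%f. LINT x|?M. abs (f x) powr p"
 have d: "(%x. v x - w x) \<in> Lp p \<Omega>" by (rule Lp_diff[OF p v w])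
 have "((%s. 3 powr p * (?I (%x. F s x - v x) + ?I (%x. F s x - w x))) \<longlongrightarrow> 3 powr p * (0 + 0)) G"
  using lv lw unfolding Lp_norm_tendsto_0_iff[OF p] by (intro tendsto_intros)
 then have lim: "((%s. 3 powr p * (?I (%x. F s x - v x) + ?I (%x. F s x - w x))) \<longlongrightarrow> 0) G" by simp
 have "eventually (%s. ?I (%x. v x - w x) <= 3 powr p * (?I (%x. F s x - v x) + ?I (%x. F s x - w x))) G"
  using F
 proof eventually_elim
  case (elim s)
  note a = LpD(2)[OF Lp_diff[OF p elim v]] and b = LpD(2)[OF Lp_diff[OF p elim w]]
  have "?I (%x. v x - w x) <= (LINT x|?M. 3 powr p * (abs (F s x - v x) powr p + abs (F s x - w x) powr p))"
  proof (rule integral_mono[OF LpD(2)[OF d]])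
   show "integrable ?M (%x. 3 powr p * (abs (F s x - v x) powr p + abs (F s x - w x) powr p))" using a b by simp
   show "abs (v x - w x) powr p <= 3 powr p * (abs (F s x - v x) powr p + abs (F s x - w x) powr p)" for x
    using powr_sum_le(2)[OF p, of "F s x - w x" "F s x - v x"] by (simp add: add.commute)
  qed
  also have "... = 3 powr p * (?I (%x. F s x - v x) + ?I (%x. F s x - w x))" using a b by simp
  finally show ?case .
 qed
 then have "?I (%x. v x - w x) <= 0" using tendsto_lowerbound[OF lim _ G] by blast
 moreover have "?I (%x. v x - w x) >= 0" by (rule integral_nonneg_AE) simp
 ultimately have "?I (%x. v x - w x) = 0" by simp
 then have "AE x in ?M. abs (v x - w x) powr p = 0"
  using integral_nonneg_eq_0_iff_AE[OF LpD(2)[OF d]] by simp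
 then show ?thesis by (rule eventually_mono) simp
qed

lemma trivial_limit_within_Ici: "at (t::real) within {0..} \<noteq> bot" if "t >= 0"
proof -
 have "at_right t <= at t within {0..}" by (rule at_le) (use that in auto)
 then show ?thesis by (metis bot.extremum_uniqueI trivial_limit_at_right_real)
qed

text \<open>The derivative chosen in the definition of \<open>curve_deriv\<close> can be replaced by any
 explicit one, by uniqueness of \<open>L\<^sup>p\<close> limits.\<close>
lemma curve_deriv_AE:
 fixes F :: "real => real => real"
 assumes p: "p > 0" and F: "!!t. t >= 0 ==> F t \<in> Lp p \<Omega>" and t: "t >= 0"
  and d: "has_curve_deriv {0..} (Lp p \<Omega>) (Lp_norm p \<Omega>) F v t"
 shows "has_curve_deriv {0..} (Lp p \<Omega>) (Lp_norm p \<Omega>) F (curve_deriv {0..} (Lp p \<Omega>) (Lp_norm p \<Omega>) F t) t"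
  "AE x in lebesgue_on \<Omega>. v x = curve_deriv {0..} (Lp p \<Omega>) (Lp_norm p \<Omega>) F t x"
proof -
 let ?w = "curve_deriv {0..} (Lp p \<Omega>) (Lp_norm p \<Omega>) F t"
 show w: "has_curve_deriv {0..} (Lp p \<Omega>) (Lp_norm p \<Omega>) F ?w t"
  using someI[of "%v. has_curve_deriv {0..} (Lp p \<Omega>) (Lp_norm p \<Omega>) F v t" v] d by (simp add: curve_deriv_def)
 show "AE x in lebesgue_on \<Omega>. v x = ?w x"
 proof (rule Lp_limit_unique[OF p, where F = "%s x. (F s x - F t x) / (s - t)" and G = "at t within {0..}"])
  have "eventually (%s. s \<in> {0..}) (at t within {0..})" by (simp add: eventually_at_filter)
  then show "eventually (%s. (%x. (F s x - F t x) / (s - t)) \<in> Lp p \<Omega>) (at t within {0..})"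
  proof (rule eventually_mono)
   fix s :: real assume "s \<in> {0..}"
   then show "(%x. (F s x - F t x) / (s - t)) \<in> Lp p \<Omega>"
    using Lp_cmult[OF Lp_diff[OF p F F[OF t]], of s "1 / (s - t)"] by simp
  qed
  show "at t within {0..} \<noteq> bot" by (rule trivial_limit_within_Ici[OF t])
 qed (use d w in \<open>simp_all add: has_curve_deriv_def\<close>)
qed

lemma C0_curve_AE_cong:
 fixes F :: "real => 'a::euclidean_space => real"
 assumes p: "p > 0" and F: "F \<in> C0_curve J (Lp p \<Omega>) (Lp_norm p \<Omega>)" and \<Omega>: "\<Omega> \<in> sets lebesgue"
  and eq: "!!t. t \<in> J ==> AE x in lebesgue_on \<Omega>. F t x = G t x"
 shows "G \<in> C0_curve J (Lp p \<Omega>) (Lp_norm p \<Omega>)"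
 unfolding C0_curve_def
proof (intro CollectI conjI ballI)
 have FLp: "F t \<in> Lp p \<Omega>" if "t \<in> J" for t using F that by (auto simp: C0_curve_def)
 show GLp: "G t \<in> Lp p \<Omega>" if "t \<in> J" for t
  using Lp_AE_cong[OF FLp[OF that] eq[OF that] measurable_lebesgue_on_AE[OF LpD(1)[OF FLp[OF that]] eq[OF that] \<Omega>]] .
 fix t assume t: "t \<in> J"
 have "((%s. Lp_norm p \<Omega> (%x. F s x - F t x)) \<longlongrightarrow> 0) (at t within J)" using F t by (auto simp: C0_curve_def)
 moreover have "eventually (%s. s \<in> J) (at t within J)" by (simp add: eventually_at_filter)
 then have "eventually (%s. Lp_norm p \<Omega> (%x. F s x - F t x) = Lp_norm p \<Omega> (%x. G s x - G t x)) (at t within J)"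
 proof (rule eventually_mono)
  fix s assume s: "s \<in> J"
  have "AE x in lebesgue_on \<Omega>. F s x - F t x = G s x - G t x"
   using eq[OF s] eq[OF t] by eventually_elim simp
  then show "Lp_norm p \<Omega> (%x. F s x - F t x) = Lp_norm p \<Omega> (%x. G s x - G t x)"
   by (rule Lp_norm_AE_cong) (intro borel_measurable_diff LpD(1)[OF FLp] LpD(1)[OF GLp] s t)+
 qed
 ultimately show "((%s. Lp_norm p \<Omega> (%x. G s x - G t x)) \<longlongrightarrow> 0) (at t within J)"
  by (rule Lim_transform_eventually)
qed

lemma Lp_imp_L1_loc:
 assumes p: "p >= 1" and g: "g \<in> Lp p {a<..<b::real}"
 shows "g \<in> L1_loc {a<..<b}"
proof -
 interpret finite_measure "leb a b" by (rule finite_measure_Ioo)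
 have i: "integrable (leb a b) g" by (rule integrable_of_powr[OF p LpD[OF g]])
 show ?thesis unfolding L1_loc_def
 proof (intro CollectI allI impI)
  fix K :: "real set" assume K: "compact K \<and> K \<subseteq> {a<..<b}"
  then have "K \<in> sets lebesgue" by (simp add: lmeasurable_compact fmeasurableD)
  then show "integrable (lebesgue_on K) g" using integrable_lebesgue_on_subset[OF i] K by simp
 qed
qed

lemma test_function_deriv:
 assumes "phi \<in> test_functions {a<..<b::real}"
 shows "deriv phi \<in> test_functions {a<..<b}" "(phi has_real_derivative deriv phi x) (at x)"
  "continuous_on UNIV phi" "continuous_on UNIV (deriv phi)"
  "x \<notin> {a<..<b} ==> phi x = 0" "x \<notin> {a<..<b} ==> deriv phi x = 0"
proof -
 obtain K where K: "smooth phi" "compact K" "K \<subseteq> {a<..<b}" "!!z. z \<notin> K ==> phi z = 0"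
  by (rule test_functionsE[OF assms]) (rule that)
 have d0: "deriv phi x = 0" if "x \<notin> K" for x
 proof -
  have "eventually (%y. y \<in> - K) (nhds x)"
   by (rule eventually_nhds_in_open) (use K(2) that compact_imp_closed open_Compl in auto)
  then have "eventually (%y. phi y = 0) (nhds x)" by (rule eventually_mono) (use K(4) in auto)
  then have "deriv phi x = deriv (%_. 0) x" by (rule deriv_cong_ev) simp
  then show ?thesis by simp
 qed
 show T: "deriv phi \<in> test_functions {a<..<b}"
  by (rule test_functionsI[OF smooth_real_deriv(2)[OF K(1)] K(2,3) d0])
 show "(phi has_real_derivative deriv phi x) (at x)" by (rule smooth_real_deriv(1)[OF K(1)])
 show "continuous_on UNIV phi" "continuous_on UNIV (deriv phi)"
  using smoothD(2)[OF K(1)] smoothD(2)[OF smooth_real_deriv(2)[OF K(1)]] by auto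
 show "x \<notin> {a<..<b} ==> phi x = 0" using K(3,4) by blast
 show "x \<notin> {a<..<b} ==> deriv phi x = 0" using K(3) d0 by blast
qed

lemma weak_deriv_unique:
 assumes g: "g \<in> L1_loc {a<..<b}" "is_weak_deriv {a<..<b} f g" and h: "h \<in> L1_loc {a<..<b}" "is_weak_deriv {a<..<b} f h"
  and ab: "a < b"
 shows "AE x in leb a b. g x = h x"
proof -
 have gh: "(%x. g x - h x) \<in> L1_loc {a<..<b}" using g(1) h(1) by (auto simp: L1_loc_def)
 have "AE x in leb a b. g x - h x = 0"
 proof (rule weakly_zero_imp_AE_zero[OF ab gh])
  fix phi assume phi: "phi \<in> test_functions {a<..<b}"
  have "(LINT x|leb a b. (g x - h x) * phi x) = (LINT x|leb a b. g x * phi x) - (LINT x|leb a b. h x * phi x)"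
   by (simp add: left_diff_distrib L1_loc_mult_test[OF g(1) phi] L1_loc_mult_test[OF h(1) phi])
  then show "(LINT x|leb a b. (g x - h x) * phi x) = 0"
   using g(2) h(2) phi by (simp add: is_weak_deriv_def)
 qed
 then show ?thesis by (rule eventually_mono) simp
qed

text \<open>As weak derivatives are unique, every explicit one in \<open>L\<^sup>p\<close> represents the chosen one.\<close>
lemma weak_deriv_AE:
 assumes p: "p >= 1" and g: "g \<in> Lp p {a<..<b}" "is_weak_deriv {a<..<b} f g" and ab: "a < b"
 shows "AE x in leb a b. g x = weak_deriv {a<..<b} f x"
  "weak_deriv {a<..<b} f \<in> Lp p {a<..<b}" "is_weak_deriv {a<..<b} f (weak_deriv {a<..<b} f)"
proof -
 have gl: "g \<in> L1_loc {a<..<b}" by (rule Lp_imp_L1_loc[OF p g(1)])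
 have w: "weak_deriv {a<..<b} f \<in> L1_loc {a<..<b} \<and> is_weak_deriv {a<..<b} f (weak_deriv {a<..<b} f)"
  unfolding weak_deriv_def by (rule someI[where x = g]) (use gl g in auto)
 show ae: "AE x in leb a b. g x = weak_deriv {a<..<b} f x"
  by (rule weak_deriv_unique[OF gl g(2) _ _ ab]) (use w in auto)
 show "weak_deriv {a<..<b} f \<in> Lp p {a<..<b}"
  by (rule Lp_AE_cong[OF g(1) ae measurable_lebesgue_on_AE[OF LpD(1)[OF g(1)] ae]]) simp
 show "is_weak_deriv {a<..<b} f (weak_deriv {a<..<b} f)" using w by simp
qed

lemma integrable_mult_continuous:
 fixes f phi :: "real => real"
 assumes f: "integrable (leb a b) f" and phi: "continuous_on {a..b} phi"
 shows "integrable (leb a b) (%x. f x * phi x)"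
proof -
 obtain B where B: "!!x. x \<in> {a..b} ==> abs (phi x) <= B"
  using compact_imp_bounded[OF compact_continuous_image[OF phi compact_Icc]]
  unfolding bounded_iff by (metis imageI real_norm_def)
 have m: "phi \<in> borel_measurable (leb a b)"
  by (rule continuous_imp_measurable_on_sets_lebesgue[OF continuous_on_subset[OF phi]]) auto
 show ?thesis
 proof (rule Bochner_Integration.integrable_bound[OF integrable_mult_right[OF f, of B]])
  show "(%x. f x * phi x) \<in> borel_measurable (leb a b)" using f m by (intro borel_measurable_times) auto
  show "AE x in leb a b. norm (f x * phi x) <= norm (B * f x)"
  proof (rule AE_I2)
   fix x assume "x \<in> space (leb a b)"
   then have "abs (phi x) <= abs B" using B[of x] by simp
   then have "abs (phi x) * abs (f x) <= abs B * abs (f x)" by (rule mult_right_mono) simp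
   then show "norm (f x * phi x) <= norm (B * f x)" by (simp add: abs_mult mult.commute)
  qed
 qed
qed

lemma signed_powr_mono: "q > 0 ==> x <= y ==> signed_powr q x <= signed_powr q y"
 unfolding signed_powr_def by (intro diff_mono powr_mono2) auto

text \<open>Convexity of the power, in the form of its tangent line; integrating it with \<open>m\<close> the
 mean value gives Jensen's inequality.\<close>
lemma abs_powr_above_tangent:
 fixes x m p :: real
 assumes p: "p > 1"
 shows "abs m powr p + p * signed_powr (p - 1) m * (x - m) <= abs x powr p"
proof -
 consider "x = m" | "x < m" | "m < x" by linarith
 then show ?thesis
 proof cases
  case 2
  have "\<exists>\<xi>. x < \<xi> \<and> \<xi> < m \<and> abs m powr p - abs x powr p = (m - x) * (p * signed_powr (p - 1) \<xi>)"
   by (rule MVT2[OF 2]) (rule DERIV_abs_powr[OF p])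
  then obtain \<xi> where \<xi>: "x < \<xi>" "\<xi> < m" "abs m powr p - abs x powr p = (m - x) * (p * signed_powr (p - 1) \<xi>)" by blast
  have "(m - x) * (p * signed_powr (p - 1) \<xi>) <= (m - x) * (p * signed_powr (p - 1) m)"
   using signed_powr_mono[of "p - 1" \<xi> m] \<xi> p by (intro mult_left_mono) auto
  then show ?thesis using \<xi>(3) by (simp add: algebra_simps)
 next
  case 3
  have "\<exists>\<xi>. m < \<xi> \<and> \<xi> < x \<and> abs x powr p - abs m powr p = (x - m) * (p * signed_powr (p - 1) \<xi>)"
   by (rule MVT2[OF 3]) (rule DERIV_abs_powr[OF p])
  then obtain \<xi> where \<xi>: "m < \<xi>" "\<xi> < x" "abs x powr p - abs m powr p = (x - m) * (p * signed_powr (p - 1) \<xi>)" by blast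
  have "(x - m) * (p * signed_powr (p - 1) m) <= (x - m) * (p * signed_powr (p - 1) \<xi>)"
   using signed_powr_mono[of "p - 1" m \<xi>] \<xi> p by (intro mult_left_mono) auto
  then show ?thesis using \<xi>(3) by (simp add: algebra_simps)
 qed simp
qed

lemma Jensen_powr:
 fixes X :: "real => real"
 assumes p: "p > 1" and ab: "a < b" and X: "lint {a..b} X" "lint {a..b} (%x. abs (X x) powr p)"
 shows "abs ((LBINT x:{a..b}. X x) / (b - a)) powr p <= (LBINT x:{a..b}. abs (X x) powr p) / (b - a)"
proof -
 define m where "m = (LBINT x:{a..b}. X x) / (b - a)"
 define c where "c = abs m powr p - p * signed_powr (p - 1) m * m"
 have ci: "lint {a..b} (%_. c)" by (rule set_integrable_bounded[where B = "abs c"]) auto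
 have Xi: "lint {a..b} (%x. p * signed_powr (p - 1) m * X x)" using X(1) by (rule set_integrable_mult_right)
 have "(LBINT x:{a..b}. c + p * signed_powr (p - 1) m * X x) <= (LBINT x:{a..b}. abs (X x) powr p)"
 proof (rule set_integral_mono[OF set_integral_add(1)[OF ci Xi] X(2)])
  fix x show "c + p * signed_powr (p - 1) m * X x <= abs (X x) powr p"
   using abs_powr_above_tangent[OF p, of m "X x"] by (simp add: c_def algebra_simps)
 qed
 moreover have "(LBINT x:{a..b}. c + p * signed_powr (p - 1) m * X x) = (b - a) * abs m powr p"
 proof -
  have "(LBINT x:{a..b}. c + p * signed_powr (p - 1) m * X x) = (b - a) * c + p * signed_powr (p - 1) m * (LBINT x:{a..b}. X x)"
   using set_integral_add(2)[OF ci Xi] ab by (simp add: set_lebesgue_integral_def)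
  also have "(LBINT x:{a..b}. X x) = (b - a) * m" using ab by (simp add: m_def)
  finally show ?thesis by (simp add: c_def algebra_simps)
 qed
 ultimately show ?thesis using ab by (simp add: m_def[symmetric] field_simps)
qed

section \<open>Displacement and transport identities\<close>

context characteristics
begin

lemma set_integral_support:
 fixes F :: "real => real"
 assumes "!!y. y \<notin> {u..v} ==> F y = 0" "{u..v} \<subseteq> {a..b}"
 shows "(LBINT y:{a..b}. F y) = (LBINT y:{u..v}. F y)"
 unfolding set_lebesgue_integral_def
 by (rule integral_cong_space) (use assms in \<open>auto simp: indicator_def\<close>)

text \<open>The identity along single characteristics, integrated over their labels; a substitution and
 Fubini's theorem turn it into a distributional equation in one cell.\<close>
lemma transport_identity:
 assumes phic: "continuous_on UNIV (%(t, y). phi t y)" and psic: "continuous_on UNIV (%(t, y). psi t y)"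
  and D: "!!xi t. ((%t. phi t (xi + t)) has_real_derivative psi t (xi + t)) (at t)"
  and out_all: "\<forall>t y. y <= of_int n \<or> of_int n + 1 <= y --> phi t y = 0 \<and> psi t y = 0" and T: "0 <= T"
 shows "(LBINT y:{of_int n..of_int n + 1}. z T (y - T) * phi T y) - (LBINT y:{of_int n..of_int n + 1}. h0 y * phi 0 y)
  = (LBINT t:{0..T}. LBINT y:{of_int n..of_int n + 1}. z t (y - t) * psi t y + k t (y - t) * phi t y)"
  "lint {0..T} (%t. LBINT y:{of_int n..of_int n + 1}. z t (y - t) * psi t y + k t (y - t) * phi t y)"
proof -
 let ?N = "of_int n :: real"
 let ?a = "?N - T" and ?b = "?N + 1"
 have out: "phi t y = 0 \<and> psi t y = 0" if "y <= of_int n \<or> of_int n + 1 <= y" for t y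
  using out_all that by blast
 define F where "F t xi = z t xi * psi t (xi + t) + k t xi * phi t (xi + t)" for t xi
 have bnd: "\<exists>B\<ge>0. \<forall>t\<in>{0..T}. \<forall>y. abs (f t y) <= B" if fc: "continuous_on UNIV (%(t, y). f t y)"
  and f0: "!!t y. y <= ?N \<or> ?N + 1 <= y ==> f t y = 0" for f :: "real => real => real"
 proof -
  have "compact ((%(t, y). f t y) ` ({0..T} \<times> {?N..?N+1}))"
   by (rule compact_continuous_image[OF continuous_on_subset[OF fc]]) (auto intro: compact_Times)
  then obtain B where B: "\<forall>x\<in>(%(t, y). f t y) ` ({0..T} \<times> {?N..?N+1}). norm x <= B" using compact_imp_bounded bounded_iff by metis
  have "abs (f t y) <= abs B" if "t \<in> {0..T}" for t y
  proof (cases "y \<in> {?N..?N+1}")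
   case True
   then have "f t y \<in> (%(t, y). f t y) ` ({0..T} \<times> {?N..?N+1})" using that by force
   then show ?thesis using B by force
  qed (use f0[of y t] in auto)
  then show ?thesis by (intro exI[of _ "abs B"]) auto
 qed
 obtain B1 where B1: "B1 >= 0" "!!t y. t \<in> {0..T} ==> abs (phi t y) <= B1" using bnd[OF phic] out by blast
 obtain B2 where B2: "B2 >= 0" "!!t y. t \<in> {0..T} ==> abs (psi t y) <= B2" using bnd[OF psic] out by blast
 obtain B where B: "B >= 0" "!!t xi. 0 <= t ==> t <= T ==> abs (z t xi) <= B * (1 + abs (h0 xi))"
  "!!t xi. 0 <= t ==> t <= T ==> abs (k t xi) <= B * (2 + abs (h0 xi) + abs (h0 (- xi - 2 * t)))"
  by (rule k_bound_exists[of T]) blast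
 have m2: "(%x. f (g x) (h x)) \<in> borel_measurable M" if "continuous_on UNIV (%(t, y). f t y)" "g \<in> borel_measurable M" "h \<in> borel_measurable M"
  for f :: "real => real => real" and g h and M :: "'c measure"
  by (rule measurable_curried[OF _ that(2,3)]) (use borel_measurable_continuous_onI[OF that(1)] in \<open>simp add: borel_prod\<close>)
 note [measurable] = m2[OF phic] m2[OF psic]
 have Fm: "(%(t, xi). F t xi) \<in> borel2"
  unfolding F_def case_prod_beta by measurable
 have Fle: "abs (F t xi) <= (2 * B * (B1 + B2)) * (1 + abs (h0 xi) + abs (h0 (- xi - 2 * t)))" if t: "t \<in> {0..T}" for t xi
 proof -
  let ?S = "1 + abs (h0 xi) + abs (h0 (- xi - 2 * t))"
  have "1 + abs (h0 xi) <= 2 * ?S" "2 + abs (h0 xi) + abs (h0 (- xi - 2 * t)) <= 2 * ?S" by simp_all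
  note S = this[THEN mult_left_mono[OF _ B(1)]]
  have "abs (z t xi) <= B * (2 * ?S)" using order_trans[OF B(2) S(1)] t by simp
  then have "abs (z t xi * psi t (xi + t)) <= (B * (2 * ?S)) * B2"
   unfolding abs_mult by (rule mult_mono[OF _ B2(2)[OF t]]) (use B(1) in auto)
  moreover have "abs (k t xi) <= B * (2 * ?S)" using order_trans[OF B(3) S(2)] t by simp
  then have "abs (k t xi * phi t (xi + t)) <= (B * (2 * ?S)) * B1"
   unfolding abs_mult by (rule mult_mono[OF _ B1(2)[OF t]]) (use B(1) in auto)
  ultimately have "abs (F t xi) <= (B * (2 * ?S)) * B2 + (B * (2 * ?S)) * B1" unfolding F_def by linarith
  then show ?thesis by (simp add: algebra_simps)
 qed
 have C: "0 <= 2 * B * (B1 + B2)" using B B1 B2 by simp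
 note R = rectangle_Fubini[OF Fm _ _ h0_abs_integrable Fle C, of 0 T ?a ?b]
 have shift: "(LBINT xi:{?a..?b}. f (xi + t)) = (LBINT y:{?N..?N + 1}. f y)"
  if "t \<in> {0..T}" "!!y. y \<notin> {?N..?N+1} ==> f y = 0" for f :: "real => real" and t
 proof -
  have "(LBINT xi:{?a..?b}. f (xi + t)) = (LBINT y:{?a + t..?b + t}. f y)" by (rule set_integral_shift(1))
  also have "... = (LBINT y:{?N..?N + 1}. f y)"
   by (rule set_integral_support[OF that(2)]) (use that(1) in auto)
  finally show ?thesis .
 qed
 have zero: "phi t y = 0" "psi t y = 0" if "y \<notin> {?N..?N + 1}" for t y
  using out[of y t] that by auto
 have inner: "(LBINT xi:{?a..?b}. F t xi) = (LBINT y:{?N..?N + 1}. z t (y - t) * psi t y + k t (y - t) * phi t y)" if t: "t \<in> {0..T}" for t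
 proof -
  have "z t (y - t) * psi t y + k t (y - t) * phi t y = 0" if "y \<notin> {?N..?N + 1}" for y using zero[OF that] by simp
  from shift[OF t, of "%y. z t (y - t) * psi t y + k t (y - t) * phi t y", OF this] show ?thesis by (simp add: F_def)
 qed
 have "lint {0..T} (%t. LBINT xi:{?a..?b}. F t xi)" by (rule R(2)) auto
 then show "lint {0..T} (%t. LBINT y:{?N..?N + 1}. z t (y - t) * psi t y + k t (y - t) * phi t y)"
  using set_integrable_cong[OF refl refl inner, of "{0..T}"] by simp
 have zi: "lint {?a..?b} (%xi. z t xi * phi t (xi + t))" if t: "t \<in> {0..T}" for t
 proof (rule set_integrable_le[where g = "%xi. B * B1 * (1 + abs (h0 xi))"])
  show "lint {?a..?b} (%xi. B * B1 * (1 + abs (h0 xi)))"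
   by (intro set_integrable_mult_right set_integral_add(1) h0_abs_integrable set_integrable_bounded[where B = 1]) auto
  show "abs (z t xi * phi t (xi + t)) <= B * B1 * (1 + abs (h0 xi))" for xi
   unfolding abs_mult using mult_mono[OF B(2)[of t xi] B1(2)[OF t, of "xi + t"]] t B(1) by (simp add: ac_simps)
 qed (auto, measurable)
 have h0i: "lint {?a..?b} (%xi. h0 xi * phi 0 xi)" using zi[of 0] T by (simp add: z_initial)
 have "(LBINT xi:{?a..?b}. z T xi * phi T (xi + T) - h0 xi * phi 0 xi) = (LBINT xi:{?a..?b}. LBINT t:{0..T}. F t xi)"
 proof (rule set_lebesgue_integral_cong)
  have "continuous_on UNIV (%t. psi t (xi + t))" for xi
  proof -
   have "continuous_on UNIV (%t. (t, xi + t))" by (intro continuous_intros)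
   from continuous_on_compose2[OF psic this] show ?thesis by simp
  qed
  then show "\<forall>xi. xi \<in> {?a..?b} --> z T xi * phi T (xi + T) - h0 xi * phi 0 xi = (LBINT t:{0..T}. F t xi)"
   unfolding F_def by (intro allI impI transport_along_characteristic D out T)
 qed simp
 also have "... = (LBINT t:{0..T}. LBINT xi:{?a..?b}. F t xi)" by (rule R(1)[symmetric]) auto
 also have "... = (LBINT t:{0..T}. LBINT y:{?N..?N + 1}. z t (y - t) * psi t y + k t (y - t) * phi t y)"
  by (rule set_lebesgue_integral_cong) (use inner in auto)
 finally have "(LBINT xi:{?a..?b}. z T xi * phi T (xi + T)) - (LBINT xi:{?a..?b}. h0 xi * phi 0 xi) = ..."
  using set_integral_diff(2)[OF zi[of T] h0i] T by simp
 moreover have "(LBINT xi:{?a..?b}. z T xi * phi T (xi + T)) = (LBINT y:{?N..?N + 1}. z T (y - T) * phi T y)"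
 proof -
  have "z T (y - T) * phi T y = 0" if "y \<notin> {?N..?N + 1}" for y using zero[OF that] by simp
  from shift[of T "%y. z T (y - T) * phi T y", OF _ this] show ?thesis using T by simp
 qed
 moreover have "(LBINT xi:{?a..?b}. h0 xi * phi 0 xi) = (LBINT y:{?N..?N + 1}. h0 y * phi 0 y)"
 proof -
  have "h0 y * phi 0 y = 0" if "y \<notin> {?N..?N + 1}" for y using zero[OF that] by simp
  from shift[of 0 "%y. h0 y * phi 0 y", OF _ this] show ?thesis using T by simp
 qed
 ultimately show "(LBINT y:{?N..?N + 1}. z T (y - T) * phi T y) - (LBINT y:{?N..?N + 1}. h0 y * phi 0 y)
  = (LBINT t:{0..T}. LBINT y:{?N..?N + 1}. z t (y - t) * psi t y + k t (y - t) * phi t y)" by simp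
qed

end

lemma half_powr_le:
 fixes a b p :: real
 assumes p: "p > 0"
 shows "abs ((a + b) / 2) powr p <= abs a powr p + abs b powr p" "abs ((a - b) / 2) powr p <= abs a powr p + abs b powr p"
proof -
 have *: "abs c powr p <= abs a powr p + abs b powr p" if "abs c <= max (abs a) (abs b)" for c
 proof -
  have "abs c powr p <= max (abs a) (abs b) powr p" by (rule powr_mono2) (use p that in auto)
  also have "... <= abs a powr p + abs b powr p" by (auto simp: max_def)
  finally show ?thesis .
 qed
 show "abs ((a + b) / 2) powr p <= abs a powr p + abs b powr p" "abs ((a - b) / 2) powr p <= abs a powr p + abs b powr p"
  by (rule *; simp add: abs_le_iff max_def; linarith)+
qed

lemma has_curve_deriv_imp_continuous:
 fixes F :: "real => real => real"
 assumes p: "p > 0" and F: "!!t. t >= 0 ==> F t \<in> Lp p \<Omega>" and t: "t >= 0"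
  and d: "has_curve_deriv {0..} (Lp p \<Omega>) (Lp_norm p \<Omega>) F v t"
 shows "((%s. Lp_norm p \<Omega> (%x. F s x - F t x)) \<longlongrightarrow> 0) (at t within {0..})"
 unfolding Lp_norm_tendsto_0_iff[OF p]
proof (rule Lim_null_comparison)
 let ?I = "%f. LINT x|lebesgue_on \<Omega>. abs (f x) powr p"
 let ?Q = "%s x. (F s x - F t x) / (s - t)"
 have v: "v \<in> Lp p \<Omega>" and l: "((%s. ?I (%x. ?Q s x - v x)) \<longlongrightarrow> 0) (at t within {0..})"
  using d by (simp_all add: has_curve_deriv_def Lp_norm_tendsto_0_iff[OF p])
 have "((%s. abs (s - t) powr p * (3 powr p * (?I (%x. ?Q s x - v x) + ?I v))) \<longlongrightarrow> 0 * (3 powr p * (0 + ?I v))) (at t within {0..})"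
 proof (intro tendsto_intros l)
  have "((%s. abs (s - t)) \<longlongrightarrow> 0) (at t within {0..})"
   by (rule tendsto_rabs_zero) (auto intro!: tendsto_eq_intros)
  then show "((%s. abs (s - t) powr p) \<longlongrightarrow> 0) (at t within {0..})"
   by (rule tendsto_zero_powrI[OF _ tendsto_const]) (use p in auto)
 qed
 then show "((%s. abs (s - t) powr p * (3 powr p * (?I (%x. ?Q s x - v x) + ?I v))) \<longlongrightarrow> 0) (at t within {0..})" by simp
 have "eventually (%s. s \<in> {0..} \<and> s \<noteq> t) (at t within {0..})" by (simp add: eventually_at_filter)
 then show "eventually (%s. norm (?I (%x. F s x - F t x)) <= abs (s - t) powr p * (3 powr p * (?I (%x. ?Q s x - v x) + ?I v))) (at t within {0..})"
 proof (rule eventually_mono)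
  fix s assume s: "s \<in> {0..} \<and> s \<noteq> t"
  have Q: "?Q s \<in> Lp p \<Omega>" using Lp_cmult[OF Lp_diff[OF p F F[OF t]], of s "1 / (s - t)"] s by simp
  note Qv = LpD(2)[OF Lp_diff[OF p Q v]]
  have "?I (?Q s) <= (LINT x|lebesgue_on \<Omega>. 3 powr p * (abs (?Q s x - v x) powr p + abs (v x) powr p))"
  proof (rule integral_mono[OF LpD(2)[OF Q]])
   show "abs (?Q s x) powr p <= 3 powr p * (abs (?Q s x - v x) powr p + abs (v x) powr p)" for x
    using powr_sum_le(1)[OF p, of "?Q s x - v x" "v x"] by simp
  qed (use Qv LpD(2)[OF v] in simp)
  also have "... = 3 powr p * (?I (%x. ?Q s x - v x) + ?I v)" using Qv LpD(2)[OF v] by simp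
  finally have "abs (s - t) powr p * ?I (?Q s) <= abs (s - t) powr p * (3 powr p * (?I (%x. ?Q s x - v x) + ?I v))"
   by (rule mult_left_mono) simp
  moreover have "abs (s - t) powr p * ?I (?Q s) = ?I (%x. F s x - F t x)"
  proof -
   have "abs (s - t) powr p * abs (?Q s x) powr p = abs (F s x - F t x) powr p" for x
    using s by (simp add: abs_divide flip: powr_mult)
   then show ?thesis by (simp flip: integral_mult_right_zero)
  qed
  ultimately show "norm (?I (%x. F s x - F t x)) <= abs (s - t) powr p * (3 powr p * (?I (%x. ?Q s x - v x) + ?I v))"
   by (simp add: integral_nonneg_AE)
 qed
qed

lemma pdiff_zero_off:
 fixes phi :: "'a::euclidean_space => real"
 assumes K: "closed K" and phi: "!!z. z \<notin> K ==> phi z = 0" and z: "z \<notin> K"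
 shows "pdiff b phi z = 0"
proof -
 have ev: "eventually (%y. phi y = 0) (at z)"
  using eventually_nhds_in_open[of "- K" z] K z phi unfolding eventually_at_filter
  by (auto elim!: eventually_mono simp: open_Compl)
 have "((%_. 0) has_derivative (%_. 0)) (at z)" by simp
 then have "(phi has_derivative (%_. 0)) (at z)"
  by (rule has_derivative_transform_eventually) (use ev phi[OF z] in \<open>auto elim: eventually_mono\<close>)
 then show ?thesis using pdiff_eqI[of phi "%_. 0" z b] by simp
qed

context characteristics
begin

text \<open>The time derivative of the solution, recovered from the folded function as half the sum of both
 Riemann invariants; \<open>ux\<close> is half their difference.\<close>
definition ut :: "real => real => real" where "ut t x = (z t (x - t) + z t (- x - t)) / 2"
definition ux :: "real => real => real" where "ux t x = (z t (- x - t) - z t (x - t)) / 2"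

lemma ut_even: "ut t (- x) = ut t x"
 by (simp add: ut_def add.commute)

lemma ut_measurable [measurable (raw)]:
 assumes [measurable]: "f \<in> borel_measurable M" "g \<in> borel_measurable M"
 shows "(%x. ut (f x) (g x)) \<in> borel_measurable M"
 unfolding ut_def by measurable

lemma ux_measurable [measurable (raw)]:
 assumes [measurable]: "f \<in> borel_measurable M" "g \<in> borel_measurable M"
 shows "(%x. ux (f x) (g x)) \<in> borel_measurable M"
 unfolding ux_def by measurable

lemma \<alpha>_slice_measurable [measurable (raw)]:
 assumes [measurable]: "f \<in> borel_measurable M" "g \<in> borel_measurable M"
 shows "(%x. \<alpha> (f x) (g x)) \<in> borel_measurable M"
 by (rule measurable_curried[OF \<alpha>_measurable]) measurable

text \<open>A common envelope of the Riemann invariants at \<open>(t, x)\<close> by the initial datum,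
 integrable in \<open>x\<close> and in \<open>t\<close>.\<close>
definition env :: "real => real => real" where
 "env t x = 1 + abs (h0 (x - t)) + abs (h0 (- x - t))"

lemma shifted_integrable:
 fixes f :: "real => real"
 assumes "!!a b. lint {a..b} f"
 shows "lint {a..b} (%x. f (x - t))" "lint {a..b} (%x. f (t - x))"
  "lint {a..b} (%x. f (- x - t))"
proof -
 show "lint {a..b} (%x. f (x - t))" using set_integral_shift(2)[of a b f "- t"] assms by simp
 show "lint {a..b} (%x. f (t - x))"
  using set_integral_reflect(2)[of a b "%x. f (x + t)"] set_integral_shift(2)[of "- b" "- a" f t] assms by (simp add: add.commute)
 show "lint {a..b} (%x. f (- x - t))"
  using set_integral_reflect(2)[of a b "%x. f (x - t)"] set_integral_shift(2)[of "- b" "- a" f "- t"] assms by simp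
qed

lemma env_integrable: "lint {a..b} (%x. C * env t x)"
 unfolding env_def
 by (intro set_integrable_mult_right set_integral_add(1) shifted_integrable(1)[of "%y. abs (h0 y)"] shifted_integrable(3)[of "%y. abs (h0 y)"]
   h0_abs_integrable set_integrable_bounded[where B = 1]) auto

lemma env_bound:
 assumes C: "C >= 0"
 obtains Q where "!!t. t \<in> {0..T} ==> (LBINT x:{0..1}. C * env t x) <= Q"
proof
 fix t assume t: "t \<in> {0..T}"
 let ?f = "%y. abs (h0 y)"
 have one: "lint {0..1} (%_::real. 1::real)" by (rule set_integrable_bounded[where B = 1]) auto
 note i1 = shifted_integrable(1)[of ?f 0 1 t, OF h0_abs_integrable] and i2 = shifted_integrable(3)[of ?f 0 1 t, OF h0_abs_integrable]
 have "(LBINT x:{0..1}. C * env t x) = C * ((LBINT x:{0..1::real}. 1) + (LBINT x:{0..1}. ?f (x - t)) + (LBINT x:{0..1}. ?f (- x - t)))"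
  unfolding env_def using set_integral_add(2)[OF set_integral_add(1)[OF one i1] i2] set_integral_add(2)[OF one i1] by simp
 also have "(LBINT x:{0..1}. ?f (x - t)) = (LBINT x:{- t..1 - t}. ?f x)"
  using set_integral_shift(1)[of 0 1 ?f "- t"] by simp
 also have "(LBINT x:{0..1}. ?f (- x - t)) = (LBINT x:{- 1 - t..- t}. ?f x)"
  using set_integral_reflect(1)[of 0 1 "%x. ?f (x - t)"] set_integral_shift(1)[of "- 1" 0 ?f "- t"] by simp
 also have "C * ((LBINT x:{0..1::real}. 1) + (LBINT x:{- t..1 - t}. ?f x) + (LBINT x:{- 1 - t..- t}. ?f x))
  <= C * ((LBINT x:{0..1::real}. 1) + (LBINT x:{- T..1}. ?f x) + (LBINT x:{- 1 - T..0}. ?f x))"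
  by (intro mult_left_mono add_mono set_integral_subset_le[OF h0_abs_integrable]) (use t C in auto)
 finally show "(LBINT x:{0..1}. C * env t x) <= C * ((LBINT x:{0..1::real}. 1) + (LBINT x:{- T..1}. ?f x) + (LBINT x:{- 1 - T..0}. ?f x))" .
qed

lemma strip_Fubini:
 fixes F :: "real => real => real"
 assumes F: "(%(t, x). F t x) \<in> borel2"
  and le: "!!t x. t \<in> {0..T} ==> x \<in> {0..1} ==> abs (F t x) <= C * env t x" and C: "0 <= C"
 shows "(LBINT t:{0..T}. LBINT x:{0..1}. F t x) = (LBINT x:{0..1}. LBINT t:{0..T}. F t x)"
  "lint {0..T} (%t. LBINT x:{0..1}. F t x)"
  "lint {0..1} (%x. LBINT t:{0..T}. F t x)"
  "t \<in> {0..T} ==> lint {0..1} (F t)"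
proof -
 obtain Q where Q: "!!t. t \<in> {0..T} ==> (LBINT x:{0..1}. C * env t x) <= Q"
  using env_bound[OF C] by blast
 note R = rectangle_Fubini_dominated[OF F env_integrable le Q]
 show "(LBINT t:{0..T}. LBINT x:{0..1}. F t x) = (LBINT x:{0..1}. LBINT t:{0..T}. F t x)"
  "lint {0..T} (%t. LBINT x:{0..1}. F t x)"
  "lint {0..1} (%x. LBINT t:{0..T}. F t x)"
  "t \<in> {0..T} ==> lint {0..1} (F t)"
  by (rule R; assumption)+
qed

lemma ut_env_bound:
 obtains B where "B >= 0" "!!t x. t \<in> {0..T} ==> abs (z t (x - t)) <= B * env t x"
  "!!t x. t \<in> {0..T} ==> abs (z t (- x - t)) <= B * env t x"
  "!!t x. t \<in> {0..T} ==> abs (ut t x) <= B * env t x" "!!t x. t \<in> {0..T} ==> abs (ux t x) <= B * env t x"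
proof -
 obtain B where B: "B >= 0" "!!t xi. 0 <= t ==> t <= T ==> abs (z t xi) <= B * (1 + abs (h0 xi))"
  using z_bound_exists by blast
 have 1: "abs (z t (x - t)) <= B * env t x" if "t \<in> {0..T}" for t x
  using B(2)[of t "x - t"] that mult_left_mono[OF _ B(1), of "1 + abs (h0 (x - t))" "env t x"] by (simp add: env_def)
 have 2: "abs (z t (- x - t)) <= B * env t x" if "t \<in> {0..T}" for t x
  using B(2)[of t "- x - t"] that mult_left_mono[OF _ B(1), of "1 + abs (h0 (- x - t))" "env t x"] by (simp add: env_def)
 show thesis
 proof (rule that[OF B(1) 1 2])
  show "abs (ut t x) <= B * env t x" "abs (ux t x) <= B * env t x" if "t \<in> {0..T}" for t x
   using 1[OF that, of x] 2[OF that, of x] by (auto simp: ut_def ux_def abs_le_iff)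
 qed
qed

lemma slice_integrable:
 assumes t: "0 <= t"
 shows "lint {a..b} (%x. z t (x - t))" "lint {a..b} (%x. z t (- x - t))"
  "lint {a..b} (ut t)" "lint {a..b} (ux t)"
proof -
 obtain B where B: "B >= 0" "!!s x. s \<in> {0..t} ==> abs (z s (x - s)) <= B * env s x"
  "!!s x. s \<in> {0..t} ==> abs (z s (- x - s)) <= B * env s x"
  by (rule ut_env_bound) blast
 show 1: "lint {a..b} (%x. z t (x - t))" and 2: "lint {a..b} (%x. z t (- x - t))"
  by (rule set_integrable_le[OF env_integrable[of a b B t]]; use B t in auto)+
 show "lint {a..b} (ut t)" using set_integral_add(1)[OF 1 2] by (simp add: ut_def[abs_def])
 show "lint {a..b} (ux t)" using set_integral_diff(1)[OF 2 1] by (simp add: ux_def[abs_def])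
qed

text \<open>The folded function contains each Riemann invariant exactly once per period.\<close>
lemma energy_split:
 assumes t: "0 <= t"
 shows "(LBINT x:{0..1}. abs (z t (x - t)) powr p) + (LBINT x:{0..1}. abs (z t (- x - t)) powr p) = (LBINT y:{0..2}. abs (z t (y - t)) powr p)"
  "lint {a..b} (%x. abs (z t (x - t)) powr p)" "lint {a..b} (%x. abs (z t (- x - t)) powr p)"
proof -
 let ?f = "%y. abs (z t (y - t)) powr p"
 have i: "lint {a..b} ?f" for a b
  by (rule shifted_integrable(1)[of "%y. abs (z t y) powr p"]) (rule z_powr_integrable[OF t])
 then show "lint {a..b} (%x. abs (z t (x - t)) powr p)" .
 show "lint {a..b} (%x. abs (z t (- x - t)) powr p)"
  by (rule shifted_integrable(3)[of "%y. abs (z t y) powr p"]) (rule z_powr_integrable[OF t])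
 have per: "?f (y + 2) = ?f y" for y using z_periodic[of t "y - t"] by (simp add: algebra_simps)
 have "(LBINT x:{0..1}. abs (z t (- x - t)) powr p) = (LBINT y:{- 1..0}. ?f y)"
  using set_integral_reflect(1)[of 0 1 ?f] by simp
 also have "... = (LBINT y:{1..2}. ?f y)"
  using set_integral_shift(1)[of "- 1" 0 ?f 2] per by simp
 finally show "(LBINT x:{0..1}. abs (z t (x - t)) powr p) + (LBINT x:{0..1}. abs (z t (- x - t)) powr p) = (LBINT y:{0..2}. ?f y)"
  using set_integral_Icc_combine[OF i, of 0 1 2] by simp
qed

lemma ut_powr:
 assumes t: "0 <= t"
 shows "lint {a..b} (%x. abs (ut t x) powr p)" "lint {a..b} (%x. abs (ux t x) powr p)"
  "(LBINT x:{0..1}. abs (ut t x) powr p) <= (LBINT y:{0..2}. abs (z t (y - t)) powr p)"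
  "(LBINT x:{0..1}. abs (ux t x) powr p) <= (LBINT y:{0..2}. abs (z t (y - t)) powr p)"
proof -
 have p0: "p > 0" using p by simp
 note E = energy_split[OF t]
 have S: "lint {a..b} (%x. abs (z t (x - t)) powr p + abs (z t (- x - t)) powr p)" for a b
  by (rule set_integral_add(1)[OF E(2,3)])
 have lt: "\<bar>\<bar>ut t x\<bar> powr p\<bar> <= \<bar>z t (x - t)\<bar> powr p + \<bar>z t (- x - t)\<bar> powr p" for x
  using half_powr_le(1)[OF p0] by (simp add: ut_def)
 have lx: "\<bar>\<bar>ux t x\<bar> powr p\<bar> <= \<bar>z t (x - t)\<bar> powr p + \<bar>z t (- x - t)\<bar> powr p" for x
  using half_powr_le(2)[OF p0, of "z t (- x - t)" "z t (x - t)"] by (simp add: ux_def)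
 show i1: "lint {a..b} (%x. abs (ut t x) powr p)" for a b by (rule set_integrable_le[OF S _ _ lt]) auto
 show i2: "lint {a..b} (%x. abs (ux t x) powr p)" for a b by (rule set_integrable_le[OF S _ _ lx]) auto
 show "(LBINT x:{0..1}. abs (ut t x) powr p) <= (LBINT y:{0..2}. abs (z t (y - t)) powr p)"
  using set_integral_mono[OF i1 S, of 0 1] lt set_integral_add(2)[OF E(2,3), of 0 1] E(1) by simp
 show "(LBINT x:{0..1}. abs (ux t x) powr p) <= (LBINT y:{0..2}. abs (z t (y - t)) powr p)"
  using set_integral_mono[OF i2 S, of 0 1] lx set_integral_add(2)[OF E(2,3), of 0 1] E(1) by simp
qed

lemma energy_bounded:
 assumes "0 <= t"
 shows "(LBINT y:{0..2}. abs (z t (y - t)) powr p) <= 4 * (LBINT y:{0..2}. abs (h0 y) powr p)"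
 using energy_decay[OF assms, of 0] c p powr_le1[of p "abs c"] by simp

lemma ut_continuous:
 assumes t0: "0 <= t0"
 shows "((%t. LBINT x:{0..1}. abs (ut t x - ut t0 x) powr p) \<longlongrightarrow> 0) (at t0 within {0..})"
  "((%t. LBINT x:{0..1}. abs (ux t x - ux t0 x) powr p) \<longlongrightarrow> 0) (at t0 within {0..})"
proof -
 have p0: "p > 0" using p by simp
 let ?D = "%t y. abs (z t (y - t) - z t0 (y - t0)) powr p"
 have "((%t. (LBINT y:{0..1}. ?D t y) + (LBINT y:{-1..0}. ?D t y)) \<longlongrightarrow> 0 + 0) (at t0 within {0..})"
  by (intro tendsto_add H_continuous t0) auto
 then have lim: "((%t. (LBINT y:{0..1}. ?D t y) + (LBINT y:{-1..0}. ?D t y)) \<longlongrightarrow> 0) (at t0 within {0..})" by simp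
 have Di: "lint {a..b} (?D t)" if t: "0 <= t" for t a b
  by (rule set_integrable_le[OF set_integrable_mult_right[OF set_integral_add(1)[OF energy_split(2)[OF t] energy_split(2)[OF t0]], where a = "3 powr p"]])
    (use powr_sum_le(2)[OF p0] in auto)
 have Dr: "(LBINT y:{-1..0}. ?D t y) = (LBINT x:{0..1}. ?D t (- x))" for t
  using set_integral_reflect(1)[of 0 1 "?D t"] by simp
 have Dri: "lint {0..1} (%x. ?D t (- x))" if "0 <= t" for t
  using set_integral_reflect(2)[of 0 1 "?D t"] Di[OF that] by simp
 have ev: "eventually (%t. t \<in> {0..}) (at t0 within {0..})" by (simp add: eventually_at_filter)
 have main: "((%t. LBINT x:{0..1}. f t x) \<longlongrightarrow> 0) (at t0 within {0..})"
  if f: "!!t. f t \<in> borel1" "!!t x. 0 <= f t x" "!!t x. f t x <= ?D t x + ?D t (- x)" for f :: "real => real => real"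
 proof (rule Lim_null_comparison[OF eventually_mono[OF ev] lim])
  fix t :: real assume "t \<in> {0..}"
  then have t: "0 <= t" by simp
  note S = set_integral_add[OF Di[OF t] Dri[OF t]]
  have fi: "lint {0..1} (f t)" by (rule set_integrable_le[OF S(1)]) (use f in auto)
  have "norm (LBINT x:{0..1}. f t x) = (LBINT x:{0..1}. f t x)"
   unfolding real_norm_def by (rule abs_of_nonneg) (auto simp: set_lebesgue_integral_def f(2) intro!: integral_nonneg_AE)
  also have "... <= (LBINT x:{0..1}. ?D t x + ?D t (- x))" by (rule set_integral_mono[OF fi S(1) f(3)])
  also have "... = (LBINT y:{0..1}. ?D t y) + (LBINT y:{-1..0}. ?D t y)" using S(2) Dr by simp
  finally show "norm (LBINT x:{0..1}. f t x) <= (LBINT y:{0..1}. ?D t y) + (LBINT y:{-1..0}. ?D t y)" .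
 qed
 show "((%t. LBINT x:{0..1}. abs (ut t x - ut t0 x) powr p) \<longlongrightarrow> 0) (at t0 within {0..})"
 proof (rule main)
  show "abs (ut t x - ut t0 x) powr p <= ?D t x + ?D t (- x)" for t x
   using half_powr_le(1)[OF p0, of "z t (x - t) - z t0 (x - t0)" "z t (- x - t) - z t0 (- x - t0)"]
   by (simp add: ut_def diff_divide_distrib add_divide_distrib algebra_simps)
 qed auto
 show "((%t. LBINT x:{0..1}. abs (ux t x - ux t0 x) powr p) \<longlongrightarrow> 0) (at t0 within {0..})"
 proof (rule main)
  show "abs (ux t x - ux t0 x) powr p <= ?D t x + ?D t (- x)" for t x
   using half_powr_le(2)[OF p0, of "z t (- x - t) - z t0 (- x - t0)" "z t (x - t) - z t0 (x - t0)"]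
   by (simp add: ux_def diff_divide_distrib add_divide_distrib algebra_simps)
 qed auto
qed

text \<open>The transport identities for the cells \<open>(0,1)\<close> and \<open>(-1,0)\<close>, added and
 subtracted. The first is the wave equation for \<open>u\<^sub>t\<close>, the second the compatibility of the
 mixed derivatives.\<close>
lemma transport_pair:
 assumes c: "continuous_on UNIV (%(t, x). phi t x)" "continuous_on UNIV (%(t, x). phit t x)" "continuous_on UNIV (%(t, x). phix t x)"
  and Dp: "!!xi t. ((%t. phi t (xi + t)) has_real_derivative phit t (xi + t) + phix t (xi + t)) (at t)"
  and Dm: "!!xi t. ((%t. phi t (xi - t)) has_real_derivative phit t (xi - t) - phix t (xi - t)) (at t)"
  and out: "!!t x. x <= 0 \<or> 1 <= x ==> phi t x = 0 \<and> phit t x = 0 \<and> phix t x = 0" and T: "0 <= T"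
 shows "(LBINT x:{0..1}. ut T x * phi T x) - (LBINT x:{0..1}. ut 0 x * phi 0 x)
   = (LBINT t:{0..T}. LBINT x:{0..1}. ut t x * phit t x - ux t x * phix t x - \<alpha> t x * ut t x * phi t x)" (is ?S)
  "(LBINT x:{0..1}. ux T x * phi T x) - (LBINT x:{0..1}. ux 0 x * phi 0 x)
   = (LBINT t:{0..T}. LBINT x:{0..1}. ux t x * phit t x - ut t x * phix t x)" (is ?D)
proof -
 have m: "continuous_on UNIV (%x. f t x)" if "continuous_on UNIV (%(t, x). f t x)" for f :: "real => real => real" and t
 proof -
  have "continuous_on UNIV (%x::real. (t, x))" by (intro continuous_intros)
  from continuous_on_compose2[OF that this] show ?thesis by simp
 qed
 have sl: "continuous_on {0..1} (phi t)" "continuous_on {0..1} (phit t)" "continuous_on {0..1} (phix t)" for t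
  using m[OF c(1)] m[OF c(2)] m[OF c(3)] continuous_on_subset by blast+
 have fi: "continuous_on UNIV (%(t, x). f t (- x))" if "continuous_on UNIV (%(t, x). f t x)" for f :: "real => real => real"
 proof -
  have "continuous_on UNIV (%q::real\<times>real. (fst q, - snd q))" by (intro continuous_intros)
  from continuous_on_compose2[OF that this] show ?thesis by (simp add: case_prod_beta)
 qed
 have keven: "k t (x - t) = - \<alpha> t x * ut t x" "k t (- x - t) = - \<alpha> t x * ut t x" for t x
 proof -
  have a: "- (x - t) - 2 * t = - x - t" "- (- x - t) - 2 * t = x - t" "- x - t + t = - x" "x - t + t = x" by simp_all
  show "k t (x - t) = - \<alpha> t x * ut t x" "k t (- x - t) = - \<alpha> t x * ut t x"
   unfolding dens_def ut_def a \<alpha>_even by (simp_all add: add.commute)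
 qed
 define I1 where "I1 t = (LBINT x:{0..1}. z t (x - t) * (phit t x + phix t x) - \<alpha> t x * ut t x * phi t x)" for t
 define I2 where "I2 t = (LBINT x:{0..1}. z t (- x - t) * (phit t x - phix t x) - \<alpha> t x * ut t x * phi t x)" for t
 have s1: "continuous_on UNIV (%(t, x). phit t x + phix t x)"
  using continuous_on_add[OF c(2,3)] by (simp add: case_prod_beta)
 have s2: "continuous_on UNIV (%(t, x). phit t x - phix t x)"
  using continuous_on_diff[OF c(2,3)] by (simp add: case_prod_beta)
 have o1: "\<forall>t y. y <= of_int 0 \<or> of_int 0 + 1 <= y --> phi t y = 0 \<and> phit t y + phix t y = 0"
  using out by simp
 note X1 = transport_identity[OF c(1) s1 Dp o1 T]
 have e1: "(LBINT x:{0..1}. z T (x - T) * phi T x) - (LBINT x:{0..1}. h0 x * phi 0 x) = (LBINT t:{0..T}. I1 t)"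
  "lint {0..T} I1"
  using X1 by (simp_all add: keven I1_def[abs_def])
 have D2: "((%t. phi t (- (xi + t))) has_real_derivative phit t (- (xi + t)) - phix t (- (xi + t))) (at t)" for xi t
  using Dm[of "- xi" t] by simp
 have o2: "\<forall>t y. y <= of_int (- 1) \<or> of_int (- 1) + 1 <= y --> phi t (- y) = 0 \<and> phit t (- y) - phix t (- y) = 0"
 proof (intro allI impI)
  fix t y :: real assume "y <= of_int (- 1) \<or> of_int (- 1) + 1 <= y"
  then show "phi t (- y) = 0 \<and> phit t (- y) - phix t (- y) = 0" using out[of "- y" t] by auto
 qed
 note X2 = transport_identity[of "%t x. phi t (- x)" "%t x. phit t (- x) - phix t (- x)", OF fi[OF c(1)] fi[OF s2] D2 o2 T]
 have rf: "(LBINT y:{-1..0}. f y) = (LBINT x:{0..1}. f (- x))" for f :: "real => real"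
  using set_integral_reflect(1)[of 0 1 f] by simp
 have e2: "(LBINT x:{0..1}. z T (- x - T) * phi T x) - (LBINT x:{0..1}. h0 (- x) * phi 0 x) = (LBINT t:{0..T}. I2 t)"
  "lint {0..T} I2"
  using X2 by (simp_all add: rf keven I2_def[abs_def] \<alpha>_even ut_even)
 have i1: "lint {0..1} (%x. z t (x - t) * f x)" and i2: "lint {0..1} (%x. z t (- x - t) * f x)"
  and it: "lint {0..1} (%x. ut t x * f x)" and ix: "lint {0..1} (%x. ux t x * f x)"
  and ia: "lint {0..1} (%x. \<alpha> t x * ut t x * f x)"
  if f: "continuous_on {0..1} f" and t: "0 <= t" for f t
 proof -
  show "lint {0..1} (%x. z t (x - t) * f x)" "lint {0..1} (%x. z t (- x - t) * f x)"
   "lint {0..1} (%x. ut t x * f x)" "lint {0..1} (%x. ux t x * f x)"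
   using set_integrable_continuous_mult[OF f slice_integrable(1)[OF t]] set_integrable_continuous_mult[OF f slice_integrable(2)[OF t]]
    set_integrable_continuous_mult[OF f slice_integrable(3)[OF t]] set_integrable_continuous_mult[OF f slice_integrable(4)[OF t]]
   by (simp_all add: mult.commute)
  have "lint {0..1} (%x. \<alpha> t x * ut t x)"
  proof (rule set_integrable_le[OF set_integrable_mult_right[OF set_integrable_abs[OF slice_integrable(3)[OF t]], where a = A]])
   show "abs (\<alpha> t x * ut t x) <= A * abs (ut t x)" for x
    unfolding abs_mult using \<alpha>_nonneg[of t x] \<alpha>_le[of t x] by (intro mult_right_mono) auto
  qed auto
  from set_integrable_continuous_mult[OF f this]
  show "lint {0..1} (%x. \<alpha> t x * ut t x * f x)" by (simp add: mult.commute)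
 qed
 have J1: "lint {0..1} (%x. z t (x - t) * (phit t x + phix t x) - \<alpha> t x * ut t x * phi t x)"
  and J2: "lint {0..1} (%x. z t (- x - t) * (phit t x - phix t x) - \<alpha> t x * ut t x * phi t x)" if t: "0 <= t" for t
  by (intro set_integral_diff(1) i1 i2 ia continuous_intros sl t)+
 have "(LBINT x:{0..1}. ut t x * phi t x) = ((LBINT x:{0..1}. z t (x - t) * phi t x) + (LBINT x:{0..1}. z t (- x - t) * phi t x)) / 2"
  "(LBINT x:{0..1}. ux t x * phi t x) = ((LBINT x:{0..1}. z t (- x - t) * phi t x) - (LBINT x:{0..1}. z t (x - t) * phi t x)) / 2"
  if t: "0 <= t" for t
 proof -
  have "(LBINT x:{0..1}. ut t x * phi t x) = (LBINT x:{0..1}. (z t (x - t) * phi t x + z t (- x - t) * phi t x) / 2)"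
   "(LBINT x:{0..1}. ux t x * phi t x) = (LBINT x:{0..1}. (z t (- x - t) * phi t x - z t (x - t) * phi t x) / 2)"
   by (rule arg_cong[where f = "set_lebesgue_integral lborel {0..1}"], simp add: fun_eq_iff ut_def ux_def algebra_simps)+
  then show "(LBINT x:{0..1}. ut t x * phi t x) = ((LBINT x:{0..1}. z t (x - t) * phi t x) + (LBINT x:{0..1}. z t (- x - t) * phi t x)) / 2"
   "(LBINT x:{0..1}. ux t x * phi t x) = ((LBINT x:{0..1}. z t (- x - t) * phi t x) - (LBINT x:{0..1}. z t (x - t) * phi t x)) / 2"
   using set_integral_add(2)[OF i1[OF sl(1)[of t] t] i2[OF sl(1)[of t] t]] set_integral_diff(2)[OF i2[OF sl(1)[of t] t] i1[OF sl(1)[of t] t]]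
   by simp_all
 qed
 note half = this
 have "(LBINT x:{0..1}. ut t x * phit t x - ux t x * phix t x - \<alpha> t x * ut t x * phi t x) = (I1 t + I2 t) / 2" if t: "t \<in> {0..T}" for t
 proof -
  have t0: "0 <= t" using t by simp
  have "(I1 t + I2 t) / 2 = (LBINT x:{0..1}. ((z t (x - t) * (phit t x + phix t x) - \<alpha> t x * ut t x * phi t x) + (z t (- x - t) * (phit t x - phix t x) - \<alpha> t x * ut t x * phi t x)) / 2)"
   using set_integral_add(2)[OF J1[OF t0] J2[OF t0]] by (simp add: I1_def I2_def)
  also have "... = (LBINT x:{0..1}. ut t x * phit t x - ux t x * phix t x - \<alpha> t x * ut t x * phi t x)"
   by (rule arg_cong[where f = "set_lebesgue_integral lborel {0..1}"]) (simp add: fun_eq_iff ut_def ux_def field_simps)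
  finally show ?thesis by simp
 qed
 then have "(LBINT t:{0..T}. LBINT x:{0..1}. ut t x * phit t x - ux t x * phix t x - \<alpha> t x * ut t x * phi t x) = (LBINT t:{0..T}. (I1 t + I2 t) / 2)"
  by (intro set_lebesgue_integral_cong) auto
 also have "... = ((LBINT t:{0..T}. I1 t) + (LBINT t:{0..T}. I2 t)) / 2"
  using set_integral_add(2)[OF e1(2) e2(2)] by simp
 finally show ?S using half[OF T] half[of 0] e1(1) e2(1) by (simp add: z_initial field_simps)
 have "(LBINT x:{0..1}. ux t x * phit t x - ut t x * phix t x) = (I2 t - I1 t) / 2" if t: "t \<in> {0..T}" for t
 proof -
  have t0: "0 <= t" using t by simp
  have "(I2 t - I1 t) / 2 = (LBINT x:{0..1}. ((z t (- x - t) * (phit t x - phix t x) - \<alpha> t x * ut t x * phi t x) - (z t (x - t) * (phit t x + phix t x) - \<alpha> t x * ut t x * phi t x)) / 2)"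
   using set_integral_diff(2)[OF J2[OF t0] J1[OF t0]] by (simp add: I1_def I2_def)
  also have "... = (LBINT x:{0..1}. ux t x * phit t x - ut t x * phix t x)"
   by (rule arg_cong[where f = "set_lebesgue_integral lborel {0..1}"]) (simp add: fun_eq_iff ut_def ux_def field_simps)
  finally show ?thesis by simp
 qed
 then have "(LBINT t:{0..T}. LBINT x:{0..1}. ux t x * phit t x - ut t x * phix t x) = (LBINT t:{0..T}. (I2 t - I1 t) / 2)"
  by (intro set_lebesgue_integral_cong) auto
 also have "... = ((LBINT t:{0..T}. I2 t) - (LBINT t:{0..T}. I1 t)) / 2"
  using set_integral_diff(2)[OF e2(2) e1(2)] by simp
 finally show ?D using half[OF T] half[of 0] e1(1) e2(1) by (simp add: z_initial field_simps)
qed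

lemma ut_time_integrable:
 assumes a: "0 <= a"
 shows "lint {a..b} (%s. ut s x)" "lint {a..b} (%s. abs (ut s x) powr p)"
proof -
 obtain B where B: "B >= 0" "!!t xi. 0 <= t ==> t <= b ==> abs (z t xi) <= B * (1 + abs (h0 xi))"
  using z_bound_exists by blast
 let ?e = "%xi. abs B powr p * (1 + abs (h0 xi)) powr p"
 have p0: "p > 0" using p by simp
 have G: "lint {a..b} (%s. ?e (x - s) + ?e (- x - s))"
  using set_integral_add(1)[OF shifted_integrable(2)[of ?e a b x, OF envelope_integrable] shifted_integrable(2)[of ?e a b "- x", OF envelope_integrable]] by simp
 have le: "\<bar>\<bar>ut s x\<bar> powr p\<bar> <= ?e (x - s) + ?e (- x - s)" if s: "s \<in> {a..b}" for s
 proof -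
  have "abs (ut s x) powr p <= abs (z s (x - s)) powr p + abs (z s (- x - s)) powr p"
   using half_powr_le(1)[OF p0] by (simp add: ut_def)
  also have "... <= ?e (x - s) + ?e (- x - s)"
   by (intro add_mono powr_const_le B(2)) (use s a p0 in auto)
  finally show ?thesis by simp
 qed
 show i: "lint {a..b} (%s. abs (ut s x) powr p)" by (rule set_integrable_le[OF G _ _ le]) auto
 have "lint {a..b} (%s. 1 + abs (ut s x) powr p)"
  by (rule set_integral_add(1)[OF set_integrable_bounded[where B = 1] i]) auto
 then show "lint {a..b} (%s. ut s x)"
  by (rule set_integrable_le) (use abs_le_powr[of p 1] p in auto)
qed

text \<open>The displacement accumulated since time zero.\<close>
definition Iu :: "real => real => real" where "Iu t x = (LBINT s:{0..t}. ut s x)"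

lemma Iu_measurable [measurable (raw)]:
 assumes "f \<in> borel_measurable M" "g \<in> borel_measurable M"
 shows "(%x. Iu (f x) (g x)) \<in> borel_measurable M"
proof -
 have "(%q. (if 0 <= snd q \<and> snd q <= fst (fst q) then 1 else 0) * ut (snd q) (snd (fst q)))
   \<in> borel_measurable ((borel \<Otimes>\<^sub>M borel) \<Otimes>\<^sub>M lborel)"
  by measurable
 moreover have "(%q. (if 0 <= snd q \<and> snd q <= fst (fst q) then 1 else 0) * ut (snd q) (snd (fst q)))
  = (%(q, s). indicator {0..fst q} s *\<^sub>R ut s (snd q))"
  by (auto simp: fun_eq_iff indicator_def)
 ultimately have "(%(q, s). indicator {0..fst q} s *\<^sub>R ut s (snd q))
   \<in> borel_measurable ((borel \<Otimes>\<^sub>M borel) \<Otimes>\<^sub>M lborel)" by simp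
 from lborel.borel_measurable_lebesgue_integral[OF this]
 have "(%(t, x). Iu t x) \<in> borel2"
  by (simp add: Iu_def set_lebesgue_integral_def case_prod_beta)
 then show ?thesis by (rule measurable_curried[OF _ assms])
qed

lemma Iu_bound:
 obtains D where "D >= 0" "!!t x. t \<in> {0..T} ==> x \<in> {0..1} ==> abs (Iu t x) <= D"
proof -
 obtain B where B: "B >= 0" "!!t x. t \<in> {0..T} ==> abs (ut t x) <= B * env t x"
  by (rule ut_env_bound) blast
 let ?f = "%y. abs (h0 y)"
 define D where "D = B * ((LBINT s:{0..T::real}. 1) + (LBINT y:{- T..1}. ?f y) + (LBINT y:{- 1 - T..0}. ?f y))"
 have one: "lint {a..b} (%_. 1::real)" for a b :: real by (rule set_integrable_bounded[where B = 1]) auto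
 have D: "abs (Iu t x) <= D" if t: "t \<in> {0..T}" and x: "x \<in> {0..1}" for t x
 proof -
  note i1 = shifted_integrable(2)[of ?f 0 t x, OF h0_abs_integrable] and i2 = shifted_integrable(2)[of ?f 0 t "- x", OF h0_abs_integrable]
  have ei: "lint {0..t} (%s. B * env s x)"
   unfolding env_def using set_integral_add(1)[OF set_integral_add(1)[OF one i1] i2] by simp
  have "abs (Iu t x) <= (LBINT s:{0..t}. abs (ut s x))"
   unfolding Iu_def using set_integral_norm_bound[OF ut_time_integrable(1)[of 0 t x]] by simp
  also have "... <= (LBINT s:{0..t}. B * env s x)"
   by (rule set_integral_mono[OF set_integrable_abs[OF ut_time_integrable(1)] ei]) (use B(2) t in auto)
  also have "... = B * ((LBINT s:{0..t}. 1) + (LBINT s:{0..t}. ?f (x - s)) + (LBINT s:{0..t}. ?f (- x - s)))"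
   unfolding env_def using set_integral_add(2)[OF set_integral_add(1)[OF one i1] i2] set_integral_add(2)[OF one i1] by simp
  also have "(LBINT s:{0..t}. ?f (x - s)) = (LBINT y:{x - t..x}. ?f y)"
   using set_integral_reflect(1)[of 0 t "%y. ?f (y + x)"] set_integral_shift(1)[of "- t" 0 ?f x] by (simp add: add.commute)
  also have "(LBINT s:{0..t}. ?f (- x - s)) = (LBINT y:{- x - t..- x}. ?f y)"
   using set_integral_reflect(1)[of 0 t "%y. ?f (y - x)"] set_integral_shift(1)[of "- t" 0 ?f "- x"]
  proof -
   have sw: "- x - s = - s - x" for s by simp
   show ?thesis unfolding sw
    using set_integral_reflect(1)[of 0 t "%y. ?f (y - x)"] set_integral_shift(1)[of "- t" 0 ?f "- x"] by simp
  qed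
  also have "B * ((LBINT s:{0..t}. 1) + (LBINT y:{x - t..x}. ?f y) + (LBINT y:{- x - t..- x}. ?f y)) <= D"
   unfolding D_def
   by (intro mult_left_mono add_mono set_integral_subset_le[OF h0_abs_integrable] set_integral_subset_le[OF one]) (use t x B in auto)
  finally show ?thesis .
 qed
 have "B * ((LBINT s:{0..T}. 1) + (LBINT y:{- T..1}. ?f y) + (LBINT y:{- 1 - T..0}. ?f y)) >= 0"
  by (intro mult_nonneg_nonneg add_nonneg_nonneg B(1)) (auto simp: set_lebesgue_integral_def intro: integral_nonneg_AE)
 then show thesis using that[of D] D by (simp add: D_def)
qed

text \<open>The difference quotient is a time average of \<open>ut\<close>; Jensen's inequality and Fubini's
 theorem reduce its convergence to the continuity of \<open>ut\<close> in \<open>L\<^sup>p\<close>.\<close>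
lemma Iu_derivative:
 assumes t: "0 <= t"
 shows "((%s. LBINT x:{0..1}. abs ((Iu s x - Iu t x) / (s - t) - ut t x) powr p) \<longlongrightarrow> 0) (at t within {0..})"
proof (rule tendstoI)
 fix e :: real assume e: "e > 0"
 let ?\<delta> = "%r. LBINT x:{0..1}. abs (ut r x - ut t x) powr p"
 have p0: "p > 0" using p by simp
 have "eventually (%r. dist (?\<delta> r) 0 < e / 2) (at t within {0..})"
  using tendstoD[OF ut_continuous(1)[OF t], of "e/2"] e by simp
 then obtain d where d: "d > 0" "!!r. r \<in> {0..} ==> r \<noteq> t ==> dist r t < d ==> dist (?\<delta> r) 0 < e / 2"
  unfolding eventually_at by blast
 have \<delta>: "?\<delta> r <= e / 2" if "r >= 0" "abs (r - t) < d" for r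
  using d(2)[of r] that e p0 by (cases "r = t") (auto simp: dist_real_def)
 have key: "(LBINT x:{0..1}. abs ((Iu s x - Iu t x) / (s - t) - ut t x) powr p) <= e / 2"
  if s: "s >= 0" "s \<noteq> t" "abs (s - t) < d" for s
 proof -
  define a where "a = min s t"
  define b where "b = max s t"
  have ab: "0 <= a" "a < b" using s t by (auto simp: a_def b_def)
  have avg: "(Iu s x - Iu t x) / (s - t) - ut t x = (LBINT r:{a..b}. ut r x - ut t x) / (b - a)" for x
  proof -
   have ba: "(Iu s x - Iu t x) / (s - t) = (Iu b x - Iu a x) / (b - a)"
    using s minus_divide_divide[of "Iu s x - Iu t x" "s - t"] by (auto simp: a_def b_def min_def max_def)
   have "Iu b x = Iu a x + (LBINT r:{a..b}. ut r x)"
    unfolding Iu_def by (rule set_integral_Icc_combine[OF ut_time_integrable(1)]) (use ab in auto)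
   moreover have "(LBINT r:{a..b}. ut r x - ut t x) = (LBINT r:{a..b}. ut r x) - (b - a) * ut t x"
   proof -
    have ci: "lint {a..b} (%_. ut t x)" by (rule set_integrable_bounded[where B = "abs (ut t x)"]) auto
    have "(LBINT r:{a..b}. ut t x) = (b - a) * ut t x" using ab by (simp add: set_lebesgue_integral_def)
    then show ?thesis using set_integral_diff(2)[OF ut_time_integrable(1)[OF ab(1)] ci] by simp
   qed
   ultimately show ?thesis using ba ab by (simp add: diff_divide_distrib)
  qed
  have Xi: "lint {a..b} (%r. ut r x - ut t x)" for x
   by (rule set_integral_diff(1)[OF ut_time_integrable(1)[OF ab(1)] set_integrable_bounded[where B = "abs (ut t x)"]]) auto
  have Xpi: "lint {a..b} (%r. abs (ut r x - ut t x) powr p)" for x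
  proof (rule set_integrable_le)
   show "lint {a..b} (%r. 3 powr p * (abs (ut r x) powr p + abs (ut t x) powr p))"
    by (intro set_integrable_mult_right set_integral_add(1) ut_time_integrable(2) ab set_integrable_bounded[where B = "abs (ut t x) powr p"]) auto
  qed (use powr_sum_le(2)[OF p0] in auto)
  have J: "abs ((Iu s x - Iu t x) / (s - t) - ut t x) powr p <= (LBINT r:{a..b}. abs (ut r x - ut t x) powr p) / (b - a)" for x
   unfolding avg by (rule Jensen_powr[OF p ab(2) Xi Xpi])
  have Fm: "(%(r, x). abs (ut r x - ut t x) powr p) \<in> borel2"
   unfolding case_prod_beta by measurable
  have Gi: "lint {0..1} (%x. 3 powr p * (abs (ut r x) powr p + abs (ut t x) powr p))" if "r \<in> {a..b}" for r
   by (intro set_integrable_mult_right set_integral_add(1) ut_powr(1) t) (use that ab in auto)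
  have le: "\<bar>\<bar>ut r x - ut t x\<bar> powr p\<bar> <= 3 powr p * (\<bar>ut r x\<bar> powr p + \<bar>ut t x\<bar> powr p)" for r x
   using powr_sum_le(2)[OF p0] by simp
  let ?E = "4 * (LBINT y:{0..2}. abs (h0 y) powr p)"
  have Q: "(LBINT x:{0..1}. 3 powr p * (abs (ut r x) powr p + abs (ut t x) powr p)) <= 3 powr p * (?E + ?E)" if "r \<in> {a..b}" for r
  proof -
   have r: "0 <= r" using that ab by simp
   have "(LBINT x:{0..1}. 3 powr p * (abs (ut r x) powr p + abs (ut t x) powr p)) = 3 powr p * ((LBINT x:{0..1}. abs (ut r x) powr p) + (LBINT x:{0..1}. abs (ut t x) powr p))"
    using set_integral_add(2)[OF ut_powr(1)[OF r] ut_powr(1)[OF t]] by simp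
   then show ?thesis
    using ut_powr(3)[OF r] ut_powr(3)[OF t] energy_bounded[OF r] energy_bounded[OF t]
    by (auto intro!: mult_left_mono add_mono)
  qed
  note R = rectangle_Fubini_dominated[OF Fm Gi le Q]
  have R3: "lint {0..1} (%x. (LBINT r:{a..b}. abs (ut r x - ut t x) powr p) / (b - a))"
   by (rule set_integrable_divide) (rule R(3))
  have "(LBINT x:{0..1}. abs ((Iu s x - Iu t x) / (s - t) - ut t x) powr p) <= (LBINT x:{0..1}. (LBINT r:{a..b}. abs (ut r x - ut t x) powr p) / (b - a))"
   by (rule set_integral_mono[OF set_integrable_le[OF R3] R3 J]) (use J in auto)
  also have "... = (LBINT r:{a..b}. ?\<delta> r) / (b - a)" using R(1) by simp
  also have "... <= (LBINT r:{a..b}. e / 2) / (b - a)"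
  proof (rule divide_right_mono[OF set_integral_mono])
   show "lint {a..b} ?\<delta>" by (rule R(2))
   show "lint {a..b} (%_. e / 2)" by (rule set_integrable_bounded[where B = "abs (e/2)"]) auto
   show "?\<delta> r <= e / 2" if "r \<in> {a..b}" for r
    by (rule \<delta>) (use that ab s in \<open>auto simp: a_def b_def\<close>)
  qed (use ab in simp)
  also have "... = e / 2" using ab by (simp add: set_lebesgue_integral_def field_simps)
  finally show ?thesis .
 qed
 have nn: "(LBINT x:{0..1}. abs ((Iu s x - Iu t x) / (s - t) - ut t x) powr p) >= 0" for s
  unfolding set_lebesgue_integral_def by (rule integral_nonneg_AE) auto
 show "eventually (%s. dist (LBINT x:{0..1}. abs ((Iu s x - Iu t x) / (s - t) - ut t x) powr p) 0 < e) (at t within {0..})"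
  unfolding eventually_at
 proof (intro exI[of _ d] conjI ballI impI d(1))
  fix s assume s: "s \<in> {0..}" "s \<noteq> t \<and> dist s t < d"
  then show "dist (LBINT x:{0..1}. abs ((Iu s x - Iu t x) / (s - t) - ut t x) powr p) 0 < e"
   using key[of s] nn[of s] e by (simp add: dist_real_def)
 qed
qed

end

lemma is_weak_deriv_diff:
 assumes f: "integrable (leb a b) f" "integrable (leb a b) f'" "is_weak_deriv {a<..<b} f f'"
  and g: "integrable (leb a b) g" "integrable (leb a b) g'" "is_weak_deriv {a<..<b} g g'"
 shows "is_weak_deriv {a<..<b} (%x. f x - g x) (%x. f' x - g' x)"
 unfolding is_weak_deriv_def
proof
 fix phi assume phi: "phi \<in> test_functions {a<..<b}"
 note c = test_function_deriv(3,4)[OF phi, THEN continuous_on_subset, OF subset_UNIV, of "{a..b}"]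
 have "(LINT x|leb a b. (f x - g x) * deriv phi x) = (LINT x|leb a b. f x * deriv phi x) - (LINT x|leb a b. g x * deriv phi x)"
  by (simp add: left_diff_distrib integrable_mult_continuous f g c)
 also have "... = - ((LINT x|leb a b. f' x * phi x) - (LINT x|leb a b. g' x * phi x))"
  using f(3) g(3) phi by (simp add: is_weak_deriv_def)
 also have "... = - (LINT x|leb a b. (f' x - g' x) * phi x)"
  by (simp add: left_diff_distrib integrable_mult_continuous f g c)
 finally show "(LINT x|leb a b. (f x - g x) * deriv phi x) = - (LINT x|leb a b. (f' x - g' x) * phi x)" .
qed

lemma test_function_bounded:
 assumes "phi \<in> test_functions \<Omega>"
 obtains M where "M >= 0" "!!z. abs (phi z) <= M"
proof -
 obtain K where K: "smooth phi" "compact K" "K \<subseteq> \<Omega>" "!!z. z \<notin> K ==> phi z = 0"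
  by (rule test_functionsE[OF assms]) (rule that)
 obtain B where B: "!!x. x \<in> K ==> abs (phi x) <= B"
  using compact_imp_bounded[OF compact_continuous_image[OF continuous_on_subset[OF smoothD(2)[OF K(1)] subset_UNIV] K(2)]]
  unfolding bounded_iff by (metis imageI real_norm_def)
 have "abs (phi z) <= abs B" for z using B[of z] K(4)[of z] by (cases "z \<in> K") auto
 then show thesis using that[of "abs B"] by simp
qed

lemma Basis_plane: "(1, 0) \<in> (Basis :: (real \<times> real) set)" "(0, 1) \<in> (Basis :: (real \<times> real) set)"
 by (auto simp: Basis_prod_def)

lemma pdiff_direction:
 fixes phi :: "real \<times> real => real"
 assumes "phi differentiable (at (t, y + sg * t))"
 shows "((%t. phi (t, y + sg * t)) has_real_derivative dt phi (t, y + sg * t) + sg * dx phi (t, y + sg * t)) (at t)"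
proof -
 obtain D where D: "(phi has_derivative D) (at (t, y + sg * t))" using assms by (auto simp: differentiable_def)
 have i: "((%t. (t, y + sg * t)) has_derivative (%h. (h, sg * h))) (at t)"
  by (auto intro!: derivative_eq_intros)
 have "((%t. phi (t, y + sg * t)) has_derivative (%h. D (h, sg * h))) (at t)"
  using has_derivative_compose[OF i D] .
 moreover have "D (h, sg * h) = (dt phi (t, y + sg * t) + sg * dx phi (t, y + sg * t)) * h" for h
 proof -
  have l: "linear D" by (rule has_derivative_linear[OF D])
  have "D (h, sg * h) = D (h *\<^sub>R (1, 0) + (sg * h) *\<^sub>R (0, 1))" by simp
  also have "... = h *\<^sub>R D (1, 0) + (sg * h) *\<^sub>R D (0, 1)" by (simp only: linear_add[OF l] linear_scale[OF l])
  finally show ?thesis using pdiff_eqI[OF D] by (simp add: algebra_simps)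
 qed
 ultimately show ?thesis by (simp add: has_field_derivative_def)
qed


section \<open>Curves in L1 paired with test functions\<close>

lemma integrable_mult_bounded:
 fixes f psi :: "'a => real"
 assumes f: "integrable M f" and psi: "psi \<in> borel_measurable M" "!!x. x \<in> space M ==> abs (psi x) <= B"
 shows "integrable M (%x. f x * psi x)" "abs (LINT x|M. f x * psi x) <= B * (LINT x|M. abs (f x))"
proof -
 have le: "abs (f x * psi x) <= B * abs (f x)" if "x \<in> space M" for x
  using mult_left_mono[OF psi(2)[OF that], of "abs (f x)"] by (simp add: abs_mult mult.commute)
 have B: "integrable M (%x. B * abs (f x))" using f by simp
 show i: "integrable M (%x. f x * psi x)"
 proof (rule Bochner_Integration.integrable_bound[OF B])
  show "AE x in M. norm (f x * psi x) <= norm (B * abs (f x))"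
   unfolding real_norm_def by (intro AE_I2 order_trans[OF le abs_ge_self])
 qed (use f psi(1) in auto)
 have "abs (LINT x|M. f x * psi x) <= (LINT x|M. abs (f x * psi x))" by (rule integral_abs_bound)
 also have "... <= (LINT x|M. B * abs (f x))" by (rule integral_mono) (use i B le in auto)
 finally show "abs (LINT x|M. f x * psi x) <= B * (LINT x|M. abs (f x))" by simp
qed

text \<open>Convergence in \<open>L\<^sup>1\<close> of one factor and bounded pointwise convergence of the
 other one.\<close>
lemma L1_pairing_tendsto:
 fixes g :: "'a => real"
 assumes G: "!!n::nat. integrable M (G n)" and g: "integrable M g" and lim: "(%n. LINT x|M. abs (G n x - g x)) \<longlonglongrightarrow> 0"
  and psi: "!!n. psi n \<in> borel_measurable M" "!!n x. x \<in> space M ==> abs (psi n x) <= B"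
  and psi0: "!!x. x \<in> space M ==> (%n. psi n x) \<longlonglongrightarrow> psi0 x"
 shows "(%n. LINT x|M. G n x * psi n x) \<longlonglongrightarrow> (LINT x|M. g x * psi0 x)"
proof -
 have psi0m: "psi0 \<in> borel_measurable M" by (rule borel_measurable_LIMSEQ_real[OF psi0 psi(1)])
 have 1: "(%n. LINT x|M. g x * psi n x) \<longlonglongrightarrow> (LINT x|M. g x * psi0 x)"
 proof (rule integral_dominated_convergence[where w = "%x. B * abs (g x)"])
  show "AE x in M. norm (g x * psi n x) <= B * abs (g x)" for n
   unfolding real_norm_def abs_mult mult.commute[of B] by (intro AE_I2 mult_left_mono psi(2) abs_ge_zero)
  show "AE x in M. (%n. g x * psi n x) \<longlonglongrightarrow> g x * psi0 x" by (intro AE_I2 tendsto_intros psi0)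
 qed (use g psi(1) psi0m in auto)
 have "(%n. LINT x|M. (G n x - g x) * psi n x) \<longlonglongrightarrow> 0"
 proof (rule Lim_null_comparison[OF always_eventually])
  show "\<forall>n. norm (LINT x|M. (G n x - g x) * psi n x) <= B * (LINT x|M. abs (G n x - g x))"
   using integrable_mult_bounded(2)[OF _ psi] G g by simp
  show "(%n. B * (LINT x|M. abs (G n x - g x))) \<longlonglongrightarrow> 0" using tendsto_mult_left[OF lim, of B] by simp
 qed
 from tendsto_add[OF this 1] show ?thesis
  using integrable_mult_bounded(1)[OF G psi] integrable_mult_bounded(1)[OF g psi] by (simp add: left_diff_distrib)
qed

lemma continuous_on_integral_Ioo:
 fixes f :: "real => real"
 assumes "continuous_on {a..b} f"
 shows "integrable (leb a b) f" "(LINT x|leb a b. f x) = integral {a..b} f"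
proof -
 show 1: "integrable (leb a b) f"
  by (rule integrable_lebesgue_on_subset[OF continuous_imp_integrable_real[OF assms]]) auto
 show "(LINT x|leb a b. f x) = integral {a..b} f"
  using lebesgue_integral_eq_integral[OF 1] by (simp add: integral_open_interval_real)
qed

lemma integral_lebesgue_on_support:
 fixes f :: "'a::euclidean_space => real"
 assumes "S \<in> sets lebesgue" "T \<in> sets lebesgue" "S \<subseteq> T" "!!x. x \<in> T ==> x \<notin> S ==> f x = 0"
 shows "(LINT x|lebesgue_on T. f x) = (LINT x|lebesgue_on S. f x)"
 using assms by (auto simp: integral_restrict_space indicator_def intro!: Bochner_Integration.integral_cong)

text \<open>Distributional identities are tested on continuous curves in \<open>L\<^sup>1\<close>. The two
 arguments of such a curve need not be jointly measurable, which rules out Fubini's theorem; all limits are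
 therefore taken in iterated integrals.\<close>
definition L1_curve :: "real set => real set => (real => real => real) => bool" where
 "L1_curve J D F \<longleftrightarrow> (\<forall>t\<in>J. integrable (lebesgue_on D) (F t)) \<and>
   (\<forall>t\<in>J. ((%s. LINT x|lebesgue_on D. abs (F s x - F t x)) \<longlongrightarrow> 0) (at t within J))"

definition pairing :: "real set => (real => real => real) => (real \<times> real => real) => real => real" where
 "pairing D F psi t = (LINT x|lebesgue_on D. F t x * psi (t, x))"

lemma L1_curveD: "L1_curve J D F ==> t \<in> J ==> integrable (lebesgue_on D) (F t)"
 by (simp add: L1_curve_def)

lemma L1_curve_seq:
 assumes F: "L1_curve J D F" and t: "t \<in> J" and s: "!!k. s k \<in> J" "s \<longlonglongrightarrow> t"
 shows "(%k. LINT x|lebesgue_on D. abs (F (s k) x - F t x)) \<longlonglongrightarrow> 0"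
proof -
 have "continuous (at t within J) (%s. LINT x|lebesgue_on D. abs (F s x - F t x))"
  using F t by (simp add: L1_curve_def continuous_within)
 then show ?thesis using s unfolding continuous_within_sequentially by (auto simp: o_def)
qed

lemma L1_curve_combine:
 assumes F: "L1_curve J D F" and G: "L1_curve J D G"
 shows "L1_curve J D (%t x. F t x + sg * G t x)"
 unfolding L1_curve_def
proof (intro conjI ballI)
 show i: "integrable (lebesgue_on D) (%x. F t x + sg * G t x)" if "t \<in> J" for t
  using L1_curveD[OF F that] L1_curveD[OF G that] by simp
 fix t assume t: "t \<in> J"
 have ev: "eventually (%s. s \<in> J) (at t within J)" by (simp add: eventually_at_filter)
 show "((%s. LINT x|lebesgue_on D. abs (F s x + sg * G s x - (F t x + sg * G t x))) \<longlongrightarrow> 0) (at t within J)"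
 proof (rule Lim_null_comparison[OF eventually_mono[OF ev]])
  fix s assume s: "s \<in> J"
  note I = L1_curveD[OF F s] L1_curveD[OF F t] L1_curveD[OF G s] L1_curveD[OF G t]
  have "(LINT x|lebesgue_on D. abs (F s x + sg * G s x - (F t x + sg * G t x))) <= (LINT x|lebesgue_on D. abs (F s x - F t x) + abs sg * abs (G s x - G t x))"
  proof (rule integral_mono)
   show "abs (F s x + sg * G s x - (F t x + sg * G t x)) <= abs (F s x - F t x) + abs sg * abs (G s x - G t x)" for x
    using abs_triangle_ineq[of "F s x - F t x" "sg * (G s x - G t x)"] abs_mult[of sg "G s x - G t x"] by (simp add: algebra_simps)
  qed (use I in auto)
  then show "norm (LINT x|lebesgue_on D. abs (F s x + sg * G s x - (F t x + sg * G t x)))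
   <= (LINT x|lebesgue_on D. abs (F s x - F t x)) + abs sg * (LINT x|lebesgue_on D. abs (G s x - G t x))"
   using I by simp
 next
  show "((%s. (LINT x|lebesgue_on D. abs (F s x - F t x)) + abs sg * (LINT x|lebesgue_on D. abs (G s x - G t x))) \<longlongrightarrow> 0) (at t within J)"
   using F G t unfolding L1_curve_def by (auto intro!: tendsto_eq_intros)
 qed
qed

lemma L1_norm_continuous:
 assumes F: "L1_curve J D F"
 shows "continuous_on J (%t. LINT x|lebesgue_on D. abs (F t x))"
 unfolding continuous_on_eq_continuous_within
proof (intro ballI continuous_within_sequentiallyI)
 fix t s assume t: "t \<in> J" and s: "s \<longlonglongrightarrow> t" "\<forall>n::nat. s n \<in> J"
 have "(%n. (LINT x|lebesgue_on D. abs (F (s n) x)) - (LINT x|lebesgue_on D. abs (F t x))) \<longlonglongrightarrow> 0"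
 proof (rule Lim_null_comparison[OF always_eventually L1_curve_seq[OF F t _ s(1)]])
  show "\<forall>n. norm ((LINT x|lebesgue_on D. abs (F (s n) x)) - (LINT x|lebesgue_on D. abs (F t x))) <= (LINT x|lebesgue_on D. abs (F (s n) x - F t x))"
  proof
   fix n
   have I: "integrable (lebesgue_on D) (F (s n))" "integrable (lebesgue_on D) (F t)" using L1_curveD[OF F] s t by auto
   have "(LINT x|lebesgue_on D. abs (F (s n) x)) - (LINT x|lebesgue_on D. abs (F t x)) = (LINT x|lebesgue_on D. abs (F (s n) x) - abs (F t x))" using I by simp
   also have "norm ... <= (LINT x|lebesgue_on D. \<bar>\<bar>F (s n) x\<bar> - \<bar>F t x\<bar>\<bar>)" unfolding real_norm_def by (rule integral_abs_bound)
   also have "... <= (LINT x|lebesgue_on D. abs (F (s n) x - F t x))" by (rule integral_mono) (use I in auto)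
   finally show "norm ((LINT x|lebesgue_on D. abs (F (s n) x)) - (LINT x|lebesgue_on D. abs (F t x))) <= (LINT x|lebesgue_on D. abs (F (s n) x - F t x))" .
  qed
 qed (use s in auto)
 then show "(%n. LINT x|lebesgue_on D. abs (F (s n) x)) \<longlonglongrightarrow> (LINT x|lebesgue_on D. abs (F t x))" by (simp add: LIM_zero_iff)
qed

lemma continuous_slice_measurable:
 fixes psi :: "real \<times> real => real"
 assumes "continuous_on UNIV psi"
 shows "(%x. psi (t, x)) \<in> borel_measurable (leb a b)"
proof (rule lebesgue_on_borel(1)[OF borel_measurable_continuous_onI])
 show "continuous_on UNIV (%x. psi (t, x))" by (rule continuous_on_compose2[OF assms]) (auto intro!: continuous_intros)
qed simp

lemma pairing_continuous:
 assumes F: "L1_curve J {a<..<b} F" and psi: "continuous_on UNIV psi" "!!t x. t \<in> J ==> x \<in> {a<..<b} ==> abs (psi (t, x)) <= B"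
 shows "continuous_on J (pairing {a<..<b} F psi)"
 unfolding continuous_on_eq_continuous_within
proof (intro ballI continuous_within_sequentiallyI)
 fix t s assume t: "t \<in> J" and s: "s \<longlonglongrightarrow> t" "\<forall>n::nat. s n \<in> J"
 show "(%n. pairing {a<..<b} F psi (s n)) \<longlonglongrightarrow> pairing {a<..<b} F psi t"
  unfolding pairing_def
 proof (rule L1_pairing_tendsto[where B = B])
  show "(%n. psi (s n, x)) \<longlonglongrightarrow> psi (t, x)" for x
   by (rule continuous_on_tendsto_compose[OF psi(1)]) (auto intro!: tendsto_intros s)
  show "(%n. LINT x|leb a b. abs (F (s n) x - F t x)) \<longlonglongrightarrow> 0" by (rule L1_curve_seq[OF F t _ s(1)]) (use s in auto)
 qed (use s t psi(2) L1_curveD[OF F] continuous_slice_measurable[OF psi(1)] in auto)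
qed

text \<open>Replacing the curve by its values at the times \<open>i / k\<close> gives countably many pieces,
 each measurable by Fubini's theorem for one fixed function of \<open>x\<close>; they converge pointwise by
 continuity of the curve.\<close>
lemma pairing_measurable:
 fixes psi :: "real \<times> real => real"
 assumes F: "L1_curve {0..} {a<..<b} F" and psi [measurable]: "psi \<in> borel2" and B: "!!q. abs (psi q) <= B"
 shows "pairing {a<..<b} F psi \<in> borel_measurable (leb 0 T)"
proof -
 let ?D = "leb a b"
 have m: "(%t. LINT x|?D. f x * psi (t, x)) \<in> borel1" if f: "integrable ?D f" for f
 proof -
  obtain g where g [measurable]: "g \<in> borel1" and ae: "AE x in ?D. f x = g x"
   by (rule borel_representative[OF borel_measurable_integrable[OF f]]) auto
  have "(LINT x|?D. f x * psi (t, x)) = (LBINT x. indicator {a<..<b} x *\<^sub>R (g x * psi (t, x)))" for t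
  proof -
   have gm: "(%x. g x * psi (t, x)) \<in> borel1" by measurable
   have "(LINT x|?D. f x * psi (t, x)) = (LINT x|?D. g x * psi (t, x))"
    by (rule integral_lebesgue_on_cong_AE[OF lebesgue_on_borel(1)[OF gm]]) (use ae in \<open>auto elim!: eventually_mono\<close>)
   then show ?thesis using lebesgue_on_borel(3)[OF gm, of "{a<..<b}"] by (simp add: set_lebesgue_integral_def)
  qed
  moreover have "(%t. LBINT x. indicator {a<..<b} x *\<^sub>R (g x * psi (t, x))) \<in> borel1"
   by (rule lborel.borel_measurable_lebesgue_integral) measurable
  ultimately show ?thesis by simp
 qed
 \<comment> \<open>The curve is frozen at the time \<open>i / Suc k\<close>; the maximum keeps negative \<open>i\<close> in its domain.\<close>
 define h where "h i k t = (LINT x|?D. F (max 0 (real_of_int i / real (Suc k))) x * psi (t, x))" for i k t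
 have hm: "(%t. h \<lfloor>real (Suc k) * t\<rfloor> k t) \<in> borel1" for k
 proof (rule measurable_compose_countable[where f = "%i. h i k" and g = "%t. \<lfloor>real (Suc k) * t\<rfloor>"])
  show "h i k \<in> borel1" for i
   unfolding h_def by (rule m[OF L1_curveD[OF F]]) simp
 qed measurable
 show ?thesis
 proof (rule borel_measurable_LIMSEQ_real[where u = "%k t. h \<lfloor>real (Suc k) * t\<rfloor> k t"])
  show "(%t. h \<lfloor>real (Suc k) * t\<rfloor> k t) \<in> borel_measurable (leb 0 T)" for k
   by (rule lebesgue_on_borel(1)[OF hm]) simp
  fix t assume "t \<in> space (leb 0 T)"
  then have t: "0 < t" by simp
  define s where "s k = max 0 (real_of_int \<lfloor>real (Suc k) * t\<rfloor> / real (Suc k))" for k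
  have s0: "s k \<in> {0..}" for k by (simp add: s_def)
  have sl: "s \<longlonglongrightarrow> t"
  proof (rule tendsto_sandwich[OF always_eventually always_eventually])
   show "\<forall>k. t - 1 / real (Suc k) <= s k"
   proof
    fix k
    have "real (Suc k) * t - 1 <= real_of_int \<lfloor>real (Suc k) * t\<rfloor>" by linarith
    from divide_right_mono[OF this, of "real (Suc k)"] show "t - 1 / real (Suc k) <= s k"
     by (simp add: s_def diff_divide_distrib le_max_iff_disj del: of_nat_Suc)
   qed
   show "\<forall>k. s k <= t"
   proof
    fix k
    have "real_of_int \<lfloor>real (Suc k) * t\<rfloor> <= real (Suc k) * t" by linarith
    from divide_right_mono[OF this, of "real (Suc k)"] show "s k <= t" using t by (simp add: s_def del: of_nat_Suc)
   qed
   show "(%k. t - 1 / real (Suc k)) \<longlonglongrightarrow> t" using tendsto_diff[OF tendsto_const LIMSEQ_inverse_real_of_nat, of t] by (simp add: inverse_eq_divide)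
  qed simp
  have "(%x. psi (t, x)) \<in> borel_measurable ?D" by (rule lebesgue_on_borel(1)) simp_all
  then have "(%k. LINT x|?D. F (s k) x * psi (t, x)) \<longlonglongrightarrow> (LINT x|?D. F t x * psi (t, x))"
   by (intro L1_pairing_tendsto[where B = B] L1_curve_seq[OF F _ s0 sl] L1_curveD[OF F] s0 B tendsto_const) (use t in auto)
  then show "(%k. h \<lfloor>real (Suc k) * t\<rfloor> k t) \<longlonglongrightarrow> pairing {a<..<b} F psi t" by (simp add: h_def s_def pairing_def)
 qed
qed

lemma pairing_integrable:
 fixes psi :: "real \<times> real => real"
 assumes F: "L1_curve {0..} {a<..<b} F" and psi [measurable]: "psi \<in> borel2" and B: "!!q. abs (psi q) <= B"
 shows "integrable (leb 0 T) (pairing {a<..<b} F psi)"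
  "abs (LINT t|leb 0 T. pairing {a<..<b} F psi t) <= B * (LINT t|leb 0 T. LINT x|leb a b. abs (F t x))"
  "t >= 0 ==> integrable (leb a b) (%x. F t x * psi (t, x))"
proof -
 have psim: "(%x. psi (t, x)) \<in> borel_measurable (leb a b)" for t by (rule lebesgue_on_borel(1)) simp_all
 have le: "abs (pairing {a<..<b} F psi t) <= B * (LINT x|leb a b. abs (F t x))" if "t \<in> {0..}" for t
  unfolding pairing_def by (rule integrable_mult_bounded(2)[OF L1_curveD[OF F that] psim B])
 have i: "integrable (leb 0 T) (%t. B * (LINT x|leb a b. abs (F t x)))"
  by (intro continuous_on_integral_Ioo(1) continuous_intros continuous_on_subset[OF L1_norm_continuous[OF F]]) auto
 show 1: "integrable (leb 0 T) (pairing {a<..<b} F psi)"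
  by (rule Bochner_Integration.integrable_bound[OF i pairing_measurable[OF F psi B]])
    (use le in \<open>auto intro!: AE_I2 simp: order_trans[OF _ abs_ge_self]\<close>)
 have "abs (LINT t|leb 0 T. pairing {a<..<b} F psi t) <= (LINT t|leb 0 T. abs (pairing {a<..<b} F psi t))" by (rule integral_abs_bound)
 also have "... <= (LINT t|leb 0 T. B * (LINT x|leb a b. abs (F t x)))"
  by (rule integral_mono) (use 1 i le in auto)
 finally show "abs (LINT t|leb 0 T. pairing {a<..<b} F psi t) <= B * (LINT t|leb 0 T. LINT x|leb a b. abs (F t x))" by simp
 show "t >= 0 ==> integrable (leb a b) (%x. F t x * psi (t, x))"
  using integrable_mult_bounded(1)[OF L1_curveD[OF F] psim B] by simp
qed

lemma test_function_plane:
 fixes phi :: "real \<times> real => real"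
 assumes phi: "phi \<in> test_functions ({0<..<T} \<times> {a<..<b})"
 shows "dt phi \<in> test_functions ({0<..<T} \<times> {a<..<b})" "dx phi \<in> test_functions ({0<..<T} \<times> {a<..<b})"
  "smooth phi" "continuous_on UNIV phi" "phi \<in> borel2"
  "((%t. phi (t, x)) has_real_derivative dt phi (t, x)) (at t)"
  "(%x. phi (t, x)) \<in> test_functions {a<..<b}" "deriv (%x. phi (t, x)) x = dx phi (t, x)"
  "t \<notin> {0<..<T} ==> phi (t, x) = 0"
proof -
 obtain K where K: "smooth phi" "compact K" "K \<subseteq> {0<..<T} \<times> {a<..<b}" "!!q. q \<notin> K ==> phi q = 0"
  by (rule test_functionsE[OF phi]) (rule that)
 have "pdiff b phi q = 0" if "q \<notin> K" for b q
  using pdiff_zero_off[where phi = phi, OF compact_imp_closed[OF K(2)] _ that] K(4) by simp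
 then show "dt phi \<in> test_functions ({0<..<T} \<times> {a<..<b})" "dx phi \<in> test_functions ({0<..<T} \<times> {a<..<b})"
  by (auto intro!: test_functionsI[OF smoothD(3)[OF K(1)] K(2,3)] Basis_plane)
 show "smooth phi" "continuous_on UNIV phi" by (fact K(1) smoothD(2)[OF K(1)])+
 then show "phi \<in> borel2" by (simp add: borel_prod borel_measurable_continuous_onI)
 show "((%t. phi (t, x)) has_real_derivative dt phi (t, x)) (at t)"
  using slice_has_derivative[of phi "(0, x)" t "(1, 0)"] smoothD(1)[OF K(1)] by simp
 show "deriv (%x. phi (t, x)) x = dx phi (t, x)"
  using DERIV_imp_deriv[OF slice_has_derivative[of phi "(t, 0)" x "(0, 1)"]] smoothD(1)[OF K(1)] by simp
 show "(%x. phi (t, x)) \<in> test_functions {a<..<b}"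
 proof (rule test_functionsI)
  show "smooth (%x. phi (t, x))" using smooth_slice[OF Basis_plane(2) K(1), of "(t, 0)"] by simp
  show "compact (snd ` K)" by (rule compact_continuous_image[OF _ K(2)]) (intro continuous_intros)
  show "snd ` K \<subseteq> {a<..<b}" using K(3) by auto
  show "phi (t, x) = 0" if "x \<notin> snd ` K" for x using that K(4)[of "(t, x)"] by force
 qed
 show "t \<notin> {0<..<T} ==> phi (t, x) = 0" using K(3) K(4)[of "(t, x)"] by blast
qed

text \<open>Integration by parts in time: the pairing is continuously differentiable and vanishes at both
 ends.\<close>
lemma pairing_time_derivative:
 assumes F: "L1_curve {0..} {a<..<b} F" and V: "L1_curve {0..} {a<..<b} V"
  and d: "!!t. t >= 0 ==> ((%s. LINT x|leb a b. abs ((F s x - F t x) / (s - t) - V t x)) \<longlongrightarrow> 0) (at t within {0..})"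
  and phi: "phi \<in> test_functions ({0<..<T} \<times> {a<..<b})" and T: "0 < T"
 shows "(LINT t|leb 0 T. pairing {a<..<b} V phi t) = - (LINT t|leb 0 T. pairing {a<..<b} F (dt phi) t)"
proof -
 let ?D = "leb a b" and ?phi1 = "dt phi"
 note P = test_function_plane[OF phi] and P1 = test_function_plane[OF test_function_plane(1)[OF phi]]
 obtain M where M: "!!q. abs (phi q) <= M" using test_function_bounded[OF phi] by blast
 obtain M1 where M1: "!!q. abs (?phi1 q) <= M1" using test_function_bounded[OF P(1)] by blast
 note m = continuous_slice_measurable[OF P(4)] and m1 = continuous_slice_measurable[OF P1(4)]
 let ?q = "pairing {a<..<b} F phi"
 let ?q' = "%t. pairing {a<..<b} V phi t + pairing {a<..<b} F ?phi1 t"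
 have q: "(?q has_real_derivative ?q' t) (at t within {0..})" if t: "t \<in> {0..}" for t
  unfolding has_field_derivative_iff tendsto_at_iff_sequentially
 proof (intro allI impI)
  fix X assume X: "\<forall>i. X i \<in> {0..} - {t}" "X \<longlonglongrightarrow> t"
  let ?Q = "%n x. (phi (X n, x) - phi (t, x)) / (X n - t)"
  have Q: "?Q n \<in> borel_measurable ?D" "abs (?Q n x) <= M1" "(%n. ?Q n x) \<longlonglongrightarrow> ?phi1 (t, x)" for n x
  proof -
   show "?Q n \<in> borel_measurable ?D" using m by measurable
   have "norm (phi (X n, x) - phi (t, x)) <= M1 * norm (X n - t)"
    by (rule field_differentiable_bound[of UNIV "%t. phi (t, x)" "%t. ?phi1 (t, x)"]) (use P(6) M1 in auto)
   then show "abs (?Q n x) <= M1" using X(1)[rule_format, of n] by (simp add: divide_le_eq)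
   show "(%n. ?Q n x) \<longlonglongrightarrow> ?phi1 (t, x)"
    using P(6)[of x t] X unfolding has_field_derivative_iff tendsto_at_iff_sequentially by (auto simp: o_def)
  qed
  have D: "integrable ?D (%x. (F (X n) x - F t x) / (X n - t))" for n
   using L1_curveD[OF F, of "X n"] L1_curveD[OF F t] X(1) by auto
  have 1: "(%n. LINT x|?D. (F (X n) x - F t x) / (X n - t) * phi (X n, x)) \<longlonglongrightarrow> pairing {a<..<b} V phi t"
   unfolding pairing_def
  proof (rule L1_pairing_tendsto[OF D L1_curveD[OF V t] _ m M])
   show "(%n. LINT x|?D. abs ((F (X n) x - F t x) / (X n - t) - V t x)) \<longlonglongrightarrow> 0"
    using d[of t] t X unfolding tendsto_at_iff_sequentially by (auto simp: o_def)
   show "(%n. phi (X n, x)) \<longlonglongrightarrow> phi (t, x)" for x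
    by (rule continuous_on_tendsto_compose[OF P(4)]) (auto intro!: tendsto_intros X)
  qed
  have 2: "(%n. LINT x|?D. F t x * ?Q n x) \<longlonglongrightarrow> pairing {a<..<b} F ?phi1 t"
   unfolding pairing_def by (rule L1_pairing_tendsto[OF L1_curveD[OF F t] L1_curveD[OF F t] _ Q]) simp
  have "(?q (X n) - ?q t) / (X n - t) = (LINT x|?D. (F (X n) x - F t x) / (X n - t) * phi (X n, x)) + (LINT x|?D. F t x * ?Q n x)" for n
  proof -
   have Xn: "X n \<in> {0..}" "X n \<noteq> t" using X(1) by auto
   have i: "integrable ?D (%x. F (X n) x * phi (X n, x))" "integrable ?D (%x. F t x * phi (t, x))"
    using integrable_mult_bounded(1)[OF L1_curveD[OF F] m M] Xn t by auto
   have "(LINT x|?D. (F (X n) x - F t x) / (X n - t) * phi (X n, x)) + (LINT x|?D. F t x * ?Q n x)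
    = (LINT x|?D. (F (X n) x - F t x) / (X n - t) * phi (X n, x) + F t x * ?Q n x)"
    using integrable_mult_bounded(1)[OF D m M] integrable_mult_bounded(1)[OF L1_curveD[OF F t] Q(1,2)] by simp
   also have "... = (LINT x|?D. (F (X n) x * phi (X n, x) - F t x * phi (t, x)) / (X n - t))"
    by (intro integral_cong_space) (simp add: diff_divide_distrib algebra_simps)
   also have "... = (?q (X n) - ?q t) / (X n - t)" using i by (simp add: pairing_def)
   finally show ?thesis by simp
  qed
  then show "((%s. (?q s - ?q t) / (s - t)) \<circ> X) \<longlonglongrightarrow> ?q' t" using tendsto_add[OF 1 2] by (simp add: o_def)
 qed
 have c: "continuous_on {0..T} (pairing {a<..<b} V phi)" "continuous_on {0..T} (pairing {a<..<b} F ?phi1)"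
  by (rule continuous_on_subset[OF pairing_continuous[OF V P(4) M]] continuous_on_subset[OF pairing_continuous[OF F P1(4) M1]]; simp)+
 have "(?q' has_integral ?q T - ?q 0) {0..T}"
 proof (rule fundamental_theorem_of_calculus)
  show "(?q has_vector_derivative ?q' t) (at t within {0..T})" if "t \<in> {0..T}" for t
   by (rule has_vector_derivative_within_subset[where S = "{0..}"])
     (use q[of t] that in \<open>auto simp: has_real_derivative_iff_has_vector_derivative\<close>)
 qed (use T in simp)
 moreover have "?q T = 0" "?q 0 = 0" using P(9) by (simp_all add: pairing_def)
 ultimately have "integral {0..T} ?q' = 0" by (auto dest: integral_unique)
 then have "(LINT t|leb 0 T. ?q' t) = 0" using continuous_on_integral_Ioo(2)[OF continuous_on_add[OF c]] by simp
 then show ?thesis using continuous_on_integral_Ioo(1)[OF c(1)] continuous_on_integral_Ioo(1)[OF c(2)] by simp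
qed


lemma L1_curve_of_Lp:
 assumes p: "p >= 1" and F: "F \<in> C0_curve J (Lp p {a<..<b}) (Lp_norm p {a<..<b})"
 shows "L1_curve J {a<..<b} F"
 unfolding L1_curve_def
proof (intro conjI ballI)
 have p0: "p > 0" using p by simp
 fix t assume t: "t \<in> J"
 have Lp: "F s \<in> Lp p {a<..<b}" if "s \<in> J" for s using F that by (simp add: C0_curve_def)
 show "integrable (leb a b) (F t)"
  by (rule finite_measure.integrable_of_powr[OF finite_measure_Ioo p LpD[OF Lp[OF t]]])
 show "((%s. LINT x|leb a b. abs (F s x - F t x)) \<longlongrightarrow> 0) (at t within J)"
 proof (rule finite_measure.L1_tendsto_0_of_Lp[OF finite_measure_Ioo p])
  have "eventually (%s. s \<in> J) (at t within J)" by (simp add: eventually_at_filter)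
  then show "\<forall>\<^sub>F s in at t within J. (%x. F s x - F t x) \<in> borel_measurable (leb a b) \<and> integrable (leb a b) (%x. abs (F s x - F t x) powr p)"
   by (rule eventually_mono) (use LpD[OF Lp_diff[OF p0 Lp Lp[OF t]]] in blast)
  show "((%s. LINT x|leb a b. abs (F s x - F t x) powr p) \<longlongrightarrow> 0) (at t within J)"
   using F t unfolding C0_curve_def Lp_norm_tendsto_0_iff[OF p0] by simp
 qed
qed

lemma test_function_finite_time:
 fixes phi :: "real \<times> real => real"
 assumes "phi \<in> test_functions ({0<..} \<times> {a<..<b})"
 obtains T where "0 < T" "phi \<in> test_functions ({0<..<T} \<times> {a<..<b})"
proof -
 obtain K where K: "smooth phi" "compact K" "K \<subseteq> {0<..} \<times> {a<..<b}" "!!q. q \<notin> K ==> phi q = 0"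
  by (rule test_functionsE[OF assms]) (rule that)
 obtain r where r: "!!q. q \<in> K ==> norm q <= r" using compact_imp_bounded[OF K(2)] by (auto simp: bounded_iff)
 have "fst q < abs r + 1" if "q \<in> K" for q using r[OF that] norm_fst_le[of "fst q" "snd q"] by simp
 then have "K \<subseteq> {0<..<\<bar>r\<bar> + 1} \<times> {a<..<b}" using K(3) by fastforce
 from test_functionsI[OF K(1,2) this K(4)] show thesis by (intro that[of "abs r + 1"]) auto
qed

lemma C1_curve_L1:
 assumes p: "p >= 1" and u: "u \<in> C1_curve {0..} (Lp p {a<..<b}) (Lp_norm p {a<..<b})"
 defines "v \<equiv> curve_deriv {0..} (Lp p {a<..<b}) (Lp_norm p {a<..<b}) u"
 shows "L1_curve {0..} {a<..<b} u" "L1_curve {0..} {a<..<b} v"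
  "t >= 0 ==> ((%s. LINT x|leb a b. abs ((u s x - u t x) / (s - t) - v t x)) \<longlongrightarrow> 0) (at t within {0..})"
proof -
 have p0: "p > 0" using p by simp
 show "L1_curve {0..} {a<..<b} u" "L1_curve {0..} {a<..<b} v"
  using u by (auto simp: C1_curve_def v_def intro!: L1_curve_of_Lp[OF p])
 have uL: "u t \<in> Lp p {a<..<b}" and vL: "v t \<in> Lp p {a<..<b}" if "t >= 0" for t
  using u that by (auto simp: C1_curve_def C0_curve_def v_def)
 assume t: "t >= 0"
 have "\<exists>w. has_curve_deriv {0..} (Lp p {a<..<b}) (Lp_norm p {a<..<b}) u w t" using u t by (simp add: C1_curve_def)
 from someI_ex[OF this] have "has_curve_deriv {0..} (Lp p {a<..<b}) (Lp_norm p {a<..<b}) u (v t) t"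
  by (simp add: curve_deriv_def v_def)
 then have lim: "((%s. LINT x|leb a b. abs ((u s x - u t x) / (s - t) - v t x) powr p) \<longlongrightarrow> 0) (at t within {0..})"
  unfolding has_curve_deriv_def Lp_norm_tendsto_0_iff[OF p0] by simp
 have ev: "eventually (%s. s \<in> {0..}) (at t within {0..})" by (simp add: eventually_at_filter)
 show "((%s. LINT x|leb a b. abs ((u s x - u t x) / (s - t) - v t x)) \<longlongrightarrow> 0) (at t within {0..})"
 proof (rule finite_measure.L1_tendsto_0_of_Lp[OF finite_measure_Ioo p eventually_mono[OF ev] lim])
  fix s :: real assume s: "s \<in> {0..}"
  have "(%x. 1 / (s - t) * (u s x - u t x) - v t x) \<in> Lp p {a<..<b}"
   by (intro Lp_diff[OF p0] Lp_cmult uL vL) (use s t in auto)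
  from LpD[OF this] show "(%x. (u s x - u t x) / (s - t) - v t x) \<in> borel_measurable (leb a b) \<and>
   integrable (leb a b) (%x. abs ((u s x - u t x) / (s - t) - v t x) powr p)" by simp
 qed
qed

text \<open>Integration by parts once in time and once in space turns the second order equation into a first
 order system for \<open>v = u\<^sub>t\<close> and \<open>d = u\<^sub>x\<close>. The second identity is the
 compatibility \<open>u\<^sub>x\<^sub>t = u\<^sub>t\<^sub>x\<close>; it presupposes that the mixed derivatives
 of the test function coincide.\<close>
lemma wave_pairing:
 fixes b :: "real \<times> real => real"
 assumes C: "L1_curve {0..} {l<..<r} u" "L1_curve {0..} {l<..<r} v" "L1_curve {0..} {l<..<r} d"
  and der: "!!t. t >= 0 ==> ((%s. LINT x|leb l r. abs ((u s x - u t x) / (s - t) - v t x)) \<longlongrightarrow> 0) (at t within {0..})"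
  and wd: "!!t. t >= 0 ==> is_weak_deriv {l<..<r} (u t) (d t)"
  and b [measurable]: "b \<in> borel2" and bA: "!!q. abs (b q) <= A"
  and phi: "phi \<in> test_functions ({0<..<T} \<times> {l<..<r})" and T: "0 < T"
 defines "I \<equiv> %F psi. LINT t|leb 0 T. pairing {l<..<r} F psi t"
 shows "(LINT t|lebesgue_on {0<..}. LINT x|leb l r. u t x * dt (dt phi) (t, x) - u t x * dx (dx phi) (t, x)
    + b (t, x) * v t x * phi (t, x)) = I d (dx phi) - I v (dt phi) + I v (%q. b q * phi q)"
  "dx (dt phi) = dt (dx phi) ==> I d (dt phi) = I v (dx phi)"
proof -
 note P = test_function_plane[OF phi]
 note P11 = test_function_plane[OF test_function_plane(1)[OF P(1)]] and P22 = test_function_plane[OF test_function_plane(2)[OF P(2)]]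
 obtain M where M: "M >= 0" "!!q. abs (phi q) <= M" using test_function_bounded[OF phi] by blast
 obtain M11 where M11: "!!q. abs (dt (dt phi) q) <= M11" using test_function_bounded[OF test_function_plane(1)[OF P(1)]] by blast
 obtain M22 where M22: "!!q. abs (dx (dx phi) q) <= M22" using test_function_bounded[OF test_function_plane(2)[OF P(2)]] by blast
 note [measurable] = P(5)
 have bm: "(%q. b q * phi q) \<in> borel2" by measurable
 have bM: "abs (b q * phi q) <= A * M" for q
  unfolding abs_mult using bA[of q] M by (intro mult_mono) auto
 have spaceI: "I u (dx psi) = - I d psi" if "psi \<in> test_functions ({0<..<T} \<times> {l<..<r})" for psi
 proof -
  have "pairing {l<..<r} u (dx psi) t = - pairing {l<..<r} d psi t" if "t >= 0" for t
   using bspec[OF wd[OF that, unfolded is_weak_deriv_def] test_function_plane(7)] test_function_plane(8) \<open>psi \<in> _\<close>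
   by (simp add: pairing_def)
  then have "I u (dx psi) = (LINT t|leb 0 T. - pairing {l<..<r} d psi t)"
   unfolding I_def by (intro integral_cong_space) simp
  then show ?thesis by (simp add: I_def)
 qed
 have time: "I v psi = - I u (dt psi)" if "psi \<in> test_functions ({0<..<T} \<times> {l<..<r})" for psi
  unfolding I_def by (rule pairing_time_derivative[OF C(1,2) _ that T]) (rule der)
 let ?W = "%t. LINT x|leb l r. u t x * dt (dt phi) (t, x) - u t x * dx (dx phi) (t, x)
    + b (t, x) * v t x * phi (t, x)"
 have "(LINT t|lebesgue_on {0<..}. ?W t) = (LINT t|leb 0 T. ?W t)"
  by (rule integral_lebesgue_on_support) (auto simp: P(9) P11(9) P22(9))
 also have "... = (LINT t|leb 0 T. pairing {l<..<r} u (dt (dt phi)) t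
   - pairing {l<..<r} u (dx (dx phi)) t + pairing {l<..<r} v (%q. b q * phi q) t)"
 proof (rule integral_cong_space)
  fix t assume "t \<in> space (leb 0 T)"
  then have t: "0 <= t" by simp
  show "?W t = pairing {l<..<r} u (dt (dt phi)) t - pairing {l<..<r} u (dx (dx phi)) t
   + pairing {l<..<r} v (%q. b q * phi q) t"
   using pairing_integrable(3)[OF C(1) P11(5) M11 t] pairing_integrable(3)[OF C(1) P22(5) M22 t] pairing_integrable(3)[OF C(2) bm bM t]
   by (simp add: pairing_def mult.left_commute mult.assoc)
 qed
 also have "... = I u (dt (dt phi)) - I u (dx (dx phi)) + I v (%q. b q * phi q)"
  unfolding I_def using pairing_integrable(1)[OF C(1) P11(5) M11] pairing_integrable(1)[OF C(1) P22(5) M22] pairing_integrable(1)[OF C(2) bm bM] by simp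
 also have "... = I d (dx phi) - I v (dt phi) + I v (%q. b q * phi q)" using time[OF P(1)] spaceI[OF P(2)] by simp
 finally show "(LINT t|lebesgue_on {0<..}. ?W t) = I d (dx phi) - I v (dt phi) + I v (%q. b q * phi q)" .
 show "I d (dt phi) = I v (dx phi)" if "dx (dt phi) = dt (dx phi)"
  using spaceI[OF P(1)] time[OF P(2)] that by simp
qed

section \<open>The weak solution\<close>

text \<open>Adds the displacement: \<open>h0\<close> folds the initial Riemann invariants, so its odd part
 determines the derivative of \<open>u0\<close>.\<close>
locale damped_wave = characteristics p c A \<alpha> h0
 for p c A :: real and \<alpha> :: "real => real => real" and h0 :: "real => real" +
 fixes \<kappa> :: real and u0 :: "real => real"
 assumes \<kappa>: "0 < \<kappa>" and c_def: "c = (1 - \<kappa>) / (1 + \<kappa>)"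
  and u0_measurable [measurable]: "u0 \<in> borel1"
  and u0_Lp: "u0 \<in> Lp p \<J>"
  and u0_deriv: "is_weak_deriv \<J> u0 (%x. (h0 (- x) - h0 x) / 2)"
begin

definition u :: "real => real => real" where "u t x = u0 x + Iu t x"

lemma p0: "p > 0" "p >= 1" using p by simp_all

lemma u_measurable [measurable (raw)]:
 assumes [measurable]: "f \<in> borel_measurable M" "g \<in> borel_measurable M"
 shows "(%x. u (f x) (g x)) \<in> borel_measurable M"
 unfolding u_def by measurable

lemma ut_slice [measurable]: "ut t \<in> borel1" "ux t \<in> borel1"
 by measurable

lemma u_slice [measurable]: "u t \<in> borel1" "Iu t \<in> borel1"
 by measurable

lemma Lp_of_borel:
 fixes f :: "real => real"
 assumes [measurable]: "f \<in> borel1" and i: "lint {a..b} (%x. abs (f x) powr p)"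
 shows "f \<in> Lp p {a<..<b}"
proof -
 have m: "(%x. abs (f x) powr p) \<in> borel1" by measurable
 show ?thesis using lborel_Ioo_Icc(2)[OF m] i lebesgue_on_borel(1)[OF assms(1), of "{a<..<b}"] by (simp add: Lp_def)
qed

lemma ut_Lp: "0 <= t ==> ut t \<in> Lp p \<J>" and ux_Lp: "0 <= t ==> ux t \<in> Lp p \<J>"
 by (auto intro!: Lp_of_borel ut_powr)

lemma u_Lp: assumes t: "0 <= t" shows "u t \<in> Lp p \<J>"
proof -
 obtain D where D: "D >= 0" "!!s x. s \<in> {0..t} ==> x \<in> {0..1} ==> abs (Iu s x) <= D"
  by (rule Iu_bound[of t]) (rule that)
 have "\<bar>\<bar>Iu t x\<bar> powr p\<bar> <= D powr p" if "x \<in> {0..1}" for x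
  using D(2)[of t x] that t p0 by (auto intro!: powr_mono2)
 then have "Iu t \<in> Lp p \<J>"
  by (intro Lp_of_borel set_integrable_bounded[where B = "D powr p"]) auto
 from Lp_add[OF p0(1) u0_Lp this] show ?thesis by (simp add: u_def[abs_def])
qed

lemma Lp_integrable: "f \<in> Lp p {a<..<b::real} ==> integrable (leb a b) f"
 by (rule finite_measure.integrable_of_powr[OF finite_measure_Ioo p0(2) LpD])

text \<open>Test functions that do not depend on time, inserted in the compatibility identity.\<close>
lemma u_weak_deriv: assumes t: "0 <= t" shows "is_weak_deriv \<J> (u t) (ux t)"
 unfolding is_weak_deriv_def
proof
 fix om assume om: "om \<in> test_functions \<J>"
 note d = test_function_deriv[OF om]
 have [measurable]: "om \<in> borel1" "deriv om \<in> borel1"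
  using d(3,4) by (auto intro: borel_measurable_continuous_onI)
 have c2: "continuous_on UNIV (%(t::real, x). f x)" if "continuous_on UNIV f" for f :: "real => real"
  unfolding case_prod_beta by (rule continuous_on_compose2[OF that]) (auto intro!: continuous_intros)
 have D1: "((%t. om (xi + t)) has_real_derivative 0 + deriv om (xi + t)) (at t)" for xi t
  using DERIV_chain2[OF d(2) DERIV_add[OF DERIV_const[of xi] DERIV_ident]] by simp
 have D2: "((%t. om (xi - t)) has_real_derivative 0 - deriv om (xi - t)) (at t)" for xi t
  using DERIV_chain2[OF d(2) DERIV_diff[OF DERIV_const[of xi] DERIV_ident]] by simp
 have "(LBINT x:{0..1}. ux t x * om x) - (LBINT x:{0..1}. ux 0 x * om x)
   = (LBINT s:{0..t}. LBINT x:{0..1}. ux s x * 0 - ut s x * deriv om x)"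
  by (rule transport_pair(2)[where phi = "%_. om" and phit = "%_ _. 0" and phix = "%_. deriv om", OF c2[OF d(3)] c2 c2[OF d(4)] D1 D2 _ t])
    (use d(5,6) in auto)
 also have "... = - (LBINT s:{0..t}. LBINT x:{0..1}. ut s x * deriv om x)" by (simp add: set_lebesgue_integral_def)
 also have "(LBINT s:{0..t}. LBINT x:{0..1}. ut s x * deriv om x) = (LBINT x:{0..1}. Iu t x * deriv om x)"
 proof -
  obtain B where B: "B >= 0" "!!s x. s \<in> {0..t} ==> abs (ut s x) <= B * env s x"
   by (rule ut_env_bound) blast
  obtain M where M: "M >= 0" "!!x. abs (deriv om x) <= M" using test_function_bounded[OF d(1)] by blast
  have "(LBINT s:{0..t}. LBINT x:{0..1}. ut s x * deriv om x) = (LBINT x:{0..1}. LBINT s:{0..t}. ut s x * deriv om x)"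
  proof (rule strip_Fubini(1)[where C = "B * M"])
   show "(%(s, x). ut s x * deriv om x) \<in> borel2" unfolding case_prod_beta by measurable
   show "abs (ut s x * deriv om x) <= B * M * env s x" if "s \<in> {0..t}" for s x
    unfolding abs_mult using mult_mono[OF B(2)[OF that, of x] M(2)[of x]] M(1) B(2)[OF that, of x] by (simp add: ac_simps)
  qed (use B M in auto)
  then show ?thesis by (simp add: Iu_def)
 qed
 finally have 1: "(LBINT x:{0..1}. Iu t x * deriv om x) = (LBINT x:{0..1}. ux 0 x * om x) - (LBINT x:{0..1}. ux t x * om x)" by simp
 have ux0: "ux 0 = (%x. (h0 (- x) - h0 x) / 2)" by (simp add: ux_def[abs_def] z_initial)
 have "(LINT x|\<U>. u t x * deriv om x) = (LINT x|\<U>. u0 x * deriv om x) + (LINT x|\<U>. Iu t x * deriv om x)"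
 proof -
  have c: "continuous_on {0..1} (deriv om)" using d(4) continuous_on_subset by blast
  have i0: "integrable \<U> (%x. u0 x * deriv om x)"
   by (rule integrable_mult_continuous[OF Lp_integrable[OF u0_Lp] c])
  have "integrable \<U> (%x. u t x * deriv om x)"
   by (rule integrable_mult_continuous[OF Lp_integrable[OF u_Lp[OF t]] c])
  then have "integrable \<U> (%x. u t x * deriv om x - u0 x * deriv om x)" using i0 by simp
  then have "integrable \<U> (%x. Iu t x * deriv om x)" by (simp add: u_def algebra_simps)
  then show ?thesis using i0 by (simp add: u_def distrib_right)
 qed
 also have "(LINT x|\<U>. Iu t x * deriv om x) = (LBINT x:{0..1}. Iu t x * deriv om x)"
  by (rule lborel_Ioo_Icc) measurable
 also have "(LINT x|\<U>. u0 x * deriv om x) = - (LINT x|\<U>. ux 0 x * om x)"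
  using u0_deriv om by (simp add: is_weak_deriv_def ux0)
 also have "(LINT x|\<U>. ux 0 x * om x) = (LBINT x:{0..1}. ux 0 x * om x)"
  by (rule lborel_Ioo_Icc) measurable
 also have "- (LBINT x:{0..1}. ux 0 x * om x) + (LBINT x:{0..1}. Iu t x * deriv om x) = - (LBINT x:{0..1}. ux t x * om x)"
  using 1 by simp
 also have "(LBINT x:{0..1}. ux t x * om x) = (LINT x|\<U>. ux t x * om x)"
  by (rule lborel_Ioo_Icc[symmetric]) measurable
 finally show "(LINT x|\<U>. u t x * deriv om x) = - (LINT x|\<U>. ux t x * om x)" .
qed

lemma u_curve_deriv: assumes t: "0 <= t"
 shows "has_curve_deriv {0..} (Lp p \<J>) (Lp_norm p \<J>) u (ut t) t"
 unfolding has_curve_deriv_def Lp_norm_tendsto_0_iff[OF p0(1)]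
proof
 have "(LINT x|\<U>. abs ((u s x - u t x) / (s - t) - ut t x) powr p) = (LBINT x:{0..1}. abs ((Iu s x - Iu t x) / (s - t) - ut t x) powr p)" for s
 proof -
  have "(LINT x|\<U>. abs ((Iu s x - Iu t x) / (s - t) - ut t x) powr p) = (LBINT x:{0..1}. abs ((Iu s x - Iu t x) / (s - t) - ut t x) powr p)"
   by (rule lborel_Ioo_Icc) measurable
  then show ?thesis by (simp add: u_def)
 qed
 then show "((%s. LINT x|\<U>. abs ((u s x - u t x) / (s - t) - ut t x) powr p) \<longlongrightarrow> 0) (at t within {0..})"
  using Iu_derivative[OF t] by simp
qed (rule ut_Lp[OF t])

lemma time_deriv_AE: "0 <= t ==> AE x in \<U>. ut t x = time_deriv p u t x"
 using curve_deriv_AE(2)[OF p0(1) u_Lp _ u_curve_deriv] by simp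

lemma ut_C0: "ut \<in> C0_curve {0..} (Lp p \<J>) (Lp_norm p \<J>)"
 and ux_C0: "ux \<in> C0_curve {0..} (Lp p \<J>) (Lp_norm p \<J>)"
proof -
 have "(LINT x|\<U>. abs (ut s x - ut t x) powr p) = (LBINT x:{0..1}. abs (ut s x - ut t x) powr p)"
  "(LINT x|\<U>. abs (ux s x - ux t x) powr p) = (LBINT x:{0..1}. abs (ux s x - ux t x) powr p)" for s t
  by (rule lborel_Ioo_Icc; measurable)+
 then show "ut \<in> C0_curve {0..} (Lp p \<J>) (Lp_norm p \<J>)"
  "ux \<in> C0_curve {0..} (Lp p \<J>) (Lp_norm p \<J>)"
  unfolding C0_curve_def Lp_norm_tendsto_0_iff[OF p0(1)]
  using ut_continuous ut_Lp ux_Lp by auto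
qed

lemma u_C1: "u \<in> C1_curve {0..} (Lp p \<J>) (Lp_norm p \<J>)"
proof -
 have "u \<in> C0_curve {0..} (Lp p \<J>) (Lp_norm p \<J>)"
  using u_Lp has_curve_deriv_imp_continuous[OF p0(1) u_Lp _ u_curve_deriv] by (auto simp: C0_curve_def)
 moreover have "time_deriv p u \<in> C0_curve {0..} (Lp p \<J>) (Lp_norm p \<J>)"
  by (rule C0_curve_AE_cong[OF p0(1) ut_C0]) (use time_deriv_AE in auto)
 ultimately show ?thesis using u_curve_deriv by (auto simp: C1_curve_def)
qed

lemma space_deriv_AE: "0 <= t ==> AE x in \<U>. ux t x = space_deriv u t x"
 by (rule weak_deriv_AE(1)[OF p0(2) ux_Lp u_weak_deriv]) auto

lemma u_W1p: "u \<in> C0_curve {0..} (W1p p \<J>) (W1p_norm p \<J>)"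
 unfolding C0_curve_def
proof (intro CollectI conjI ballI)
 fix t :: real assume "t \<in> {0..}"
 then have t: "0 <= t" by simp
 show "u t \<in> W1p p \<J>" using u_Lp[OF t] ux_Lp[OF t] u_weak_deriv[OF t] by (auto simp: W1p_def)
 have "((%s. Lp_norm p \<J> (%x. u s x - u t x) + Lp_norm p \<J> (%x. ux s x - ux t x)) \<longlongrightarrow> 0 + 0) (at t within {0..})"
  using u_C1 ux_C0 t by (intro tendsto_add) (auto simp: C1_curve_def C0_curve_def)
 moreover have "eventually (%s. s \<in> {0..}) (at t within {0..})" by (simp add: eventually_at_filter)
 then have "eventually (%s. Lp_norm p \<J> (%x. u s x - u t x) + Lp_norm p \<J> (%x. ux s x - ux t x) = W1p_norm p \<J> (%x. u s x - u t x)) (at t within {0..})"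
 proof (rule eventually_mono)
  fix s :: real assume "s \<in> {0..}"
  then have s: "0 <= s" by simp
  have d: "(%x. ux s x - ux t x) \<in> Lp p \<J>" by (rule Lp_diff[OF p0(1) ux_Lp[OF s] ux_Lp[OF t]])
  have w: "is_weak_deriv \<J> (%x. u s x - u t x) (%x. ux s x - ux t x)"
   by (intro is_weak_deriv_diff Lp_integrable u_Lp ux_Lp u_weak_deriv s t)
  note W = weak_deriv_AE[OF p0(2) d w zero_less_one]
  show "Lp_norm p \<J> (%x. u s x - u t x) + Lp_norm p \<J> (%x. ux s x - ux t x) = W1p_norm p \<J> (%x. u s x - u t x)"
   unfolding W1p_norm_def using Lp_norm_AE_cong[OF W(1) LpD(1)[OF d] LpD(1)[OF W(2)]] by simp
 qed
 ultimately show "((%s. W1p_norm p \<J> (%x. u s x - u t x)) \<longlongrightarrow> 0) (at t within {0..})"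
  using Lim_transform_eventually by fastforce
qed

text \<open>The trace at \<open>x\<close> of \<open>u\<^sub>t\<close> for \<open>sg = 1\<close> and of
 \<open>u\<^sub>x\<close> for \<open>sg = - 1\<close>. At the boundary points both invariants are taken from
 inside the interval, hence \<open>Zc\<close> instead of \<open>z\<close>.\<close>
definition trace_curve :: "real => real => real => real" where
 "trace_curve sg x t = (Zc (- 1) t (- x - t) + sg * Zc 0 t (x - t)) / 2"

lemma trace_slice [measurable]: "trace_curve sg x \<in> borel1"
 unfolding trace_curve_def[abs_def] by measurable

lemma trace_curve_C0:
 assumes sg: "abs sg = 1" and T: "0 < T"
 shows "trace_curve sg \<in> C0_curve {0..1} (Lp p {0<..<T}) (Lp_norm p {0<..<T})"
proof -
 obtain B where B: "B >= 0" "!!n t xi. entry n xi <= t ==> t <= T ==> abs (Zc n t xi) <= B * (1 + abs (h0 xi))"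
  by (rule k_bound_exists[of T]) blast
 let ?e = "%xi. abs B powr p * (1 + abs (h0 xi)) powr p"
 have G: "lint {0..T} (%t. abs (Zc 0 t (x - t)) powr p)" if x: "x \<in> {0..1}" for x
 proof (rule set_integrable_le[OF shifted_integrable(2)[of ?e 0 T x, OF envelope_integrable]])
  show "\<bar>\<bar>Zc 0 t (x - t)\<bar> powr p\<bar> <= ?e (x - t)" if "t \<in> {0..T}" for t
   using powr_const_le[OF abs_ge_zero B(2)[of 0 "x - t" t]] that x p0 by (auto simp: entry_def)
 qed auto
 have F: "lint {0..T} (%t. abs (Zc (- 1) t (- x - t)) powr p)" if x: "x \<in> {0..1}" for x
 proof (rule set_integrable_le[OF shifted_integrable(2)[of ?e 0 T "- x", OF envelope_integrable]])
  show "\<bar>\<bar>Zc (- 1) t (- x - t)\<bar> powr p\<bar> <= ?e (- x - t)" if "t \<in> {0..T}" for t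
   using powr_const_le[OF abs_ge_zero B(2)[of "- 1" "- x - t" t]] that x p0 by (auto simp: entry_def)
 qed auto
 have hp: "abs ((a + sg * b) / 2) powr p <= abs a powr p + abs b powr p" for a b
  using half_powr_le(1)[OF p0(1), of a "sg * b"] sg by (simp add: abs_mult)
 have mem: "trace_curve sg x \<in> Lp p {0<..<T}" if x: "x \<in> {0..1}" for x
 proof (rule Lp_of_borel[OF trace_slice set_integrable_le[OF set_integral_add(1)[OF F[OF x] G[OF x]]]])
  show "\<bar>\<bar>trace_curve sg x t\<bar> powr p\<bar> <= \<bar>Zc (- 1) t (- x - t)\<bar> powr p + \<bar>Zc 0 t (x - t)\<bar> powr p" for t
   using hp by (simp add: trace_curve_def)
 qed auto
 have lim: "((%x. LBINT t:{0..T}. abs (trace_curve sg x t - trace_curve sg x0 t) powr p) \<longlongrightarrow> 0) (at x0 within {0..1})"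
  if x0: "x0 \<in> {0..1}" for x0
 proof -
  let ?DG = "%x t. abs (Zc 0 t (x - t) - Zc 0 t (x0 - t)) powr p"
  let ?DF = "%x t. abs (Zc (- 1) t (- x - t) - Zc (- 1) t (- x0 - t)) powr p"
  have g: "((%x. LBINT t:{0..T}. ?DG x t) \<longlongrightarrow> 0) (at x0 within {0..1})"
   using trace_continuous[of x0 0 T] x0 T by simp
  have "((%y. LBINT t:{0..T}. abs (Zc (- 1) t (y - t) - Zc (- 1) t (- x0 - t)) powr p) \<longlongrightarrow> 0) (at (- x0) within {- 1..0})"
   using trace_continuous[of "- x0" "- 1" T] x0 T by simp
  moreover have "filterlim uminus (at (- x0) within {- 1..0}) (at x0 within {0..1})"
   unfolding filterlim_at by (auto intro!: tendsto_eq_intros simp: eventually_at_filter)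
  ultimately have f: "((%x. LBINT t:{0..T}. ?DF x t) \<longlongrightarrow> 0) (at x0 within {0..1})"
   by (rule filterlim_compose)
  have sum: "((%x. (LBINT t:{0..T}. ?DF x t) + (LBINT t:{0..T}. ?DG x t)) \<longlongrightarrow> 0) (at x0 within {0..1})"
   using tendsto_add[OF f g] by simp
  have ev: "eventually (%x. x \<in> {0..1}) (at x0 within {0..1})" by (simp add: eventually_at_filter)
  show ?thesis
  proof (rule Lim_null_comparison[OF eventually_mono[OF ev] sum])
   fix x :: real assume x: "x \<in> {0..1}"
   have iG: "lint {0..T} (?DG x)"
    by (rule set_integrable_le[OF set_integrable_mult_right[OF set_integral_add(1)[OF G[OF x] G[OF x0]], where a = "3 powr p"]])
      (use powr_sum_le(2)[OF p0(1)] in auto)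
   have iF: "lint {0..T} (?DF x)"
    by (rule set_integrable_le[OF set_integrable_mult_right[OF set_integral_add(1)[OF F[OF x] F[OF x0]], where a = "3 powr p"]])
      (use powr_sum_le(2)[OF p0(1)] in auto)
   have le: "abs (trace_curve sg x t - trace_curve sg x0 t) powr p <= ?DF x t + ?DG x t" for t
    using hp[of "Zc (- 1) t (- x - t) - Zc (- 1) t (- x0 - t)" "Zc 0 t (x - t) - Zc 0 t (x0 - t)"]
    by (simp add: trace_curve_def add_divide_distrib diff_divide_distrib algebra_simps)
   have i: "lint {0..T} (%t. abs (trace_curve sg x t - trace_curve sg x0 t) powr p)"
    by (rule set_integrable_le[OF set_integral_add(1)[OF iF iG]]) (use le in auto)
   have "norm (LBINT t:{0..T}. abs (trace_curve sg x t - trace_curve sg x0 t) powr p) = (LBINT t:{0..T}. abs (trace_curve sg x t - trace_curve sg x0 t) powr p)"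
    unfolding real_norm_def by (rule abs_of_nonneg) (auto simp: set_lebesgue_integral_def intro: integral_nonneg_AE)
   also have "... <= (LBINT t:{0..T}. ?DF x t + ?DG x t)"
    by (rule set_integral_mono[OF i set_integral_add(1)[OF iF iG] le])
   finally show "norm (LBINT t:{0..T}. abs (trace_curve sg x t - trace_curve sg x0 t) powr p) <= (LBINT t:{0..T}. ?DF x t) + (LBINT t:{0..T}. ?DG x t)"
    using set_integral_add(2)[OF iF iG] by simp
  qed
 qed
 have "(LINT t|leb 0 T. abs (trace_curve sg x t - trace_curve sg x0 t) powr p) = (LBINT t:{0..T}. abs (trace_curve sg x t - trace_curve sg x0 t) powr p)" for x x0
  by (rule lborel_Ioo_Icc) measurable
 then show ?thesis unfolding C0_curve_def Lp_norm_tendsto_0_iff[OF p0(1)] using mem lim by simp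
qed

lemma trace_curve_of:
 assumes sg: "abs sg = 1" and T: "0 < T"
  and v: "!!t. 0 <= t ==> AE x in \<U>. (z t (- x - t) + sg * z t (x - t)) / 2 = v t x"
 shows "space_curve_of p T v (trace_curve sg)"
 unfolding space_curve_of_def
proof (intro conjI ballI trace_curve_C0[OF sg T])
 fix phi :: "real \<times> real => real" assume phi: "phi \<in> test_functions ({0<..<T} \<times> \<J>)"
 have "continuous_on UNIV phi" by (rule test_functionsE[OF phi]) (rule smoothD)
 then have "phi \<in> borel1" by (rule borel_measurable_continuous_onI)
 then have [measurable]: "phi \<in> borel2" by (simp add: borel_prod)
 obtain M where M: "M >= 0" "!!q. abs (phi q) <= M" using test_function_bounded[OF phi] by blast
 define V where "V t x = (z t (- x - t) + sg * z t (x - t)) / 2" for t x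
 have [measurable]: "(%x. V (f x) (g x)) \<in> borel_measurable N" if [measurable]: "f \<in> borel_measurable N" "g \<in> borel_measurable N" for f g and N :: "'c measure"
  unfolding V_def by measurable
 obtain B where B: "B >= 0" "!!t x. t \<in> {0..T} ==> abs (z t (x - t)) <= B * env t x"
  "!!t x. t \<in> {0..T} ==> abs (z t (- x - t)) <= B * env t x"
  by (rule ut_env_bound) blast
 have VB: "abs (V t x) <= B * env t x" if "t \<in> {0..T}" for t x
 proof -
  have "abs (z t (- x - t) + sg * z t (x - t)) <= abs (z t (- x - t)) + abs (sg * z t (x - t))" by (rule abs_triangle_ineq)
  also have "abs (sg * z t (x - t)) = abs (z t (x - t))" using sg by (simp add: abs_mult)
  finally show ?thesis using B(2)[OF that, of x] B(3)[OF that, of x] by (simp add: V_def)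
 qed
 have Fb: "abs (V t x * phi (t, x)) <= B * M * env t x" if "t \<in> {0..T}" for t x
  unfolding abs_mult using mult_mono[OF VB[OF that, of x] M(2)[of "(t, x)"]] M(1) VB[OF that, of x] by (simp add: ac_simps)
 have Fm: "(%(t, x). V t x * phi (t, x)) \<in> borel2" unfolding case_prod_beta by measurable
 have m1: "(%t. LBINT x:{0..1}. V t x * phi (t, x)) \<in> borel1"
  and m2: "(%x. LBINT t:{0..T}. V t x * phi (t, x)) \<in> borel1"
 proof -
  have "(%t. LBINT x. indicator {0..1} x *\<^sub>R (V t x * phi (t, x))) \<in> borel_measurable lborel"
   by (rule lborel.borel_measurable_lebesgue_integral) (unfold case_prod_beta, measurable)
  then show "(%t. LBINT x:{0..1}. V t x * phi (t, x)) \<in> borel1" by (simp add: set_lebesgue_integral_def)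
  have "(%x. LBINT t. indicator {0..T} t *\<^sub>R (V t x * phi (t, x))) \<in> borel_measurable lborel"
   by (rule lborel.borel_measurable_lebesgue_integral) (unfold case_prod_beta, measurable)
  then show "(%x. LBINT t:{0..T}. V t x * phi (t, x)) \<in> borel1" by (simp add: set_lebesgue_integral_def)
 qed
 have s1: "(%x. V t x * phi (t, x)) \<in> borel1" for t by measurable
 have s2: "(%t. V t x * phi (t, x)) \<in> borel1" for x by measurable
 have "(LINT t|leb 0 T. LINT x|\<U>. v t x * phi (t, x)) = (LINT t|leb 0 T. (LBINT x:{0..1}. V t x * phi (t, x)))"
 proof (rule integral_cong_space)
  fix t :: real assume "t \<in> space (leb 0 T)"
  then have t: "0 <= t" by simp
  have "(LINT x|\<U>. v t x * phi (t, x)) = (LINT x|\<U>. V t x * phi (t, x))"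
  proof (rule integral_lebesgue_on_cong_AE)
   show "(%x. V t x * phi (t, x)) \<in> borel_measurable \<U>" by (rule lebesgue_on_borel(1)[OF s1]) simp
   show "AE x in \<U>. V t x * phi (t, x) = v t x * phi (t, x)"
    using v[OF t] by (rule eventually_mono) (simp add: V_def)
  qed simp
  then show "(LINT x|\<U>. v t x * phi (t, x)) = (LBINT x:{0..1}. V t x * phi (t, x))"
   using lborel_Ioo_Icc(1)[OF s1] by simp
 qed
 also have "... = (LBINT t:{0..T}. LBINT x:{0..1}. V t x * phi (t, x))" by (rule lborel_Ioo_Icc(1)[OF m1])
 also have "... = (LBINT x:{0..1}. LBINT t:{0..T}. V t x * phi (t, x))"
  by (rule strip_Fubini(1)[OF Fm Fb]) (use B M in auto)
 also have "... = (LINT x|\<U>. (LBINT t:{0..T}. V t x * phi (t, x)))" by (rule lborel_Ioo_Icc(1)[OF m2, symmetric])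
 also have "... = (LINT x|\<U>. LINT t|leb 0 T. trace_curve sg x t * phi (t, x))"
 proof (rule integral_cong_space)
  fix x :: real assume "x \<in> space \<U>"
  then have x: "0 < x" "x < 1" by simp_all
  have "(LINT t|leb 0 T. trace_curve sg x t * phi (t, x)) = (LINT t|leb 0 T. V t x * phi (t, x))"
  proof (rule integral_cong_space)
   fix t :: real assume "t \<in> space (leb 0 T)"
   then have "0 <= t" by simp
   then have "Zc (- 1) t (- x - t) = z t (- x - t)" "Zc 0 t (x - t) = z t (x - t)"
    using x by (auto intro!: Zc_eq_z)
   then show "trace_curve sg x t * phi (t, x) = V t x * phi (t, x)" by (simp add: trace_curve_def V_def)
  qed
  then show "(LBINT t:{0..T}. V t x * phi (t, x)) = (LINT t|leb 0 T. trace_curve sg x t * phi (t, x))"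
   using lborel_Ioo_Icc(1)[OF s2] by simp
 qed
 finally show "(LINT t|leb 0 T. LINT x|\<U>. v t x * phi (t, x)) = (LINT x|\<U>. LINT t|leb 0 T. trace_curve sg x t * phi (t, x))" .
qed

text \<open>The reflected invariant is \<open>c\<close> times the incoming one, and \<open>c * (1 + \<kappa>)
 = 1 - \<kappa>\<close>.\<close>
lemma boundary_conditions:
 assumes t: "0 < t"
 shows "trace_curve (- 1) 0 t - \<kappa> * trace_curve 1 0 t = 0" "trace_curve (- 1) 1 t + \<kappa> * trace_curve 1 1 t = 0"
proof -
 have k1: "c * (1 + \<kappa>) = 1 - \<kappa>" using \<kappa> by (simp add: c_def)
 have "z t (- t) = c * Zc (- 1) t (- t)" by (rule Zc_jump[OF t]) simp
 moreover have "Zc 0 t (- t) = z t (- t)" by (rule Zc_eq_z) (use t in auto)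
 ultimately have g: "Zc 0 t (- t) = c * Zc (- 1) t (- t)" by simp
 have "trace_curve (- 1) 0 t - \<kappa> * trace_curve 1 0 t = ((1 - \<kappa>) * Zc (- 1) t (- t) - (1 + \<kappa>) * Zc 0 t (- t)) / 2"
  by (simp add: trace_curve_def field_simps)
 also have "... = ((1 - \<kappa>) - c * (1 + \<kappa>)) * Zc (- 1) t (- t) / 2" by (simp add: g algebra_simps)
 finally show "trace_curve (- 1) 0 t - \<kappa> * trace_curve 1 0 t = 0" using k1 by simp
 have "z t (1 - t) = c * Zc 0 t (1 - t)" by (rule Zc_jump[OF t]) simp
 moreover have "z t (1 - t) = z t (- 1 - t)" using z_periodic[of t "- 1 - t"] by (simp add: algebra_simps)
 moreover have "Zc (- 1) t (- 1 - t) = z t (- 1 - t)" by (rule Zc_eq_z) (use t in auto)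
 ultimately have f: "Zc (- 1) t (- 1 - t) = c * Zc 0 t (1 - t)" by simp
 have "trace_curve (- 1) 1 t + \<kappa> * trace_curve 1 1 t = ((1 + \<kappa>) * Zc (- 1) t (- 1 - t) - (1 - \<kappa>) * Zc 0 t (1 - t)) / 2"
  by (simp add: trace_curve_def field_simps)
 also have "... = (c * (1 + \<kappa>) - (1 - \<kappa>)) * Zc 0 t (1 - t) / 2" by (simp add: f algebra_simps)
 finally show "trace_curve (- 1) 1 t + \<kappa> * trace_curve 1 1 t = 0" using k1 by simp
qed

lemma u_wave: "wave_eq_distr p (%q. \<alpha> (fst q) (snd q)) u"
 unfolding wave_eq_distr_def
proof
 fix phi :: "real \<times> real => real" assume phi': "phi \<in> test_functions ({0<..} \<times> \<J>)"
 obtain T where T: "0 < T" and phi: "phi \<in> test_functions ({0<..<T} \<times> \<J>)" by (rule test_function_finite_time[OF phi'])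
 define phi1 where "phi1 = dt phi"
 define phi2 where "phi2 = dx phi"
 note P = test_function_plane[OF phi, folded phi1_def phi2_def]
 note P1 = test_function_plane[OF P(1)] and P2 = test_function_plane[OF P(2)]
 note [measurable] = P(5) P1(5) P2(5)
 obtain M where M: "M >= 0" "!!q. abs (phi q) <= M" using test_function_bounded[OF phi] by blast
 obtain M1 where M1: "!!q. abs (phi1 q) <= M1" using test_function_bounded[OF P(1)] by blast
 obtain M2 where M2: "!!q. abs (phi2 q) <= M2" using test_function_bounded[OF P(2)] by blast
 have am: "(%q. \<alpha> (fst q) (snd q)) \<in> borel2" by measurable
 have aA: "abs (\<alpha> (fst q) (snd q)) <= A" for q using \<alpha>_nonneg \<alpha>_le by simp
 have aphim: "(%q. \<alpha> (fst q) (snd q) * phi q) \<in> borel2" by measurable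
 have aphiM: "abs (\<alpha> (fst q) (snd q) * phi q) <= A * M" for q
  unfolding abs_mult by (intro mult_mono aA M) (use A in auto)
 note C = C1_curve_L1[OF p0(2) u_C1] L1_curve_of_Lp[OF p0(2) ux_C0]
 define J where "J t = (LBINT x:{0..1}. ut t x * phi1 (t, x) - ux t x * phi2 (t, x) - \<alpha> t x * ut t x * phi (t, x))" for t
 have Jm: "J \<in> borel1"
 proof -
  have "(%t. LBINT x. indicator {0..1} x *\<^sub>R (ut t x * phi1 (t, x) - ux t x * phi2 (t, x) - \<alpha> t x * ut t x * phi (t, x))) \<in> borel_measurable lborel"
   by (rule lborel.borel_measurable_lebesgue_integral) (unfold case_prod_beta, measurable)
  then show ?thesis by (simp add: set_lebesgue_integral_def J_def[abs_def])
 qed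
 let ?U = "\<U>" and ?L = "leb 0 T"
 let ?I = "%F psi. LINT t|?L. pairing \<J> F psi t"
 have J: "pairing \<J> ux phi2 t - pairing \<J> (time_deriv p u) phi1 t + pairing \<J> (time_deriv p u) (%q. \<alpha> (fst q) (snd q) * phi q) t = - J t"
  if t: "0 <= t" for t
 proof -
  have m: "(%x. ux t x * phi2 (t, x) - ut t x * phi1 (t, x) + ut t x * (\<alpha> t x * phi (t, x))) \<in> borel1" by measurable
  have "pairing \<J> ux phi2 t - pairing \<J> (time_deriv p u) phi1 t + pairing \<J> (time_deriv p u) (%q. \<alpha> (fst q) (snd q) * phi q) t
   = (LINT x|?U. ux t x * phi2 (t, x) - time_deriv p u t x * phi1 (t, x) + time_deriv p u t x * (\<alpha> t x * phi (t, x)))"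
   using pairing_integrable(3)[OF C(4) P2(5) M2 t] pairing_integrable(3)[OF C(2) P1(5) M1 t] pairing_integrable(3)[OF C(2) aphim aphiM t]
   by (simp add: pairing_def)
  also have "... = (LINT x|?U. ux t x * phi2 (t, x) - ut t x * phi1 (t, x) + ut t x * (\<alpha> t x * phi (t, x)))"
   by (rule integral_lebesgue_on_cong_AE[OF lebesgue_on_borel(1)[OF m]])
     (use time_deriv_AE[OF t] in \<open>auto elim!: eventually_mono\<close>)
  also have "... = (LBINT x:{0..1}. - (ut t x * phi1 (t, x) - ux t x * phi2 (t, x) - \<alpha> t x * ut t x * phi (t, x)))"
   unfolding lborel_Ioo_Icc(1)[OF m] by (simp add: algebra_simps)
  also have "... = - J t" by (simp only: J_def set_lebesgue_integral_def scaleR_minus_right Bochner_Integration.integral_minus)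
  finally show ?thesis .
 qed
 have "(LINT t|lebesgue_on {0<..}. LINT x|?U. u t x * dt (dt phi) (t, x) - u t x * dx (dx phi) (t, x)
   + \<alpha> (fst (t, x)) (snd (t, x)) * time_deriv p u t x * phi (t, x)) = ?I ux phi2 - ?I (time_deriv p u) phi1 + ?I (time_deriv p u) (%q. \<alpha> (fst q) (snd q) * phi q)"
  unfolding phi1_def phi2_def by (rule wave_pairing(1)[OF C(1,2,4) C(3) u_weak_deriv am aA phi T])
 also have "... = (LINT t|?L. pairing \<J> ux phi2 t - pairing \<J> (time_deriv p u) phi1 t + pairing \<J> (time_deriv p u) (%q. \<alpha> (fst q) (snd q) * phi q) t)"
  using pairing_integrable(1)[OF C(4) P2(5) M2] pairing_integrable(1)[OF C(2) P1(5) M1] pairing_integrable(1)[OF C(2) aphim aphiM] by simp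
 also have "... = (LINT t|?L. - J t)" by (rule integral_cong_space) (use J in simp)
 also have "... = - (LBINT t:{0..T}. J t)" using lborel_Ioo_Icc(1)[OF Jm, of 0 T] by simp
 also have "(LBINT t:{0..T}. J t) = 0"
 proof -
  have off: "phi (t, x) = 0" "phi1 (t, x) = 0" "phi2 (t, x) = 0" if "x \<notin> \<J>" for t x
   using test_function_deriv(5)[OF P(7)] test_function_deriv(5)[OF P1(7)] test_function_deriv(5)[OF P2(7)] that by auto
  have D1: "((%t. phi (t, xi + t)) has_real_derivative phi1 (t, xi + t) + phi2 (t, xi + t)) (at t)" for xi t
   using pdiff_direction[of phi t xi 1] smoothD(1)[OF P(3)] by (simp add: phi1_def phi2_def)
  have D2: "((%t. phi (t, xi - t)) has_real_derivative phi1 (t, xi - t) - phi2 (t, xi - t)) (at t)" for xi t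
   using pdiff_direction[of phi t xi "- 1"] smoothD(1)[OF P(3)] by (simp add: phi1_def phi2_def)
  have "(LBINT x:{0..1}. ut T x * phi (T, x)) - (LBINT x:{0..1}. ut 0 x * phi (0, x)) = (LBINT t:{0..T}. J t)"
   unfolding J_def
   by (rule transport_pair(1)[where phi = "%t x. phi (t, x)" and phit = "%t x. phi1 (t, x)" and phix = "%t x. phi2 (t, x)", OF _ _ _ D1 D2 _ less_imp_le[OF T]])
     (use P(4) P1(4) P2(4) off in auto)
  then show ?thesis using P(9)[of T] P(9)[of 0] by simp
 qed
 finally show "(LINT t|lebesgue_on {0<..}. LINT x|?U.
   u t x * dt (dt phi) (t, x) - u t x * dx (dx phi) (t, x)
   + \<alpha> (fst (t, x)) (snd (t, x)) * time_deriv p u t x * phi (t, x)) = 0" by simp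
qed

lemma u_initial: "u 0 x = u0 x" by (simp add: u_def Iu_def set_integral_singleton)

lemma u_weak_solution: "weak_solution p \<kappa> (%q. \<alpha> (fst q) (snd q)) u0 (ut 0) u"
 unfolding weak_solution_def
proof (intro conjI allI impI)
 show "u \<in> C0_curve {0..} (W1p p \<J>) (W1p_norm p \<J>)" by (rule u_W1p)
 show "u \<in> C1_curve {0..} (Lp p \<J>) (Lp_norm p \<J>)" by (rule u_C1)
 show "wave_eq_distr p (%q. \<alpha> (fst q) (snd q)) u" by (rule u_wave)
 show "AE x in \<U>. u 0 x = u0 x" by (simp add: u_initial)
 show "AE x in \<U>. time_deriv p u 0 x = ut 0 x"
  using time_deriv_AE[of 0] by (auto elim: eventually_mono)
 fix T :: real assume T: "0 < T"
 have vt: "space_curve_of p T (time_deriv p u) (trace_curve 1)"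
  by (rule trace_curve_of[OF _ T]) (use time_deriv_AE in \<open>auto simp: ut_def add.commute\<close>)
 have vx: "space_curve_of p T (space_deriv u) (trace_curve (- 1))"
  by (rule trace_curve_of[OF _ T]) (use space_deriv_AE in \<open>auto simp: ux_def\<close>)
 have "AE t in leb 0 T. trace_curve (- 1) 0 t - \<kappa> * trace_curve 1 0 t = 0 \<and> trace_curve (- 1) 1 t + \<kappa> * trace_curve 1 1 t = 0"
  using boundary_conditions by (intro AE_I2) simp
 then show "\<exists>vt vx. space_curve_of p T (time_deriv p u) vt \<and> space_curve_of p T (space_deriv u) vx \<and>
  (AE t in leb 0 T. vx 0 t - \<kappa> * vt 0 t = 0 \<and> vx 1 t + \<kappa> * vt 1 t = 0)"
  using vt vx by blast
qed

end

section \<open>Uniqueness\<close>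

lemma weak_solution_curves:
 assumes p: "1 < p" and w: "weak_solution p \<kappa> a u0 u1 u"
 shows "L1_curve {0..} \<J> u" "L1_curve {0..} \<J> (time_deriv p u)" "L1_curve {0..} \<J> (space_deriv u)"
  "!!t. t >= 0 ==> ((%s. LINT x|\<U>. abs ((u s x - u t x) / (s - t) - time_deriv p u t x)) \<longlongrightarrow> 0) (at t within {0..})"
  "!!t. t >= 0 ==> is_weak_deriv \<J> (u t) (space_deriv u t)"
  "!!t. t >= 0 ==> space_deriv u t \<in> Lp p \<J>"
proof -
 have p0: "p > 0" "p >= 1" using p by simp_all
 have C1: "u \<in> C1_curve {0..} (Lp p \<J>) (Lp_norm p \<J>)"
  and W: "u \<in> C0_curve {0..} (W1p p \<J>) (W1p_norm p \<J>)"
  using w by (auto simp: weak_solution_def)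
 note C = C1_curve_L1[OF p0(2) C1]
 show u: "L1_curve {0..} \<J> u" and "L1_curve {0..} \<J> (time_deriv p u)" by (fact C(1) C(2))+
 show "!!t. t >= 0 ==> ((%s. LINT x|\<U>. abs ((u s x - u t x) / (s - t) - time_deriv p u t x)) \<longlongrightarrow> 0) (at t within {0..})" by (rule C(3))
 have wd: "is_weak_deriv \<J> (u t) (space_deriv u t) \<and> space_deriv u t \<in> Lp p \<J>" if "t >= 0" for t
 proof -
  have "u t \<in> W1p p \<J>" using W that by (simp add: C0_curve_def)
  then obtain g where "g \<in> Lp p \<J>" "is_weak_deriv \<J> (u t) g" by (auto simp: W1p_def)
  from weak_deriv_AE(2,3)[OF p0(2) this] show ?thesis by simp
 qed
 then show "!!t. t >= 0 ==> is_weak_deriv \<J> (u t) (space_deriv u t)"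
  "!!t. t >= 0 ==> space_deriv u t \<in> Lp p \<J>" by blast+
 have sI: "integrable \<U> (space_deriv u t)" if "t >= 0" for t
  by (rule finite_measure.integrable_of_powr[OF finite_measure_Ioo p0(2) LpD]) (use wd that in auto)
 have "space_deriv u \<in> C0_curve {0..} (Lp p \<J>) (Lp_norm p \<J>)"
  unfolding C0_curve_def
 proof (intro CollectI conjI ballI)
  fix t :: real assume t: "t \<in> {0..}"
  show "space_deriv u t \<in> Lp p \<J>" using wd t by simp
  have ev: "eventually (%s. s \<in> {0..}) (at t within {0..})" by (simp add: eventually_at_filter)
  show "((%s. Lp_norm p \<J> (%x. space_deriv u s x - space_deriv u t x)) \<longlongrightarrow> 0) (at t within {0..})"
  proof (rule Lim_null_comparison[OF eventually_mono[OF ev]])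
   show "((%s. W1p_norm p \<J> (%x. u s x - u t x)) \<longlongrightarrow> 0) (at t within {0..})"
    using W t by (simp add: C0_curve_def)
   fix s :: real assume s: "s \<in> {0..}"
   have i: "is_weak_deriv \<J> (%x. u s x - u t x) (%x. space_deriv u s x - space_deriv u t x)"
    by (intro is_weak_deriv_diff L1_curveD[OF u] sI) (use s t wd in auto)
   have d: "(%x. space_deriv u s x - space_deriv u t x) \<in> Lp p \<J>" by (intro Lp_diff[OF p0(1)]) (use wd s t in auto)
   note A = weak_deriv_AE[OF p0(2) d i zero_less_one]
   show "norm (Lp_norm p \<J> (%x. space_deriv u s x - space_deriv u t x)) <= W1p_norm p \<J> (%x. u s x - u t x)"
    unfolding W1p_norm_def using Lp_norm_AE_cong[OF A(1) LpD(1)[OF d] LpD(1)[OF A(2)], of p] Lp_norm_nonneg[of p \<J> "%x. u s x - u t x"]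
     Lp_norm_nonneg[of p \<J> "%x. space_deriv u s x - space_deriv u t x"] by simp
  qed
 qed
 then show "L1_curve {0..} \<J> (space_deriv u)" by (rule L1_curve_of_Lp[OF p0(2)])
qed

lemma pairing_combine:
 fixes psi :: "real \<times> real => real"
 assumes F: "L1_curve {0..} {a<..<b} F" and G: "L1_curve {0..} {a<..<b} G"
  and psi: "psi \<in> borel2" "!!q. abs (psi q) <= B"
 shows "(LINT t|leb 0 T. pairing {a<..<b} (%t x. F t x + sg * G t x) psi t)
  = (LINT t|leb 0 T. pairing {a<..<b} F psi t) + sg * (LINT t|leb 0 T. pairing {a<..<b} G psi t)"
proof -
 have "(LINT t|leb 0 T. pairing {a<..<b} (%t x. F t x + sg * G t x) psi t)
  = (LINT t|leb 0 T. pairing {a<..<b} F psi t + sg * pairing {a<..<b} G psi t)"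
 proof (rule integral_cong_space)
  fix t assume "t \<in> space (leb 0 T)"
  then have t: "0 <= t" by simp
  show "pairing {a<..<b} (%t x. F t x + sg * G t x) psi t = pairing {a<..<b} F psi t + sg * pairing {a<..<b} G psi t"
   using pairing_integrable(3)[OF F psi t] pairing_integrable(3)[OF G psi t]
   by (simp add: pairing_def distrib_right mult.assoc)
 qed
 then show ?thesis using pairing_integrable(1)[OF F psi] pairing_integrable(1)[OF G psi] by simp
qed

lemma pairing_test_combine:
 fixes psi rho :: "real \<times> real => real"
 assumes F: "L1_curve {0..} {a<..<b} F"
  and psi: "psi \<in> borel2" "!!q. abs (psi q) <= B"
  and rho: "rho \<in> borel2" "!!q. abs (rho q) <= C"
 shows "(LINT t|leb 0 T. pairing {a<..<b} F (%q. psi q - sg * rho q) t)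
  = (LINT t|leb 0 T. pairing {a<..<b} F psi t) - sg * (LINT t|leb 0 T. pairing {a<..<b} F rho t)"
proof -
 have "(LINT t|leb 0 T. pairing {a<..<b} F (%q. psi q - sg * rho q) t)
  = (LINT t|leb 0 T. pairing {a<..<b} F psi t - sg * pairing {a<..<b} F rho t)"
 proof (rule integral_cong_space)
  fix t assume "t \<in> space (leb 0 T)"
  then have t: "0 <= t" by simp
  show "pairing {a<..<b} F (%q. psi q - sg * rho q) t = pairing {a<..<b} F psi t - sg * pairing {a<..<b} F rho t"
   using pairing_integrable(3)[OF F psi t] pairing_integrable(3)[OF F rho t]
   by (simp add: pairing_def right_diff_distrib mult.left_commute)
 qed
 then show ?thesis using pairing_integrable(1)[OF F psi] pairing_integrable(1)[OF F rho] by simp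
qed

lemma test_function_direction:
 fixes phi :: "real \<times> real => real"
 assumes phi: "phi \<in> test_functions ({0<..<T} \<times> {a<..<b})"
 obtains M where "(%q. dt phi q - sg * dx phi q) \<in> borel2" "!!q. abs (dt phi q - sg * dx phi q) <= M"
proof -
 note P = test_function_plane[OF phi]
 obtain M1 where M1: "!!q. abs (dt phi q) <= M1" using test_function_bounded[OF P(1)] by blast
 obtain M2 where M2: "!!q. abs (dx phi q) <= M2" using test_function_bounded[OF P(2)] by blast
 show thesis
 proof (rule that)
  show "(%q. dt phi q - sg * dx phi q) \<in> borel2"
   using test_function_plane(5)[OF P(1)] test_function_plane(5)[OF P(2)] by measurable
  show "abs (dt phi q - sg * dx phi q) <= M1 + abs sg * M2" for q
  proof -
   have "abs (dt phi q - sg * dx phi q) <= abs (dt phi q) + abs sg * abs (dx phi q)"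
    unfolding abs_mult[symmetric] by (rule abs_triangle_ineq4)
   then show ?thesis using M1[of q] mult_left_mono[OF M2[of q] abs_ge_zero[of sg]] by linarith
  qed
 qed
qed

text \<open>Both identities of \<open>wave_pairing\<close> combined: \<open>u\<^sub>t + sg u\<^sub>x\<close>
 is transported with speed \<open>- sg\<close> and driven by the damping.\<close>
lemma first_order_system:
 fixes a :: "real \<times> real => real"
 assumes p: "1 < p" and w: "weak_solution p \<kappa> a u0 u1 u"
  and a [measurable]: "a \<in> borel2" and aA: "!!q. abs (a q) <= A"
  and phi: "phi \<in> test_functions ({0<..<T} \<times> \<J>)" and sym: "dx (dt phi) = dt (dx phi)"
  and T: "0 < T" and sg: "sg * sg = 1"
 shows "(LINT t|leb 0 T. pairing \<J> (%t x. time_deriv p u t x + sg * space_deriv u t x)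
   (%q. dt phi q - sg * dx phi q) t)
  = (LINT t|leb 0 T. pairing \<J> (time_deriv p u) (%q. a q * phi q) t)"
proof -
 note C = weak_solution_curves[OF p w]
 note P = test_function_plane[OF phi] and P1 = test_function_plane(5)[OF test_function_plane(1)[OF phi]] and P2 = test_function_plane(5)[OF test_function_plane(2)[OF phi]]
 obtain M1 where M1: "!!q. abs (dt phi q) <= M1" using test_function_bounded[OF P(1)] by blast
 obtain M2 where M2: "!!q. abs (dx phi q) <= M2" using test_function_bounded[OF P(2)] by blast
 obtain M where dm: "(%q. dt phi q - sg * dx phi q) \<in> borel2" and dM: "!!q. abs (dt phi q - sg * dx phi q) <= M"
  by (rule test_function_direction[OF phi]) (rule that)
 have "phi \<in> test_functions ({0<..} \<times> \<J>)" using phi unfolding test_functions_def by fastforce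
 then have 0: "(LINT t|lebesgue_on {0<..}. LINT x|\<U>. u t x * dt (dt phi) (t, x) - u t x * dx (dx phi) (t, x)
    + a (t, x) * time_deriv p u t x * phi (t, x)) = 0" using w by (simp add: weak_solution_def wave_eq_distr_def)
 let ?I = "%F psi. LINT t|leb 0 T. pairing \<J> F psi t"
 have "?I (space_deriv u) (dx phi) - ?I (time_deriv p u) (dt phi) + ?I (time_deriv p u) (%q. a q * phi q) = 0"
  by (rule trans[OF wave_pairing(1)[OF C(1,2,3,4,5) a aA phi T, symmetric] 0])
 then have 1: "?I (time_deriv p u) (dt phi) - ?I (space_deriv u) (dx phi) = ?I (time_deriv p u) (%q. a q * phi q)" by simp
 have 2: "?I (space_deriv u) (dt phi) = ?I (time_deriv p u) (dx phi)"
  by (rule wave_pairing(2)[OF C(1,2,3,4,5) a aA phi T sym])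
 show ?thesis
  unfolding pairing_combine[OF C(2,3) dm dM] pairing_test_combine[OF C(2) P1 M1 P2 M2] pairing_test_combine[OF C(3) P1 M1 P2 M2]
  using 1 2 sg by (simp add: algebra_simps mult.assoc[symmetric])
qed

lemma pdiff_ridge:
 assumes "smooth (g :: real => real)"
 shows "pdiff b (%q. g (v \<bullet> q)) = (%q. (v \<bullet> b) * deriv g (v \<bullet> q))"
proof
 fix q
 have i: "((%q. v \<bullet> q) has_derivative (%h. v \<bullet> h)) (at q)" by (auto intro!: derivative_eq_intros)
 have "((%q. g (v \<bullet> q)) has_derivative (%h. (v \<bullet> h) * deriv g (v \<bullet> q))) (at q)"
  using has_derivative_compose[OF i smooth_real_deriv(1)[OF assms, of "v \<bullet> q", unfolded has_field_derivative_def]]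
  by (simp add: mult.commute)
 then show "pdiff b (%q. g (v \<bullet> q)) q = (v \<bullet> b) * deriv g (v \<bullet> q)" by (rule pdiff_eqI)
qed

text \<open>Together with the next lemma, this provides the symmetry of mixed derivatives for products of
 ridge functions, the only test functions to which it is applied.\<close>
lemma mixed_pdiff_ridge:
 assumes "smooth (g :: real => real)"
 shows "pdiff b (pdiff c (%q. g (v \<bullet> q))) = pdiff c (pdiff b (%q. g (v \<bullet> q)))"
proof -
 have "pdiff b (%q. (v \<bullet> c) * deriv g (v \<bullet> q)) = (%q. (v \<bullet> b) * ((v \<bullet> c) * deriv (deriv g) (v \<bullet> q)))" for b c
 proof
  fix q
  have i: "((%q. v \<bullet> q) has_derivative (%h. v \<bullet> h)) (at q)" by (auto intro!: derivative_eq_intros)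
  have "((%q. (v \<bullet> c) * deriv g (v \<bullet> q)) has_derivative (%h. (v \<bullet> h) * ((v \<bullet> c) * deriv (deriv g) (v \<bullet> q)))) (at q)"
   using has_derivative_mult_right[OF has_derivative_compose[OF i smooth_real_deriv(1)[OF smooth_real_deriv(2)[OF assms], of "v \<bullet> q", unfolded has_field_derivative_def]], of "v \<bullet> c"]
   by (simp add: ac_simps)
  then show "pdiff b (%q. (v \<bullet> c) * deriv g (v \<bullet> q)) q = (v \<bullet> b) * ((v \<bullet> c) * deriv (deriv g) (v \<bullet> q))" by (rule pdiff_eqI)
 qed
 then show ?thesis by (simp add: pdiff_ridge[OF assms] ac_simps)
qed

lemma mixed_pdiff_mult:
 assumes f: "smooth f" "pdiff b (pdiff c f) = pdiff c (pdiff b f)" and g: "smooth g" "pdiff b (pdiff c g) = pdiff c (pdiff b g)"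
  and bc: "b \<in> Basis" "c \<in> Basis"
 shows "pdiff b (pdiff c (%q. f q * g q)) = pdiff c (pdiff b (%q. f q * g q))"
proof -
 note D = smoothD(1)[OF f(1)] smoothD(1)[OF g(1)] smoothD(1)[OF smoothD(3)[OF f(1) bc(1)]] smoothD(1)[OF smoothD(3)[OF f(1) bc(2)]]
  smoothD(1)[OF smoothD(3)[OF g(1) bc(1)]] smoothD(1)[OF smoothD(3)[OF g(1) bc(2)]]
 show ?thesis by (simp add: pdiff_mult pdiff_add D f(2) g(2) algebra_simps)
qed

lemma test_function_tensor:
 assumes rho: "rho \<in> test_functions {0<..<T::real}" and om: "om \<in> test_functions {a<..<b::real}"
 shows "(%q. rho (fst q) * om (snd q)) \<in> test_functions ({0<..<T} \<times> {a<..<b})"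
proof -
 obtain K where K: "smooth rho" "compact K" "K \<subseteq> {0<..<T}" "!!t. t \<notin> K ==> rho t = 0" by (rule test_functionsE[OF rho]) (rule that)
 obtain L where L: "smooth om" "compact L" "L \<subseteq> {a<..<b}" "!!t. t \<notin> L ==> om t = 0" by (rule test_functionsE[OF om]) (rule that)
 show ?thesis
 proof (rule test_functionsI)
  show "smooth (%q. rho (fst q) * om (snd q))" by (intro smooth_mult smooth_fst smooth_snd K L)
  show "compact (K \<times> L)" by (intro compact_Times K L)
 qed (use K L in \<open>auto simp: mem_Times_iff\<close>)
qed

lemma L1_curve_subset: "L1_curve J D F ==> I \<subseteq> J ==> L1_curve I D F"
 unfolding L1_curve_def by (meson subsetD tendsto_within_subset)

text \<open>The test functions are \<open>rho m (t) om n (x) \<theta>(t + sg x)\<close> with cutoffs in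
 both variables. The transport operator annihilates the last factor, so only derivatives of cutoffs remain.
 The limit in \<open>n\<close> produces the traces at both ends of the interval, through the curve
 \<open>W\<close> that is continuous in \<open>x\<close>; the limit in \<open>m\<close> then produces the
 values at the times \<open>0\<close> and \<open>T\<close>.\<close>
lemma characteristic_balance:
 fixes \<theta> :: "real => real"
 assumes F: "L1_curve {0..} \<J> F" and W: "L1_curve {0..1} {0<..<T} W" and T: "0 < T" and sg: "sg * sg = 1"
  and pair: "\<forall>phi\<in>test_functions ({0<..<T} \<times> \<J>).
   (LINT t|leb 0 T. LINT x|\<U>. F t x * phi (t, x)) = (LINT x|\<U>. LINT t|leb 0 T. W x t * phi (t, x))"
  and N: "\<forall>phi\<in>test_functions ({0<..<T} \<times> \<J>). \<forall>B. dx (dt phi) = dt (dx phi) --> (\<forall>q. abs (phi q) <= B) -->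
   abs (LINT t|leb 0 T. pairing \<J> F (%q. dt phi q - sg * dx phi q) t) <= N * B"
  and \<theta>: "smooth \<theta>" and B: "!!t x. t \<in> {0..T} ==> x \<in> {0..1} ==> abs (\<theta> (t + sg * x)) <= B"
 shows "abs ((LINT x|\<U>. F T x * \<theta> (T + sg * x)) - (LINT x|\<U>. F 0 x * \<theta> (sg * x))
  + sg * ((LINT t|leb 0 T. W 0 t * \<theta> t) - (LINT t|leb 0 T. W 1 t * \<theta> (t + sg)))) <= N * B"
proof -
 let ?L = "leb 0 T" and ?U = "\<U>"
 obtain rho rho' where rho: "!!n. rho n \<in> test_functions {0<..<T}"
  "!!n x. (rho n has_real_derivative rho' n x) (at x)" "!!n. smooth (rho' n)"
  "!!n x. 0 <= rho n x" "!!n x. rho n x <= 1" "!!x. 0 < x ==> x < T ==> (%n. rho n x) \<longlonglongrightarrow> 1"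
  "!!R. continuous_on {0..T} R ==> (%n. LINT x|leb 0 T. rho' n x * R x) \<longlonglongrightarrow> R 0 - R T"
  by (rule cutoffs_exist[OF T]) blast
 obtain om om' where om: "!!n. om n \<in> test_functions \<J>"
  "!!n x. (om n has_real_derivative om' n x) (at x)" "!!n. smooth (om' n)"
  "!!n x. 0 <= om n x" "!!n x. om n x <= 1" "!!x. 0 < x ==> x < 1 ==> (%n. om n x) \<longlonglongrightarrow> 1"
  "!!R. continuous_on {0..1} R ==> (%n. LINT x|leb 0 1. om' n x * R x) \<longlonglongrightarrow> R 0 - R (1::real)"
  by (rule cutoffs_exist[of 0 1]) auto
 have rhod: "deriv (rho n) = rho' n" and omd: "deriv (om n) = om' n" for n
  using DERIV_imp_deriv[OF rho(2)] DERIV_imp_deriv[OF om(2)] by blast+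
 have rhot: "rho' n \<in> test_functions {0<..<T}" and omt: "om' n \<in> test_functions \<J>" for n
  using test_function_deriv(1)[OF rho(1)[of n]] test_function_deriv(1)[OF om(1)[of n]] by (simp_all add: rhod omd)
 have rhos: "smooth (rho n)" and oms: "smooth (om n)" for n
  using rho(1)[of n] om(1)[of n] by (simp_all add: test_functions_def smooth_def)
 have B0: "0 <= B" using B[of 0 0] T by (simp add: order_trans[OF abs_ge_zero])
 define \<Theta> where "\<Theta> q = \<theta> ((1, sg) \<bullet> q)" for q :: "real \<times> real"
 have \<Theta>e: "\<Theta> (t, x) = \<theta> (t + sg * x)" for t x by (simp add: \<Theta>_def)
 have \<Theta>s: "smooth \<Theta>" unfolding \<Theta>_def[abs_def] using smooth_compose_inner[OF \<theta>, of "(1, sg)" 0] by simp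
 note \<Theta>c = smoothD(2)[OF \<Theta>s]
 define P where "P n = pairing \<J> F (%q. om n (snd q) * \<Theta> q)" for n
 define Q where "Q = pairing \<J> F \<Theta>"
 define R where "R m = pairing {0<..<T} W (%q. rho m (snd q) * \<Theta> (snd q, fst q))" for m
 have key: "abs ((LINT t|?L. rho' m t * P n t) - sg * (LINT x|?U. om' n x * R m x)) <= N * B" for m n
 proof -
  define phi where "phi q = rho m (fst q) * om n (snd q) * \<Theta> q" for q
  define psi1 where "psi1 q = rho' m (fst q) * om n (snd q) * \<Theta> q" for q
  define psi2 where "psi2 q = rho m (fst q) * om' n (snd q) * \<Theta> q" for q
  have tf: "phi \<in> test_functions ({0<..<T} \<times> \<J>)" "psi1 \<in> test_functions ({0<..<T} \<times> \<J>)" "psi2 \<in> test_functions ({0<..<T} \<times> \<J>)"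
   unfolding phi_def[abs_def] psi1_def[abs_def] psi2_def[abs_def] by (intro test_function_mult test_function_tensor \<Theta>s rho(1) rhot om(1) omt)+
  have e: "rho m (fst q) = rho m ((1, 0) \<bullet> q)" "om n (snd q) = om n ((0, 1) \<bullet> q)" for q :: "real \<times> real"
   by (simp_all add: inner_prod_def)
  have phie: "phi = (%q. rho m ((1, 0) \<bullet> q) * om n ((0, 1) \<bullet> q) * \<theta> ((1, sg) \<bullet> q))"
   by (simp add: phi_def[abs_def] \<Theta>_def e)
  note r = smooth_compose_inner[OF rhos[of m], of "(1, 0) :: real \<times> real" 0, simplified] smooth_compose_inner[OF oms[of n], of "(0, 1) :: real \<times> real" 0, simplified]
   smooth_compose_inner[OF \<theta>, of "(1, sg) :: real \<times> real" 0, simplified]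
  note rr = smooth_mult[OF r(1,2)]
  have sym: "dx (dt phi) = dt (dx phi)"
   unfolding phie by (intro mixed_pdiff_mult rr r mixed_pdiff_ridge rhos oms \<theta> Basis_plane)
  have d: "(%q. dt phi q - sg * dx phi q) = (%q. psi1 q - sg * psi2 q)"
  proof
   fix q
   have s: "sg * (sg * x) = x" for x using sg by (simp add: mult.assoc[symmetric])
   show "dt phi q - sg * dx phi q = psi1 q - sg * psi2 q"
    unfolding phie psi1_def psi2_def \<Theta>_def
    unfolding pdiff_mult[OF smoothD(1)[OF rr] smoothD(1)[OF r(3)]] pdiff_mult[OF smoothD(1)[OF r(1)] smoothD(1)[OF r(2)]]
     pdiff_ridge[OF rhos] pdiff_ridge[OF oms] pdiff_ridge[OF \<theta>] rhod omd
    by (simp add: inner_prod_def algebra_simps s)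
  qed
  obtain M1 where M1: "!!q. abs (psi1 q) <= M1" using test_function_bounded[OF tf(2)] by blast
  obtain M2 where M2: "!!q. abs (psi2 q) <= M2" using test_function_bounded[OF tf(3)] by blast
  have phiB: "abs (phi q) <= B" for q
  proof (cases "q \<in> {0<..<T} \<times> \<J>")
   case True
   then have "abs (\<Theta> q) <= B" using B[of "fst q" "snd q"] \<Theta>e[of "fst q" "snd q"] by (auto simp: mem_Times_iff)
   moreover have "abs (rho m (fst q) * om n (snd q)) <= 1 * 1"
    unfolding abs_mult using rho(4,5)[of m "fst q"] om(4,5)[of n "snd q"] by (intro mult_mono) auto
   ultimately show ?thesis unfolding phi_def abs_mult[of "rho m (fst q) * om n (snd q)"]
    using mult_mono[of "abs (rho m (fst q) * om n (snd q))" 1 "abs (\<Theta> q)" B] by simp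
  next
   case False
   then have "phi q = 0" using test_function_deriv(5)[OF rho(1)[of m]] test_function_deriv(5)[OF om(1)[of n]]
    by (auto simp: phi_def mem_Times_iff)
   then show ?thesis using B0 by simp
  qed
  have I1: "pairing \<J> F psi1 t = rho' m t * P n t" for t
  proof -
   have "pairing \<J> F psi1 t = (LINT x|?U. rho' m t * (F t x * (om n x * \<Theta> (t, x))))"
    unfolding pairing_def by (intro integral_cong_space) (simp add: psi1_def)
   then show ?thesis by (simp add: P_def pairing_def)
  qed
  have "(LINT t|?L. pairing \<J> F psi2 t) = (LINT x|?U. LINT t|?L. W x t * psi2 (t, x))"
   using pair tf(3) by (simp add: pairing_def)
  also have "... = (LINT x|?U. om' n x * R m x)"
  proof (rule integral_cong_space)
   fix x
   have "(LINT t|?L. W x t * psi2 (t, x)) = (LINT t|?L. om' n x * (W x t * (rho m t * \<Theta> (t, x))))"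
    by (intro integral_cong_space) (simp add: psi2_def)
   then show "(LINT t|?L. W x t * psi2 (t, x)) = om' n x * R m x" by (simp add: R_def pairing_def)
  qed
  finally have I2: "(LINT t|?L. pairing \<J> F psi2 t) = (LINT x|?U. om' n x * R m x)" .
  have "abs (LINT t|?L. pairing \<J> F (%q. psi1 q - sg * psi2 q) t) <= N * B"
   using N[rule_format, OF tf(1) sym phiB] unfolding d .
  then show ?thesis
   unfolding pairing_test_combine[OF F test_function_plane(5)[OF tf(2)] M1 test_function_plane(5)[OF tf(3)] M2] I1 I2 .
 qed
 have \<Theta>B: "abs (\<Theta> (t, x)) <= B" if "t \<in> {0..T}" "x \<in> {0..1}" for t x using B[OF that] by (simp add: \<Theta>e)
 have om\<Theta>B: "abs (om n x * \<Theta> (t, x)) <= B" if "t \<in> {0..T}" "x \<in> {0..1}" for n t x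
  unfolding abs_mult using mult_mono[of "abs (om n x)" 1 "abs (\<Theta> (t, x))" B] \<Theta>B[OF that] om(4,5)[of n x] by simp
 have rho\<Theta>B: "abs (rho m t * \<Theta> (t, x)) <= B" if "t \<in> {0..T}" "x \<in> {0..1}" for m t x
  unfolding abs_mult using mult_mono[of "abs (rho m t)" 1 "abs (\<Theta> (t, x))" B] \<Theta>B[OF that] rho(4,5)[of m t] by simp
 have FT: "L1_curve {0..T} \<J> F" by (rule L1_curve_subset[OF F]) auto
 have com: "continuous_on UNIV (%q. om n (snd q) * \<Theta> q)" for n
  by (rule smoothD(2)[OF smooth_mult[OF smooth_snd[OF oms] \<Theta>s]])
 have crho: "continuous_on UNIV (%q. rho m (snd q) * \<Theta> (snd q, fst q))" for m
  by (intro continuous_on_mult smoothD(2)[OF smooth_snd[OF rhos]] continuous_on_compose2[OF \<Theta>c]) (auto intro!: continuous_intros)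
 have Pc: "continuous_on {0..T} (P n)" for n unfolding P_def by (rule pairing_continuous[where B = B, OF FT com]) (use om\<Theta>B in auto)
 have Qc: "continuous_on {0..T} Q" unfolding Q_def by (rule pairing_continuous[where B = B, OF FT \<Theta>c]) (use \<Theta>B in auto)
 have Rc: "continuous_on {0..1} (R m)" for m unfolding R_def by (rule pairing_continuous[where B = B, OF W crho]) (use rho\<Theta>B in auto)
 obtain K where K: "!!t. t \<in> {0..T} ==> (LINT x|?U. abs (F t x)) <= K"
  using compact_imp_bounded[OF compact_continuous_image[OF L1_norm_continuous[OF FT] compact_Icc]] unfolding bounded_iff by fastforce
 have n_lim: "(%n. (LINT t|?L. rho' m t * P n t) - sg * (LINT x|?U. om' n x * R m x)) \<longlonglongrightarrow> (LINT t|?L. rho' m t * Q t) - sg * (R m 0 - R m 1)" for m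
 proof (intro tendsto_diff tendsto_mult_left om(7)[OF Rc])
  show "(%n. LINT t|?L. rho' m t * P n t) \<longlonglongrightarrow> (LINT t|?L. rho' m t * Q t)"
  proof (rule L1_pairing_tendsto[where B = "B * K"])
   show "integrable ?L (rho' m)" "integrable ?L (rho' m)"
    by (rule continuous_on_integral_Ioo(1)[OF continuous_on_subset[OF smoothD(2)[OF rho(3)]]]; simp)+
   show "P n \<in> borel_measurable ?L" for n using continuous_on_integral_Ioo(1)[OF Pc] by (rule borel_measurable_integrable)
   fix t assume "t \<in> space ?L"
   then have t: "t \<in> {0..T}" "t \<in> {0..}" by auto
   note m = continuous_slice_measurable[OF com]
   show "abs (P n t) <= B * K" for n
   proof -
    have "abs (P n t) <= B * (LINT x|?U. abs (F t x))" unfolding P_def pairing_def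
     by (rule integrable_mult_bounded(2)[OF L1_curveD[OF F t(2)] m]) (use om\<Theta>B t in auto)
    also have "... <= B * K" by (rule mult_left_mono[OF K[OF t(1)] B0])
    finally show ?thesis .
   qed
   show "(%n. P n t) \<longlonglongrightarrow> Q t" unfolding P_def Q_def pairing_def
   proof (rule L1_pairing_tendsto[where B = B, OF L1_curveD[OF F t(2)] L1_curveD[OF F t(2)] _ m])
    show "(%n. om n (snd (t, x)) * \<Theta> (t, x)) \<longlonglongrightarrow> \<Theta> (t, x)" if "x \<in> space ?U" for x
     using tendsto_mult_right[OF om(6)[of x], of "\<Theta> (t, x)"] that by simp
   qed (use om\<Theta>B t in auto)
  qed simp
 qed
 have m_le: "abs ((LINT t|?L. rho' m t * Q t) - sg * (R m 0 - R m 1)) <= N * B" for m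
  by (rule LIMSEQ_le_const2[OF tendsto_rabs[OF n_lim]]) (use key in auto)
 have Rlim: "(%m. R m x) \<longlonglongrightarrow> (LINT t|?L. W x t * \<theta> (t + sg * x))" if x: "x \<in> {0..1}" for x
  unfolding R_def pairing_def
 proof (rule L1_pairing_tendsto[where B = B, OF L1_curveD[OF W x] L1_curveD[OF W x] _ continuous_slice_measurable[OF crho]])
  show "(%m. rho m (snd (x, t)) * \<Theta> (snd (x, t), fst (x, t))) \<longlonglongrightarrow> \<theta> (t + sg * x)" if "t \<in> space ?L" for t
   using tendsto_mult_right[OF rho(6)[of t], of "\<Theta> (t, x)"] that by (simp add: \<Theta>e)
 qed (use rho\<Theta>B x in auto)
 have lim: "(%m. (LINT t|?L. rho' m t * Q t) - sg * (R m 0 - R m 1)) \<longlonglongrightarrow> Q 0 - Q T - sg * ((LINT t|?L. W 0 t * \<theta> (t + sg * 0)) - (LINT t|?L. W 1 t * \<theta> (t + sg * 1)))"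
  by (intro tendsto_diff tendsto_mult_left rho(7)[OF Qc] Rlim) auto
 have "abs (Q 0 - Q T - sg * ((LINT t|?L. W 0 t * \<theta> (t + sg * 0)) - (LINT t|?L. W 1 t * \<theta> (t + sg * 1)))) <= N * B"
  by (rule LIMSEQ_le_const2[OF tendsto_rabs[OF lim]]) (use m_le in auto)
 then show ?thesis by (simp add: Q_def pairing_def \<Theta>e abs_le_iff algebra_simps)
qed

text \<open>A function on an interval, extended by zero and moved along an isometry of the line, together with
 the change of variables for its integrals.\<close>
definition line_density :: "real set => (real => real) => (real => real) => bool" where
 "line_density D f g \<longleftrightarrow> (\<forall>x. x \<notin> D --> g x = 0) \<and>
  (\<forall>sg c. abs sg = 1 --> integrable lborel (%y. g (sg * (y - c)))) \<and>
  (\<forall>sg c psi. abs sg = 1 --> psi \<in> borel1 --> (LINT x|lebesgue_on D. f x * psi (c + sg * x)) = (LBINT y. g (sg * (y - c)) * psi y)) \<and>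
  (\<forall>sg c. abs sg = 1 --> (LINT x|lebesgue_on D. abs (f x)) = (LBINT y. abs (g (sg * (y - c)))))"

lemma line_densityD:
 assumes "line_density D f g"
 shows "x \<notin> D ==> g x = 0" "abs sg = 1 ==> integrable lborel (%y. g (sg * (y - c)))"
  "abs sg = 1 ==> psi \<in> borel1 ==> (LINT x|lebesgue_on D. f x * psi (c + sg * x)) = (LBINT y. g (sg * (y - c)) * psi y)"
  "abs sg = 1 ==> (LINT x|lebesgue_on D. abs (f x)) = (LBINT y. abs (g (sg * (y - c))))"
 using assms unfolding line_density_def by blast+

lemma line_density_exists:
 assumes f: "integrable (lebesgue_on {a<..<b::real}) f"
 obtains g where "line_density {a<..<b} f g"
proof -
 obtain g0 where g0 [measurable]: "g0 \<in> borel1" and ae: "AE x in leb a b. f x = g0 x"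
  by (rule borel_representative[OF borel_measurable_integrable[OF f]]) auto
 define g where "g x = indicator {a<..<b} x * g0 x" for x
 have [measurable]: "g \<in> borel1" unfolding g_def[abs_def] by measurable
 have tr: "(LINT x|leb a b. h (f x) x) = (LBINT x. h (g x) x)" if [measurable]: "case_prod h \<in> borel2" and h0: "!!x. h 0 x = 0" for h :: "real => real => real"
 proof -
  have m: "(%x. h (g0 x) x) \<in> borel1"
   by (rule measurable_Pair_compose_split[OF that(1)]) simp_all
  have "(LINT x|leb a b. h (f x) x) = (LINT x|leb a b. h (g0 x) x)"
   by (rule integral_lebesgue_on_cong_AE[OF lebesgue_on_borel(1)[OF m]]) (use ae in \<open>auto elim!: eventually_mono\<close>)
  also have "... = (LBINT x:{a<..<b}. h (g0 x) x)" by (rule lebesgue_on_borel(3)[OF m]) simp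
  also have "... = (LBINT x. h (g x) x)"
   unfolding set_lebesgue_integral_def by (intro integral_cong_space) (simp add: g_def h0 indicator_def)
  finally show ?thesis .
 qed
 have gi: "integrable lborel g"
 proof -
  have "integrable (leb a b) g0"
   by (rule integrable_cong_AE_imp[OF f lebesgue_on_borel(1)[OF g0]]) (use ae in \<open>auto elim: eventually_mono\<close>)
  then have "lint {a<..<b} g0" using lebesgue_on_borel(2)[OF g0, of "{a<..<b}"] by simp
  then show ?thesis by (simp add: set_integrable_def g_def[abs_def])
 qed
 have push: "(LBINT x. h (c + sg * x)) = (LBINT y. h y)" if "abs sg = 1" for h :: "real => real" and sg c
  using lborel_integral_real_affine[of sg h c] that by auto
 have ss: "sg * (sg * x) = x" if "abs sg = 1" for sg x :: real using that by (auto simp: abs_if split: if_splits)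
 have "line_density {a<..<b} f g"
  unfolding line_density_def
 proof (intro conjI allI impI)
  show "g x = 0" if "x \<notin> {a<..<b}" for x using that by (simp add: g_def)
  show "integrable lborel (%y. g (sg * (y - c)))" if "abs sg = 1" for sg c
   using lborel_integrable_real_affine[OF gi, of sg "- (sg * c)"] that by (auto simp: algebra_simps)
  show "(LINT x|leb a b. f x * psi (c + sg * x)) = (LBINT y. g (sg * (y - c)) * psi y)"
   if s: "abs sg = 1" and [measurable]: "psi \<in> borel1" for sg c psi
  proof -
   have "(LINT x|leb a b. f x * psi (c + sg * x)) = (LBINT x. g x * psi (c + sg * x))"
    by (rule tr[where h = "%u x. u * psi (c + sg * x)"]) (simp_all add: case_prod_beta)
   also have "... = (LBINT x. g (sg * ((c + sg * x) - c)) * psi (c + sg * x))" by (simp add: ss[OF s])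
   finally show ?thesis using push[OF s, where h = "%y. g (sg * (y - c)) * psi y" and c = c] by simp
  qed
  show "(LINT x|leb a b. abs (f x)) = (LBINT y. abs (g (sg * (y - c))))" if s: "abs sg = 1" for sg c
  proof -
   have "(LINT x|leb a b. abs (f x)) = (LBINT x. abs (g x))"
    by (rule tr[where h = "%u x. abs u"]) (simp_all add: case_prod_beta)
   also have "... = (LBINT x. abs (g (sg * ((c + sg * x) - c))))" by (simp add: ss[OF s])
   finally show ?thesis using push[OF s, where h = "%y. abs (g (sg * (y - c)))" and c = c] by simp
  qed
 qed
 then show thesis by (rule that)
qed

text \<open>In the variable \<open>t + sg x\<close> the four integrals combine to the pairing of one function
 \<open>J\<close> with \<open>\<theta>\<close>, so \<open>\<parallel>J\<parallel> \<le> N\<close> in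
 \<open>L\<^sup>1\<close>. The two outgoing parts of \<open>J\<close> have disjoint supports, hence their
 norms add up.\<close>
lemma L1_balance_of_polynomials:
 assumes T: "0 < T" and sg: "sg = 1 \<or> sg = - 1"
  and f: "integrable \<U> f1" "integrable \<U> f0"
  and g: "integrable (leb 0 T) g0" "integrable (leb 0 T) g1"
  and bound: "\<forall>\<theta> B. real_polynomial_function \<theta> --> (\<forall>t\<in>{0..T}. \<forall>x\<in>{0..1}. abs (\<theta> (t + sg * x)) <= B) -->
   abs ((LINT x|\<U>. f1 x * \<theta> (T + sg * x)) - (LINT x|\<U>. f0 x * \<theta> (sg * x))
    + sg * ((LINT t|leb 0 T. g0 t * \<theta> t) - (LINT t|leb 0 T. g1 t * \<theta> (t + sg)))) <= N * B"
 shows "(LINT x|\<U>. abs (f1 x)) + (LINT t|leb 0 T. abs (if sg = 1 then g0 t else g1 t))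
  <= (LINT x|\<U>. abs (f0 x)) + (LINT t|leb 0 T. abs (if sg = 1 then g1 t else g0 t)) + N"
proof -
 have s1: "abs sg = 1" using sg by auto
 obtain F1 where F1: "line_density \<J> f1 F1" by (rule line_density_exists[OF f(1)])
 obtain F0 where F0: "line_density \<J> f0 F0" by (rule line_density_exists[OF f(2)])
 obtain G0 where G0: "line_density {0<..<T} g0 G0" by (rule line_density_exists[OF g(1)])
 obtain G1 where G1: "line_density {0<..<T} g1 G1" by (rule line_density_exists[OF g(2)])
 note F1 = line_densityD[OF F1] and F0 = line_densityD[OF F0] and G0 = line_densityD[OF G0] and G1 = line_densityD[OF G1]
 let ?F1 = "%y. F1 (sg * (y - T))" and ?F0 = "%y. F0 (sg * (y - 0))" and ?G0 = "%y. G0 (1 * (y - 0))" and ?G1 = "%y. G1 (1 * (y - sg))"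
 note int = F1(2)[OF s1, of T] F0(2)[OF s1, of 0] G0(2)[of 1 0] G1(2)[of 1 sg]
 define lo where "lo = min 0 sg"
 define hi where "hi = T + max 0 sg"
 define J where "J y = ?F1 y - ?F0 y + sg * (?G0 y - ?G1 y)" for y
 have range: "t + sg * x \<in> {lo..hi}" if "t \<in> {0..T}" "x \<in> {0..1}" for t x
  using sg that by (auto simp: lo_def hi_def)
 have off: "?F1 y = 0" "?F0 y = 0" "?G0 y = 0" "?G1 y = 0" if "y \<notin> {lo..hi}" for y
  using sg that T by (auto simp: lo_def hi_def intro!: F1(1) F0(1) G0(1) G1(1))
 have Ji: "integrable lborel J" unfolding J_def[abs_def] using int by simp
 then have Jm [measurable]: "J \<in> borel1" using borel_measurable_integrable[OF Ji] by simp
 have on: "(LINT y|lebesgue_on {lo..hi}. h y) = (LBINT y. h y)" if hm: "h \<in> borel1" and h0: "!!y. y \<notin> {lo..hi} ==> h y = 0" for h :: "real => real"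
 proof -
  have "(LINT y|lebesgue_on {lo..hi}. h y) = (LBINT y:{lo..hi}. h y)" by (rule lebesgue_on_borel(3)[OF hm]) simp
  also have "... = (LBINT y. h y)" unfolding set_lebesgue_integral_def
   by (intro integral_cong_space) (use h0 in \<open>auto simp: indicator_def\<close>)
  finally show ?thesis .
 qed
 have J0: "J y = 0" if "y \<notin> {lo..hi}" for y unfolding J_def off[OF that] by simp
 have "(LINT y|lebesgue_on {lo..hi}. abs (J y)) <= N"
 proof (rule L1_norm_le_of_polynomials)
  show "integrable (lebesgue_on {lo..hi}) J"
   using lebesgue_on_borel(2)[OF Jm, of "{lo..hi}"] integrable_mult_indicator[OF _ Ji, of "{lo..hi}"] by (simp add: set_integrable_def)
  fix P B assume P: "real_polynomial_function P" and PB: "!!y. y \<in> {lo..hi} ==> abs (P y) <= B"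
  \<comment> \<open>A polynomial is bounded on the interval only, so it is cut off outside, where \<open>J\<close> vanishes.\<close>
  define P' where "P' y = indicator {lo..hi} y * P y" for y
  have Pm [measurable]: "P \<in> borel1" by (rule borel_measurable_continuous_onI[OF smoothD(2)[OF smooth_polynomial[OF P]]])
  have P'm [measurable]: "P' \<in> borel1" unfolding P'_def[abs_def] by measurable
  have B0: "0 <= B" using PB[OF range[of 0 0]] T by (simp add: order_trans[OF abs_ge_zero])
  have P'B: "abs (P' y) <= B" for y using PB[of y] B0 by (simp add: P'_def indicator_def)
  have P'e: "P (t + sg * x) = P' (t + sg * x)" if "t \<in> {0..T}" "x \<in> {0..1}" for t x using range[OF that] by (simp add: P'_def)
  have e1: "(LINT x|\<U>. f1 x * P (T + sg * x)) = (LBINT y. ?F1 y * P' y)"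
   unfolding F1(3)[OF s1 P'm, symmetric] using P'e T by (intro integral_cong_space) simp
  have e2: "(LINT x|\<U>. f0 x * P (sg * x)) = (LBINT y. ?F0 y * P' y)"
   unfolding F0(3)[OF s1 P'm, symmetric] using P'e[of 0] T by (intro integral_cong_space) simp
  have e3: "(LINT t|leb 0 T. g0 t * P t) = (LBINT y. ?G0 y * P' y)"
   unfolding G0(3)[OF abs_one P'm, symmetric] using P'e[of _ 0] by (intro integral_cong_space) simp
  have e4: "(LINT t|leb 0 T. g1 t * P (t + sg)) = (LBINT y. ?G1 y * P' y)"
   unfolding G1(3)[OF abs_one P'm, symmetric] using P'e[of _ 1] by (intro integral_cong_space) (simp add: add.commute)
  have i: "integrable lborel (%y. h y * P' y)" if "integrable lborel h" for h
   by (rule integrable_mult_bounded(1)[OF that, where B = B]) (use P'B in auto)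
  have "(LINT y|lebesgue_on {lo..hi}. J y * P y) = (LBINT y. J y * P y)" by (rule on) (use J0 in auto)
  also have "... = (LBINT y. ?F1 y * P' y - ?F0 y * P' y + sg * (?G0 y * P' y - ?G1 y * P' y))"
  proof (rule integral_cong_space)
   fix y
   have "J y * P y = J y * P' y" using J0[of y] by (cases "y \<in> {lo..hi}") (auto simp: P'_def)
   then show "J y * P y = ?F1 y * P' y - ?F0 y * P' y + sg * (?G0 y * P' y - ?G1 y * P' y)" by (simp add: J_def algebra_simps)
  qed
  also have "... = (LBINT y. ?F1 y * P' y) - (LBINT y. ?F0 y * P' y) + sg * ((LBINT y. ?G0 y * P' y) - (LBINT y. ?G1 y * P' y))"
   using int[THEN i] by simp
  also have "abs (...) <= N * B"
   unfolding e1[symmetric] e2[symmetric] e3[symmetric] e4[symmetric] using bound P PB range by blast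
  finally show "abs (LINT y|lebesgue_on {lo..hi}. J y * P y) <= N * B" .
 qed
 then have JN: "(LBINT y. abs (J y)) <= N" using on[of "%y. abs (J y)"] J0 by simp
 note norms = F1(4)[OF s1, of T] F0(4)[OF s1, of 0] G0(4)[OF abs_one, of 0] G1(4)[OF abs_one, of sg]
 show ?thesis
 proof (cases "sg = 1")
  case True
  have "abs (?F1 y) + abs (?G0 y) <= abs (?F0 y) + abs (?G1 y) + abs (J y)" for y
  proof -
   have "?F1 y = 0 \<or> ?G0 y = 0" using F1(1)[of "y - T"] G0(1)[of y] True by (cases "y < T") auto
   then show ?thesis using True unfolding J_def by auto
  qed
  then have "(LBINT y. abs (?F1 y) + abs (?G0 y)) <= (LBINT y. abs (?F0 y) + abs (?G1 y) + abs (J y))"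
   by (intro integral_mono) (use int Ji in auto)
  then show ?thesis using int Ji JN True norms by simp
 next
  case False
  then have m: "sg = - 1" using sg by simp
  have "abs (?F1 y) + abs (?G1 y) <= abs (?F0 y) + abs (?G0 y) + abs (J y)" for y
  proof -
   have "?F1 y = 0 \<or> ?G1 y = 0" using F1(1)[of "T - y"] G1(1)[of "y + 1"] m by (cases "y < T - 1") auto
   then show ?thesis using m unfolding J_def by auto
  qed
  then have "(LBINT y. abs (?F1 y) + abs (?G1 y)) <= (LBINT y. abs (?F0 y) + abs (?G0 y) + abs (J y))"
   by (intro integral_mono) (use int Ji in auto)
  then show ?thesis using int Ji JN m norms by simp
 qed
qed

lemma Gronwall_zero:
 fixes n :: "real => real"
 assumes n: "continuous_on {0..} n" "!!t. 0 <= t ==> 0 <= n t"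
  and le: "!!t. 0 <= t ==> n t <= A * integral {0..t} n" and A: "0 <= A" and T: "0 <= T"
 shows "n T = 0"
proof -
 let ?E = "%t. exp (- A * t) * integral {0..t} n"
 have c: "continuous_on {0..T} n" by (rule continuous_on_subset[OF n(1)]) auto
 have D: "((%t. integral {0..t} n) has_real_derivative n t) (at t within {0..T})" if "t \<in> {0..T}" for t
  by (rule integral_has_real_derivative[OF c that])
 have "?E T <= ?E 0"
 proof (rule DERIV_nonpos_imp_decreasing_open[OF T])
  fix t assume t: "0 < t" "t < T"
  have "((%t. integral {0..t} n) has_real_derivative n t) (at t)" using D[of t] t by (simp add: at_within_Icc_at)
  then have "(?E has_real_derivative exp (- A * t) * (n t - A * integral {0..t} n)) (at t)"
   by (auto intro!: derivative_eq_intros simp: algebra_simps)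
  moreover have "exp (- A * t) * (n t - A * integral {0..t} n) <= 0" using le[of t] t by (simp add: mult_le_0_iff)
  ultimately show "\<exists>y. (?E has_real_derivative y) (at t) \<and> y <= 0" by blast
 next
  show "continuous_on {0..T} ?E"
   using D by (intro continuous_intros DERIV_continuous_on[where D = n]) auto
 qed
 then have "integral {0..T} n <= 0" by (simp add: mult_le_0_iff)
 then have "n T <= 0" using le[OF T] A by (meson mult_nonneg_nonpos order_trans)
 then show ?thesis using n(2)[OF T] by simp
qed

text \<open>The part of \<open>space_curve_of\<close> that is linear in both curves.\<close>
definition same_distribution :: "real => (real => real => real) => (real => real => real) => bool" where
 "same_distribution T v w \<longleftrightarrow> (\<forall>phi\<in>test_functions ({0<..<T} \<times> \<J>).
   (LINT t|leb 0 T. LINT x|\<U>. v t x * phi (t, x)) = (LINT x|\<U>. LINT t|leb 0 T. w x t * phi (t, x)))"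

lemma same_distribution_combine:
 assumes v: "L1_curve {0..} \<J> v" "L1_curve {0..} \<J> v'"
  and w: "L1_curve {0..1} {0<..<T} w" "L1_curve {0..1} {0<..<T} w'"
  and s: "same_distribution T v w" "same_distribution T v' w'"
 shows "same_distribution T (%t x. v t x + sg * v' t x) (%x t. w x t + sg * w' x t)"
 unfolding same_distribution_def
proof
 fix phi assume phi: "phi \<in> test_functions ({0<..<T} \<times> \<J>)"
 note P = test_function_plane[OF phi]
 obtain M where M: "!!q. abs (phi q) <= M" using test_function_bounded[OF phi] by blast
 have sc: "continuous_on UNIV (%q. phi (snd q, fst q))" by (rule continuous_on_compose2[OF P(4)]) (auto intro!: continuous_intros)
 note m = continuous_slice_measurable[OF sc, simplified]
 have Wi: "integrable \<U> (%x. LINT t|leb 0 T. w x t * phi (t, x))"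
  if "L1_curve {0..1} {0<..<T} w" for w
  using continuous_on_integral_Ioo(1)[OF pairing_continuous[OF that sc M]] by (simp add: pairing_def[abs_def])
 have "(LINT t|leb 0 T. LINT x|\<U>. (v t x + sg * v' t x) * phi (t, x))
  = (LINT t|leb 0 T. LINT x|\<U>. v t x * phi (t, x)) + sg * (LINT t|leb 0 T. LINT x|\<U>. v' t x * phi (t, x))"
  using pairing_combine[OF v P(5) M, of T sg] by (simp add: pairing_def)
 also have "... = (LINT x|\<U>. LINT t|leb 0 T. w x t * phi (t, x)) + sg * (LINT x|\<U>. LINT t|leb 0 T. w' x t * phi (t, x))"
  using s phi by (simp add: same_distribution_def)
 also have "... = (LINT x|\<U>. (LINT t|leb 0 T. w x t * phi (t, x)) + sg * (LINT t|leb 0 T. w' x t * phi (t, x)))"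
  using Wi[OF w(1)] Wi[OF w(2)] by simp
 also have "... = (LINT x|\<U>. LINT t|leb 0 T. (w x t + sg * w' x t) * phi (t, x))"
 proof (rule integral_cong_space)
  fix x assume "x \<in> space \<U>"
  then have x: "x \<in> {0..1}" by simp
  show "(LINT t|leb 0 T. w x t * phi (t, x)) + sg * (LINT t|leb 0 T. w' x t * phi (t, x)) = (LINT t|leb 0 T. (w x t + sg * w' x t) * phi (t, x))"
   using integrable_mult_bounded(1)[OF L1_curveD[OF w(1) x] m M] integrable_mult_bounded(1)[OF L1_curveD[OF w(2) x] m M]
   by (simp add: distrib_right mult.assoc)
 qed
 finally show "(LINT t|leb 0 T. LINT x|\<U>. (v t x + sg * v' t x) * phi (t, x))
  = (LINT x|\<U>. LINT t|leb 0 T. (w x t + sg * w' x t) * phi (t, x))" .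
qed

lemma space_deriv_initial:
 assumes p: "1 < p" and w: "weak_solution p \<kappa> a u0 u1 u" and w': "weak_solution p \<kappa> a u0 u1 u'"
 shows "AE x in \<U>. space_deriv u 0 x = space_deriv u' 0 x"
proof -
 note C = weak_solution_curves[OF p w] and C' = weak_solution_curves[OF p w']
 have loc: "space_deriv u 0 \<in> L1_loc \<J>" "space_deriv u' 0 \<in> L1_loc \<J>"
  using Lp_imp_L1_loc[OF _ C(6)] Lp_imp_L1_loc[OF _ C'(6)] p by auto
 have "AE x in \<U>. u 0 x = u0 x" "AE x in \<U>. u' 0 x = u0 x"
  using w w' by (auto simp: weak_solution_def)
 then have ae: "AE x in \<U>. u' 0 x = u 0 x" by eventually_elim simp
 have "is_weak_deriv \<J> (u 0) (space_deriv u' 0)"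
  unfolding is_weak_deriv_def
 proof
  fix phi assume phi: "phi \<in> test_functions \<J>"
  have "integrable \<U> (%x. u' 0 x * deriv phi x)"
   by (rule integrable_mult_continuous[OF L1_curveD[OF C'(1)] continuous_on_subset[OF test_function_deriv(4)[OF phi]]]) auto
  then have "(LINT x|\<U>. u 0 x * deriv phi x) = (LINT x|\<U>. u' 0 x * deriv phi x)"
   by (intro integral_lebesgue_on_cong_AE borel_measurable_integrable) (use ae in \<open>auto elim: eventually_mono\<close>)
  then show "(LINT x|\<U>. u 0 x * deriv phi x) = - (LINT x|\<U>. space_deriv u' 0 x * phi x)"
   using C'(5)[of 0] phi by (simp add: is_weak_deriv_def)
 qed
 then show ?thesis using weak_deriv_unique[OF loc(1) C(5) loc(2)] by simp
qed

text \<open>Adding the \<open>L\<^sup>1\<close> balances of both Riemann invariants, the traces cancel: at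
 each end the boundary condition makes the reflected trace at most as large as the incoming one, as
 \<open>\<bar>1 - \<kappa>\<bar> \<le> 1 + \<kappa>\<close>.\<close>
lemma velocity_difference_bound:
 fixes a :: "real \<times> real => real"
 assumes p: "1 < p" and \<kappa>: "0 < \<kappa>" and a: "a \<in> borel2" and aA: "!!q. abs (a q) <= A"
  and w: "weak_solution p \<kappa> a u0 u1 u" and w': "weak_solution p \<kappa> a u0 u1 u'" and T: "0 < T"
 defines "n \<equiv> %t. LINT x|\<U>. abs (time_deriv p u' t x + (- 1) * time_deriv p u t x)"
 shows "n T <= A * (LINT t|leb 0 T. n t)"
proof -
 let ?L = "leb 0 T" and ?U = "\<U>"
 have p1: "p >= 1" using p by simp
 have A0: "0 <= A" using aA[of 0] by (simp add: order_trans[OF abs_ge_zero])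
 note C = weak_solution_curves[OF p w] and C' = weak_solution_curves[OF p w']
 obtain vt vx where tr: "space_curve_of p T (time_deriv p u) vt" "space_curve_of p T (space_deriv u) vx"
  "AE t in ?L. vx 0 t - \<kappa> * vt 0 t = 0 \<and> vx 1 t + \<kappa> * vt 1 t = 0"
  using w T unfolding weak_solution_def by blast
 obtain vt' vx' where tr': "space_curve_of p T (time_deriv p u') vt'" "space_curve_of p T (space_deriv u') vx'"
  "AE t in ?L. vx' 0 t - \<kappa> * vt' 0 t = 0 \<and> vx' 1 t + \<kappa> * vt' 1 t = 0"
  using w' T unfolding weak_solution_def by blast
 have W: "L1_curve {0..1} {0<..<T} vt" "L1_curve {0..1} {0<..<T} vx" "L1_curve {0..1} {0<..<T} vt'" "L1_curve {0..1} {0<..<T} vx'"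
  using tr tr' by (auto simp: space_curve_of_def intro!: L1_curve_of_Lp[OF p1])
 have S: "same_distribution T (time_deriv p u) vt" "same_distribution T (space_deriv u) vx"
  "same_distribution T (time_deriv p u') vt'" "same_distribution T (space_deriv u') vx'"
  using tr tr' by (auto simp: space_curve_of_def same_distribution_def)
 let ?F = "%sg t x. (time_deriv p u' t x + sg * space_deriv u' t x) + (- 1) * (time_deriv p u t x + sg * space_deriv u t x)"
 let ?W = "%sg x t. (vt' x t + sg * vx' x t) + (- 1) * (vt x t + sg * vx x t)"
 note Fc = L1_curve_combine[OF L1_curve_combine[OF C'(2,3)] L1_curve_combine[OF C(2,3)]]
 note Wc = L1_curve_combine[OF L1_curve_combine[OF W(3,4)] L1_curve_combine[OF W(1,2)]]
 note Vc = L1_curve_combine[OF C'(2) C(2), of "- 1"]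
 have pair: "same_distribution T (?F sg) (?W sg)" for sg
  by (intro same_distribution_combine L1_curve_combine C C' W S)
 define N where "N = A * (LINT t|?L. n t)"
 have bound: "abs (LINT t|?L. pairing \<J> (?F sg) (%q. dt phi q - sg * dx phi q) t) <= N * B"
  if phi: "phi \<in> test_functions ({0<..<T} \<times> \<J>)" and sym: "dx (dt phi) = dt (dx phi)"
   and B: "\<forall>q. abs (phi q) <= B" and s: "sg * sg = 1" for phi B sg
 proof -
  obtain M where m12: "(%q. dt phi q - sg * dx phi q) \<in> borel2" and b12: "!!q. abs (dt phi q - sg * dx phi q) <= M"
   by (rule test_function_direction[OF phi]) (rule that)
  have am: "(%q. a q * phi q) \<in> borel2" using a test_function_plane(5)[OF phi] by measurable
  have aB: "abs (a q * phi q) <= A * B" for q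
   unfolding abs_mult by (intro mult_mono aA B[rule_format] A0 abs_ge_zero)
  let ?psi = "%q. dt phi q - sg * dx phi q"
  have "(LINT t|?L. pairing \<J> (?F sg) ?psi t) = (LINT t|?L. pairing \<J> (%t x. time_deriv p u' t x + sg * space_deriv u' t x) ?psi t)
   + (- 1) * (LINT t|?L. pairing \<J> (%t x. time_deriv p u t x + sg * space_deriv u t x) ?psi t)"
   by (rule pairing_combine[OF L1_curve_combine[OF C'(2,3)] L1_curve_combine[OF C(2,3)] m12 b12])
  also have "... = (LINT t|?L. pairing \<J> (time_deriv p u') (%q. a q * phi q) t) + (- 1) * (LINT t|?L. pairing \<J> (time_deriv p u) (%q. a q * phi q) t)"
   by (simp only: first_order_system[OF p w a aA phi sym T s] first_order_system[OF p w' a aA phi sym T s])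
  also have "... = (LINT t|?L. pairing \<J> (%t x. time_deriv p u' t x + (- 1) * time_deriv p u t x) (%q. a q * phi q) t)"
   by (rule pairing_combine[OF C'(2) C(2) am aB, symmetric])
  finally have e: "(LINT t|?L. pairing \<J> (?F sg) ?psi t)
   = (LINT t|?L. pairing \<J> (%t x. time_deriv p u' t x + (- 1) * time_deriv p u t x) (%q. a q * phi q) t)" .
  have eN: "N * B = A * B * (LINT t|?L. n t)" by (simp add: N_def)
  show ?thesis unfolding e eN unfolding n_def by (rule pairing_integrable(2)[OF Vc am aB])
 qed
 have balance: "(LINT x|?U. abs (?F sg T x)) + (LINT t|?L. abs (if sg = 1 then ?W sg 0 t else ?W sg 1 t)) <= (LINT t|?L. abs (if sg = 1 then ?W sg 1 t else ?W sg 0 t)) + N"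
  if sg: "sg = 1 \<or> sg = - 1" for sg
 proof -
  have s: "sg * sg = 1" using sg by auto
  have "AE x in ?U. time_deriv p u 0 x = u1 x" "AE x in ?U. time_deriv p u' 0 x = u1 x"
   using w w' by (auto simp: weak_solution_def)
  with space_deriv_initial[OF p w w'] have "AE x in ?U. 0 = abs (?F sg 0 x)" by eventually_elim simp
  then have z: "(LINT x|?U. abs (?F sg 0 x)) = 0"
   using integral_lebesgue_on_cong_AE[of "%_. 0" \<J> "%x. abs (?F sg 0 x)"] by simp
  have "(LINT x|?U. abs (?F sg T x)) + (LINT t|?L. abs (if sg = 1 then ?W sg 0 t else ?W sg 1 t))
   <= (LINT x|?U. abs (?F sg 0 x)) + (LINT t|?L. abs (if sg = 1 then ?W sg 1 t else ?W sg 0 t)) + N"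
  proof (rule L1_balance_of_polynomials[OF T sg])
   show "integrable ?U (?F sg T)" "integrable ?U (?F sg 0)" by (rule L1_curveD[OF Fc]; use T in simp)+
   show "integrable ?L (?W sg 0)" "integrable ?L (?W sg 1)" by (rule L1_curveD[OF Wc]; simp)+
   show "\<forall>\<theta> B. real_polynomial_function \<theta> --> (\<forall>t\<in>{0..T}. \<forall>x\<in>{0..1}. abs (\<theta> (t + sg * x)) <= B) -->
    abs ((LINT x|?U. ?F sg T x * \<theta> (T + sg * x)) - (LINT x|?U. ?F sg 0 x * \<theta> (sg * x))
     + sg * ((LINT t|?L. ?W sg 0 t * \<theta> t) - (LINT t|?L. ?W sg 1 t * \<theta> (t + sg)))) <= N * B"
   proof (intro allI impI)
    fix \<theta> B assume \<theta>: "real_polynomial_function \<theta>" and B: "\<forall>t\<in>{0..T}. \<forall>x\<in>{0..1}. abs (\<theta> (t + sg * x)) <= B"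
    show "abs ((LINT x|?U. ?F sg T x * \<theta> (T + sg * x)) - (LINT x|?U. ?F sg 0 x * \<theta> (sg * x))
     + sg * ((LINT t|?L. ?W sg 0 t * \<theta> t) - (LINT t|?L. ?W sg 1 t * \<theta> (t + sg)))) <= N * B"
    proof (rule characteristic_balance[OF Fc Wc T s pair[unfolded same_distribution_def] _ smooth_polynomial[OF \<theta>]])
     show "\<forall>phi\<in>test_functions ({0<..<T} \<times> \<J>). \<forall>B. dx (dt phi) = dt (dx phi) --> (\<forall>q. abs (phi q) <= B) -->
      abs (LINT t|?L. pairing \<J> (?F sg) (%q. dt phi q - sg * dx phi q) t) <= N * B"
      using bound s by blast
     show "abs (\<theta> (t + sg * x)) <= B" if "t \<in> {0..T}" "x \<in> {0..1}" for t x using B that by blast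
    qed
   qed
  qed
  then show ?thesis using z by simp
 qed
 have Wi: "integrable ?L (?W sg x)" if "x \<in> {0..1}" for sg x by (rule L1_curveD[OF Wc that])
 have r: "abs (1 - \<kappa>) <= 1 + \<kappa>" using \<kappa> by auto
 have b1: "(LINT t|?L. abs (?W 1 1 t)) <= (LINT t|?L. abs (?W (- 1) 1 t))"
 proof (rule integral_mono_AE)
  show "AE t in ?L. abs (?W 1 1 t) <= abs (?W (- 1) 1 t)"
   using tr(3) tr'(3)
  proof eventually_elim
   case (elim t)
   then have "vx 1 t = - \<kappa> * vt 1 t" "vx' 1 t = - \<kappa> * vt' 1 t" by simp_all
   then have e: "?W 1 1 t = (1 - \<kappa>) * (vt' 1 t - vt 1 t)" "?W (- 1) 1 t = (1 + \<kappa>) * (vt' 1 t - vt 1 t)" by (simp_all add: algebra_simps)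
   show ?case unfolding e abs_mult using r \<kappa> by (intro mult_right_mono) auto
  qed
 qed ((rule integrable_abs, rule Wi, simp)+)
 have b0: "(LINT t|?L. abs (?W (- 1) 0 t)) <= (LINT t|?L. abs (?W 1 0 t))"
 proof (rule integral_mono_AE)
  show "AE t in ?L. abs (?W (- 1) 0 t) <= abs (?W 1 0 t)"
   using tr(3) tr'(3)
  proof eventually_elim
   case (elim t)
   then have "vx 0 t = \<kappa> * vt 0 t" "vx' 0 t = \<kappa> * vt' 0 t" by simp_all
   then have e: "?W (- 1) 0 t = (1 - \<kappa>) * (vt' 0 t - vt 0 t)" "?W 1 0 t = (1 + \<kappa>) * (vt' 0 t - vt 0 t)" by (simp_all add: algebra_simps)
   show ?case unfolding e abs_mult using r \<kappa> by (intro mult_right_mono) auto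
  qed
 qed ((rule integrable_abs, rule Wi, simp)+)
 have Fi: "integrable ?U (?F sg T)" for sg by (rule L1_curveD[OF Fc]) (use T in simp)
 have "2 * n T = (LINT x|?U. abs (?F 1 T x + ?F (- 1) T x))"
 proof -
  have "(LINT x|?U. abs (?F 1 T x + ?F (- 1) T x)) = (LINT x|?U. 2 * abs (time_deriv p u' T x + (- 1) * time_deriv p u T x))"
  proof (rule integral_cong_space)
   fix x
   have "?F 1 T x + ?F (- 1) T x = 2 * (time_deriv p u' T x + (- 1) * time_deriv p u T x)" by simp
   then show "abs (?F 1 T x + ?F (- 1) T x) = 2 * abs (time_deriv p u' T x + (- 1) * time_deriv p u T x)" by (simp only: abs_mult abs_numeral)
  qed
  then show ?thesis by (simp add: n_def)
 qed
 also have "... <= (LINT x|?U. abs (?F 1 T x) + abs (?F (- 1) T x))"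
  by (intro integral_mono integrable_abs Bochner_Integration.integrable_add Fi abs_triangle_ineq)
 also have "... = (LINT x|?U. abs (?F 1 T x)) + (LINT x|?U. abs (?F (- 1) T x))" using Fi[of 1] Fi[of "- 1"] by simp
 also have "... <= 2 * N" using balance[of 1] balance[of "- 1"] b0 b1 by simp
 finally show ?thesis by (simp add: N_def)
qed

text \<open>By Gronwall's lemma the velocities agree, so the \<open>L\<^sup>1\<close> distance of the
 solutions has derivative zero in time, and it vanishes initially.\<close>
theorem weak_solution_unique:
 fixes a :: "real \<times> real => real"
 assumes p: "1 < p" and \<kappa>: "0 < \<kappa>" and a: "a \<in> borel2" and aA: "!!q. abs (a q) <= A"
  and w: "weak_solution p \<kappa> a u0 u1 u" and w': "weak_solution p \<kappa> a u0 u1 u'" and t: "0 <= t"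
 shows "AE x in \<U>. u' t x = u t x"
proof -
 let ?U = "\<U>"
 note C = weak_solution_curves[OF p w] and C' = weak_solution_curves[OF p w']
 define n where "n t = (LINT x|?U. abs (time_deriv p u' t x + (- 1) * time_deriv p u t x))" for t
 define m where "m t = (LINT x|?U. abs (u' t x - u t x))" for t
 have A0: "0 <= A" using aA[of 0] by (simp add: order_trans[OF abs_ge_zero])
 have nc: "continuous_on {0..} n" unfolding n_def by (rule L1_norm_continuous[OF L1_curve_combine[OF C'(2) C(2)]])
 have n_le: "n s <= A * integral {0..s} n" if s: "0 <= s" for s
 proof (cases "s = 0")
  case False
  then have "n s <= A * (LINT t|leb 0 s. n t)"
   using velocity_difference_bound[OF p \<kappa> a aA w w', of s] s by (simp add: n_def)
  moreover have "(LINT t|leb 0 s. n t) = integral {0..s} n"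
   by (rule continuous_on_integral_Ioo(2)[OF continuous_on_subset[OF nc]]) auto
  ultimately show ?thesis by simp
 next
  case True
  have "AE x in ?U. time_deriv p u 0 x = u1 x" "AE x in ?U. time_deriv p u' 0 x = u1 x"
   using w w' by (auto simp: weak_solution_def)
  then have "AE x in ?U. 0 = abs (time_deriv p u' 0 x + (- 1) * time_deriv p u 0 x)" by eventually_elim simp
  then have "n 0 = 0" unfolding n_def
   using integral_lebesgue_on_cong_AE[of "%_. 0" \<J> "%x. abs (time_deriv p u' 0 x + (- 1) * time_deriv p u 0 x)"] by simp
  then show ?thesis using True by simp
 qed
 have n0: "n s = 0" if "0 <= s" for s
  by (rule Gronwall_zero[OF nc _ n_le A0 that]) (simp add: n_def)
 have ui: "integrable ?U (u s)" "integrable ?U (u' s)" "integrable ?U (time_deriv p u s)" "integrable ?U (time_deriv p u' s)" if "0 <= s" for s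
  using L1_curveD[OF C(1)] L1_curveD[OF C'(1)] L1_curveD[OF C(2)] L1_curveD[OF C'(2)] that by auto
 have "(m has_field_derivative 0) (at s within {0..})" if s: "s \<in> {0..}" for s
  unfolding has_field_derivative_iff
 proof (rule Lim_null_comparison)
  let ?Q = "%u r x. (u r x - u s x) / (r - s)"
  show "((%r. (LINT x|?U. abs (?Q u' r x - time_deriv p u' s x)) + (LINT x|?U. abs (?Q u r x - time_deriv p u s x))) \<longlongrightarrow> 0) (at s within {0..})"
   using tendsto_add[OF C'(4)[of s] C(4)[of s]] s by simp
  have ev: "eventually (%r. r \<in> {0..} \<and> r \<noteq> s) (at s within {0..})" by (simp add: eventually_at_filter)
  then show "\<forall>\<^sub>F r in at s within {0..}. norm ((m r - m s) / (r - s)) <= (LINT x|?U. abs (?Q u' r x - time_deriv p u' s x)) + (LINT x|?U. abs (?Q u r x - time_deriv p u s x))"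
  proof (rule eventually_mono)
   fix r assume r: "r \<in> {0..} \<and> r \<noteq> s"
   note I = ui[of r] ui[of s]
   have i: "integrable ?U (%x. ?Q u' r x - ?Q u r x)" using I r s by simp
   have e: "m r - m s = (LINT x|?U. abs (u' r x - u r x) - abs (u' s x - u s x))" unfolding m_def using I r s by simp
   have "\<bar>m r - m s\<bar> <= (LINT x|?U. \<bar>\<bar>u' r x - u r x\<bar> - \<bar>u' s x - u s x\<bar>\<bar>)" unfolding e by (rule integral_abs_bound)
   also have "... <= (LINT x|?U. abs (r - s) * abs (?Q u' r x - ?Q u r x))"
   proof (rule integral_mono)
    fix x
    have "(r - s) * (?Q u' r x - ?Q u r x) = (u' r x - u r x) - (u' s x - u s x)" using r by (simp add: diff_divide_distrib[symmetric])
    then show "\<bar>\<bar>u' r x - u r x\<bar> - \<bar>u' s x - u s x\<bar>\<bar> <= \<bar>r - s\<bar> * \<bar>?Q u' r x - ?Q u r x\<bar>"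
     unfolding abs_mult[symmetric] by (simp only: abs_triangle_ineq3)
   qed (use I i r s in auto)
   finally have 1: "abs (m r - m s) <= abs (r - s) * (LINT x|?U. abs (?Q u' r x - ?Q u r x))" by simp
   let ?S = "(LINT x|?U. abs (?Q u' r x - time_deriv p u' s x)) + (LINT x|?U. abs (?Q u r x - time_deriv p u s x))"
   have "(LINT x|?U. abs (?Q u' r x - ?Q u r x)) <= (LINT x|?U. abs (?Q u' r x - time_deriv p u' s x) + abs (?Q u r x - time_deriv p u s x) + abs (time_deriv p u' s x + (- 1) * time_deriv p u s x))"
    by (rule integral_mono) (use I r s i in auto)
   also have "... = ?S + n s"
    unfolding n_def using I r s by simp
   finally have "(LINT x|?U. abs (?Q u' r x - ?Q u r x)) <= ?S" using n0[of s] s by simp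
   from order_trans[OF 1 mult_left_mono[OF this abs_ge_zero]] show "norm ((m r - m s) / (r - s)) <= ?S"
    using r unfolding real_norm_def abs_divide by (subst pos_divide_le_eq) (simp_all only: mult.commute, simp)
  qed
 qed
 then obtain c where c: "\<forall>s\<in>{0..}. m s = c" using has_field_derivative_zero_constant[of "{0..}" m] by auto
 have "AE x in ?U. u 0 x = u0 x" "AE x in ?U. u' 0 x = u0 x" using w w' by (auto simp: weak_solution_def)
 then have "AE x in ?U. 0 = abs (u' 0 x - u 0 x)" by eventually_elim simp
 then have "m 0 = 0" unfolding m_def
  using integral_lebesgue_on_cong_AE[of "%_. 0" \<J> "%x. abs (u' 0 x - u 0 x)"] by simp
 then have "m t = 0" using c t by auto
 then have "AE x in ?U. abs (u' t x - u t x) = 0"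
  unfolding m_def using ui(1,2)[OF t] by (subst (asm) integral_nonneg_eq_0_iff_AE) auto
 then show ?thesis by (rule eventually_mono) simp
qed

section \<open>The main theorem\<close>

text \<open>For almost every time the two coefficients agree almost everywhere in space. Since Bochner
 integrals of functions that are not measurable vanish by convention, the measurability in time provided by
 the Borel coefficient is essential here.\<close>
lemma wave_eq_distr_cong:
 fixes a b :: "real \<times> real => real"
 assumes p: "1 < p" and w: "weak_solution p \<kappa> d u0 u1 u"
  and b [measurable]: "b \<in> borel2" and bA: "!!q. abs (b q) <= A"
  and ae: "AE q in lebesgue_on ({0<..} \<times> \<J>). b q = a q"
 shows "wave_eq_distr p a u \<longleftrightarrow> wave_eq_distr p b u"
proof -
 note C = weak_solution_curves[OF p w]
 have S: "{0<..} \<times> \<J> \<in> sets (borel :: (real \<times> real) measure)" by (intro borel_open open_Times) auto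
 have ae2: "AE t in lborel. AE x in lborel. (t, x) \<in> {0<..} \<times> \<J> --> b (t, x) = a (t, x)"
  by (rule lborel_pair.AE_pair) (unfold lborel_prod, use ae S in \<open>simp add: AE_lebesgue_on_iff\<close>)
 have aet: "AE t in leb 0 T. AE x in \<U>. b (t, x) = a (t, x)" for T
  using ae2 by (auto simp: AE_lebesgue_on_iff elim!: eventually_mono)
 let ?W = "%phi a t. LINT x|\<U>. u t x * dt (dt phi) (t, x) - u t x * dx (dx phi) (t, x)
    + a (t, x) * time_deriv p u t x * phi (t, x)"
 have "(LINT t|lebesgue_on {0<..}. ?W phi a t) = (LINT t|lebesgue_on {0<..}. ?W phi b t)"
  if phi': "phi \<in> test_functions ({0<..} \<times> \<J>)" for phi
 proof -
  obtain T where T: "0 < T" and phi: "phi \<in> test_functions ({0<..<T} \<times> \<J>)" by (rule test_function_finite_time[OF phi'])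
  note P = test_function_plane[OF phi]
  note P11 = test_function_plane[OF test_function_plane(1)[OF P(1)]] and P22 = test_function_plane[OF test_function_plane(2)[OF P(2)]]
  obtain M where M: "M >= 0" "!!q. abs (phi q) <= M" using test_function_bounded[OF phi] by blast
  obtain M11 where M11: "!!q. abs (dt (dt phi) q) <= M11" using test_function_bounded[OF test_function_plane(1)[OF P(1)]] by blast
  obtain M22 where M22: "!!q. abs (dx (dx phi) q) <= M22" using test_function_bounded[OF test_function_plane(2)[OF P(2)]] by blast
  note [measurable] = P(5)
  have bm: "(%q. b q * phi q) \<in> borel2" by measurable
  have bM: "abs (b q * phi q) <= A * M" for q
   unfolding abs_mult using bA[of q] M by (intro mult_mono) auto
  note i = pairing_integrable(3)[OF C(1) P11(5) M11] pairing_integrable(3)[OF C(1) P22(5) M22] pairing_integrable(3)[OF C(2) bm bM]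
  have We: "?W phi b t = pairing \<J> u (dt (dt phi)) t - pairing \<J> u (dx (dx phi)) t
    + pairing \<J> (time_deriv p u) (%q. b q * phi q) t" if t: "t >= 0" for t
   using i[OF t] by (simp add: pairing_def mult.left_commute mult.assoc)
  have Wm: "?W phi b \<in> borel_measurable (leb 0 T)"
  proof (subst measurable_cong)
   show "?W phi b t = pairing \<J> u (dt (dt phi)) t - pairing \<J> u (dx (dx phi)) t
    + pairing \<J> (time_deriv p u) (%q. b q * phi q) t" if "t \<in> space (leb 0 T)" for t
    by (rule We) (use that in simp)
   show "(%t. pairing \<J> u (dt (dt phi)) t - pairing \<J> u (dx (dx phi)) t
    + pairing \<J> (time_deriv p u) (%q. b q * phi q) t) \<in> borel_measurable (leb 0 T)"
    by (intro borel_measurable_add borel_measurable_diff pairing_measurable[OF C(1) P11(5) M11] pairing_measurable[OF C(1) P22(5) M22] pairing_measurable[OF C(2) bm bM])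
  qed
  have "(LINT t|lebesgue_on {0<..}. ?W phi a t) = (LINT t|leb 0 T. ?W phi a t)"
   by (rule integral_lebesgue_on_support) (auto simp: P(9) P11(9) P22(9))
  also have "... = (LINT t|leb 0 T. ?W phi b t)"
  proof (rule integral_lebesgue_on_cong_AE[OF Wm])
   have "AE t in leb 0 T. t \<in> {0<..<T}" by (intro AE_I2) simp
   with aet show "AE t in leb 0 T. ?W phi b t = ?W phi a t"
   proof eventually_elim
    case (elim t)
    then have t: "0 <= t" by simp
    have "(%x. u t x * dt (dt phi) (t, x) - u t x * dx (dx phi) (t, x)
     + b (t, x) * time_deriv p u t x * phi (t, x)) \<in> borel_measurable \<U>"
     using i[OF t, THEN borel_measurable_integrable] by (simp add: mult.left_commute mult.assoc)
    then show ?case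
    proof (rule integral_lebesgue_on_cong_AE[symmetric])
     show "AE x in \<U>. u t x * dt (dt phi) (t, x) - u t x * dx (dx phi) (t, x) + b (t, x) * time_deriv p u t x * phi (t, x)
      = u t x * dt (dt phi) (t, x) - u t x * dx (dx phi) (t, x) + a (t, x) * time_deriv p u t x * phi (t, x)"
      using elim(1) by (rule eventually_mono) simp
    qed simp
   qed
  qed simp
  also have "... = (LINT t|lebesgue_on {0<..}. ?W phi b t)"
   by (rule integral_lebesgue_on_support[symmetric]) (auto simp: P(9) P11(9) P22(9))
  finally show ?thesis .
 qed
 then show ?thesis by (simp add: wave_eq_distr_def)
qed

lemma weak_solution_cong:
 assumes p: "1 < p" and b: "b \<in> borel2" "!!q. abs (b q) <= A"
  and ae: "AE q in lebesgue_on ({0<..} \<times> \<J>). b q = a q"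
  and u0: "AE x in \<U>. va x = u0 x" and u1: "AE x in \<U>. vb x = u1 x"
 shows "weak_solution p \<kappa> a u0 u1 u \<longleftrightarrow> weak_solution p \<kappa> b va vb u"
proof -
 have "wave_eq_distr p a u \<longleftrightarrow> wave_eq_distr p b u" if "weak_solution p \<kappa> a u0 u1 u \<or> weak_solution p \<kappa> b va vb u"
  using that wave_eq_distr_cong[OF p _ b ae] by blast
 moreover have "(AE x in \<U>. u 0 x = u0 x) \<longleftrightarrow> (AE x in \<U>. u 0 x = va x)"
  by (rule eventually_cong[OF u0]) auto
 moreover have "(AE x in \<U>. time_deriv p u 0 x = u1 x) \<longleftrightarrow> (AE x in \<U>. time_deriv p u 0 x = vb x)"
  by (rule eventually_cong[OF u1]) auto
 ultimately show ?thesis unfolding weak_solution_def by blast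
qed

text \<open>The distance to the nearest even integer, an even 2-periodic extension of the identity on
 \<open>[0,1]\<close>.\<close>
definition zigzag :: "real => real" where "zigzag y = arccos (cos (pi * y)) / pi"

lemma zigzag:
 "continuous_on UNIV zigzag" "zigzag (y + 2) = zigzag y" "zigzag (- y) = zigzag y"
 "0 <= y ==> y <= 1 ==> zigzag y = y" "1 <= y ==> y <= 2 ==> zigzag y = 2 - y"
proof -
 show "continuous_on UNIV zigzag" unfolding zigzag_def[abs_def] by (intro continuous_intros) auto
 have c: "cos (pi * (y + 2)) = cos (pi * y)" for y
  using cos_periodic[of "pi * y"] by (simp add: algebra_simps)
 then show "zigzag (y + 2) = zigzag y" by (simp add: zigzag_def)
 show e: "zigzag (- y) = zigzag y" for y by (simp add: zigzag_def)
 show i: "zigzag y = y" if "0 <= y" "y <= 1" for y using that by (simp add: zigzag_def arccos_cos mult_left_le)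
 show "zigzag y = 2 - y" if "1 <= y" "y <= 2"
  using i[of "2 - y"] e[of "2 - y"] c[of "y - 2"] that by (simp add: zigzag_def)
qed

lemma set_integrable_zigzag:
 assumes g: "lint {0..1} g"
 shows "lint {0..2} (%y. g (zigzag y) :: real)"
proof -
 have "lint {0..1} (%y. g (zigzag y))"
  by (subst set_integrable_cong[OF refl refl, where f' = g]) (use g in \<open>auto simp: zigzag(4)\<close>)
 moreover have "lint {1..2} (%y. g (zigzag y))"
 proof -
  have "lint {1 + (- 2)..2 + (- 2)} (%y. g (- y))" unfolding set_integral_reflect(2) using g by simp
  then have "lint {1..2} (%y. g (- (y + (- 2))))" by (rule set_integral_shift(2)[where f = "%y. g (- y)", THEN iffD2])
  then show ?thesis by (subst set_integrable_cong[OF refl refl, where f' = "%y. g (2 - y)"]) (auto simp: zigzag(5))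
 qed
 ultimately have "lint ({0..1} \<union> {1..2}) (%y. g (zigzag y))" by (rule set_integrable_Un) auto
 moreover have "{0..1} \<union> {1..2} = {0..2::real}" by auto
 ultimately show ?thesis by simp
qed

context damped_wave
begin

text \<open>Each of the two norms is at most the \<open>p\<close>-th root of the folded energy.\<close>
lemma exponential_decay:
 assumes t: "0 <= t"
  and mu: "0 <= mu" "mu <= 1" "A * cross_const p * mu <= 1" "(1 + mu) * abs c powr p <= 1"
  and S: "0 <= S" "0 <= K" "(LBINT y:{0..2}. abs (h0 y) powr p) <= K * S powr p"
 shows "Lp_norm p \<J> (time_deriv p u t) + Lp_norm p \<J> (space_deriv u t)
  <= 2 * (4 * K) powr (1 / p) * exp (- (2 * ln (1 + mu / 8) / p) * t) * S"
proof -
 define r where "r = 2 * ln (1 + mu / 8)"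
 have E: "(LBINT y:{0..2}. abs (z t (y - t)) powr p) <= 4 * exp (- r * t) * (K * S powr p)"
  using order_trans[OF energy_decay[OF t mu] mult_left_mono[OF S(3)]] by (simp add: r_def)
 have root: "X powr (1 / p) <= (4 * K) powr (1 / p) * exp (- (r / p) * t) * S" if "0 <= X" "X <= 4 * exp (- r * t) * (K * S powr p)" for X
 proof -
  have "X powr (1 / p) <= (4 * K * exp (- r * t) * S powr p) powr (1 / p)"
   using that p by (intro powr_mono2) (auto simp: ac_simps)
  also have "... = (4 * K) powr (1 / p) * exp (- r * t) powr (1 / p) * (S powr p) powr (1 / p)"
   using S by (simp add: powr_mult)
  also have "exp (- r * t) powr (1 / p) = exp (- (r / p) * t)" by (simp add: powr_def)
  also have "(S powr p) powr (1 / p) = S" using S p by (simp add: powr_powr)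
  finally show ?thesis .
 qed
 have norm: "Lp_norm p \<J> f = (LBINT x:{0..1}. abs (f x) powr p) powr (1 / p)" if [measurable]: "f \<in> borel1" for f
  unfolding Lp_norm_def by (subst lborel_Ioo_Icc(1)) auto
 have nn: "0 <= (LBINT x:{0..1}. abs (f x) powr p)" for f :: "real => real"
  unfolding set_lebesgue_integral_def by (rule Bochner_Integration.integral_nonneg) simp
 have "Lp_norm p \<J> (ut t) <= (4 * K) powr (1 / p) * exp (- (r / p) * t) * S"
  unfolding norm[OF ut_slice(1)] by (rule root[OF nn order_trans[OF ut_powr(3)[OF t] E]])
 moreover have "Lp_norm p \<J> (ux t) <= (4 * K) powr (1 / p) * exp (- (r / p) * t) * S"
  unfolding norm[OF ut_slice(2)] by (rule root[OF nn order_trans[OF ut_powr(4)[OF t] E]])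
 moreover have "Lp_norm p \<J> (time_deriv p u t) = Lp_norm p \<J> (ut t)"
  using Lp_norm_AE_cong[OF time_deriv_AE[OF t] LpD(1)[OF ut_Lp[OF t]] measurable_lebesgue_on_AE[OF LpD(1)[OF ut_Lp[OF t]] time_deriv_AE[OF t]]] by simp
 moreover have "Lp_norm p \<J> (space_deriv u t) = Lp_norm p \<J> (ux t)"
  using Lp_norm_AE_cong[OF space_deriv_AE[OF t] LpD(1)[OF ux_Lp[OF t]] measurable_lebesgue_on_AE[OF LpD(1)[OF ux_Lp[OF t]] space_deriv_AE[OF t]]] by simp
 ultimately show ?thesis by (simp add: r_def)
qed

end

text \<open>Folding the initial invariants \<open>u1 - v0\<close> and \<open>u1 + v0\<close>: the sign of
 \<open>sin (pi * y)\<close> tells on which side of an even integer \<open>y\<close> lies.\<close>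
lemma solution_exists:
 fixes a :: "real \<times> real => real"
 assumes p: "1 < p" and \<kappa>: "0 < \<kappa>" and a [measurable]: "a \<in> borel2" and aA: "!!q. 0 <= a q" "!!q. a q <= A"
  and m [measurable]: "u0 \<in> borel1" "u1 \<in> borel1" "v0 \<in> borel1"
  and L: "u0 \<in> Lp p \<J>" "u1 \<in> Lp p \<J>" "v0 \<in> Lp p \<J>"
  and wd: "is_weak_deriv \<J> u0 v0"
  and mu: "0 <= mu" "mu <= 1" "A * cross_const p * mu <= 1" "(1 + mu) * abs ((1 - \<kappa>) / (1 + \<kappa>)) powr p <= 1"
 obtains u where "weak_solution p \<kappa> a u0 u1 u"
  "!!t. 0 <= t ==> Lp_norm p \<J> (time_deriv p u t) + Lp_norm p \<J> (space_deriv u t)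
   <= 2 * (4 * (4 * 3 powr p)) powr (1 / p) * exp (- (2 * ln (1 + mu / 8) / p) * t) * (Lp_norm p \<J> u1 + Lp_norm p \<J> v0)"
proof -
 have p0: "p > 0" "p >= 1" using p by simp_all
 define c where "c = (1 - \<kappa>) / (1 + \<kappa>)"
 define \<alpha> where "\<alpha> t y = a (t, zigzag y)" for t y
 define h0 where "h0 y = (if 0 <= sin (pi * y) then u1 (zigzag y) - v0 (zigzag y) else u1 (zigzag y) + v0 (zigzag y))" for y
 have [measurable]: "zigzag \<in> borel1" by (rule borel_measurable_continuous_onI[OF zigzag(1)])
 have s2: "sin (pi * (y + 2)) = sin (pi * y)" for y
  using sin_periodic[of "pi * y"] by (simp add: algebra_simps)
 have h0p: "h0 x = u1 x - v0 x" "h0 (- x) = u1 x + v0 x" if "x \<in> \<J>" for x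
 proof -
  have "0 < sin (pi * x)" using that by (intro sin_gt_zero) auto
  then show "h0 x = u1 x - v0 x" "h0 (- x) = u1 x + v0 x" using that by (auto simp: h0_def zigzag(3) zigzag(4))
 qed
 have pi: "lint {0..1} (%x. abs (f x) powr p)" if "f \<in> Lp p \<J>" and [measurable]: "f \<in> borel1" for f
  using LpD(2)[OF that(1)] by (subst (asm) lborel_Ioo_Icc(2)) auto
 have I: "lint {0..1} (%x. 3 powr p * (abs (u1 x) powr p + abs (v0 x) powr p))"
  by (intro set_integrable_mult_right set_integral_add(1) pi L m)
 have h0_le: "abs (h0 y) powr p <= 3 powr p * (abs (u1 (zigzag y)) powr p + abs (v0 (zigzag y)) powr p)" for y
  unfolding h0_def using powr_sum_le[OF p0(1)] by simp
 have h0m [measurable]: "h0 \<in> borel1" unfolding h0_def[abs_def] by measurable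
 have h0i: "lint {0..2} (%y. abs (h0 y) powr p)"
  by (rule set_integrable_le[OF set_integrable_zigzag[OF I]]) (use h0_le in auto)
 interpret damped_wave p c A \<alpha> h0 \<kappa> u0
 proof unfold_locales
  show "1 < p" "0 < \<kappa>" "c = (1 - \<kappa>) / (1 + \<kappa>)" by (fact p \<kappa> c_def)+
  show "abs c < 1" using \<kappa> by (simp add: c_def abs_less_iff divide_less_eq less_divide_eq)
  show "0 <= A" using aA order_trans by blast
  show "(%(s, y). \<alpha> s y) \<in> borel2" unfolding \<alpha>_def case_prod_beta by measurable
  show "0 <= \<alpha> s y" "\<alpha> s y <= A" "\<alpha> s (y + 2) = \<alpha> s y" "\<alpha> s (- y) = \<alpha> s y" for s y using aA by (simp_all add: \<alpha>_def zigzag(2,3))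
  show "h0 \<in> borel1" "lint {0..2} (%y. abs (h0 y) powr p)" by (fact h0m h0i)+
  show "h0 (y + 2) = h0 y" for y by (simp only: h0_def s2 zigzag(2))
  show "u0 \<in> borel1" "u0 \<in> Lp p \<J>" by (fact m L)+
  have "(LINT x|\<U>. (h0 (- x) - h0 x) / 2 * phi x) = (LINT x|\<U>. v0 x * phi x)" for phi
   by (intro integral_cong_space) (simp add: h0p)
  then show "is_weak_deriv \<J> u0 (%x. (h0 (- x) - h0 x) / 2)" using wd by (simp only: is_weak_deriv_def)
 qed
 have ut0: "ut 0 x = u1 x" if "x \<in> \<J>" for x by (simp add: ut_def z_initial h0p[OF that])
 have "weak_solution p \<kappa> a u0 u1 u"
 proof (subst weak_solution_cong[where b = "%q. \<alpha> (fst q) (snd q)" and A = A and va = u0 and vb = "ut 0"])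
  show "weak_solution p \<kappa> (%q. \<alpha> (fst q) (snd q)) u0 (ut 0) u" by (rule u_weak_solution)
  show "(%q. \<alpha> (fst q) (snd q)) \<in> borel2" unfolding \<alpha>_def by measurable
  show "abs (\<alpha> (fst q) (snd q)) <= A" for q using aA by (simp add: \<alpha>_def)
  have "\<alpha> (fst q) (snd q) = a q" if "q \<in> {0<..} \<times> \<J>" for q
   using that by (cases q) (simp add: \<alpha>_def zigzag(4))
  then show "AE q in lebesgue_on ({0<..} \<times> \<J>). \<alpha> (fst q) (snd q) = a q" by (intro AE_I2) auto
  show "AE x in \<U>. ut 0 x = u1 x" by (intro AE_I2) (simp add: ut0)
 qed (use p in auto)
 moreover have "Lp_norm p \<J> (time_deriv p u t) + Lp_norm p \<J> (space_deriv u t)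
   <= 2 * (4 * (4 * 3 powr p)) powr (1 / p) * exp (- (2 * ln (1 + mu / 8) / p) * t) * (Lp_norm p \<J> u1 + Lp_norm p \<J> v0)" if t: "0 <= t" for t
 proof (rule exponential_decay[OF t mu(1,2,3)])
  let ?N = "%f. Lp_norm p \<J> f"
  show "(1 + mu) * abs c powr p <= 1" using mu(4) by (simp add: c_def)
  \<comment> \<open>The factor \<open>3 powr p\<close> splits the sums in \<open>h0\<close>; the two halves of the period and the two norms double it twice.\<close>
  show "0 <= ?N u1 + ?N v0" "0 <= 4 * 3 powr p" by (simp_all add: Lp_norm_nonneg)
  have N: "(LBINT x:{0..1}. abs (f x) powr p) = ?N f powr p" if [measurable]: "f \<in> borel1" for f
   unfolding Lp_norm_powr[OF p0(1)] by (rule lborel_Ioo_Icc(1)[symmetric]) measurable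
  have "(LBINT x:{0..1}. abs (h0 x) powr p) <= (LBINT x:{0..1}. 3 powr p * (abs (u1 x) powr p + abs (v0 x) powr p))"
  proof (rule set_integral_mono[OF h0_powr_integrable I])
   show "abs (h0 x) powr p <= 3 powr p * (abs (u1 x) powr p + abs (v0 x) powr p)" if "x \<in> {0..1}" for x
    using h0_le[of x] that by (simp add: zigzag(4))
  qed
  moreover have "(LBINT x:{0..1}. abs (h0 (- x)) powr p) <= (LBINT x:{0..1}. 3 powr p * (abs (u1 x) powr p + abs (v0 x) powr p))"
  proof (rule set_integral_mono[OF _ I])
   show "lint {0..1} (%x. abs (h0 (- x)) powr p)" using energy_split(3)[of 0 0 1] by (simp add: z_initial)
   show "abs (h0 (- x)) powr p <= 3 powr p * (abs (u1 x) powr p + abs (v0 x) powr p)" if "x \<in> {0..1}" for x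
    using h0_le[of "- x"] that by (simp add: zigzag(3) zigzag(4))
  qed
  moreover have "(LBINT y:{0..2}. abs (h0 y) powr p) = (LBINT x:{0..1}. abs (h0 x) powr p) + (LBINT x:{0..1}. abs (h0 (- x)) powr p)"
   using energy_split(1)[of 0] by (simp add: z_initial)
  moreover have "(LBINT x:{0..1}. 3 powr p * (abs (u1 x) powr p + abs (v0 x) powr p)) = 3 powr p * (?N u1 powr p + ?N v0 powr p)"
   using set_integral_add(2)[OF pi[OF L(2) m(2)] pi[OF L(3) m(3)]] by (simp add: N)
  moreover have "3 powr p * (?N u1 powr p + ?N v0 powr p) <= 3 powr p * (2 * (?N u1 + ?N v0) powr p)"
  proof (rule mult_left_mono)
   have "?N u1 powr p <= (?N u1 + ?N v0) powr p" "?N v0 powr p <= (?N u1 + ?N v0) powr p"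
    using p0 by (auto intro!: powr_mono2 simp: Lp_norm_nonneg)
   then show "?N u1 powr p + ?N v0 powr p <= 2 * (?N u1 + ?N v0) powr p" by simp
  qed simp
  ultimately show "(LBINT y:{0..2}. abs (h0 y) powr p) <= 4 * 3 powr p * (?N u1 + ?N v0) powr p" by linarith
 qed
 ultimately show thesis by (rule that)
qed

text \<open>The essential bound and the sign condition hold almost everywhere only; clipping makes them hold
 everywhere.\<close>
lemma bounded_borel_representative:
 fixes a :: "real \<times> real => real"
 assumes a: "a \<in> Linf S" and nonneg: "AE q in lebesgue_on S. 0 <= a q" and S: "S \<in> sets lebesgue"
 obtains b where "b \<in> borel2" "!!q. 0 <= b q" "!!q. b q <= max 0 (Linf_norm S a)" "AE q in lebesgue_on S. b q = a q"
proof -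
 have am: "a \<in> borel_measurable (lebesgue_on S)" and fin: "esssup (lebesgue_on S) (%x. ereal (abs (a x))) < \<infinity>" using a by (auto simp: Linf_def)
 have le: "AE q in lebesgue_on S. abs (a q) <= Linf_norm S a"
  using esssup_AE[of "%x. ereal (abs (a x))" "lebesgue_on S"]
 proof (rule eventually_mono)
  fix q assume "ereal (abs (a q)) <= esssup (lebesgue_on S) (%x. ereal (abs (a x)))"
  then show "abs (a q) <= Linf_norm S a" using fin unfolding Linf_norm_def
   by (cases "esssup (lebesgue_on S) (%x. ereal (abs (a x)))") auto
 qed
 obtain g where g: "g \<in> borel1" and ae: "AE q in lebesgue_on S. a q = g q"
  by (rule borel_representative[OF am S])
 show thesis
 proof (rule that)
  show "(%q. max 0 (min (max 0 (Linf_norm S a)) (g q))) \<in> borel2" using g by (simp add: borel_prod)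
  show "AE q in lebesgue_on S. max 0 (min (max 0 (Linf_norm S a)) (g q)) = a q" using le ae nonneg by eventually_elim auto
 qed auto
qed

text \<open>The parameter \<open>mu\<close> must satisfy a bound from the damping and one from the boundary
 factor. For the latter \<open>mu \<le> 1 - b\<close> with \<open>b = \<bar>c\<bar>\<^sup>p\<close> suffices,
 because \<open>(2 - b) b = 1 - (1 - b)\<^sup>2\<close>. The data are replaced by Borel representatives before
 the folded problem is set up.\<close>
theorem theorem6p1:
  fixes p \<kappa> A :: real
  assumes "1 < p" and "\<kappa> > 0"
  shows "\<exists>C>0. \<exists>\<gamma>>0.
    \<forall>a :: real \<times> real \<Rightarrow> real.
      a \<in> Linf ({0<..} \<times> unit_interval) \<and>
      (AE z in lebesgue_on ({0<..} \<times> unit_interval). 0 \<le> a z) \<and>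
      Linf_norm ({0<..} \<times> unit_interval) a = A \<longrightarrow>
      (\<forall>u0 \<in> W1p p unit_interval. \<forall>u1 \<in> Lp p unit_interval.
        \<exists>u. weak_solution p \<kappa> a u0 u1 u \<and>
          (\<forall>u'. weak_solution p \<kappa> a u0 u1 u' \<longrightarrow>
             (\<forall>t\<ge>0. AE x in lebesgue_on unit_interval. u' t x = u t x)) \<and>
          (\<forall>t\<ge>0. Lp_norm p unit_interval (time_deriv p u t)
                  + Lp_norm p unit_interval (space_deriv u t)
             \<le> C * exp (- \<gamma> * t) *
               (Lp_norm p unit_interval u1 + Lp_norm p unit_interval (weak_deriv unit_interval u0))))"
proof -
 note p = assms(1) and \<kappa> = assms(2)
 have p0: "p > 0" "p >= 1" using p by simp_all
 define b where "b = abs ((1 - \<kappa>) / (1 + \<kappa>)) powr p"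
 define K where "K = max 0 A * cross_const p"
 define mu where "mu = min (1 - b) (1 / (K + 1))"
 have K: "0 <= K" using p by (simp add: K_def cross_const_def)
 have "abs ((1 - \<kappa>) / (1 + \<kappa>)) < 1" using \<kappa> by (simp add: abs_less_iff divide_less_eq less_divide_eq)
 then have "b < 1 powr p" unfolding b_def using p0 by (intro powr_less_mono2) auto
 then have b: "0 <= b" "b < 1" by (simp_all add: b_def)
 have mu: "0 < mu" "mu <= 1" "K * mu <= 1" "(1 + mu) * b <= 1"
 proof -
  show "0 < mu" "mu <= 1" using b K by (auto simp: mu_def)
  have "K * mu <= K * (1 / (K + 1))" by (rule mult_left_mono) (use K in \<open>auto simp: mu_def\<close>)
  also have "... <= 1" using K by simp
  finally show "K * mu <= 1" .
  have "(1 + mu) * b <= (1 + (1 - b)) * b" by (rule mult_right_mono) (use b in \<open>auto simp: mu_def\<close>)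
  also have "... = 1 - (1 - b)\<^sup>2" by (simp add: power2_eq_square algebra_simps)
  finally show "(1 + mu) * b <= 1" by (smt (verit) zero_le_power2)
 qed
 define \<gamma> where "\<gamma> = 2 * ln (1 + mu / 8) / p"
 define C where "C = 2 * (4 * (4 * 3 powr p)) powr (1 / p)"
 have "0 < C" "0 < \<gamma>" using mu(1) p0 by (simp_all add: C_def \<gamma>_def)
 moreover have "\<exists>u. weak_solution p \<kappa> a u0 u1 u \<and>
     (\<forall>u'. weak_solution p \<kappa> a u0 u1 u' --> (\<forall>t\<ge>0. AE x in \<U>. u' t x = u t x)) \<and>
     (\<forall>t\<ge>0. Lp_norm p \<J> (time_deriv p u t) + Lp_norm p \<J> (space_deriv u t)
       <= C * exp (- \<gamma> * t) * (Lp_norm p \<J> u1 + Lp_norm p \<J> (weak_deriv \<J> u0)))"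
  if a: "a \<in> Linf ({0<..} \<times> \<J>)" "AE q in lebesgue_on ({0<..} \<times> \<J>). 0 <= a q" "Linf_norm ({0<..} \<times> \<J>) a = A"
   and u0: "u0 \<in> W1p p \<J>" and u1: "u1 \<in> Lp p \<J>" for a u0 u1
 proof -
  have S: "{0<..} \<times> \<J> \<in> sets (lebesgue :: (real \<times> real) measure)"
   by (rule sets_completionI_sets) (auto intro!: borel_open open_Times)
  obtain d where d: "d \<in> borel2" "!!q. 0 <= d q" "!!q. d q <= max 0 A" "AE q in lebesgue_on ({0<..} \<times> \<J>). d q = a q"
   by (rule bounded_borel_representative[OF a(1,2) S]) (use a(3) in auto)
  have dA: "abs (d q) <= max 0 A" for q using d(2,3)[of q] by simp
  obtain g where g: "g \<in> Lp p \<J>" "is_weak_deriv \<J> u0 g" and u0L: "u0 \<in> Lp p \<J>" using u0 by (auto simp: W1p_def)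
  note W = weak_deriv_AE[OF p0(2) g zero_less_one]
  have rep: "\<exists>f'. f' \<in> borel1 \<and> (AE x in \<U>. f' x = f x) \<and> f' \<in> Lp p \<J> \<and> Lp_norm p \<J> f' = Lp_norm p \<J> f"
   if f: "f \<in> Lp p \<J>" for f
  proof -
   obtain f' where f': "f' \<in> borel1" "AE x in \<U>. f x = f' x" by (rule borel_representative[OF LpD(1)[OF f]]) auto
   have m: "f' \<in> borel_measurable \<U>" by (rule lebesgue_on_borel(1)[OF f'(1)]) simp
   show ?thesis using f' Lp_AE_cong[OF f f'(2) m] Lp_norm_AE_cong[OF f'(2) LpD(1)[OF f] m, of p] by (auto elim: eventually_mono)
  qed
  obtain v where v: "v \<in> borel1" "AE x in \<U>. v x = u0 x" "v \<in> Lp p \<J>" using rep[OF u0L] by blast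
  obtain v1 where v1: "v1 \<in> borel1" "AE x in \<U>. v1 x = u1 x" "v1 \<in> Lp p \<J>" "Lp_norm p \<J> v1 = Lp_norm p \<J> u1"
   using rep[OF u1] by blast
  obtain v' where v': "v' \<in> borel1" "AE x in \<U>. v' x = weak_deriv \<J> u0 x" "v' \<in> Lp p \<J>"
   "Lp_norm p \<J> v' = Lp_norm p \<J> (weak_deriv \<J> u0)" using rep[OF W(2)] by blast
  have int: "(LINT x|\<U>. f' x * phi x) = (LINT x|\<U>. f x * phi x)"
   if "f' \<in> borel1" "AE x in \<U>. f' x = f x" "continuous_on UNIV phi" for f f' phi :: "real => real"
  proof (rule integral_lebesgue_on_cong_AE[symmetric])
   show "(%x. f' x * phi x) \<in> borel_measurable \<U>"
    by (rule lebesgue_on_borel(1)) (use that(1) borel_measurable_continuous_onI[OF that(3)] in auto)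
  qed (use that(2) in \<open>auto elim: eventually_mono\<close>)
  have wd: "is_weak_deriv \<J> v v'"
   unfolding is_weak_deriv_def
  proof
   fix phi assume phi: "phi \<in> test_functions \<J>"
   show "(LINT x|\<U>. v x * deriv phi x) = - (LINT x|\<U>. v' x * phi x)"
    using W(3) phi int[OF v(1,2) test_function_deriv(4)[OF phi]] int[OF v'(1,2) test_function_deriv(3)[OF phi]] by (simp add: is_weak_deriv_def)
  qed
  note cong = weak_solution_cong[OF p d(1) dA d(4) v(2) v1(2)]
  obtain u where u: "weak_solution p \<kappa> d v v1 u"
   "!!t. 0 <= t ==> Lp_norm p \<J> (time_deriv p u t) + Lp_norm p \<J> (space_deriv u t)
    <= C * exp (- \<gamma> * t) * (Lp_norm p \<J> v1 + Lp_norm p \<J> v')"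
   by (rule solution_exists[OF p \<kappa> d(1,2,3) v(1) v1(1) v'(1) v(3) v1(3) v'(3) wd less_imp_le[OF mu(1)] mu(2) mu(3)[unfolded K_def] mu(4)[unfolded b_def], folded C_def \<gamma>_def])
    (rule that)
  show ?thesis
  proof (intro exI[of _ u] conjI allI impI)
   show "weak_solution p \<kappa> a u0 u1 u" using u(1) cong by blast
   show "AE x in \<U>. u' t x = u t x" if "weak_solution p \<kappa> a u0 u1 u'" "0 <= t" for u' t
    by (rule weak_solution_unique[OF p \<kappa> d(1) dA u(1) _ that(2)]) (use that(1) cong in blast)
   show "Lp_norm p \<J> (time_deriv p u t) + Lp_norm p \<J> (space_deriv u t)
    <= C * exp (- \<gamma> * t) * (Lp_norm p \<J> u1 + Lp_norm p \<J> (weak_deriv \<J> u0))" if "0 <= t" for t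
    using u(2)[OF that] by (simp only: v1(4) v'(4))
  qed
 qed
 ultimately show ?thesis by blast
qed

end
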